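(* Let $X(\mathbb{R}^n)$ be a reflection-invariant Banach function space. (a) If $a\in\mathcal{M}^0_{X(\mathbb{R}^n)}$, then $\|a\|_{L^\infty(\mathbb{R}^n)}\le\|a\|_{\mathcal{M}^0_{X(\mathbb{R}^n)}}$. (b) If $X(\mathbb{R}^n)$ is reflexive and $a\in\mathcal{M}_{X(\mathbb{R}^n)}\subset S'(\mathbb{R}^n)$, then $a\in L^\infty(\mathbb{R}^n)$ and $\|a\|_{L^\infty(\mathbb{R}^n)}\le\|a\|_{\mathcal{M}_{X(\mathbb{R}^n)}}$. The constant $1$ on the right-hand sides of both inequalities is best possible.
   Context: Banach function spaces: let $\mathfrak{M}^+(\mathbb{R}^n)$ be the set of Lebesgue measurable functions on $\mathbb{R}^n$ with values in $[0,\infty]$. A Banach function norm is a map $\rho:\mathfrak{M}^+(\mathbb{R}^n)\to[0,\infty]$ such that for all $f,g,f_j\in\mathfrak{M}^+$, all $a\ge0$, all measurable $E$: (A1) $\rho(f)=0\iff f=0$ a.e., $\rho(af)=a\rho(f)$, $\rho(f+g)\le\rho(f)+\rho(g)$; (A2) $0\le g\le f$ a.e. implies $\rho(g)\le\rho(f)$; (A3) $0\le f_j\uparrow f$ a.e. implies $\rho(f_j)\uparrow\rho(f)$; (A4) $|E|<\infty$ implies $\rho(\chi_E)<\infty$; (A5) $|E|<\infty$ implies $\int_Ef\le C_E\rho(f)$ with $C_E\in(0,\infty)$ independent of $f$. $X(\mathbb{R}^n)$ is the set of measurable complex $f$ with $\rho(|f|)<\infty$, $\|f\|_X=\rho(|f|)$.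 $X(\mathbb{R}^n)$ is reflection-invariant if $\|f\|_X=\|\widetilde f\|_X$ for all $f\in X$, where $\widetilde f(x)=f(-x)$. Fourier transform: $(Fu)(\xi)=\int u(x)e^{-ix\xi}dx$. $\mathcal{M}_{X(\mathbb{R}^n)}$ is the set of $a\in S'(\mathbb{R}^n)$ with $\|a\|_{\mathcal{M}_{X}}:=\sup\{\|F^{-1}aFu\|_{X}/\|u\|_{X}: u\in (S(\mathbb{R}^n)\cap X)\setminus\{0\}\}<\infty$ (Fourier transforms on $S$, $S'$). $\mathcal{M}^0_{X(\mathbb{R}^n)}$ is the set of $a\in L^\infty(\mathbb{R}^n)$ with $\|a\|_{\mathcal{M}^0_{X}}:=\sup\{\|F^{-1}aFu\|_{X}/\|u\|_{X}: u\in (L^2(\mathbb{R}^n)\cap X)\setminus\{0\}\}<\infty$, with $F^{\pm1}$ on $L^2(\mathbb{R}^n)$. *)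

theory Defs
  imports "HOL-Analysis.Analysis"
begin

definition banach_function_norm :: "((real^'n \<Rightarrow> ennreal) \<Rightarrow> ennreal) \<Rightarrow> bool" where
  "banach_function_norm \<rho> \<longleftrightarrow>
     \<comment> \<open>(A1)\<close>
     (\<forall>f \<in> borel_measurable lebesgue. \<rho> f = 0 \<longleftrightarrow> (AE x in lebesgue. f x = 0)) \<and>
     (\<forall>f \<in> borel_measurable lebesgue. \<forall>a::real. a \<ge> 0 \<longrightarrow>
         \<rho> (\<lambda>x. ennreal a * f x) = ennreal a * \<rho> f) \<and>
     (\<forall>f \<in> borel_measurable lebesgue. \<forall>g \<in> borel_measurable lebesgue.
         \<rho> (\<lambda>x. f x + g x) \<le> \<rho> f + \<rho> g) \<and>
     \<comment> \<open>(A2)\<close>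
     (\<forall>f \<in> borel_measurable lebesgue. \<forall>g \<in> borel_measurable lebesgue.
         (AE x in lebesgue. g x \<le> f x) \<longrightarrow> \<rho> g \<le> \<rho> f) \<and>
     \<comment> \<open>(A3)\<close>
     (\<forall>fs f. (\<forall>j. fs j \<in> borel_measurable lebesgue) \<longrightarrow> f \<in> borel_measurable lebesgue \<longrightarrow>
         (AE x in lebesgue. incseq (\<lambda>j. fs j x) \<and> (\<lambda>j. fs j x) \<longlonglongrightarrow> f x) \<longrightarrow>
         incseq (\<lambda>j. \<rho> (fs j)) \<and> (\<lambda>j. \<rho> (fs j)) \<longlonglongrightarrow> \<rho> f) \<and>
     \<comment> \<open>(A4)\<close>
     (\<forall>E \<in> sets lebesgue. emeasure lebesgue E < \<infinity> \<longrightarrow> \<rho> (indicator E) < \<infinity>) \<and>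
     \<comment> \<open>(A5)\<close>
     (\<forall>E \<in> sets lebesgue. emeasure lebesgue E < \<infinity> \<longrightarrow>
         (\<exists>C::real. 0 < C \<and> (\<forall>f \<in> borel_measurable lebesgue.
             (\<integral>\<^sup>+ x \<in> E. f x \<partial>lebesgue) \<le> ennreal C * \<rho> f)))"

definition Xn :: "((real^'n \<Rightarrow> ennreal) \<Rightarrow> ennreal) \<Rightarrow> ((real^'n) \<Rightarrow> complex) \<Rightarrow> ennreal" where
  "Xn \<rho> f = \<rho> (\<lambda>x. ennreal (cmod (f x)))"

definition Xset :: "((real^'n \<Rightarrow> ennreal) \<Rightarrow> ennreal) \<Rightarrow> ((real^'n) \<Rightarrow> complex) set" where
  "Xset \<rho> = {f. f \<in> borel_measurable lebesgue \<and> Xn \<rho> f < \<infinity>}"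

definition reflection_invariant :: "((real^'n \<Rightarrow> ennreal) \<Rightarrow> ennreal) \<Rightarrow> bool" where
  "reflection_invariant \<rho> \<longleftrightarrow> (\<forall>f \<in> Xset \<rho>. Xn \<rho> f = Xn \<rho> (\<lambda>x. f (- x)))"

definition Xdual :: "((real^'n \<Rightarrow> ennreal) \<Rightarrow> ennreal) \<Rightarrow> (((real^'n) \<Rightarrow> complex) \<Rightarrow> complex) set" where
  "Xdual \<rho> = {L. (\<forall>f \<in> Xset \<rho>. \<forall>g \<in> Xset \<rho>. L (\<lambda>x. f x + g x) = L f + L g) \<and>
                  (\<forall>f \<in> Xset \<rho>. \<forall>c. L (\<lambda>x. c * f x) = c * L f) \<and>
                  (\<exists>C. \<forall>f \<in> Xset \<rho>. cmod (L f) \<le> C * enn2real (Xn \<rho> f))}"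

definition dual_norm :: "((real^'n \<Rightarrow> ennreal) \<Rightarrow> ennreal) \<Rightarrow> (((real^'n) \<Rightarrow> complex) \<Rightarrow> complex) \<Rightarrow> real" where
  "dual_norm \<rho> L = Inf {C. 0 \<le> C \<and> (\<forall>f \<in> Xset \<rho>. cmod (L f) \<le> C * enn2real (Xn \<rho> f))}"

definition reflexive_X :: "((real^'n \<Rightarrow> ennreal) \<Rightarrow> ennreal) \<Rightarrow> bool" where
  "reflexive_X \<rho> \<longleftrightarrow>
     (\<forall>\<Phi>. ((\<forall>L \<in> Xdual \<rho>. \<forall>L' \<in> Xdual \<rho>. \<Phi> (\<lambda>h. L h + L' h) = \<Phi> L + \<Phi> L') \<and>
           (\<forall>L \<in> Xdual \<rho>. \<forall>c. \<Phi> (\<lambda>h. c * L h) = c * \<Phi> L) \<and>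
           (\<exists>C. \<forall>L \<in> Xdual \<rho>. cmod (\<Phi> L) \<le> C * dual_norm \<rho> L))
        \<longrightarrow> (\<exists>f \<in> Xset \<rho>. \<forall>L \<in> Xdual \<rho>. \<Phi> L = L f))"

definition Linf_norm :: "((real^'n) \<Rightarrow> complex) \<Rightarrow> ennreal" where
  "Linf_norm a = Inf {C. AE x in lebesgue. ennreal (cmod (a x)) \<le> C}"

definition Linf :: "((real^'n) \<Rightarrow> complex) set" where
  "Linf = {a. a \<in> borel_measurable lebesgue \<and> Linf_norm a < \<infinity>}"

definition FT :: "((real^'n) \<Rightarrow> complex) \<Rightarrow> (real^'n) \<Rightarrow> complex" where
  "FT u \<xi> = (LINT x|lebesgue. u x * cis (- (x \<bullet> \<xi>)))"

definition IFT :: "((real^'n) \<Rightarrow> complex) \<Rightarrow> (real^'n) \<Rightarrow> complex" where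
  "IFT v x = complex_of_real (1 / (2 * pi) ^ CARD('n)) * (LINT \<xi>|lebesgue. v \<xi> * cis (x \<bullet> \<xi>))"

definition L2 :: "((real^'n) \<Rightarrow> complex) set" where
  "L2 = {f. f \<in> borel_measurable lebesgue \<and> integrable lebesgue (\<lambda>x. (cmod (f x))^2)}"

text \<open>Plancherel extension: limit in L^2 of the transforms of the truncations to balls.\<close>
definition FT2 :: "((real^'n) \<Rightarrow> complex) \<Rightarrow> (real^'n) \<Rightarrow> complex" where
  "FT2 u = (SOME g. g \<in> L2 \<and>
      (\<lambda>k::nat. \<integral>\<^sup>+ \<xi>. ennreal ((cmod (FT (\<lambda>y. indicator (ball 0 (real k)) y * u y) \<xi> - g \<xi>))^2) \<partial>lebesgue)
        \<longlonglongrightarrow> 0)"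

definition IFT2 :: "((real^'n) \<Rightarrow> complex) \<Rightarrow> (real^'n) \<Rightarrow> complex" where
  "IFT2 v = (SOME g. g \<in> L2 \<and>
      (\<lambda>k::nat. \<integral>\<^sup>+ x. ennreal ((cmod (IFT (\<lambda>y. indicator (ball 0 (real k)) y * v y) x - g x))^2) \<partial>lebesgue)
        \<longlonglongrightarrow> 0)"

definition pderiv_dir :: "'n \<Rightarrow> ((real^'n) \<Rightarrow> complex) \<Rightarrow> (real^'n) \<Rightarrow> complex" where
  "pderiv_dir i f x = vector_derivative (\<lambda>t::real. f (x + t *\<^sub>R axis i 1)) (at 0)"

fun Dl :: "'n list \<Rightarrow> ((real^'n) \<Rightarrow> complex) \<Rightarrow> (real^'n) \<Rightarrow> complex" where
  "Dl [] f = f"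
| "Dl (i # is) f = pderiv_dir i (Dl is f)"

definition schwartz :: "((real^'n) \<Rightarrow> complex) \<Rightarrow> bool" where
  "schwartz \<phi> \<longleftrightarrow>
     (\<forall>is i x. (\<lambda>t::real. Dl is \<phi> (x + t *\<^sub>R axis i 1)) differentiable (at 0)) \<and>
     (\<forall>is. continuous_on UNIV (Dl is \<phi>)) \<and>
     (\<forall>is (k::nat). bounded (range (\<lambda>x. (1 + norm x) ^ k * cmod (Dl is \<phi> x))))"

definition schwartz_seminorm :: "nat \<Rightarrow> 'n list \<Rightarrow> ((real^'n) \<Rightarrow> complex) \<Rightarrow> real" where
  "schwartz_seminorm k is \<phi> = (SUP x. (1 + norm x) ^ k * cmod (Dl is \<phi> x))"

definition tempered :: "(((real^'n) \<Rightarrow> complex) \<Rightarrow> complex) \<Rightarrow> bool" where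
  "tempered T \<longleftrightarrow>
     (\<forall>\<phi> \<psi>. schwartz \<phi> \<longrightarrow> schwartz \<psi> \<longrightarrow> T (\<lambda>x. \<phi> x + \<psi> x) = T \<phi> + T \<psi>) \<and>
     (\<forall>\<phi> c. schwartz \<phi> \<longrightarrow> T (\<lambda>x. c * \<phi> x) = c * T \<phi>) \<and>
     (\<exists>N::nat. \<exists>C::real. \<forall>\<phi>. schwartz \<phi> \<longrightarrow>
        cmod (T \<phi>) \<le> C * (\<Sum>k\<le>N. \<Sum>is \<in> {is. length is \<le> N}. schwartz_seminorm k is \<phi>))"

definition represents :: "(((real^'n) \<Rightarrow> complex) \<Rightarrow> complex) \<Rightarrow> ((real^'n) \<Rightarrow> complex) \<Rightarrow> bool" where
  "represents T g \<longleftrightarrow> g \<in> borel_measurable lebesgue \<and>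
     (\<forall>\<phi>. schwartz \<phi> \<longrightarrow> integrable lebesgue (\<lambda>x. g x * \<phi> x) \<and>
                          T \<phi> = (LINT x|lebesgue. g x * \<phi> x))"

text \<open>X-norm of a distribution: infinite unless it is a regular distribution.\<close>
definition dist_Xn :: "((real^'n \<Rightarrow> ennreal) \<Rightarrow> ennreal) \<Rightarrow> (((real^'n) \<Rightarrow> complex) \<Rightarrow> complex) \<Rightarrow> ennreal" where
  "dist_Xn \<rho> T = (INF g \<in> {g. represents T g}. Xn \<rho> g)"

text \<open>F^{-1} a F u for a tempered distribution a and Schwartz u:
  the distribution phi |-> a((Fu) * F^{-1} phi).\<close>
definition mult_op :: "(((real^'n) \<Rightarrow> complex) \<Rightarrow> complex) \<Rightarrow> ((real^'n) \<Rightarrow> complex)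
    \<Rightarrow> (((real^'n) \<Rightarrow> complex) \<Rightarrow> complex)" where
  "mult_op a u = (\<lambda>\<phi>. a (\<lambda>\<xi>. FT u \<xi> * IFT \<phi> \<xi>))"

definition M_norm :: "((real^'n \<Rightarrow> ennreal) \<Rightarrow> ennreal) \<Rightarrow> (((real^'n) \<Rightarrow> complex) \<Rightarrow> complex) \<Rightarrow> ennreal" where
  "M_norm \<rho> a = (SUP u \<in> {u. schwartz u \<and> u \<in> Xset \<rho> \<and> \<not> (AE x in lebesgue. u x = 0)}.
                    dist_Xn \<rho> (mult_op a u) / Xn \<rho> u)"

definition M_set :: "((real^'n \<Rightarrow> ennreal) \<Rightarrow> ennreal) \<Rightarrow> (((real^'n) \<Rightarrow> complex) \<Rightarrow> complex) set" where
  "M_set \<rho> = {a. tempered a \<and> M_norm \<rho> a < \<infinity>}"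

definition M0_norm :: "((real^'n \<Rightarrow> ennreal) \<Rightarrow> ennreal) \<Rightarrow> ((real^'n) \<Rightarrow> complex) \<Rightarrow> ennreal" where
  "M0_norm \<rho> a = (SUP u \<in> {u. u \<in> L2 \<and> u \<in> Xset \<rho> \<and> \<not> (AE x in lebesgue. u x = 0)}.
                    Xn \<rho> (IFT2 (\<lambda>\<xi>. a \<xi> * FT2 u \<xi>)) / Xn \<rho> u)"

definition M0_set :: "((real^'n \<Rightarrow> ennreal) \<Rightarrow> ennreal) \<Rightarrow> ((real^'n) \<Rightarrow> complex) set" where
  "M0_set \<rho> = {a. a \<in> Linf \<and> M0_norm \<rho> a < \<infinity>}"

end

theory Submission
  imports Defs "HOL-Probability.Sinc_Integral"
begin

text \<open>
  Let \<open>J u (x) = cnj (u (- x))\<close>. Reflection invariance makes \<open>J\<close> an isometry of \<open>X\<close>, and \<open>J T J\<close> is the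
  adjoint of a multiplier \<open>T\<close>. If \<open>T\<close> has symbol \<open>b\<close> and norm \<open>M\<close>, then \<open>S = J T J T\<close> multiplies the
  Fourier transform by \<open>|b|\<^sup>2\<close> and the norm of \<open>S\<^sup>m\<close> is at most \<open>M\<^sup>2\<^sup>m\<close>. For a modulated bump function
  \<open>u\<close>, axiom (A5) bounds the pairing of \<open>S\<^sup>m u\<close> with \<open>u\<close> by a constant times \<open>M\<^sup>2\<^sup>m\<close>, while by Parseval this
  pairing is the integral of \<open>|b|\<^sup>2\<^sup>m |F u|\<^sup>2\<close> up to a factor. Letting \<open>m\<close> grow, \<open>|b| \<le> M\<close> wherever
  \<open>F u \<noteq> 0\<close>, and the modulations of a fixed bump reach every frequency. This is part (a).

  For a distribution \<open>a\<close>, the mollified symbols \<open>b \<xi> = a (\<phi> (\<sqdot> - \<xi>))\<close> are slowly increasing functions and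
  their multipliers are averages of modulated copies of that of \<open>a\<close>, so \<open>|b| \<le> M\<close>. Concentrating \<open>\<phi>\<close> at
  the origin gives \<open>|a v| \<le> M \<parallel>v\<parallel>\<^sub>1\<close>, and the Riesz representation theorem in \<open>L2\<close>, applied after multiplication
  by an integrable weight, yields a density bounded by \<open>M\<close>. The symbol \<open>1\<close> shows that the constant is sharp.
\<close>

section \<open>Smoothness with growth conditions\<close>

text \<open>The iteration uses \<open>J T J T\<close> and not powers of \<open>T\<close> because its
  symbol is nonnegative: the pairing with \<open>u\<close> is then an integral without cancellation,
  whereas the pairing of \<open>u\<close> with a power of \<open>T\<close> applied to
  \<open>u\<close> could be small although \<open>b\<close> is large. The constant from (A5) depends
  on \<open>u\<close> and its box but not on \<open>m\<close>, so a geometric ratio absorbs it and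
  the final bound carries the constant 1. For a distribution the operator cannot be iterated
  directly, since it need not preserve the Schwartz class. A slowly increasing symbol does preserve
  it, hence the mollification. The price is the interchange of \<open>a\<close> with integrals over
  a parameter, needed both to realise the multiplier as a function and to write the mollified one as
  an average; the theory of families of Schwartz functions serves this interchange. An L1 bound is
  not an L2 bound, but Cauchy-Schwarz bounds the L1 norm of \<open>v\<close> by the L2 norms of the
  weight and of \<open>v / wt\<close>. This loses the constant \<open>M\<close>, which is recovered
  by testing the density where it exceeds \<open>M\<close>.\<close>

definition has_pd :: "'n::finite \<Rightarrow> ((real^'n) \<Rightarrow> complex) \<Rightarrow> ((real^'n) \<Rightarrow> complex) \<Rightarrow> bool" where
  "has_pd i f f' \<longleftrightarrow> (\<forall>x. ((\<lambda>t. f (x + t *\<^sub>R axis i 1)) has_vector_derivative f' x) (at 0))"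

definition polyb :: "((real^'n) \<Rightarrow> complex) \<Rightarrow> bool" where
  "polyb f \<longleftrightarrow> (\<exists>k C. \<forall>x. cmod (f x) \<le> C * (1 + norm x) ^ k)"

definition rapid :: "((real^'n) \<Rightarrow> complex) \<Rightarrow> bool" where
  "rapid f \<longleftrightarrow> (\<forall>k. \<exists>C. \<forall>x. (1 + norm x) ^ k * cmod (f x) \<le> C)"

text \<open>Smoothness together with a growth condition \<open>P\<close> on all iterated partial derivatives: a function is
  Schwartz iff it is smooth in this sense with \<open>P = rapid\<close>, and the slowly increasing functions
  (\<open>P = polyb\<close>) are its multipliers.\<close>

coinductive smooth_in :: "(((real^'n) \<Rightarrow> complex) \<Rightarrow> bool) \<Rightarrow> ((real^'n::finite) \<Rightarrow> complex) \<Rightarrow> bool"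
  for P where
  "continuous_on UNIV f \<Longrightarrow> P f \<Longrightarrow> (\<And>i. \<exists>f'. has_pd i f f' \<and> smooth_in P f') \<Longrightarrow> smooth_in P f"

abbreviation slow :: "((real^'n::finite) \<Rightarrow> complex) \<Rightarrow> bool" where
  "slow \<equiv> smooth_in polyb"

inductive lspan :: "('a \<Rightarrow> complex) set \<Rightarrow> ('a \<Rightarrow> complex) \<Rightarrow> bool" for B where
  base: "f \<in> B \<Longrightarrow> lspan B f"
| add: "lspan B f \<Longrightarrow> lspan B g \<Longrightarrow> lspan B (\<lambda>x. f x + g x)"
| scale: "lspan B f \<Longrightarrow> lspan B (\<lambda>x. c * f x)"

definition lin_closed :: "(('a \<Rightarrow> complex) \<Rightarrow> bool) \<Rightarrow> bool" where
  "lin_closed P \<longleftrightarrow> (\<forall>f g. P f \<longrightarrow> P g \<longrightarrow> P (\<lambda>x. f x + g x)) \<and> (\<forall>f c. P f \<longrightarrow> P (\<lambda>x. c * f x))"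

section \<open>Calculus of partial derivatives\<close>

lemma has_pd_imp:
  assumes "has_pd i f f'"
  shows "pderiv_dir i f = f'" "(\<lambda>t. f (x + t *\<^sub>R axis i 1)) differentiable (at 0)"
  using assms unfolding has_pd_def pderiv_dir_def
  by (auto intro!: vector_derivative_at differentiableI_vector)

lemma has_pd_line:
  assumes "has_pd i f f'"
  shows "((\<lambda>t. f (x + t *\<^sub>R axis i 1)) has_vector_derivative f' (x + t *\<^sub>R axis i 1)) (at t)"
proof -
  have "((\<lambda>s. f ((x + t *\<^sub>R axis i 1) + s *\<^sub>R axis i 1)) has_vector_derivative f' (x + t *\<^sub>R axis i 1)) (at (t - t))"
    using assms unfolding has_pd_def by simp
  then have "((\<lambda>s. f ((x + t *\<^sub>R axis i 1) + s *\<^sub>R axis i 1)) \<circ> (\<lambda>s. s - t)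
        has_vector_derivative 1 *\<^sub>R f' (x + t *\<^sub>R axis i 1)) (at t)"
    by (intro vector_diff_chain_at) (auto intro!: derivative_eq_intros)
  then show ?thesis by (simp add: o_def algebra_simps)
qed

lemma has_pd_add: "has_pd i f f' \<Longrightarrow> has_pd i g g' \<Longrightarrow> has_pd i (\<lambda>x. f x + g x) (\<lambda>x. f' x + g' x)"
  unfolding has_pd_def by (auto intro!: has_vector_derivative_add)

lemma has_pd_scale: "has_pd i f f' \<Longrightarrow> has_pd i (\<lambda>x. c * f x) (\<lambda>x. c * f' x)"
  unfolding has_pd_def by (auto intro!: has_vector_derivative_mult_right)

lemma has_pd_mult:
  "has_pd i f f' \<Longrightarrow> has_pd i g g' \<Longrightarrow> has_pd i (\<lambda>x. f x * g x) (\<lambda>x. f x * g' x + f' x * g x)"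
  unfolding has_pd_def
proof (intro allI)
  fix x
  assume "\<forall>x. ((\<lambda>t. f (x + t *\<^sub>R axis i 1)) has_vector_derivative f' x) (at 0)"
    and "\<forall>x. ((\<lambda>t. g (x + t *\<^sub>R axis i 1)) has_vector_derivative g' x) (at 0)"
  from has_vector_derivative_mult[OF this(1)[rule_format, of x] this(2)[rule_format, of x]]
  show "((\<lambda>t. f (x + t *\<^sub>R axis i 1) * g (x + t *\<^sub>R axis i 1)) has_vector_derivative f x * g' x + f' x * g x) (at 0)"
    by simp
qed

lemma has_pd_affine:
  assumes "has_pd i f f'"
  shows "has_pd i (\<lambda>x. f (s *\<^sub>R x + b)) (\<lambda>x. complex_of_real s * f' (s *\<^sub>R x + b))"
  unfolding has_pd_def
proof
  fix x
  have "((\<lambda>t. f ((s *\<^sub>R x + b) + t *\<^sub>R axis i 1)) \<circ> (\<lambda>t. s * t)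
        has_vector_derivative s *\<^sub>R f' (s *\<^sub>R x + b)) (at 0)"
    using assms unfolding has_pd_def
    by (intro vector_diff_chain_at) (auto intro!: derivative_eq_intros)
  then show "((\<lambda>t. f (s *\<^sub>R (x + t *\<^sub>R axis i 1) + b)) has_vector_derivative complex_of_real s * f' (s *\<^sub>R x + b)) (at 0)"
    by (simp add: o_def algebra_simps scaleR_conv_of_real)
qed

lemma has_pd_cnj: "has_pd i f f' \<Longrightarrow> has_pd i (\<lambda>x. cnj (f x)) (\<lambda>x. cnj (f' x))"
  unfolding has_pd_def by (auto intro!: has_vector_derivative_cnj)

lemma smooth_inD:
  assumes "smooth_in P f"
  shows "continuous_on UNIV f" "P f" "\<exists>f'. has_pd i f f' \<and> smooth_in P f'"
  using assms by (auto elim: smooth_in.cases)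

lemma smooth_in_pderiv:
  assumes "smooth_in P f"
  shows "has_pd i f (pderiv_dir i f)" "smooth_in P (pderiv_dir i f)"
  using smooth_inD(3)[OF assms, of i] has_pd_imp(1) by auto

text \<open>Coinduction up to linear combinations, which is what the Leibniz rule requires.\<close>

lemma smooth_span:
  assumes P: "lin_closed P"
    and B: "\<And>f. f \<in> B \<Longrightarrow> continuous_on UNIV f \<and> P f \<and> (\<forall>i. \<exists>f'. has_pd i f f' \<and> lspan B f')"
    and f: "lspan B f"
  shows "smooth_in P f"
proof -
  have *: "continuous_on UNIV f \<and> P f \<and> (\<forall>i. \<exists>f'. has_pd i f f' \<and> lspan B f')" if "lspan B f" for f
    using that
  proof induction
    case (base f) then show ?case using B by blast
  next
    case (add f g)
    have "P (\<lambda>x. f x + g x)" using P add unfolding lin_closed_def by auto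
    moreover have "continuous_on UNIV (\<lambda>x. f x + g x)" using add by (auto intro: continuous_on_add)
    moreover have "\<exists>f'. has_pd i (\<lambda>x. f x + g x) f' \<and> lspan B f'" for i
    proof -
      obtain f' g' where "has_pd i f f'" "lspan B f'" "has_pd i g g'" "lspan B g'" using add by metis
      then show ?thesis using has_pd_add[of i f f' g g'] lspan.add[of B f' g'] by blast
    qed
    ultimately show ?case by blast
  next
    case (scale f c)
    have "P (\<lambda>x. c * f x)" using P scale unfolding lin_closed_def by auto
    moreover have "continuous_on UNIV (\<lambda>x. c * f x)" using scale by (auto intro: continuous_on_mult_left)
    moreover have "\<exists>f'. has_pd i (\<lambda>x. c * f x) f' \<and> lspan B f'" for i
    proof -
      obtain f' where "has_pd i f f'" "lspan B f'" using scale by metis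
      then show ?thesis using has_pd_scale[of i f f' c] lspan.scale[of B f' c] by blast
    qed
    ultimately show ?case by blast
  qed
  show ?thesis using f
    by (coinduction arbitrary: f rule: smooth_in.coinduct) (use * in blast)
qed

text \<open>The whole class of smooth functions is closed under partial derivatives, so it can serve
  as the generating set in \<open>smooth_span\<close>.\<close>

lemma smooth_in_lspan:
  assumes P: "lin_closed P" and "\<And>f. f \<in> B \<Longrightarrow> smooth_in P f" "lspan B f"
  shows "smooth_in P f"
proof (rule smooth_span[OF P])
  show "lspan (Collect (smooth_in P)) f"
    using assms(3) by induction (auto intro: lspan.intros assms(2))
  fix h assume "h \<in> Collect (smooth_in P)"
  then have h: "smooth_in P h" by simp
  have "\<exists>f'. has_pd i h f' \<and> lspan (Collect (smooth_in P)) f'" for i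
    using smooth_inD(3)[OF h, of i] by (auto intro: lspan.base)
  then show "continuous_on UNIV h \<and> P h \<and> (\<forall>i. \<exists>f'. has_pd i h f' \<and> lspan (Collect (smooth_in P)) f')"
    using smooth_inD(1,2)[OF h] by blast
qed

lemma smooth_in_add:
  "lin_closed P \<Longrightarrow> smooth_in P f \<Longrightarrow> smooth_in P g \<Longrightarrow> smooth_in P (\<lambda>x. f x + g x)"
  by (rule smooth_in_lspan[of P "{f, g}"]) (auto intro: lspan.intros)

lemma smooth_in_scale:
  "lin_closed P \<Longrightarrow> smooth_in P f \<Longrightarrow> smooth_in P (\<lambda>x. c * f x)"
  by (rule smooth_in_lspan[of P "{f}"]) (auto intro: lspan.intros)

text \<open>By the Leibniz rule the derivative of a product is a sum of two products, so the
  products are closed under differentiation only up to the span. Three growth conditions are kept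
  apart so that both slow times slow and slow times rapid are instances.\<close>

lemma smooth_in_mult:
  assumes R: "lin_closed R" and PQ: "\<And>f g. P f \<Longrightarrow> Q g \<Longrightarrow> R (\<lambda>x. f x * g x)"
    and "smooth_in P f" "smooth_in Q g"
  shows "smooth_in R (\<lambda>x. f x * g x)"
proof (rule smooth_span[OF R])
  let ?B = "{h. \<exists>f g. h = (\<lambda>x. f x * g x) \<and> smooth_in P f \<and> smooth_in Q g}"
  show "lspan ?B (\<lambda>x. f x * g x)" using assms by (auto intro: lspan.base)
  fix h assume "h \<in> ?B"
  then obtain f g where h: "h = (\<lambda>x. f x * g x)" and f: "smooth_in P f" and g: "smooth_in Q g" by auto
  show "continuous_on UNIV h \<and> R h \<and> (\<forall>i. \<exists>f'. has_pd i h f' \<and> lspan ?B f')"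
  proof (intro conjI allI)
    show "continuous_on UNIV h" unfolding h using f g by (intro continuous_on_mult smooth_inD)
    show "R h" unfolding h by (rule PQ[OF smooth_inD(2)[OF f] smooth_inD(2)[OF g]])
    fix i
    obtain f' g' where "has_pd i f f'" "smooth_in P f'" "has_pd i g g'" "smooth_in Q g'"
      using smooth_inD(3)[OF f] smooth_inD(3)[OF g] by blast
    moreover have "lspan ?B (\<lambda>x. f x * g' x + f' x * g x)"
      by (intro lspan.add lspan.base) (use f g calculation in auto)
    ultimately show "\<exists>f'. has_pd i h f' \<and> lspan ?B f'" unfolding h using has_pd_mult by blast
  qed
qed

lemma smooth_in_affine:
  assumes P: "lin_closed P" and PA: "\<And>f. P f \<Longrightarrow> P (\<lambda>x. f (s *\<^sub>R x + b))" and "smooth_in P f"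
  shows "smooth_in P (\<lambda>x. f (s *\<^sub>R x + b))"
proof (rule smooth_span[OF P])
  let ?B = "{h. \<exists>f. h = (\<lambda>x. f (s *\<^sub>R x + b)) \<and> smooth_in P f}"
  show "lspan ?B (\<lambda>x. f (s *\<^sub>R x + b))" using assms by (auto intro: lspan.base)
  fix h assume "h \<in> ?B"
  then obtain f where h: "h = (\<lambda>x. f (s *\<^sub>R x + b))" and f: "smooth_in P f" by auto
  show "continuous_on UNIV h \<and> P h \<and> (\<forall>i. \<exists>f'. has_pd i h f' \<and> lspan ?B f')"
  proof (intro conjI allI)
    show "continuous_on UNIV h" unfolding h
      by (rule continuous_on_compose2[OF smooth_inD(1)[OF f]]) (auto intro!: continuous_intros)
    show "P h" unfolding h by (rule PA[OF smooth_inD(2)[OF f]])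
    fix i
    obtain f' where "has_pd i f f'" "smooth_in P f'" using smooth_inD(3)[OF f] by blast
    moreover have "lspan ?B (\<lambda>x. complex_of_real s * f' (s *\<^sub>R x + b))"
      by (intro lspan.scale lspan.base) (use f calculation in auto)
    ultimately show "\<exists>f'. has_pd i h f' \<and> lspan ?B f'" unfolding h using has_pd_affine by blast
  qed
qed

lemma smooth_in_cnj:
  assumes P: "\<And>f. P f \<Longrightarrow> P (\<lambda>x. cnj (f x))" and "smooth_in P f"
  shows "smooth_in P (\<lambda>x. cnj (f x))"
  using assms(2)
proof (coinduction arbitrary: f rule: smooth_in.coinduct)
  case smooth_in
  have "\<exists>f'. has_pd i (\<lambda>x. cnj (f x)) f' \<and> ((\<exists>g. f' = (\<lambda>x. cnj (g x)) \<and> smooth_in P g) \<or> smooth_in P f')" for i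
    using smooth_inD(3)[OF smooth_in, of i] has_pd_cnj by blast
  then show ?case
    using P[OF smooth_inD(2)[OF smooth_in]] smooth_inD(1)[OF smooth_in] by (auto intro: continuous_on_cnj)
qed

section \<open>Polynomial bounds and rapid decay\<close>

lemma lin_closed_polyb: "lin_closed polyb"
  unfolding lin_closed_def
proof safe
  fix f g :: "(real^'n) \<Rightarrow> complex" assume "polyb f" "polyb g"
  then obtain k C l D where "\<And>x. cmod (f x) \<le> C * (1 + norm x) ^ k" "\<And>x. cmod (g x) \<le> D * (1 + norm x) ^ l"
    unfolding polyb_def by auto
  note fg = this
  have "cmod (f x + g x) \<le> (\<bar>C\<bar> + \<bar>D\<bar>) * (1 + norm x) ^ (k + l)" for x
  proof -
    have "cmod (f x + g x) \<le> C * (1 + norm x) ^ k + D * (1 + norm x) ^ l"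
      using fg[of x] norm_triangle_ineq[of "f x" "g x"] by linarith
    also have "\<dots> \<le> \<bar>C\<bar> * (1 + norm x) ^ (k+l) + \<bar>D\<bar> * (1 + norm x) ^ (k+l)"
      by (intro add_mono mult_mono power_increasing) auto
    finally show ?thesis by (simp add: algebra_simps)
  qed
  then show "polyb (\<lambda>x. f x + g x)" unfolding polyb_def by blast
next
  fix f :: "(real^'n) \<Rightarrow> complex" and c assume "polyb f"
  then obtain k C where "\<And>x. cmod (f x) \<le> C * (1 + norm x) ^ k" unfolding polyb_def by auto
  then have "cmod (c * f x) \<le> (cmod c * C) * (1 + norm x) ^ k" for x
    by (simp add: norm_mult mult_left_mono mult.assoc)
  then show "polyb (\<lambda>x. c * f x)" unfolding polyb_def by blast
qed

lemma lin_closed_rapid: "lin_closed rapid"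
  unfolding lin_closed_def rapid_def
proof safe
  fix f g :: "(real^'n) \<Rightarrow> complex" and k
  assume "\<forall>k. \<exists>C. \<forall>x. (1 + norm x) ^ k * cmod (f x) \<le> C" "\<forall>k. \<exists>C. \<forall>x. (1 + norm x) ^ k * cmod (g x) \<le> C"
  then obtain C D where "\<And>x. (1 + norm x) ^ k * cmod (f x) \<le> C" "\<And>x. (1 + norm x) ^ k * cmod (g x) \<le> D" by metis
  note fg = this
  have "(1 + norm x) ^ k * cmod (f x + g x) \<le> C + D" for x
  proof -
    have "(1 + norm x) ^ k * cmod (f x + g x) \<le> (1 + norm x) ^ k * (cmod (f x) + cmod (g x))"
      by (intro mult_left_mono norm_triangle_ineq) auto
    then show ?thesis using fg[of x] by (simp add: algebra_simps)
  qed
  then show "\<exists>C. \<forall>x. (1 + norm x) ^ k * cmod (f x + g x) \<le> C" by blast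
next
  fix f :: "(real^'n) \<Rightarrow> complex" and c k assume "\<forall>k. \<exists>C. \<forall>x. (1 + norm x) ^ k * cmod (f x) \<le> C"
  then obtain C where "\<And>x. (1 + norm x) ^ k * cmod (f x) \<le> C" by metis
  then have "(1 + norm x) ^ k * cmod (c * f x) \<le> cmod c * C" for x
    by (metis mult.left_commute mult_left_mono norm_ge_zero norm_mult)
  then show "\<exists>C. \<forall>x. (1 + norm x) ^ k * cmod (c * f x) \<le> C" by blast
qed

lemma polyb_mult: "polyb f \<Longrightarrow> polyb g \<Longrightarrow> polyb (\<lambda>x. f x * g x)"
proof -
  assume "polyb f" "polyb g"
  then obtain k C l D where fg: "\<And>x. cmod (f x) \<le> C * (1 + norm x) ^ k" "\<And>x. cmod (g x) \<le> D * (1 + norm x) ^ l"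
    unfolding polyb_def by auto
  have "cmod (f x * g x) \<le> (C * D) * (1 + norm x) ^ (k + l)" for x
  proof -
    have "cmod (f x * g x) \<le> (C * (1 + norm x) ^ k) * (D * (1 + norm x) ^ l)"
      unfolding norm_mult using fg[of x] by (intro mult_mono) (auto intro: order_trans[OF norm_ge_zero])
    then show ?thesis by (simp add: power_add algebra_simps)
  qed
  then show ?thesis unfolding polyb_def by blast
qed

lemma polyb_rapid_mult: "polyb f \<Longrightarrow> rapid g \<Longrightarrow> rapid (\<lambda>x. f x * g x)"
  unfolding rapid_def
proof
  fix k assume "polyb f" "\<forall>k. \<exists>C. \<forall>x. (1 + norm x) ^ k * cmod (g x) \<le> C"
  then obtain l C D where fg: "\<And>x. cmod (f x) \<le> C * (1 + norm x) ^ l" "\<And>x. (1 + norm x) ^ (k + l) * cmod (g x) \<le> D"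
    unfolding polyb_def by metis
  have C: "C \<ge> 0" using fg(1)[of 0] by (simp add: order_trans[OF norm_ge_zero])
  have "(1 + norm x) ^ k * cmod (f x * g x) \<le> C * D" for x
  proof -
    have "(1 + norm x) ^ k * cmod (f x * g x) \<le> (1 + norm x) ^ k * ((C * (1 + norm x) ^ l) * cmod (g x))"
      unfolding norm_mult by (intro mult_left_mono mult_right_mono fg(1)) auto
    also have "\<dots> = C * ((1 + norm x) ^ (k + l) * cmod (g x))" by (simp add: power_add algebra_simps)
    also have "\<dots> \<le> C * D" by (intro mult_left_mono fg C)
    finally show ?thesis .
  qed
  then show "\<exists>C. \<forall>x. (1 + norm x) ^ k * cmod (f x * g x) \<le> C" by blast
qed

lemma rapid_imp_polyb: "rapid f \<Longrightarrow> polyb f"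
  unfolding rapid_def polyb_def by (drule spec[of _ 0], rule exI[of _ 0]) auto

lemma one_plus_norm_affine:
  fixes x b :: "'a::real_normed_vector"
  shows "1 + norm (s *\<^sub>R x + b) \<le> (1 + \<bar>s\<bar> + norm b) * (1 + norm x)"
proof -
  have "norm (s *\<^sub>R x + b) \<le> \<bar>s\<bar> * norm x + norm b" by (metis norm_scaleR norm_triangle_ineq)
  moreover have "0 \<le> norm b * norm x" by simp
  ultimately show ?thesis using norm_ge_zero[of x] abs_ge_zero[of s]
    unfolding distrib_left distrib_right by linarith
qed

text \<open>The affine map is invertible for \<open>s \<noteq> 0\<close>, so
  \<open>1 + norm x\<close> is at most a constant times the same weight at the image point, where
  the decay of \<open>f\<close> is available.\<close>

lemma rapid_affine: assumes s: "s \<noteq> 0" and "rapid f" shows "rapid (\<lambda>x. f (s *\<^sub>R x + b))"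
  unfolding rapid_def
proof
  fix k
  obtain C where f: "\<And>x. (1 + norm x) ^ k * cmod (f x) \<le> C" using assms unfolding rapid_def by metis
  let ?D = "1 + \<bar>1/s\<bar> + norm ((1/s) *\<^sub>R b)"
  have "(1 + norm x) ^ k * cmod (f (s *\<^sub>R x + b)) \<le> ?D ^ k * C" for x
  proof -
    have "(1/s) *\<^sub>R (s *\<^sub>R x + b) + - ((1/s) *\<^sub>R b) = x" using s by (simp add: algebra_simps)
    then have "1 + norm x \<le> ?D * (1 + norm (s *\<^sub>R x + b))"
      using one_plus_norm_affine[of "1/s" "s *\<^sub>R x + b" "- ((1/s) *\<^sub>R b)"] by simp
    then have "(1 + norm x) ^ k \<le> ?D ^ k * (1 + norm (s *\<^sub>R x + b)) ^ k"
      by (metis add_nonneg_nonneg norm_ge_zero power_mono power_mult_distrib zero_le_one)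
    then have "(1 + norm x) ^ k * cmod (f (s *\<^sub>R x + b)) \<le> ?D ^ k * (1 + norm (s *\<^sub>R x + b)) ^ k * cmod (f (s *\<^sub>R x + b))"
      by (intro mult_right_mono) auto
    also have "\<dots> \<le> ?D ^ k * C" unfolding mult.assoc by (intro mult_left_mono f) auto
    finally show ?thesis .
  qed
  then show "\<exists>C. \<forall>x. (1 + norm x) ^ k * cmod (f (s *\<^sub>R x + b)) \<le> C" by blast
qed

text \<open>The recursion of \<open>Dl\<close> splits off the outermost derivative; coinduction on
  \<open>f\<close> needs the innermost one.\<close>

lemma Dl_snoc: "Dl (is @ [i]) f = Dl is (pderiv_dir i f)"
  by (induction "is") auto

lemma Dl_append: "Dl (is @ js) f = Dl is (Dl js f)"
  by (induction "is") auto

lemma schwartz_pderiv_has: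
  assumes "schwartz f" shows "has_pd i f (pderiv_dir i f)" "schwartz (pderiv_dir i f)"
proof -
  have "(\<lambda>t. Dl [] f (x + t *\<^sub>R axis i 1)) differentiable at 0" for x
    using assms unfolding schwartz_def by blast
  then show "has_pd i f (pderiv_dir i f)"
    unfolding has_pd_def pderiv_dir_def using vector_derivative_works by auto
  show "schwartz (pderiv_dir i f)"
    using assms unfolding schwartz_def Dl_snoc[symmetric] by blast
qed

text \<open>The explicit definition quantifies over all lists of derivatives at once; the
  coinductive form speaks of one derivative at a time, and all later closure properties are proved
  through it.\<close>

lemma schwartz_eq: "schwartz = smooth_in rapid"
proof (intro ext iffI)
  fix f :: "(real^'n) \<Rightarrow> complex"
  assume "schwartz f"
  then show "smooth_in rapid f"
  proof (coinduction arbitrary: f rule: smooth_in.coinduct)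
    case smooth_in
    have "continuous_on UNIV (Dl [] f)" using smooth_in unfolding schwartz_def by blast
    then have "continuous_on UNIV f" by simp
    moreover have "rapid f" unfolding rapid_def
    proof
      fix k
      have "bounded (range (\<lambda>x. (1 + norm x) ^ k * cmod (Dl [] f x)))" using smooth_in unfolding schwartz_def by blast
      then show "\<exists>C. \<forall>x. (1 + norm x) ^ k * cmod (f x) \<le> C"
        unfolding bounded_iff by (auto intro: abs_le_D1)
    qed
    ultimately show ?case using schwartz_pderiv_has[OF smooth_in] by blast
  qed
next
  fix f :: "(real^'n) \<Rightarrow> complex"
  assume f: "smooth_in rapid f"
  have D: "smooth_in rapid (Dl is f)" for "is"
    by (induction "is") (auto simp: f intro: smooth_in_pderiv)
  show "schwartz f" unfolding schwartz_def
  proof (intro conjI allI)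
    fix "is" i k x
    show "(\<lambda>t. Dl is f (x + t *\<^sub>R axis i 1)) differentiable at 0"
      using has_pd_imp(2) smooth_in_pderiv(1)[OF D] by blast
    show "continuous_on UNIV (Dl is f)" using D smooth_inD by blast
    obtain C where "\<And>x. (1 + norm x) ^ k * cmod (Dl is f x) \<le> C"
      using smooth_inD(2)[OF D[of "is"]] unfolding rapid_def by metis
    then show "bounded (range (\<lambda>x. (1 + norm x) ^ k * cmod (Dl is f x)))"
      unfolding bounded_iff by (intro exI[of _ C]) auto
  qed
qed

section \<open>Closure properties of slowly increasing and Schwartz functions\<close>

lemma slow_add: "slow f \<Longrightarrow> slow g \<Longrightarrow> slow (\<lambda>x. f x + g x)"
  by (rule smooth_in_add[OF lin_closed_polyb])

lemma slow_scale: "slow f \<Longrightarrow> slow (\<lambda>x. c * f x)"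
  by (rule smooth_in_scale[OF lin_closed_polyb])

lemma slow_mult:
  assumes "slow f" "slow g" shows "slow (\<lambda>x. f x * g x)"
  by (rule smooth_in_mult[OF lin_closed_polyb _ assms]) (rule polyb_mult)

lemma schwartz_add: "schwartz f \<Longrightarrow> schwartz g \<Longrightarrow> schwartz (\<lambda>x. f x + g x)"
  unfolding schwartz_eq by (rule smooth_in_add[OF lin_closed_rapid])

lemma schwartz_scale: "schwartz f \<Longrightarrow> schwartz (\<lambda>x. c * f x)"
  unfolding schwartz_eq by (rule smooth_in_scale[OF lin_closed_rapid])

lemma slow_schwartz_mult:
  assumes "slow f" "schwartz g" shows "schwartz (\<lambda>x. f x * g x)"
  unfolding schwartz_eq
  by (rule smooth_in_mult[OF lin_closed_rapid _ assms(1) assms(2)[unfolded schwartz_eq]]) (rule polyb_rapid_mult)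

lemma schwartz_affine:
  assumes "s \<noteq> 0" "schwartz f" shows "schwartz (\<lambda>x. f (s *\<^sub>R x + b))"
  unfolding schwartz_eq
  by (rule smooth_in_affine[OF lin_closed_rapid _ assms(2)[unfolded schwartz_eq]]) (rule rapid_affine[OF assms(1)])

lemma schwartz_imp_slow: "schwartz f \<Longrightarrow> slow f"
  unfolding schwartz_eq
  by (coinduction arbitrary: f rule: smooth_in.coinduct)
     (use smooth_inD rapid_imp_polyb in blast)

lemma schwartz_mult: "schwartz f \<Longrightarrow> schwartz g \<Longrightarrow> schwartz (\<lambda>x. f x * g x)"
  using slow_schwartz_mult schwartz_imp_slow by blast

lemma schwartz_cnj: "schwartz f \<Longrightarrow> schwartz (\<lambda>x. cnj (f x))"
  unfolding schwartz_eq by (rule smooth_in_cnj) (auto simp: rapid_def)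

lemma schwartz_reflect: "schwartz f \<Longrightarrow> schwartz (\<lambda>x. f (- x))"
  using schwartz_affine[of "-1" f 0] by simp

lemma schwartz_translate: "schwartz f \<Longrightarrow> schwartz (\<lambda>x. f (x - b))"
  using schwartz_affine[of 1 f "- b"] by simp

section \<open>Constants, coordinates and characters\<close>

lemma slow_const: "slow (\<lambda>x. c)"
proof (coinduction arbitrary: c rule: smooth_in.coinduct)
  case smooth_in
  have "polyb (\<lambda>x::real^'a. c)" unfolding polyb_def by (intro exI[of _ 0] exI[of _ "cmod c"]) auto
  moreover have "has_pd i (\<lambda>x::real^'a. c) (\<lambda>x. 0)" for i unfolding has_pd_def by auto
  ultimately show ?case by (auto intro!: exI[of _ "\<lambda>x::real^'a. 0"])
qed

lemma slow_of_pd: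
  assumes "continuous_on UNIV f" "polyb f" "\<And>i. \<exists>f'. has_pd i f f' \<and> slow f'"
  shows "slow f"
  using assms by (rule smooth_in.intros)

lemma slow_coord: "slow (\<lambda>x. complex_of_real (x $ i))"
proof (rule slow_of_pd)
  show "continuous_on UNIV (\<lambda>x::real^'a. complex_of_real (x $ i))" by (intro continuous_intros)
  have "\<bar>x $ i\<bar> \<le> 1 * (1 + norm x) ^ 1" for x :: "real^'a" using component_le_norm_cart[of x i] by simp
  then show "polyb (\<lambda>x::real^'a. complex_of_real (x $ i))" unfolding polyb_def norm_of_real by blast
  fix j
  have "has_pd j (\<lambda>x::real^'a. complex_of_real (x $ i)) (\<lambda>x. if i = j then 1 else 0)"
    unfolding has_pd_def
  proof
    fix x :: "real^'a"
    have "(\<lambda>t. complex_of_real ((x + t *\<^sub>R axis j 1) $ i))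
        = (\<lambda>t. complex_of_real (x $ i) + (if i = j then 1 else 0) * complex_of_real t)"
      by (auto simp: axis_def)
    moreover have "(\<dots> has_vector_derivative (if i = j then 1 else 0)) (at 0)"
      by (auto intro!: derivative_eq_intros has_vector_derivative_of_real)
    ultimately show "((\<lambda>t. complex_of_real ((x + t *\<^sub>R axis j 1) $ i)) has_vector_derivative (if i = j then 1 else 0)) (at 0)"
      by (simp only:)
  qed
  then show "\<exists>f'. has_pd j (\<lambda>x::real^'a. complex_of_real (x $ i)) f' \<and> slow f'" using slow_const by blast
qed

lemma has_vector_derivative_cis: "(cis has_vector_derivative \<i> * cis t) (at t)"
  unfolding has_vector_derivative_def using has_derivative_cis[of "\<lambda>x. x" "\<lambda>x. x" t UNIV] by simp

lemma has_pd_cis: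
  "has_pd i (\<lambda>x. cis (x \<bullet> \<eta>)) (\<lambda>x. \<i> * complex_of_real (\<eta> $ i) * cis (x \<bullet> \<eta>))"
  unfolding has_pd_def
proof
  fix x
  have "((\<lambda>t. cis ((x + t *\<^sub>R axis i 1) \<bullet> \<eta>)) has_vector_derivative
     ((axis i 1 \<bullet> \<eta>) *\<^sub>R (\<i> * cis ((x + 0 *\<^sub>R axis i 1) \<bullet> \<eta>)))) (at 0)"
    by (rule vector_diff_chain_at[where g = cis, unfolded o_def])
       (auto intro!: derivative_eq_intros has_vector_derivative_cis simp: inner_add_left)
  then show "((\<lambda>t. cis ((x + t *\<^sub>R axis i 1) \<bullet> \<eta>)) has_vector_derivative
     \<i> * complex_of_real (\<eta> $ i) * cis (x \<bullet> \<eta>)) (at 0)"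
    by (simp add: inner_axis' scaleR_conv_of_real algebra_simps)
qed

text \<open>Each partial derivative of a character is a constant multiple of it, so a single
  function spans a set closed under differentiation.\<close>

lemma slow_cis: "slow (\<lambda>x. cis (x \<bullet> \<eta>))"
proof (rule smooth_span[OF lin_closed_polyb])
  let ?B = "{\<lambda>x::real^'a. cis (x \<bullet> \<eta>)}"
  show "lspan ?B (\<lambda>x. cis (x \<bullet> \<eta>))" by (auto intro: lspan.base)
  fix h assume "h \<in> ?B"
  moreover have "polyb (\<lambda>x. cis (x \<bullet> \<eta>))" unfolding polyb_def by (intro exI[of _ 0] exI[of _ 1]) auto
  moreover have "lspan ?B (\<lambda>x. \<i> * complex_of_real (\<eta> $ i) * cis (x \<bullet> \<eta>))" for i
    by (intro lspan.scale lspan.base) auto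
  ultimately show "continuous_on UNIV h \<and> polyb h \<and> (\<forall>i. \<exists>f'. has_pd i h f' \<and> lspan ?B f')"
    using has_pd_cis by (auto intro!: continuous_intros)
qed

section \<open>Lebesgue measure and affine maps\<close>

lemma
  fixes c :: real and t :: "'a::euclidean_space"
  assumes c: "c \<noteq> 0"
  shows lebesgue_affine: "lebesgue = density (distr lebesgue lebesgue (\<lambda>x. t + c *\<^sub>R x)) (\<lambda>_. ennreal (\<bar>c\<bar> ^ DIM('a)))"
    and measurable_affine_lebesgue: "(\<lambda>x. t + c *\<^sub>R x) \<in> lebesgue \<rightarrow>\<^sub>M lebesgue"
proof -
  have T: "(\<lambda>x. t + (\<Sum>j\<in>Basis. (c * (x \<bullet> j)) *\<^sub>R j)) = (\<lambda>x. t + c *\<^sub>R x)"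
    unfolding scaleR_scaleR[symmetric] scaleR_sum_right[symmetric] euclidean_representation ..
  show "lebesgue = density (distr lebesgue lebesgue (\<lambda>x. t + c *\<^sub>R x)) (\<lambda>_. ennreal (\<bar>c\<bar> ^ DIM('a)))"
    using lebesgue_affine_euclidean[of "\<lambda>_. c" t] c unfolding T by simp
  show "(\<lambda>x. t + c *\<^sub>R x) \<in> lebesgue \<rightarrow>\<^sub>M lebesgue"
    using lebesgue_affine_measurable[of "\<lambda>_. c" t] c unfolding T by simp
qed

lemma borel_measurable_affine_lebesgue:
  fixes c :: real and t :: "'a::euclidean_space"
  assumes "c \<noteq> 0" "f \<in> borel_measurable lebesgue"
  shows "(\<lambda>x. f (t + c *\<^sub>R x)) \<in> borel_measurable lebesgue"
  using measurable_compose[OF measurable_affine_lebesgue[OF assms(1)] assms(2)] .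

lemma nn_integral_affine_lebesgue:
  fixes c :: real and t :: "'a::euclidean_space"
  assumes c: "c \<noteq> 0" and f: "f \<in> borel_measurable lebesgue"
  shows "(\<integral>\<^sup>+x. f x \<partial>lebesgue) = ennreal (\<bar>c\<bar> ^ DIM('a)) * (\<integral>\<^sup>+x. f (t + c *\<^sub>R x) \<partial>lebesgue)"
proof -
  note m[measurable] = measurable_affine_lebesgue[OF c, of t] and f[measurable]
  show ?thesis
    by (subst lebesgue_affine[OF c, of t]) (simp add: nn_integral_density nn_integral_distr nn_integral_cmult)
qed

lemma integrable_affine_lebesgue:
  fixes c :: real and t :: "'a::euclidean_space" and f :: "'a \<Rightarrow> 'b::{banach, second_countable_topology}"
  assumes c: "c \<noteq> 0" and f: "integrable lebesgue f"
  shows "integrable lebesgue (\<lambda>x. f (t + c *\<^sub>R x))"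
proof -
  have m: "f \<in> borel_measurable lebesgue" using f by auto
  have "(\<integral>\<^sup>+x. norm (f x) \<partial>lebesgue) = ennreal (\<bar>c\<bar> ^ DIM('a)) * (\<integral>\<^sup>+x. norm (f (t + c *\<^sub>R x)) \<partial>lebesgue)"
    using m by (intro nn_integral_affine_lebesgue c) auto
  moreover have "(\<integral>\<^sup>+x. norm (f x) \<partial>lebesgue) < \<infinity>" using f by (simp add: integrable_iff_bounded)
  ultimately have "(\<integral>\<^sup>+x. norm (f (t + c *\<^sub>R x)) \<partial>lebesgue) < \<infinity>"
    using c by (auto simp: ennreal_mult_less_top)
  then show ?thesis
    using borel_measurable_affine_lebesgue[OF c m] by (simp add: integrable_iff_bounded)
qed

lemma integral_affine_lebesgue:
  fixes c :: real and t :: "'a::euclidean_space" and f :: "'a \<Rightarrow> 'b::{banach, second_countable_topology}"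
  assumes c: "c \<noteq> 0" and f: "f \<in> borel_measurable lebesgue"
  shows "(LINT x|lebesgue. f x) = (\<bar>c\<bar> ^ DIM('a)) *\<^sub>R (LINT x|lebesgue. f (t + c *\<^sub>R x))"
proof -
  note m[measurable] = measurable_affine_lebesgue[OF c, of t] and f[measurable]
  show ?thesis
    by (subst lebesgue_affine[OF c, of t]) (simp add: integral_density integral_distr)
qed

lemmas borel_measurable_reflect_lebesgue = borel_measurable_affine_lebesgue[of "-1" _ 0, simplified]
lemmas integrable_reflect_lebesgue = integrable_affine_lebesgue[of "-1" _ 0, simplified]
lemmas integral_reflect_lebesgue = integral_affine_lebesgue[of "-1" _ 0, simplified]
lemmas integrable_translate_lebesgue = integrable_affine_lebesgue[of 1, simplified]
lemmas integral_translate_lebesgue = integral_affine_lebesgue[of 1, simplified]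

section \<open>Compactly supported smooth functions\<close>

text \<open>The family \<open>t \<mapsto> t\<^sup>-\<^sup>k exp (- 1 / t)\<close>, extended by zero, is closed under differentiation up to linear
  combinations, so its smoothness also follows by coinduction.\<close>

definition fexp :: "nat \<Rightarrow> real \<Rightarrow> real" where
  "fexp k t = (if t > 0 then (1 / t) ^ k * exp (- 1 / t) else 0)"

lemma power_le_fact_exp:
  fixes x :: real assumes "x \<ge> 0" shows "x ^ n \<le> fact n * exp x"
proof -
  have "(\<Sum>k\<in>{n}. x ^ k / fact k) \<le> (\<Sum>k. x ^ k / fact k)"
    using assms summable_exp[of x] by (intro sum_le_suminf) (auto simp: divide_inverse mult.commute)
  also have "\<dots> = exp x" by (simp add: exp_def divide_inverse mult.commute)
  finally show ?thesis by (simp add: field_simps)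
qed

lemma fexp_bounds: "0 \<le> fexp k t" "fexp k t \<le> fact k"
proof -
  show "0 \<le> fexp k t" by (simp add: fexp_def)
  show "fexp k t \<le> fact k"
  proof (cases "t > 0")
    case True
    have "(1/t) ^ k * exp (- (1 / t)) \<le> (fact k * exp (1/t)) * exp (- (1 / t))"
      using True by (intro mult_right_mono power_le_fact_exp) auto
    then show ?thesis using True by (simp add: fexp_def mult.assoc exp_minus_inverse)
  qed (simp add: fexp_def)
qed

lemma fexp_deriv:
  "(fexp k has_real_derivative (- real k * fexp (Suc k) t + fexp (k + 2) t)) (at t)"
proof -
  consider "t > 0" | "t < 0" | "t = 0" by linarith
  then show ?thesis
  proof cases
    case 1
    have A: "((\<lambda>t. 1 / t) has_real_derivative (- 1 / t\<^sup>2)) (at t)"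
      and B: "((\<lambda>t. - 1 / t) has_real_derivative (1 / t\<^sup>2)) (at t)"
      using 1 by (auto intro!: derivative_eq_intros simp: power2_eq_square)
    have "((\<lambda>t. (1 / t) ^ k * exp (- 1 / t)) has_real_derivative
        real k * (1 / t) ^ (k - 1) * (- 1 / t\<^sup>2) * exp (- 1 / t) + (1 / t) ^ k * (exp (- 1 / t) * (1 / t\<^sup>2))) (at t)"
      by (rule DERIV_cong[OF DERIV_mult[OF DERIV_power[OF A, of k] DERIV_fun_exp[OF B]]]) simp
    \<comment> \<open>The truncated exponent \<open>k - 1\<close> is harmless: for
      \<open>k = 0\<close> both sides vanish through the factor \<open>real k\<close>.\<close>
    moreover have eq: "real k * (1 / t) ^ (k - 1) * (- 1 / t\<^sup>2) = - real k * (1 / t) ^ Suc k"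
    proof (cases k)
      case (Suc m)
      have "- 1 / t\<^sup>2 = - ((1 / t) * (1 / t))" by (simp add: power2_eq_square)
      then show ?thesis unfolding Suc by (simp only: diff_Suc_1 power_Suc mult_minus_left mult_minus_right ac_simps)
    qed simp
    ultimately have "((\<lambda>t. (1 / t) ^ k * exp (- 1 / t)) has_real_derivative (- real k * fexp (Suc k) t + fexp (k + 2) t)) (at t)"
      unfolding eq using 1 by (simp add: fexp_def power2_eq_square field_simps)
    then show ?thesis
      by (rule has_field_derivative_transform_within[where d = t]) (use 1 in \<open>auto simp: fexp_def dist_real_def\<close>)
  next
    case 2
    have "((\<lambda>t. 0) has_real_derivative (- real k * fexp (Suc k) t + fexp (k + 2) t)) (at t)"
      using 2 by (simp add: fexp_def)
    then show ?thesis
      by (rule has_field_derivative_transform_within[where d = "- t"]) (use 2 in \<open>auto simp: fexp_def dist_real_def\<close>)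
  next
    case 3
    \<comment> \<open>At the origin, \<open>fexp k h\<close> equals the square of \<open>h\<close>
      times the bounded \<open>fexp (k + 2) h\<close>, so the difference quotient tends to
      zero.\<close>
    have "norm (fexp k h / h) \<le> fact (k + 2) * \<bar>h\<bar>" for h
    proof (cases "h > 0")
      case True
      then have "fexp k h = h\<^sup>2 * fexp (k + 2) h" by (simp add: fexp_def power_add power2_eq_square)
      also have "\<dots> \<le> h\<^sup>2 * fact (k + 2)" by (intro mult_left_mono fexp_bounds) auto
      finally show ?thesis using True fexp_bounds(1)[of k h] by (simp add: field_simps power2_eq_square)
    next
      case False
      then have "fexp k h / h = 0" by (simp add: fexp_def)
      moreover have "0 \<le> fact (k + 2) * \<bar>h\<bar>" by (rule mult_nonneg_nonneg) auto
      ultimately show ?thesis by (simp only: norm_zero)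
    qed
    then have "\<forall>\<^sub>F h in at 0. norm (fexp k h / h) \<le> fact (k + 2) * \<bar>h\<bar>" by (intro always_eventually) blast
    moreover have "((\<lambda>h::real. fact (k + 2) * \<bar>h\<bar>) \<longlongrightarrow> 0) (at 0)"
      by (rule tendsto_mult_right_zero) (rule tendsto_rabs_zero, rule tendsto_ident_at)
    ultimately have "((\<lambda>h. fexp k h / h) \<longlongrightarrow> 0) (at 0)" by (rule Lim_null_comparison)
    then show ?thesis using 3 by (simp add: has_field_derivative_iff fexp_def)
  qed
qed

lemma fexp_isCont: "isCont (fexp k) t"
  using DERIV_isCont[OF fexp_deriv] .

lemma slow_fexp: "slow (\<lambda>x::real^'n. complex_of_real (fexp k (s * x $ i + c)))"
proof (rule smooth_span[OF lin_closed_polyb])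
  let ?g = "\<lambda>k (x::real^'n). complex_of_real (fexp k (s * x $ i + c))"
  let ?B = "range ?g"
  show "lspan ?B (?g k)" by (auto intro: lspan.base)
  fix h :: "real^'n \<Rightarrow> complex" assume "h \<in> ?B"
  then obtain k where h: "h = ?g k" by auto
  show "continuous_on UNIV h \<and> polyb h \<and> (\<forall>i. \<exists>f'. has_pd i h f' \<and> lspan ?B f')"
  proof (intro conjI allI)
    have "isCont (\<lambda>x::real^'n. fexp k (s * x $ i + c)) x" for x
      by (rule isCont_o2[OF _ fexp_isCont]) (auto intro!: continuous_intros)
    then show "continuous_on UNIV h" unfolding h
      by (auto intro!: continuous_intros simp: continuous_on_eq_continuous_at)
    show "polyb h" unfolding h polyb_def
      by (intro exI[of _ 0] exI[of _ "fact k"]) (auto simp: fexp_bounds abs_of_nonneg)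
    fix j
    let ?d = "if i = j then s else 0"
    let ?h' = "\<lambda>x. complex_of_real ?d * (complex_of_real (- real k) * ?g (Suc k) x + ?g (k + 2) x)"
    have "has_pd j h ?h'"
      unfolding has_pd_def
    proof
      fix x
      have "((\<lambda>t. fexp k (s * (x + t *\<^sub>R axis j 1) $ i + c)) has_real_derivative
         (- real k * fexp (Suc k) (s * (x + 0 *\<^sub>R axis j 1) $ i + c) + fexp (k + 2) (s * (x + 0 *\<^sub>R axis j 1) $ i + c)) * ?d) (at 0)"
        by (rule DERIV_chain2[OF fexp_deriv]) (auto intro!: derivative_eq_intros simp: axis_def)
      then have "((\<lambda>t. fexp k (s * (x + t *\<^sub>R axis j 1) $ i + c)) has_real_derivative
         (- real k * fexp (Suc k) (s * x $ i + c) + fexp (k + 2) (s * x $ i + c)) * ?d) (at 0)"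
        by simp
      from has_vector_derivative_of_real[OF this]
      show "((\<lambda>t. h (x + t *\<^sub>R axis j 1)) has_vector_derivative ?h' x) (at 0)"
        unfolding h by (simp add: algebra_simps)
    qed
    moreover have "lspan ?B ?h'"
      by (rule lspan.scale, rule lspan.add, rule lspan.scale) (auto intro: lspan.base)
    ultimately show "\<exists>f'. has_pd j h f' \<and> lspan ?B f'" by blast
  qed
qed

lemma slow_prod:
  assumes "finite I" "\<And>i. i \<in> I \<Longrightarrow> slow (f i)" shows "slow (\<lambda>x. \<Prod>i\<in>I. f i x)"
  using assms by (induction I) (auto intro: slow_const slow_mult)

text \<open>On a compact set every polynomial weight is bounded, so a polynomial bound suffices for
  rapid decay. Vanishing off \<open>K\<close> passes to derivatives because the complement of
  \<open>K\<close> is open.\<close>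

lemma schwartz_compact_support:
  assumes "slow f" and f0: "\<And>x. x \<notin> K \<Longrightarrow> f x = 0" and K: "compact K"
  shows "schwartz f"
  unfolding schwartz_eq using assms(1,2)
proof (coinduction arbitrary: f rule: smooth_in.coinduct)
  case smooth_in
  note f = smooth_in
  obtain R where R: "\<And>x. x \<in> K \<Longrightarrow> norm x \<le> R" using K compact_imp_bounded bounded_iff by metis
  obtain l C where C: "\<And>x. cmod (f x) \<le> C * (1 + norm x) ^ l"
    using smooth_inD(2)[OF f(1)] unfolding polyb_def by auto
  have C0: "C \<ge> 0" using C[of 0] by (simp add: order_trans[OF norm_ge_zero])
  have "(1 + norm x) ^ k * cmod (f x) \<le> (1 + \<bar>R\<bar>) ^ k * (C * (1 + \<bar>R\<bar>) ^ l)" for x k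
  proof (cases "x \<in> K")
    case True
    then have "norm x \<le> \<bar>R\<bar>" using R[of x] by linarith
    then have "C * (1 + norm x) ^ l \<le> C * (1 + \<bar>R\<bar>) ^ l" using C0 by (intro mult_left_mono power_mono) auto
    then show ?thesis using C[of x] \<open>norm x \<le> \<bar>R\<bar>\<close> by (intro mult_mono power_mono) auto
  qed (use f(2) C0 in auto)
  then have "rapid f" unfolding rapid_def by blast
  moreover have "\<exists>f'. has_pd i f f' \<and> slow f' \<and> (\<forall>x. x \<notin> K \<longrightarrow> f' x = 0)" for i
  proof -
    obtain f' where f': "has_pd i f f'" "slow f'" using smooth_inD(3)[OF f(1)] by blast
    have "f' x = 0" if x: "x \<notin> K" for x
    proof -
      have "open (- K)" using K compact_imp_closed by blast
      then obtain e where e: "e > 0" "ball x e \<subseteq> - K" using x openE by blast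
      have "((\<lambda>t. 0) has_vector_derivative f' x) (at 0)"
      proof (rule has_vector_derivative_transform_within_open[where S = "ball 0 e"])
        show "((\<lambda>t. f (x + t *\<^sub>R axis i 1)) has_vector_derivative f' x) (at 0)"
          using f'(1) unfolding has_pd_def by blast
        fix t :: real assume "t \<in> ball 0 e"
        then have "x + t *\<^sub>R axis i 1 \<in> ball x e" by (simp add: dist_norm)
        then show "f (x + t *\<^sub>R axis i 1) = 0" using e f(2) by blast
      qed (use e in auto)
      then show ?thesis using has_vector_derivative_const[of 0 "at 0"] vector_derivative_at by metis
    qed
    then show ?thesis using f' by blast
  qed
  ultimately show ?case using smooth_inD(1)[OF f(1)] by blast
qed

text \<open>In each coordinate the factors are exp (- 1 / (k (x - a))) and exp (- 1 / (k (b - x))),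
  cut off to zero outside the interval. Large \<open>k\<close> makes the function tend to the
  indicator of the box, so one family provides both test functions and approximations of
  indicators.\<close>

definition bump :: "real \<Rightarrow> real^'n \<Rightarrow> real^'n \<Rightarrow> real^'n \<Rightarrow> real" where
  "bump k a b x = (\<Prod>i\<in>UNIV. fexp 0 (k * x $ i + - k * a $ i) * fexp 0 (- k * x $ i + k * b $ i))"

lemma bump_bounds: "0 \<le> bump k a b x" "bump k a b x \<le> 1"
proof -
  have "fexp 0 u \<le> 1" for u using fexp_bounds(2)[of 0 u] by simp
  then show "0 \<le> bump k a b x" "bump k a b x \<le> 1" unfolding bump_def
    by (auto intro!: prod_nonneg prod_le_1 mult_nonneg_nonneg mult_le_one fexp_bounds(1))
qed

lemma bump_support:
  assumes "k > 0" "x \<notin> box a b" shows "bump k a b x = 0"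
proof -
  obtain i where i: "\<not> (a $ i < x $ i \<and> x $ i < b $ i)" using assms(2) by (auto simp: mem_box_cart)
  have "fexp 0 (k * x $ i + - k * a $ i) * fexp 0 (- k * x $ i + k * b $ i) = 0"
  proof (cases "a $ i < x $ i")
    case True
    then have "\<not> (- k * x $ i + k * b $ i > 0)" using i assms(1) by (auto simp: algebra_simps)
    then show ?thesis by (simp add: fexp_def)
  next
    case False
    then have "\<not> (k * x $ i + - k * a $ i > 0)" using assms(1) by (auto simp: algebra_simps)
    then show ?thesis by (simp add: fexp_def)
  qed
  then show ?thesis unfolding bump_def by (intro prod_zero) auto
qed

lemma bump_pos:
  assumes "k > 0" "x \<in> box a b" shows "bump k a b x > 0"
  unfolding bump_def
  by (rule prod_pos) (use assms in \<open>auto simp: fexp_def mem_box_cart\<close>)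

lemma schwartz_bump:
  assumes k: "k > 0" shows "schwartz (\<lambda>x. complex_of_real (bump k a b x))"
proof (rule schwartz_compact_support)
  show "slow (\<lambda>x. complex_of_real (bump k a b x))"
    unfolding bump_def of_real_prod of_real_mult by (intro slow_prod slow_mult slow_fexp) auto
  show "complex_of_real (bump k a b x) = 0" if "x \<notin> cbox a b" for x
    using bump_support[OF k, of x a b] that box_subset_cbox by auto
qed auto

lemma bump_tendsto:
  "(\<lambda>k. bump (real (Suc k)) a b x) \<longlonglongrightarrow> indicator (box a b) x"
proof (cases "x \<in> box a b")
  case True
  have *: "(\<lambda>k. fexp 0 (real (Suc k) * s)) \<longlonglongrightarrow> 1" if "s > 0" for s :: real
  proof -
    have "(\<lambda>k. exp (- (1 / s) * inverse (real (Suc k)))) \<longlonglongrightarrow> exp (- (1 / s) * 0)"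
      by (intro tendsto_intros LIMSEQ_inverse_real_of_nat)
    then show ?thesis using that by (simp add: fexp_def divide_inverse mult.commute)
  qed
  have "(\<lambda>k. bump (real (Suc k)) a b x) \<longlonglongrightarrow> (\<Prod>i\<in>(UNIV::'a set). 1 * 1)"
    unfolding bump_def
  proof (intro tendsto_prod tendsto_mult)
    fix i
    have "x $ i - a $ i > 0" "b $ i - x $ i > 0" using True by (auto simp: mem_box_cart)
    from this[THEN *] show "(\<lambda>k. fexp 0 (real (Suc k) * x $ i + - real (Suc k) * a $ i)) \<longlonglongrightarrow> 1"
      "(\<lambda>k. fexp 0 (- real (Suc k) * x $ i + real (Suc k) * b $ i)) \<longlonglongrightarrow> 1"
      by (simp_all add: algebra_simps)
  qed
  then show ?thesis using True by simp
qed (simp add: bump_support del: of_nat_Suc)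

section \<open>Integrability of Schwartz functions\<close>

lemma Basis_cart: "(Basis :: (real^'n) set) = range (\<lambda>i. axis i 1)"
  by (auto simp: Basis_vec_def)

text \<open>Tonelli in coordinates; it reduces the integrals of \<open>wt\<close> and of the
  Gaussian to one dimension.\<close>

lemma nn_integral_cart_prod:
  fixes g :: "real \<Rightarrow> real"
  assumes [measurable]: "g \<in> borel_measurable borel" and g0: "\<And>t. g t \<ge> 0"
  shows "(\<integral>\<^sup>+x. ennreal (\<Prod>i\<in>UNIV. g ((x::real^'n) $ i)) \<partial>lborel) = (\<integral>\<^sup>+t. ennreal (g t) \<partial>lborel) ^ CARD('n)"
proof -
  have inj: "inj (\<lambda>i::'n. axis i (1::real))" by (auto simp: inj_on_def axis_eq_axis)
  have "(\<integral>\<^sup>+x. (\<Prod>b\<in>Basis. ennreal (g ((x::real^'n) \<bullet> b))) \<partial>lborel) = (\<Prod>b\<in>(Basis::(real^'n) set). (\<integral>\<^sup>+t. ennreal (g t) \<partial>lborel))"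
    by (rule nn_integral_lborel_prod) (auto simp: g0)
  moreover have "(\<Prod>b\<in>Basis. ennreal (g ((x::real^'n) \<bullet> b))) = ennreal (\<Prod>i\<in>UNIV. g (x $ i))" for x
    unfolding Basis_cart by (simp add: prod.reindex[OF inj] inner_axis prod_ennreal g0)
  ultimately show ?thesis by simp
qed

text \<open>An integrable substitute for a negative power of \<open>1 + norm x\<close>. The product
  form makes its integral one-dimensional and makes \<open>1 / wt\<close> a polynomial, hence slowly
  increasing.\<close>

definition wt :: "real^'n \<Rightarrow> real" where "wt x = (\<Prod>i\<in>UNIV. 1 / (1 + (x $ i)\<^sup>2))"

lemma wt_pos: "wt x > 0" unfolding wt_def by (intro prod_pos) (auto intro!: divide_pos_pos add_pos_nonneg)

lemma wt_le_1: "wt x \<le> 1" unfolding wt_def by (intro prod_le_1) (auto simp: divide_le_eq add_pos_nonneg)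

lemma wt_measurable [measurable]: "wt \<in> borel_measurable borel"
  unfolding wt_def by measurable

lemma wt_ge: "1 \<le> wt x * (1 + norm x) ^ (2 * CARD('n))" for x :: "real^'n"
proof -
  \<comment> \<open>Each of the \<open>CARD('n)\<close> factors costs two powers of
    \<open>1 + norm x\<close>; this is the origin of the exponent \<open>2 * CARD('n)\<close> here
    and below.\<close>
  have "(\<Prod>i\<in>(UNIV::'n set). 1 + (x $ i)\<^sup>2) \<le> (\<Prod>i\<in>(UNIV::'n set). (1 + norm x)\<^sup>2)"
  proof (intro prod_mono conjI)
    fix i :: 'n
    have "(x $ i)\<^sup>2 \<le> (norm x)\<^sup>2" using component_le_norm_cart[of x i] by (simp add: abs_le_square_iff[symmetric])
    moreover have "(1 + norm x)\<^sup>2 = 1 + 2 * norm x + (norm x)\<^sup>2" by (simp add: power2_eq_square algebra_simps)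
    ultimately show "1 + (x $ i)\<^sup>2 \<le> (1 + norm x)\<^sup>2" using norm_ge_zero[of x] by linarith
  qed auto
  then have "(\<Prod>i\<in>(UNIV::'n set). 1 + (x $ i)\<^sup>2) \<le> (1 + norm x) ^ (2 * CARD('n))" by (simp add: power_mult)
  moreover have "wt x * (\<Prod>i\<in>(UNIV::'n set). 1 + (x $ i)\<^sup>2) = 1"
  proof -
    have "1 + (x $ i)\<^sup>2 \<noteq> 0" for i by (simp add: add_nonneg_eq_0_iff)
    then show ?thesis unfolding wt_def prod.distrib[symmetric] by simp
  qed
  ultimately show ?thesis using mult_left_mono[OF _ less_imp_le[OF wt_pos[of x]]] by metis
qed

lemma integrable_wt: "integrable lebesgue (wt :: real^'n \<Rightarrow> real)"
proof -
  have "einterval (- \<infinity>) \<infinity> = UNIV" by (auto simp: einterval_def)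
  then have "integrable lborel (\<lambda>x::real. inverse (1 + x\<^sup>2))"
    using integrable_inverse_1_plus_square by (simp add: set_integrable_def)
  then have "(\<integral>\<^sup>+t. ennreal (norm (inverse (1 + t\<^sup>2) :: real)) \<partial>lborel) < \<infinity>" unfolding integrable_iff_bounded by blast
  moreover have "norm (inverse (1 + t\<^sup>2)) = 1 / (1 + t\<^sup>2)" for t :: real by (simp add: divide_inverse)
  ultimately have "(\<integral>\<^sup>+t. ennreal (1 / (1 + t\<^sup>2)) \<partial>lborel) < \<infinity>" by simp
  moreover have "(\<integral>\<^sup>+x. ennreal (wt (x::real^'n)) \<partial>lborel) = (\<integral>\<^sup>+t. ennreal (1 / (1 + t\<^sup>2)) \<partial>lborel) ^ CARD('n)"
    unfolding wt_def by (rule nn_integral_cart_prod) auto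
  ultimately have "(\<integral>\<^sup>+x. ennreal (wt (x::real^'n)) \<partial>lborel) < \<infinity>" by (simp add: power_less_top_ennreal)
  then have "integrable lborel (wt :: real^'n \<Rightarrow> real)"
    unfolding integrable_iff_bounded by (simp add: abs_of_pos wt_pos)
  then show ?thesis by (simp add: integrable_completion)
qed

lemma rapid_wt_bound:
  assumes "rapid f" shows "\<exists>C. \<forall>x. (1 + norm x) ^ k * cmod (f x) \<le> C * wt x"
proof -
  obtain C where C: "\<And>x. (1 + norm x) ^ (k + 2 * CARD('a)) * cmod (f x) \<le> C"
    using assms unfolding rapid_def by metis
  have "(1 + norm x) ^ k * cmod (f x) \<le> C * wt x" for x
  proof -
    have "(1 + norm x) ^ k * cmod (f x) * 1 \<le> ((1 + norm x) ^ k * cmod (f x)) * (wt x * (1 + norm x) ^ (2 * CARD('a)))"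
      by (intro mult_left_mono wt_ge) auto
    also have "\<dots> = wt x * ((1 + norm x) ^ (k + 2 * CARD('a)) * cmod (f x))" by (simp add: power_add algebra_simps)
    also have "\<dots> \<le> wt x * C" by (intro mult_left_mono C less_imp_le[OF wt_pos])
    finally show ?thesis by (simp add: mult.commute)
  qed
  then show ?thesis by blast
qed

lemma schwartzD:
  assumes "schwartz f"
  shows "continuous_on UNIV f" "rapid f" "has_pd i f (pderiv_dir i f)" "schwartz (pderiv_dir i f)"
  using assms smooth_inD smooth_in_pderiv unfolding schwartz_eq by blast+

lemma continuous_imp_lebesgue_measurable:
  "continuous_on UNIV f \<Longrightarrow> f \<in> borel_measurable lebesgue"
  by (intro measurable_completion) (simp add: borel_measurable_continuous_onI)

lemma schwartz_measurable: "schwartz f \<Longrightarrow> f \<in> borel_measurable lebesgue" "schwartz f \<Longrightarrow> f \<in> borel_measurable borel"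
  using schwartzD(1) continuous_imp_lebesgue_measurable borel_measurable_continuous_onI by blast+

lemma slow_measurable: "slow f \<Longrightarrow> f \<in> borel_measurable lebesgue"
  using smooth_inD(1) continuous_imp_lebesgue_measurable by blast

lemma schwartz_wt_bound: "schwartz f \<Longrightarrow> \<exists>C. \<forall>x. cmod (f x) \<le> C * wt x"
  using rapid_wt_bound[OF schwartzD(2), of f 0] by simp

lemma integrable_wt_bound:
  assumes "f \<in> borel_measurable lebesgue" "\<And>x. cmod (f x) \<le> C * wt x"
  shows "integrable lebesgue f"
  by (rule Bochner_Integration.integrable_bound[of _ "\<lambda>x. C * wt x"])
     (use assms integrable_wt in \<open>auto intro!: always_eventually order_trans[OF _ abs_ge_self]\<close>)

lemma schwartz_integrable: "schwartz f \<Longrightarrow> integrable lebesgue f"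
  using schwartz_wt_bound integrable_wt_bound schwartz_measurable by blast

section \<open>The Gaussian\<close>

definition gauss :: "real^'n \<Rightarrow> complex" where
  "gauss x = complex_of_real (exp (- (norm x)\<^sup>2 / 2))"

lemma has_pd_gauss: "has_pd (i::'n::finite) gauss (\<lambda>x. - complex_of_real (x $ i) * gauss x)"
  unfolding has_pd_def
proof
  fix x :: "real^'n"
  have n: "(norm (x + t *\<^sub>R axis i 1))\<^sup>2 = (norm x)\<^sup>2 + 2 * t * x $ i + t\<^sup>2" for t
    by (simp only: power2_norm_eq_inner) (simp add: inner_add inner_axis inner_axis' power2_eq_square algebra_simps)
  have "((\<lambda>t. exp (- (norm (x + t *\<^sub>R axis i 1))\<^sup>2 / 2)) has_real_derivative - x $ i * exp (- (norm x)\<^sup>2 / 2)) (at 0)"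
    unfolding n by (auto intro!: derivative_eq_intros)
  from has_vector_derivative_of_real[OF this]
  show "((\<lambda>t. gauss (x + t *\<^sub>R axis i 1)) has_vector_derivative - complex_of_real (x $ i) * gauss x) (at 0)"
    unfolding gauss_def by simp
qed

lemma gauss_continuous: "continuous_on UNIV gauss"
  unfolding gauss_def[abs_def] by (intro continuous_intros) auto

lemma gauss_rapid: "rapid (gauss :: real^'n \<Rightarrow> complex)"
  unfolding rapid_def
proof
  fix k
  have "(1 + norm x) ^ k * cmod (gauss x) \<le> fact k * exp (3/2)" for x :: "real^'n"
  proof -
    have "(1 + norm x) ^ k * cmod (gauss x) \<le> (fact k * exp (1 + norm x)) * exp (- (norm x)\<^sup>2 / 2)"
      unfolding gauss_def by (simp add: power_le_fact_exp)
    also have "\<dots> = fact k * exp (1 + norm x + - (norm x)\<^sup>2 / 2)" by (simp only: mult.assoc exp_add[symmetric])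
    also have "\<dots> \<le> fact k * exp (3/2)"
    proof (intro mult_left_mono)
      \<comment> \<open>Completing the square: with r = norm x, the exponent 1 + r - r^2 / 2 is 3 /
        2 minus half of this square.\<close>
      have "0 \<le> (norm x - 1)\<^sup>2" by simp
      then show "exp (1 + norm x + - (norm x)\<^sup>2 / 2) \<le> exp (3/2)" by (simp add: power2_diff)
    qed simp
    finally show ?thesis .
  qed
  then show "\<exists>C. \<forall>x. (1 + norm x) ^ k * cmod (gauss (x::real^'n)) \<le> C" by blast
qed

text \<open>The products of a slow function with the Gaussian are closed under differentiation,
  since a derivative of the Gaussian only contributes a coordinate factor.\<close>

lemma schwartz_gauss: "schwartz (gauss :: real^'n \<Rightarrow> complex)"
  unfolding schwartz_eq
proof (rule smooth_span[OF lin_closed_rapid])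
  let ?B = "{h. \<exists>q. slow q \<and> h = (\<lambda>x::real^'n. q x * gauss x)}"
  show "lspan ?B (gauss :: real^'n \<Rightarrow> complex)" using slow_const[of 1] by (intro lspan.base) auto
  fix h assume "h \<in> ?B"
  then obtain q where q: "slow q" and h: "h = (\<lambda>x::real^'n. q x * gauss x)" by auto
  show "continuous_on UNIV h \<and> rapid h \<and> (\<forall>i. \<exists>f'. has_pd i h f' \<and> lspan ?B f')"
  proof (intro conjI allI)
    show "continuous_on UNIV h" unfolding h
      using q by (intro continuous_on_mult gauss_continuous smooth_inD(1))
    show "rapid h" unfolding h by (rule polyb_rapid_mult[OF smooth_inD(2)[OF q] gauss_rapid])
    fix i
    obtain q' where q': "has_pd i q q'" "slow q'" using smooth_inD(3)[OF q] by blast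
    have "slow (\<lambda>x::real^'n. - 1 * complex_of_real (x $ i))" by (rule slow_scale[OF slow_coord])
    then have "slow (\<lambda>x. q x * (- 1 * complex_of_real (x $ i)) + q' x)" using slow_add[OF slow_mult[OF q] q'(2)] by blast
    then have "lspan ?B (\<lambda>x. (q x * (- 1 * complex_of_real (x $ i)) + q' x) * gauss x)" by (intro lspan.base) auto
    moreover have "has_pd i h (\<lambda>x. (q x * (- 1 * complex_of_real (x $ i)) + q' x) * gauss x)"
      using has_pd_mult[OF q'(1) has_pd_gauss] unfolding h by (simp add: algebra_simps)
    ultimately show "\<exists>f'. has_pd i h f' \<and> lspan ?B f'" by blast
  qed
qed

text \<open>The one-dimensional factor is read off from the total mass 1 of the standard normal
  density.\<close>

lemma integral_gauss: "(LINT x|lebesgue. gauss (x::real^'n)) = complex_of_real (sqrt (2 * pi) ^ CARD('n))"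
proof -
  interpret N: prob_space "density lborel (\<lambda>x. ennreal (std_normal_density x))"
    by (rule prob_space_normal_density) simp
  have "(\<integral>\<^sup>+t. ennreal (std_normal_density t) \<partial>lborel) = 1"
    using N.emeasure_space_1 by (simp add: emeasure_density)
  moreover have "exp (- t\<^sup>2 / 2) = sqrt (2 * pi) * std_normal_density t" for t
    by (simp add: std_normal_density_def)
  ultimately have "(\<integral>\<^sup>+t. ennreal (exp (- t\<^sup>2 / 2)) \<partial>lborel) = ennreal (sqrt (2 * pi))"
    by (simp add: ennreal_mult nn_integral_cmult)
  moreover have "exp (- (norm x)\<^sup>2 / 2) = (\<Prod>i\<in>UNIV. exp (- (x $ i)\<^sup>2 / 2))" for x :: "real^'n"
    by (simp add: exp_sum[symmetric] norm_vec_def L2_set_def sum_nonneg sum_negf sum_divide_distrib)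
  ultimately have "(\<integral>\<^sup>+x. ennreal (exp (- (norm (x::real^'n))\<^sup>2 / 2)) \<partial>lborel) = ennreal (sqrt (2 * pi) ^ CARD('n))"
    using nn_integral_cart_prod[of "\<lambda>t. exp (- t\<^sup>2 / 2)", where 'n = 'n] by (simp add: ennreal_power)
  then have "(LINT x|lborel. exp (- (norm (x::real^'n))\<^sup>2 / 2)) = sqrt (2 * pi) ^ CARD('n)"
    by (subst integral_eq_nn_integral) auto
  then have "(LINT x|lebesgue. exp (- (norm (x::real^'n))\<^sup>2 / 2)) = sqrt (2 * pi) ^ CARD('n)"
    by (subst integral_completion) auto
  then show ?thesis unfolding gauss_def by simp
qed

section \<open>The Fourier transform on Schwartz functions\<close>

lemma has_vector_derivative_at_0:
  fixes f :: "real \<Rightarrow> 'a::real_normed_vector"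
  shows "(f has_vector_derivative D) (at 0) \<longleftrightarrow> ((\<lambda>t. (f t - f 0) /\<^sub>R t) \<longlongrightarrow> D) (at 0)"
proof -
  have eq: "norm (((f t - f 0) - (t - 0) *\<^sub>R D) /\<^sub>R norm (t - 0)) = norm ((f t - f 0) /\<^sub>R t - D)" if "t \<noteq> 0" for t
  proof -
    have "(f t - f 0) /\<^sub>R t - D = ((f t - f 0) - (t - 0) *\<^sub>R D) /\<^sub>R t" using that by (simp add: scaleR_diff_right)
    then show ?thesis by simp
  qed
  have "(f has_vector_derivative D) (at 0) \<longleftrightarrow> ((\<lambda>t. ((f t - f 0) - (t - 0) *\<^sub>R D) /\<^sub>R norm (t - 0)) \<longlongrightarrow> 0) (at 0)"
    unfolding has_vector_derivative_def has_derivative_at_within by (simp add: bounded_linear_scaleR_left)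
  also have "\<dots> \<longleftrightarrow> ((\<lambda>t. norm (((f t - f 0) - (t - 0) *\<^sub>R D) /\<^sub>R norm (t - 0))) \<longlongrightarrow> 0) (at 0)"
    by (rule tendsto_norm_zero_iff[symmetric])
  also have "\<dots> \<longleftrightarrow> ((\<lambda>t. norm ((f t - f 0) /\<^sub>R t - D)) \<longlongrightarrow> 0) (at 0)"
    by (rule filterlim_cong[OF refl refl]) (unfold eventually_at_filter, intro always_eventually allI impI, rule eq)
  also have "\<dots> \<longleftrightarrow> ((\<lambda>t. (f t - f 0) /\<^sub>R t) \<longlongrightarrow> D) (at 0)"
    unfolding tendsto_norm_zero_iff by (rule LIM_zero_iff)
  finally show ?thesis .
qed

text \<open>The mean value inequality bounds the difference quotients by the same \<open>w\<close>
  that bounds the derivatives, and dominated convergence applies along every sequence tending to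
  0.\<close>

lemma has_vector_derivative_integral:
  fixes f :: "real \<Rightarrow> 'a \<Rightarrow> complex"
  assumes int: "\<And>t. integrable M (f t)"
    and der: "\<And>x t. x \<in> space M \<Longrightarrow> \<bar>t\<bar> < 1 \<Longrightarrow> ((\<lambda>t. f t x) has_vector_derivative f' t x) (at t)"
    and bound: "\<And>x t. x \<in> space M \<Longrightarrow> \<bar>t\<bar> < 1 \<Longrightarrow> cmod (f' t x) \<le> w x"
    and w: "integrable M w" and f'0: "f' 0 \<in> borel_measurable M"
  shows "((\<lambda>t. LINT x|M. f t x) has_vector_derivative (LINT x|M. f' 0 x)) (at 0)"
proof -
  have lip: "cmod (f t x - f 0 x) \<le> w x * \<bar>t\<bar>" if x: "x \<in> space M" and t: "\<bar>t\<bar> < 1" for x t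
  proof -
    have "norm (f t x - f 0 x) \<le> w x * norm (t - 0)"
    proof (rule differentiable_bound[where S = "{-1<..<1}" and f' = "\<lambda>t h. h *\<^sub>R f' t x"])
      fix s :: real assume s: "s \<in> {-1<..<1}"
      then have "((\<lambda>t. f t x) has_vector_derivative f' s x) (at s within {-1<..<1})"
        using der[OF x, of s] by (auto intro: has_vector_derivative_at_within)
      then show "((\<lambda>t. f t x) has_derivative (\<lambda>h. h *\<^sub>R f' s x)) (at s within {-1<..<1})"
        unfolding has_vector_derivative_def .
      show "onorm (\<lambda>h. h *\<^sub>R f' s x) \<le> w x"
      proof (rule onorm_bound)
        have "cmod (f' s x) \<le> w x" using bound[OF x, of s] s by auto
        then show "0 \<le> w x" "\<And>h. norm (h *\<^sub>R f' s x) \<le> w x * norm h"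
          by (auto simp: mult.commute[of "w x"] intro: mult_left_mono order_trans[OF norm_ge_zero])
      qed
    qed (use t in auto)
    then show ?thesis by simp
  qed
  have "((\<lambda>t. (LINT x|M. f t x - f 0 x) /\<^sub>R t) \<longlongrightarrow> (LINT x|M. f' 0 x)) (at 0)"
    unfolding tendsto_at_iff_sequentially comp_def
  proof (intro allI impI)
    fix X :: "nat \<Rightarrow> real" assume X: "\<forall>i. X i \<in> UNIV - {0}" "X \<longlonglongrightarrow> 0"
    \<comment> \<open>The bound on the derivatives is assumed only for parameters of modulus below
      1, so finitely many terms of the sequence are dropped.\<close>
    obtain N where N: "\<And>n. n \<ge> N \<Longrightarrow> \<bar>X n\<bar> < 1"
      using LIMSEQ_D[OF X(2), of 1] by auto
    have "(\<lambda>n. LINT x|M. (f (X (n + N)) x - f 0 x) /\<^sub>R X (n + N)) \<longlonglongrightarrow> (LINT x|M. f' 0 x)"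
    proof (rule integral_dominated_convergence[OF f'0 _ w])
      show "(\<lambda>x. (f (X (n + N)) x - f 0 x) /\<^sub>R X (n + N)) \<in> borel_measurable M" for n
        using int by auto
      show "AE x in M. (\<lambda>n. (f (X (n + N)) x - f 0 x) /\<^sub>R X (n + N)) \<longlonglongrightarrow> f' 0 x"
      proof (rule AE_I2)
        fix x assume x: "x \<in> space M"
        have "((\<lambda>t. (f t x - f 0 x) /\<^sub>R t) \<longlongrightarrow> f' 0 x) (at 0)"
          using der[OF x, of 0] unfolding has_vector_derivative_at_0 by simp
        moreover have "filterlim (\<lambda>n. X (n + N)) (at 0) sequentially"
          unfolding filterlim_at using X LIMSEQ_ignore_initial_segment[OF X(2), of N] by auto
        ultimately show "(\<lambda>n. (f (X (n + N)) x - f 0 x) /\<^sub>R X (n + N)) \<longlonglongrightarrow> f' 0 x"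
          by (rule filterlim_compose)
      qed
      show "AE x in M. norm ((f (X (n + N)) x - f 0 x) /\<^sub>R X (n + N)) \<le> w x" for n
      proof (rule AE_I2)
        fix x assume x: "x \<in> space M"
        have "X (n + N) \<noteq> 0" using X(1) by auto
        then show "norm ((f (X (n + N)) x - f 0 x) /\<^sub>R X (n + N)) \<le> w x"
          using lip[OF x N[of "n + N"]] by (simp add: divide_simps)
      qed
    qed
    then have "(\<lambda>n. (LINT x|M. f (X (n + N)) x - f 0 x) /\<^sub>R X (n + N)) \<longlonglongrightarrow> (LINT x|M. f' 0 x)"
      by simp
    then show "(\<lambda>n. (LINT x|M. f (X n) x - f 0 x) /\<^sub>R X n) \<longlonglongrightarrow> (LINT x|M. f' 0 x)"
      by (rule LIMSEQ_offset)
  qed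
  moreover have "(LINT x|M. f t x - f 0 x) = (LINT x|M. f t x) - (LINT x|M. f 0 x)" for t
    using int by simp
  ultimately have "((\<lambda>t. ((LINT x|M. f t x) - (LINT x|M. f 0 x)) /\<^sub>R t) \<longlongrightarrow> (LINT x|M. f' 0 x)) (at 0)"
    by simp
  then show ?thesis unfolding has_vector_derivative_at_0 .
qed

section \<open>Elementary rules for the Fourier integral\<close>

lemma integrable_mult_cis:
  "integrable lebesgue f \<Longrightarrow> integrable lebesgue (\<lambda>x. f x * cis (- (x \<bullet> \<xi>)))"
  by (rule Bochner_Integration.integrable_bound[of _ f])
     (auto simp: norm_mult intro!: borel_measurable_times[OF _ continuous_imp_lebesgue_measurable] continuous_intros)

lemma cmod_FT_le: "integrable lebesgue f \<Longrightarrow> cmod (FT f \<xi>) \<le> (LINT x|lebesgue. cmod (f x))"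
  unfolding FT_def
  by (rule order_trans[OF integral_norm_bound]) (simp add: norm_mult)

lemma FT_continuous:
  assumes f: "integrable lebesgue f" shows "continuous_on UNIV (FT f)"
  unfolding continuous_on_sequentially comp_def
proof safe
  fix X :: "nat \<Rightarrow> real^'a" and \<xi> assume X: "X \<longlonglongrightarrow> \<xi>"
  show "(\<lambda>n. FT f (X n)) \<longlonglongrightarrow> FT f \<xi>"
    unfolding FT_def
  proof (rule integral_dominated_convergence[where w = "\<lambda>x. cmod (f x)"])
    show "AE x in lebesgue. (\<lambda>n. f x * cis (- (x \<bullet> X n))) \<longlonglongrightarrow> f x * cis (- (x \<bullet> \<xi>))"
      by (intro always_eventually allI tendsto_intros X)
  qed (use integrable_mult_cis[OF f] f in \<open>auto simp: norm_mult\<close>)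
qed

lemma FT_measurable: "integrable lebesgue f \<Longrightarrow> FT f \<in> borel_measurable lebesgue"
  using FT_continuous continuous_imp_lebesgue_measurable by blast

lemma FT_cong_AE:
  assumes "f \<in> borel_measurable lebesgue" "g \<in> borel_measurable lebesgue" "AE x in lebesgue. f x = g x"
  shows "FT f = FT g"
  unfolding FT_def
  by (intro ext integral_cong_AE borel_measurable_times assms(1,2) continuous_imp_lebesgue_measurable continuous_intros)
     (use assms(3) in auto)

lemma FT_add:
  "integrable lebesgue f \<Longrightarrow> integrable lebesgue g \<Longrightarrow> FT (\<lambda>x. f x + g x) \<xi> = FT f \<xi> + FT g \<xi>"
  unfolding FT_def by (simp add: integrable_mult_cis distrib_right)

lemma FT_scale: "FT (\<lambda>x. c * f x) \<xi> = c * FT f \<xi>"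
  unfolding FT_def by (simp add: mult.assoc)

lemma FT_reflect:
  assumes "f \<in> borel_measurable lebesgue" shows "FT (\<lambda>x. f (- x)) \<xi> = FT f (- \<xi>)"
proof -
  have m: "(\<lambda>x. f x * cis (- (x \<bullet> (- \<xi>)))) \<in> borel_measurable lebesgue"
    by (intro borel_measurable_times assms continuous_imp_lebesgue_measurable continuous_intros)
  show ?thesis unfolding FT_def using integral_reflect_lebesgue[OF m] by simp
qed

lemma FT_cnj: "FT (\<lambda>x. cnj (f x)) \<xi> = cnj (FT f (- \<xi>))"
proof -
  have "cnj (f x) * cis (- (x \<bullet> \<xi>)) = cnj (f x * cis (- (x \<bullet> (- \<xi>))))" for x by (simp add: cis_cnj)
  then show ?thesis unfolding FT_def by (simp only: Bochner_Integration.integral_cnj)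
qed

lemma FT_translate:
  assumes "f \<in> borel_measurable lebesgue"
  shows "FT (\<lambda>x. f (y + x)) \<xi> = cis (y \<bullet> \<xi>) * FT f \<xi>"
proof -
  have m: "(\<lambda>x. f x * cis (- (x \<bullet> \<xi>))) \<in> borel_measurable lebesgue"
    by (intro borel_measurable_times assms continuous_imp_lebesgue_measurable continuous_intros)
  have "cis (y \<bullet> \<xi>) * (f (y + x) * cis (- ((y + x) \<bullet> \<xi>))) = f (y + x) * cis (- (x \<bullet> \<xi>))" for x
    by (simp add: cis_mult inner_add_left mult.left_commute[of "cis (y \<bullet> \<xi>)"])
  then show ?thesis unfolding FT_def integral_translate_lebesgue[OF m, of y]
    by (simp only: integral_mult_right_zero[symmetric])
qed

lemma FT_modulate: "FT (\<lambda>x. cis (x \<bullet> \<eta>) * f x) \<xi> = FT f (\<xi> - \<eta>)"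
proof -
  have "cis (x \<bullet> \<eta>) * f x * cis (- (x \<bullet> \<xi>)) = f x * cis (- (x \<bullet> (\<xi> - \<eta>)))" for x
  proof -
    have "cis (x \<bullet> \<eta>) * cis (- (x \<bullet> \<xi>)) = cis (- (x \<bullet> (\<xi> - \<eta>)))" by (simp add: cis_mult inner_diff_right)
    then show ?thesis by (metis mult.assoc mult.commute)
  qed
  then show ?thesis unfolding FT_def by (simp only:)
qed

lemma FT_scaling:
  fixes f :: "real^'n \<Rightarrow> complex"
  assumes "f \<in> borel_measurable lebesgue" "e > 0"
  shows "complex_of_real (e ^ CARD('n)) * FT (\<lambda>x. f (e *\<^sub>R x)) \<xi> = FT f ((1 / e) *\<^sub>R \<xi>)"
proof -
  have m: "(\<lambda>x. f x * cis (- (x \<bullet> (1 / e) *\<^sub>R \<xi>))) \<in> borel_measurable lebesgue"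
    by (intro borel_measurable_times assms continuous_imp_lebesgue_measurable continuous_intros)
  show ?thesis unfolding FT_def scaleR_conv_of_real[symmetric]
    using integral_affine_lebesgue[OF _ m, of e 0] assms(2) by simp
qed

lemma IFT_eq_FT: "IFT v x = complex_of_real (1 / (2 * pi) ^ CARD('n)) * FT v (- x)" for x :: "real^'n"
  unfolding IFT_def FT_def by (simp add: inner_commute)

lemma schwartz_coord_mult: "schwartz f \<Longrightarrow> schwartz (\<lambda>x. c * (complex_of_real (x $ i) * f x))"
  by (intro schwartz_scale slow_schwartz_mult[OF slow_coord])

lemma schwartz_modulate: "schwartz f \<Longrightarrow> schwartz (\<lambda>x. cis (x \<bullet> \<eta>) * f x)"
  by (rule slow_schwartz_mult[OF slow_cis])

lemma has_pd_FT:
  assumes f: "schwartz f"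
  shows "has_pd i (FT f) (FT (\<lambda>x. - \<i> * (complex_of_real (x $ i) * f x)))"
  unfolding has_pd_def
proof
  fix \<xi>
  let ?g = "\<lambda>x. - \<i> * (complex_of_real (x $ i) * f x)"
  have g: "schwartz ?g" by (rule schwartz_coord_mult[OF f])
  have "((\<lambda>t. LINT x|lebesgue. f x * cis (- (x \<bullet> (\<xi> + t *\<^sub>R axis i 1)))) has_vector_derivative
      (LINT x|lebesgue. ?g x * cis (- (x \<bullet> (\<xi> + 0 *\<^sub>R axis i 1))))) (at 0)"
  proof (rule has_vector_derivative_integral[where f' = "\<lambda>t x. ?g x * cis (- (x \<bullet> (\<xi> + t *\<^sub>R axis i 1)))" and w = "\<lambda>x. cmod (?g x)"])
    show "integrable lebesgue (\<lambda>x. f x * cis (- (x \<bullet> (\<xi> + t *\<^sub>R axis i 1))))" for t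
      by (rule integrable_mult_cis[OF schwartz_integrable[OF f]])
    show "(\<lambda>x. ?g x * cis (- (x \<bullet> (\<xi> + 0 *\<^sub>R axis i 1)))) \<in> borel_measurable lebesgue"
      by (rule borel_measurable_integrable[OF integrable_mult_cis[OF schwartz_integrable[OF g]]])
    show "integrable lebesgue (\<lambda>x. cmod (?g x))" using schwartz_integrable[OF g] by auto
    fix x t
    show "cmod (?g x * cis (- (x \<bullet> (\<xi> + t *\<^sub>R axis i 1)))) \<le> cmod (?g x)" by (simp add: norm_mult)
    have "((\<lambda>t. cis (- (x \<bullet> (\<xi> + t *\<^sub>R axis i 1)))) has_derivative
       (\<lambda>s. (- (x $ i) * s) *\<^sub>R (\<i> * cis (- (x \<bullet> (\<xi> + t *\<^sub>R axis i 1)))))) (at t)"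
      by (rule has_derivative_cis) (auto intro!: derivative_eq_intros simp: inner_add_right inner_axis)
    then have "((\<lambda>t. cis (- (x \<bullet> (\<xi> + t *\<^sub>R axis i 1)))) has_vector_derivative
       (- \<i> * complex_of_real (x $ i) * cis (- (x \<bullet> (\<xi> + t *\<^sub>R axis i 1))))) (at t)"
      unfolding has_vector_derivative_def by (simp add: scaleR_conv_of_real algebra_simps)
    from has_vector_derivative_mult_right[OF this, of "f x"]
    show "((\<lambda>t. f x * cis (- (x \<bullet> (\<xi> + t *\<^sub>R axis i 1)))) has_vector_derivative ?g x * cis (- (x \<bullet> (\<xi> + t *\<^sub>R axis i 1)))) (at t)"
      by (simp add: algebra_simps)
  qed
  then show "((\<lambda>t. FT f (\<xi> + t *\<^sub>R axis i 1)) has_vector_derivative FT ?g \<xi>) (at 0)"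
    unfolding FT_def by simp
qed

text \<open>By translation invariance the integral of \<open>f (x + t *\<^sub>R axis i 1)\<close>
  does not depend on \<open>t\<close>; differentiating under the integral at \<open>t = 0\<close>
  gives the claim without integration by parts.\<close>

lemma integral_pderiv_schwartz:
  assumes f: "schwartz f"
  shows "(LINT x|lebesgue. pderiv_dir i f x) = 0"
proof -
  note f' = schwartzD(4)[OF f, of i]
  let ?e = "axis i 1 :: real^'a"
  obtain C where C: "\<And>x. (1 + norm x) ^ (2 * CARD('a)) * cmod (pderiv_dir i f x) \<le> C"
    using schwartzD(2)[OF f'] unfolding rapid_def by metis
  have C0: "C \<ge> 0" using C[of 0] by (simp add: order_trans[OF norm_ge_zero])
  have "((\<lambda>t. LINT x|lebesgue. f (x + t *\<^sub>R ?e)) has_vector_derivative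
      (LINT x|lebesgue. pderiv_dir i f (x + 0 *\<^sub>R ?e))) (at 0)"
  proof (rule has_vector_derivative_integral[where w = "\<lambda>x. (C * 2 ^ (2 * CARD('a))) * wt x"])
    show "integrable lebesgue (\<lambda>x. f (x + t *\<^sub>R ?e))" for t
      using integrable_translate_lebesgue[OF schwartz_integrable[OF f], of "t *\<^sub>R ?e"] by (simp add: add.commute)
    show "(\<lambda>x. pderiv_dir i f (x + 0 *\<^sub>R ?e)) \<in> borel_measurable lebesgue"
      using schwartz_measurable(1)[OF f'] by simp
    show "integrable lebesgue (\<lambda>x. (C * 2 ^ (2 * CARD('a))) * wt (x :: real^'a))" using integrable_wt by auto
    fix x :: "real^'a" and t :: real
    show "((\<lambda>t. f (x + t *\<^sub>R ?e)) has_vector_derivative pderiv_dir i f (x + t *\<^sub>R ?e)) (at t)"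
      by (rule has_pd_line[OF schwartzD(3)[OF f]])
    assume t: "\<bar>t\<bar> < 1"
    let ?y = "x + t *\<^sub>R ?e"
    have "norm x \<le> norm ?y + norm (t *\<^sub>R ?e)" using norm_triangle_ineq4[of ?y "t *\<^sub>R ?e"] by simp
    moreover have "norm (t *\<^sub>R ?e) = \<bar>t\<bar>" by simp
    ultimately have "norm x \<le> norm ?y + 1" using t by simp
    \<comment> \<open>A shift of length below 1 changes the weight by at most the factor 2, so one
      integrable function dominates the derivative along the whole segment; this explains the power
      of 2 in \<open>w\<close>.\<close>
    then have "1 + norm x \<le> 2 * (1 + norm ?y)" using norm_ge_zero[of ?y] unfolding distrib_left by linarith
    then have "(1 + norm x) ^ (2 * CARD('a)) \<le> (2 * (1 + norm ?y)) ^ (2 * CARD('a))" by (intro power_mono) auto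
    then have p: "(1 + norm x) ^ (2 * CARD('a)) \<le> 2 ^ (2 * CARD('a)) * (1 + norm ?y) ^ (2 * CARD('a))"
      by (simp only: power_mult_distrib)
    have "cmod (pderiv_dir i f ?y) * 1 \<le> cmod (pderiv_dir i f ?y) * (wt x * (1 + norm x) ^ (2 * CARD('a)))"
      by (intro mult_left_mono wt_ge) auto
    also have "\<dots> \<le> cmod (pderiv_dir i f ?y) * (wt x * (2 ^ (2 * CARD('a)) * (1 + norm ?y) ^ (2 * CARD('a))))"
      using wt_pos[of x] by (intro mult_left_mono p) auto
    also have "\<dots> = (wt x * 2 ^ (2 * CARD('a))) * ((1 + norm ?y) ^ (2 * CARD('a)) * cmod (pderiv_dir i f ?y))"
      by (simp only: ac_simps)
    also have "\<dots> \<le> (wt x * 2 ^ (2 * CARD('a))) * C"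
      using wt_pos[of x] by (intro mult_left_mono C) auto
    finally show "cmod (pderiv_dir i f ?y) \<le> C * 2 ^ (2 * CARD('a)) * wt x" by (simp add: ac_simps)
  qed
  moreover have "(LINT x|lebesgue. f (x + t *\<^sub>R ?e)) = (LINT x|lebesgue. f x)" for t
    using integral_translate_lebesgue[OF schwartz_measurable(1)[OF f], of "t *\<^sub>R ?e"] by (simp add: add.commute)
  ultimately have "((\<lambda>t::real. LINT x|lebesgue. f x) has_vector_derivative (LINT x|lebesgue. pderiv_dir i f x)) (at 0)"
    by simp
  then show ?thesis using has_vector_derivative_const vector_derivative_at by metis
qed

text \<open>The integral of the derivative of the modulated function vanishes, and the product rule
  splits it into the two sides of the identity.\<close>

lemma FT_pderiv:
  assumes f: "schwartz f"
  shows "FT (pderiv_dir i f) \<xi> = \<i> * complex_of_real (\<xi> $ i) * FT f \<xi>"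
proof -
  let ?e = "\<lambda>x. cis (x \<bullet> (- \<xi>))"
  let ?g = "\<lambda>x. ?e x * f x"
  have g: "schwartz ?g" by (rule schwartz_modulate[OF f])
  have "has_pd i ?g (\<lambda>x. ?e x * pderiv_dir i f x + (\<i> * complex_of_real ((- \<xi>) $ i) * ?e x) * f x)"
    by (rule has_pd_mult[OF has_pd_cis schwartzD(3)[OF f]])
  then have "pderiv_dir i ?g = (\<lambda>x. ?e x * pderiv_dir i f x + (\<i> * complex_of_real ((- \<xi>) $ i) * ?e x) * f x)"
    by (rule has_pd_imp)
  also have "\<dots> = (\<lambda>x. pderiv_dir i f x * cis (- (x \<bullet> \<xi>)) + (- \<i> * complex_of_real (\<xi> $ i)) * (f x * cis (- (x \<bullet> \<xi>))))"
    by (simp add: algebra_simps)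
  finally have "0 = (LINT x|lebesgue. pderiv_dir i f x * cis (- (x \<bullet> \<xi>)) + (- \<i> * complex_of_real (\<xi> $ i)) * (f x * cis (- (x \<bullet> \<xi>))))"
    using integral_pderiv_schwartz[OF g, of i] by simp
  also have "\<dots> = FT (pderiv_dir i f) \<xi> + (- \<i> * complex_of_real (\<xi> $ i)) * FT f \<xi>"
    unfolding FT_def
    by (subst Bochner_Integration.integral_add)
       (auto intro!: integrable_mult_cis[OF schwartz_integrable] integrable_mult_right f schwartzD(4))
  finally show ?thesis by (simp add: algebra_simps)
qed

text \<open>Multiplication by \<open>norm \<xi>\<close> is dominated by the sum of the coordinates,
  and each coordinate factor turns into a derivative of \<open>f\<close>. One power of the weight is
  thus traded for one derivative, which the induction over all Schwartz \<open>f\<close>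
  permits.\<close>

lemma FT_rapid:
  assumes "schwartz f" shows "rapid (FT f)"
  unfolding rapid_def
proof
  fix k show "\<exists>C. \<forall>\<xi>. (1 + norm \<xi>) ^ k * cmod (FT f \<xi>) \<le> C"
    using assms
  proof (induction k arbitrary: f)
    case 0
    then show ?case using cmod_FT_le[OF schwartz_integrable] by auto
  next
    case (Suc k)
    obtain C where C: "\<And>\<xi>. (1 + norm \<xi>) ^ k * cmod (FT f \<xi>) \<le> C" using Suc by metis
    have "\<exists>D. \<forall>\<xi>. (1 + norm \<xi>) ^ k * cmod (FT (pderiv_dir i f) \<xi>) \<le> D" for i
      by (rule Suc.IH[OF schwartzD(4)[OF Suc.prems]])
    then obtain D where D: "\<And>i \<xi>. (1 + norm \<xi>) ^ k * cmod (FT (pderiv_dir i f) \<xi>) \<le> D i" by metis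
    have "(1 + norm \<xi>) ^ Suc k * cmod (FT f \<xi>) \<le> C + (\<Sum>i\<in>UNIV. D i)" for \<xi>
    proof -
      have "norm \<xi> * cmod (FT f \<xi>) \<le> (\<Sum>i\<in>UNIV. \<bar>\<xi> $ i\<bar>) * cmod (FT f \<xi>)"
        by (intro mult_right_mono norm_le_l1_cart) auto
      also have "\<dots> = (\<Sum>i\<in>UNIV. cmod (FT (pderiv_dir i f) \<xi>))"
        by (simp add: FT_pderiv[OF Suc.prems] norm_mult sum_distrib_right)
      finally have "(1 + norm \<xi>) ^ k * (norm \<xi> * cmod (FT f \<xi>)) \<le> (1 + norm \<xi>) ^ k * (\<Sum>i\<in>UNIV. cmod (FT (pderiv_dir i f) \<xi>))"
        by (intro mult_left_mono) auto
      also have "\<dots> \<le> (\<Sum>i\<in>UNIV. D i)" unfolding sum_distrib_left by (intro sum_mono D)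
      finally show ?thesis using C[of \<xi>] by (simp add: algebra_simps)
    qed
    then show ?case by blast
  qed
qed

text \<open>A derivative of a transform is the transform of another Schwartz function, so the set of
  transforms is a coinductive invariant.\<close>

lemma schwartz_FT:
  assumes "schwartz f" shows "schwartz (FT f)"
  using assms unfolding schwartz_eq[THEN fun_cong, of "FT f"]
proof (coinduction arbitrary: f rule: smooth_in.coinduct)
  case smooth_in
  have "\<exists>f'. has_pd i (FT f) f' \<and> ((\<exists>g. f' = FT g \<and> schwartz g) \<or> smooth_in rapid f')" for i
    using has_pd_FT[OF smooth_in, of i] schwartz_coord_mult[OF smooth_in, of "- \<i>" i] by blast
  then show ?case
    using FT_continuous[OF schwartz_integrable[OF smooth_in]] FT_rapid[OF smooth_in] by blast
qed

lemma schwartz_IFT: "schwartz f \<Longrightarrow> schwartz (IFT f)"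
  unfolding IFT_eq_FT[abs_def] by (intro schwartz_scale schwartz_reflect[OF schwartz_FT])

section \<open>Multiplication formula and inversion\<close>

lemma borel_representative:
  fixes f :: "real^'n \<Rightarrow> complex"
  assumes "f \<in> borel_measurable lebesgue"
  obtains g where "g \<in> borel_measurable borel" "AE x in lebesgue. f x = g x"
proof -
  have R: "(\<lambda>x. Re (f x)) \<in> borel_measurable lebesgue" and I: "(\<lambda>x. Im (f x)) \<in> borel_measurable lebesgue"
    using assms by auto
  obtain r where r: "r \<in> borel_measurable lborel" "AE x in lborel. Re (f x) = r x"
    using completion_ex_borel_measurable_real[OF R] by blast
  obtain s where s: "s \<in> borel_measurable lborel" "AE x in lborel. Im (f x) = s x"
    using completion_ex_borel_measurable_real[OF I] by blast
  show ?thesis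
  proof (rule that[of "\<lambda>x. Complex (r x) (s x)"])
    have "(\<lambda>x. complex_of_real (r x) + \<i> * complex_of_real (s x)) \<in> borel_measurable borel"
      using r(1) s(1) by simp
    then show "(\<lambda>x. Complex (r x) (s x)) \<in> borel_measurable borel" by (simp add: Complex_eq)
    have "AE x in lborel. f x = Complex (r x) (s x)" using r(2) s(2) by eventually_elim (auto simp: complex_eq_iff)
    then show "AE x in lebesgue. f x = Complex (r x) (s x)" by (rule AE_completion)
  qed
qed

lemma FT_multiplication_borel:
  fixes f g :: "real^'n \<Rightarrow> complex"
  assumes [measurable]: "f \<in> borel_measurable borel" "g \<in> borel_measurable borel"
    and f: "integrable lborel f" and g: "integrable lborel g"
  shows "(LINT \<xi>|lborel. (LINT x|lborel. f x * cis (- (x \<bullet> \<xi>))) * g \<xi>) = (LINT x|lborel. f x * (LINT \<xi>|lborel. g \<xi> * cis (- (\<xi> \<bullet> x))))"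
proof -
  have cism[measurable]: "(\<lambda>z. cis (- (fst z \<bullet> snd z))) \<in> borel_measurable (borel :: ((real^'n) \<times> (real^'n)) measure)"
    by (intro borel_measurable_continuous_onI continuous_intros)
  have "integrable (lborel \<Otimes>\<^sub>M lborel) (\<lambda>(x, \<xi>). f x * g \<xi>)"
    using lborel_pair.Fubini_integrable[of "\<lambda>(x, \<xi>). f x * g \<xi>"] f g
    by (auto simp: norm_mult borel_prod)
  then have int: "integrable (lborel \<Otimes>\<^sub>M lborel) (\<lambda>(x, \<xi>). f x * cis (- (x \<bullet> \<xi>)) * g \<xi>)"
  proof (rule Bochner_Integration.integrable_bound)
    have "(\<lambda>z. f (fst z) * cis (- (fst z \<bullet> snd z)) * g (snd z)) \<in> borel_measurable (lborel \<Otimes>\<^sub>M lborel)"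
      using cism measurable_compose[OF borel_measurable_continuous_onI[OF continuous_on_fst[OF continuous_on_id]] assms(1)]
        measurable_compose[OF borel_measurable_continuous_onI[OF continuous_on_snd[OF continuous_on_id]] assms(2)]
      by (intro borel_measurable_times) (auto simp: lborel_prod)
    then show "(\<lambda>(x, \<xi>). f x * cis (- (x \<bullet> \<xi>)) * g \<xi>) \<in> borel_measurable (lborel \<Otimes>\<^sub>M lborel)" by (simp add: case_prod_beta')
  qed (auto simp: norm_mult)
  have "(LINT \<xi>|lborel. (LINT x|lborel. f x * cis (- (x \<bullet> \<xi>)) * g \<xi>)) = (LINT x|lborel. (LINT \<xi>|lborel. f x * cis (- (x \<bullet> \<xi>)) * g \<xi>))"
    using lborel_pair.Fubini_integral[OF int] .
  moreover have "(LINT \<xi>|lborel. f x * cis (- (x \<bullet> \<xi>)) * g \<xi>) = f x * (LINT \<xi>|lborel. g \<xi> * cis (- (\<xi> \<bullet> x)))" for x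
  proof -
    have "f x * cis (- (x \<bullet> \<xi>)) * g \<xi> = f x * (g \<xi> * cis (- (\<xi> \<bullet> x)))" for \<xi> by (simp add: inner_commute)
    then show ?thesis by (simp only: integral_mult_right_zero)
  qed
  ultimately show ?thesis by (simp only: integral_mult_left_zero)
qed

text \<open>Fubini for the kernel \<open>cis (- (x \<bullet> \<xi>))\<close>. Both functions are
  first replaced by Borel representatives, because the product measure is formed from
  \<open>lborel\<close>; transforms do not see the change.\<close>

lemma FT_multiplication:
  fixes f g :: "real^'n \<Rightarrow> complex"
  assumes f: "integrable lebesgue f" and g: "integrable lebesgue g"
  shows "(LINT \<xi>|lebesgue. FT f \<xi> * g \<xi>) = (LINT x|lebesgue. f x * FT g x)"
proof -
  obtain f' where f': "f' \<in> borel_measurable borel" "AE x in lebesgue. f x = f' x"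
    by (rule borel_representative[OF borel_measurable_integrable[OF f]])
  obtain g' where g': "g' \<in> borel_measurable borel" "AE x in lebesgue. g x = g' x"
    by (rule borel_representative[OF borel_measurable_integrable[OF g]])
  have m: "f' \<in> borel_measurable lebesgue" "g' \<in> borel_measurable lebesgue"
    using f'(1) g'(1) by (auto intro!: measurable_completion)
  have i: "integrable lebesgue f'" "integrable lebesgue g'"
    using integrable_cong_AE_imp[OF f m(1)] integrable_cong_AE_imp[OF g m(2)] f'(2) g'(2) by auto
  then have il: "integrable lborel f'" "integrable lborel g'"
    using f'(1) g'(1) by (auto simp: integrable_completion)
  have c: "(\<lambda>x::real^'n. cis (- (x \<bullet> \<xi>))) \<in> borel_measurable borel" for \<xi>
    by (intro borel_measurable_continuous_onI continuous_intros)
  have FTl: "FT h \<xi> = (LINT x|lborel. h x * cis (- (x \<bullet> \<xi>)))" if h: "h \<in> borel_measurable borel" for h :: "real^'n \<Rightarrow> complex" and \<xi>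
    unfolding FT_def using h c by (intro integral_completion) simp
  have Fm: "FT f' \<in> borel_measurable borel" "FT g' \<in> borel_measurable borel"
    using FT_continuous i borel_measurable_continuous_onI by blast+
  have "(LINT \<xi>|lebesgue. FT f \<xi> * g \<xi>) = (LINT \<xi>|lebesgue. FT f' \<xi> * g' \<xi>)"
    unfolding FT_cong_AE[OF borel_measurable_integrable[OF f] m(1) f'(2)]
    using g'(2) m g Fm by (intro integral_cong_AE borel_measurable_times) (auto intro: measurable_completion)
  also have "\<dots> = (LINT \<xi>|lborel. FT f' \<xi> * g' \<xi>)" using Fm g' by (intro integral_completion) simp
  also have "\<dots> = (LINT x|lborel. f' x * FT g' x)"
    using FT_multiplication_borel[OF f'(1) g'(1) il] by (simp only: FTl[OF f'(1)] FTl[OF g'(1)])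
  also have "\<dots> = (LINT x|lebesgue. f' x * FT g' x)" using Fm f' by (intro integral_completion[symmetric]) simp
  also have "\<dots> = (LINT x|lebesgue. f x * FT g x)"
    unfolding FT_cong_AE[OF borel_measurable_integrable[OF g] m(2) g'(2)]
    using f'(2) m f Fm by (intro integral_cong_AE borel_measurable_times) (auto intro: measurable_completion)
  finally show ?thesis .
qed

text \<open>The Gaussian and its transform solve the same equations: the \<open>i\<close>-th
  derivative is minus the \<open>i\<close>-th coordinate times the function. Their quotient is
  therefore constant along coordinate lines, hence everywhere, and its value at the origin is the
  integral of the Gaussian.\<close>

lemma FT_gauss: "FT gauss \<xi> = complex_of_real (sqrt (2 * pi) ^ CARD('n)) * gauss \<xi>" for \<xi> :: "real^'n"
proof -
  define h where "h \<xi> = FT gauss \<xi> * inverse (gauss \<xi>)" for \<xi> :: "real^'n"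
  have g0: "gauss \<xi> \<noteq> 0" for \<xi> :: "real^'n" unfolding gauss_def by simp
  have F: "has_pd i (FT gauss) (\<lambda>\<xi>. - complex_of_real (\<xi> $ i) * FT gauss \<xi>)" for i :: 'n
  proof -
    have "(\<lambda>x::real^'n. - \<i> * (complex_of_real (x $ i) * gauss x)) = (\<lambda>x. \<i> * pderiv_dir i gauss x)"
      using has_pd_imp(1)[OF has_pd_gauss[of i]] by (simp add: mult.assoc)
    then have "FT (\<lambda>x. - \<i> * (complex_of_real (x $ i) * gauss x)) = (\<lambda>\<xi>. - complex_of_real (\<xi> $ i) * FT gauss \<xi>)"
      by (simp add: fun_eq_iff FT_scale FT_pderiv[OF schwartz_gauss] mult.assoc[symmetric])
    then show ?thesis using has_pd_FT[OF schwartz_gauss, of i] by simp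
  qed
  have line: "h (x + t *\<^sub>R axis i 1) = h x" for x t i
  proof -
    have "((\<lambda>t. h (x + t *\<^sub>R axis i 1)) has_vector_derivative 0) (at t)" for t
    proof -
      let ?y = "x + t *\<^sub>R axis i 1"
      have A: "((\<lambda>t. FT gauss (x + t *\<^sub>R axis i 1)) has_derivative (\<lambda>s. s *\<^sub>R (- complex_of_real (?y $ i) * FT gauss ?y))) (at t)"
        using has_pd_line[OF F] unfolding has_vector_derivative_def .
      have B: "((\<lambda>t. gauss (x + t *\<^sub>R axis i 1)) has_derivative (\<lambda>s. s *\<^sub>R (- complex_of_real (?y $ i) * gauss ?y))) (at t)"
        using has_pd_line[OF has_pd_gauss] unfolding has_vector_derivative_def .
      have "((\<lambda>t. h (x + t *\<^sub>R axis i 1)) has_derivative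
         (\<lambda>s. FT gauss ?y * - (inverse (gauss ?y) * (s *\<^sub>R (- complex_of_real (?y $ i) * gauss ?y)) * inverse (gauss ?y))
            + s *\<^sub>R (- complex_of_real (?y $ i) * FT gauss ?y) * inverse (gauss ?y))) (at t)"
        unfolding h_def by (rule has_derivative_mult[OF A Deriv.has_derivative_inverse[OF g0 B]])
      moreover have "(\<lambda>s. FT gauss ?y * - (inverse (gauss ?y) * (s *\<^sub>R (- complex_of_real (?y $ i) * gauss ?y)) * inverse (gauss ?y))
            + s *\<^sub>R (- complex_of_real (?y $ i) * FT gauss ?y) * inverse (gauss ?y)) = (\<lambda>s. s *\<^sub>R 0)"
        using g0[of ?y] by (auto simp: fun_eq_iff scaleR_conv_of_real field_simps)
      ultimately show ?thesis unfolding has_vector_derivative_def by simp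
    qed
    then have "\<exists>c. \<forall>t. h (x + t *\<^sub>R axis i 1) = c"
      using has_derivative_zero_constant[of UNIV "\<lambda>t. h (x + t *\<^sub>R axis i 1)"]
      by (auto simp: has_vector_derivative_def)
    then show ?thesis by (metis add.right_neutral scaleR_zero_left)
  qed
  have line': "h (t *\<^sub>R axis i 1 + x) = h x" for x t i using line by (simp add: add.commute)
  have "h (\<Sum>i\<in>I. (\<xi> $ i) *\<^sub>R axis i 1) = h 0" if "finite I" for I
    using that by induction (simp_all add: line')
  from this[of UNIV] have "h \<xi> = h 0" by (simp add: basis_expansion[of \<xi>, unfolded scalar_mult_eq_scaleR])
  moreover have "h 0 = complex_of_real (sqrt (2 * pi) ^ CARD('n))"
  proof -
    have "FT gauss (0::real^'n) = complex_of_real (sqrt (2 * pi) ^ CARD('n))"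
      using integral_gauss unfolding FT_def by simp
    moreover have "gauss (0::real^'n) = 1" by (simp add: gauss_def)
    ultimately show ?thesis by (simp add: h_def)
  qed
  moreover have "FT gauss \<xi> = h \<xi> * gauss \<xi>" using g0[of \<xi>] by (simp add: h_def)
  ultimately show ?thesis by (simp only:)
qed

text \<open>Inversion at the origin. The integral of \<open>FT f\<close> is regularised by a dilated
  Gaussian; the multiplication formula and a change of variable move the dilation onto
  \<open>f\<close>, and both sides converge as the dilation parameter tends to 0.\<close>

lemma integral_FT:
  fixes f :: "real^'n \<Rightarrow> complex"
  assumes f: "schwartz f"
  shows "(LINT \<xi>|lebesgue. FT f \<xi>) = complex_of_real ((2 * pi) ^ CARD('n)) * f 0"
proof -
  let ?c = "complex_of_real (sqrt (2 * pi) ^ CARD('n))"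
  let ?e = "\<lambda>k::nat. inverse (real (Suc k))"
  have e: "?e k > 0" for k by simp
  obtain B where B: "\<And>x. cmod (f x) \<le> B" using schwartzD(2)[OF f] unfolding rapid_def by (metis mult_1 power_0)
  have gm: "(gauss :: real^'n \<Rightarrow> complex) \<in> borel_measurable lebesgue" using schwartz_measurable schwartz_gauss by blast
  have eq: "(LINT \<xi>|lebesgue. FT f \<xi> * gauss (?e k *\<^sub>R \<xi>)) = (LINT x|lebesgue. f (?e k *\<^sub>R x) * (?c * gauss x))" for k
  proof -
    have gs: "schwartz (\<lambda>\<xi>::real^'n. gauss (?e k *\<^sub>R \<xi>))"
      using schwartz_affine[OF _ schwartz_gauss, of "?e k" 0] by simp
    have FTg: "complex_of_real (?e k ^ CARD('n)) * FT (\<lambda>\<xi>. gauss (?e k *\<^sub>R \<xi>)) (x::real^'n) = ?c * gauss ((1 / ?e k) *\<^sub>R x)" for x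
      using FT_scaling[OF gm e, of k x] FT_gauss[of "(1 / ?e k) *\<^sub>R x"] by simp
    have m: "(\<lambda>x. f x * FT (\<lambda>\<xi>. gauss (?e k *\<^sub>R \<xi>)) x) \<in> borel_measurable lebesgue"
      using schwartz_measurable f schwartz_FT[OF gs] by (intro borel_measurable_times) blast+
    have "(LINT \<xi>|lebesgue. FT f \<xi> * gauss (?e k *\<^sub>R \<xi>)) = (LINT x|lebesgue. f x * FT (\<lambda>\<xi>. gauss (?e k *\<^sub>R \<xi>)) x)"
      by (rule FT_multiplication[OF schwartz_integrable[OF f] schwartz_integrable[OF gs]])
    \<comment> \<open>The Jacobian of this substitution is exactly the factor that
      \<open>FT_scaling\<close> produces for the dilated Gaussian.\<close>
    also have "\<dots> = (LINT x|lebesgue. complex_of_real (?e k ^ CARD('n)) * (f (?e k *\<^sub>R x) * FT (\<lambda>\<xi>. gauss (?e k *\<^sub>R \<xi>)) (?e k *\<^sub>R x)))"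
      using integral_affine_lebesgue[OF _ m, of "?e k" 0] by (simp add: scaleR_conv_of_real)
    also have "\<dots> = (LINT x|lebesgue. f (?e k *\<^sub>R x) * (?c * gauss x))"
    proof (rule Bochner_Integration.integral_cong)
      fix x :: "real^'n"
      have "complex_of_real (?e k ^ CARD('n)) * (f (?e k *\<^sub>R x) * FT (\<lambda>\<xi>. gauss (?e k *\<^sub>R \<xi>)) (?e k *\<^sub>R x))
        = f (?e k *\<^sub>R x) * (complex_of_real (?e k ^ CARD('n)) * FT (\<lambda>\<xi>. gauss (?e k *\<^sub>R \<xi>)) (?e k *\<^sub>R x))" by (simp only: ac_simps)
      also have "\<dots> = f (?e k *\<^sub>R x) * (?c * gauss ((1 / ?e k) *\<^sub>R (?e k *\<^sub>R x)))" unfolding FTg ..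
      also have "(1 / ?e k) *\<^sub>R (?e k *\<^sub>R x) = x" by simp
      finally show "complex_of_real (?e k ^ CARD('n)) * (f (?e k *\<^sub>R x) * FT (\<lambda>\<xi>. gauss (?e k *\<^sub>R \<xi>)) (?e k *\<^sub>R x))
          = f (?e k *\<^sub>R x) * (?c * gauss x)" .
    qed simp
    finally show ?thesis .
  qed
  have lim: "(\<lambda>k. u (?e k *\<^sub>R x)) \<longlonglongrightarrow> u 0" if "continuous_on UNIV u" for u :: "real^'n \<Rightarrow> complex" and x
  proof -
    have "(\<lambda>k. ?e k *\<^sub>R x) \<longlonglongrightarrow> 0 *\<^sub>R x" by (intro tendsto_scaleR tendsto_const LIMSEQ_inverse_real_of_nat)
    then show ?thesis using that unfolding continuous_on_sequentially comp_def by auto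
  qed
  have dil: "(\<lambda>x. u (?e k *\<^sub>R x)) \<in> borel_measurable lebesgue" if "u \<in> borel_measurable lebesgue" for u :: "real^'n \<Rightarrow> complex" and k
    using borel_measurable_affine_lebesgue[OF _ that, of "?e k" 0] by simp
  have "(\<lambda>k. LINT \<xi>|lebesgue. FT f \<xi> * gauss (?e k *\<^sub>R \<xi>)) \<longlonglongrightarrow> (LINT \<xi>|lebesgue. FT f \<xi> * gauss (0::real^'n))"
  proof (rule integral_dominated_convergence[where w = "\<lambda>\<xi>. cmod (FT f \<xi>)"])
    show "integrable lebesgue (\<lambda>\<xi>. cmod (FT f \<xi>))" using schwartz_integrable[OF schwartz_FT[OF f]] by auto
    show "AE \<xi> in lebesgue. (\<lambda>k. FT f \<xi> * gauss (?e k *\<^sub>R \<xi>)) \<longlonglongrightarrow> FT f \<xi> * gauss (0::real^'n)"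
      by (intro always_eventually allI tendsto_mult tendsto_const lim[OF gauss_continuous])
    show "AE \<xi> in lebesgue. cmod (FT f \<xi> * gauss (?e k *\<^sub>R \<xi>)) \<le> cmod (FT f \<xi>)" for k
      by (intro always_eventually allI) (simp add: norm_mult gauss_def mult_left_le)
  qed (use schwartz_measurable(1)[OF schwartz_FT[OF f]] dil[OF gm] in auto)
  moreover have "(\<lambda>k. LINT x|lebesgue. f (?e k *\<^sub>R x) * (?c * gauss x)) \<longlonglongrightarrow> (LINT x|lebesgue. f 0 * (?c * gauss (x::real^'n)))"
  proof (rule integral_dominated_convergence[where w = "\<lambda>x. B * cmod (?c * gauss x)"])
    show "integrable lebesgue (\<lambda>x::real^'n. B * cmod (?c * gauss x))" using schwartz_integrable[OF schwartz_gauss] by auto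
    show "AE x in lebesgue. (\<lambda>k. f (?e k *\<^sub>R x) * (?c * gauss x)) \<longlonglongrightarrow> f 0 * (?c * gauss x)"
      by (intro always_eventually allI tendsto_mult tendsto_const lim[OF schwartzD(1)[OF f]])
    show "AE x in lebesgue. cmod (f (?e k *\<^sub>R x) * (?c * gauss x)) \<le> B * cmod (?c * gauss x)" for k
      unfolding norm_mult[of "f _"] by (intro always_eventually allI mult_right_mono B) auto
  qed (use schwartz_measurable(1)[OF f] gm dil in auto)
  ultimately have "(LINT \<xi>|lebesgue. FT f \<xi> * gauss (0::real^'n)) = (LINT x|lebesgue. f 0 * (?c * gauss (x::real^'n)))"
    unfolding eq by (rule LIMSEQ_unique)
  also have "\<dots> = f 0 * (?c * ?c)" by (simp add: integral_gauss)
  also have "?c * ?c = complex_of_real ((2 * pi) ^ CARD('n))"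
    by (simp only: of_real_mult[symmetric] power_mult_distrib[symmetric]) simp
  finally show ?thesis by (simp add: gauss_def)
qed

text \<open>Translation carries the inversion formula from the origin to every point.\<close>

lemma IFT_FT:
  assumes f: "schwartz f" shows "IFT (FT f) = f"
proof
  fix x
  have s: "schwartz (\<lambda>y. f (x + y))" using schwartz_translate[OF f, of "- x"] by (simp add: add.commute)
  have "(LINT \<xi>|lebesgue. FT (\<lambda>y. f (x + y)) \<xi>) = complex_of_real ((2 * pi) ^ CARD('a)) * f x"
    using integral_FT[OF s] by simp
  then show "IFT (FT f) x = f x"
    unfolding IFT_def by (simp add: FT_translate[OF schwartz_measurable(1)[OF f]] mult.commute)
qed

lemma FT_IFT:
  assumes f: "schwartz f" shows "FT (IFT f) = f"
proof
  fix x :: "real^'a"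
  have "FT (\<lambda>x. FT f (- x)) x = FT (FT f) (- x)"
    using FT_reflect[OF schwartz_measurable(1)[OF schwartz_FT[OF f]]] by simp
  then have "FT (IFT f) x = IFT (FT f) x" unfolding IFT_eq_FT[abs_def] FT_scale by simp
  then show "FT (IFT f) x = f x" using IFT_FT[OF f] by simp
qed

lemma parseval_schwartz:
  fixes f :: "real^'n \<Rightarrow> complex"
  assumes f: "schwartz f"
  shows "(LINT \<xi>|lebesgue. FT f \<xi> * cnj (FT f \<xi>)) = complex_of_real ((2 * pi) ^ CARD('n)) * (LINT x|lebesgue. f x * cnj (f x))"
proof -
  have F: "schwartz (FT f)" by (rule schwartz_FT[OF f])
  have "FT (\<lambda>\<xi>. cnj (FT f \<xi>)) x = complex_of_real ((2 * pi) ^ CARD('n)) * cnj (f x)" for x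
    using fun_cong[OF IFT_FT[OF f], of x] unfolding IFT_eq_FT FT_cnj
    by (simp add: field_simps)
  then have "f x * FT (\<lambda>\<xi>. cnj (FT f \<xi>)) x = complex_of_real ((2 * pi) ^ CARD('n)) * (f x * cnj (f x))" for x
    by (simp only: ac_simps)
  then show ?thesis
    using FT_multiplication[OF schwartz_integrable[OF f] schwartz_integrable[OF schwartz_cnj[OF F]]]
    by (simp only: integral_mult_right_zero)
qed

section \<open>The space of square integrable functions\<close>

text \<open>The extended-valued form decides membership in \<open>L2\<close> and suits Fatou's
  lemma; the real form \<open>q2\<close> is the one for algebra with \<open>ip\<close>.\<close>

definition N2 :: "((real^'n) \<Rightarrow> complex) \<Rightarrow> ennreal" where
  "N2 f = (\<integral>\<^sup>+x. ennreal ((cmod (f x))\<^sup>2) \<partial>lebesgue)"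

definition q2 :: "((real^'n) \<Rightarrow> complex) \<Rightarrow> real" where
  "q2 f = (LINT x|lebesgue. (cmod (f x))\<^sup>2)"

definition ip :: "((real^'n) \<Rightarrow> complex) \<Rightarrow> ((real^'n) \<Rightarrow> complex) \<Rightarrow> complex" where
  "ip f g = (LINT x|lebesgue. f x * cnj (g x))"

lemma L2_iff: "f \<in> L2 \<longleftrightarrow> f \<in> borel_measurable lebesgue \<and> N2 f < \<infinity>"
  unfolding L2_def N2_def integrable_iff_bounded by auto

lemma L2_measurable: "f \<in> L2 \<Longrightarrow> f \<in> borel_measurable lebesgue" by (simp add: L2_iff)

lemma N2_eq: "f \<in> L2 \<Longrightarrow> N2 f = ennreal (q2 f)"
  unfolding N2_def q2_def L2_def by (auto intro: nn_integral_eq_integral)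

lemma q2_nonneg: "q2 f \<ge> 0" unfolding q2_def by simp

lemma L2_mult_integrable:
  assumes "f \<in> L2" "g \<in> L2" shows "integrable lebesgue (\<lambda>x. f x * g x)"
proof (rule Bochner_Integration.integrable_bound)
  show "integrable lebesgue (\<lambda>x. (cmod (f x))\<^sup>2 + (cmod (g x))\<^sup>2)" using assms unfolding L2_def by auto
  show "(\<lambda>x. f x * g x) \<in> borel_measurable lebesgue" using assms[THEN L2_measurable] by auto
  have "cmod (f x) * cmod (g x) \<le> (cmod (f x))\<^sup>2 + (cmod (g x))\<^sup>2" for x
    using sum_squares_bound[of "cmod (f x)" "cmod (g x)"] zero_le_power2[of "cmod (f x)"] zero_le_power2[of "cmod (g x)"]
    by linarith
  then show "AE x in lebesgue. norm (f x * g x) \<le> norm ((cmod (f x))\<^sup>2 + (cmod (g x))\<^sup>2)"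
    by (auto simp: norm_mult)
qed

lemma borel_measurable_cnj:
  "f \<in> borel_measurable M \<Longrightarrow> (\<lambda>x. cnj (f x)) \<in> borel_measurable M"
  by (rule borel_measurable_continuous_on[OF continuous_on_cnj[OF continuous_on_id]])

lemma box_indicator_integrable: "integrable lebesgue (indicator (box a b) :: real^'n \<Rightarrow> real)"
  using lmeasurable_box lmeasurable_iff_integrable by blast

lemma box_indicator_measurable [measurable]: "(indicator (box a b) :: real^'n \<Rightarrow> real) \<in> borel_measurable lebesgue"
  by (rule borel_measurable_integrable[OF box_indicator_integrable])

lemma box_indicator_measurable_complex:
  "(\<lambda>x::real^'n. complex_of_real (indicator (box a b) x)) \<in> borel_measurable lebesgue"
  by (rule borel_measurable_continuous_on[OF continuous_on_of_real[OF continuous_on_id] box_indicator_measurable])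

lemma L2_cnj: "f \<in> L2 \<Longrightarrow> (\<lambda>x. cnj (f x)) \<in> L2" and q2_cnj: "q2 (\<lambda>x. cnj (f x)) = q2 f"
  unfolding L2_def q2_def by (auto intro: borel_measurable_cnj)

lemma L2_add:
  assumes "f \<in> L2" "g \<in> L2" shows "(\<lambda>x. f x + g x) \<in> L2"
  unfolding L2_def
proof safe
  note [measurable] = assms[THEN L2_measurable]
  show "(\<lambda>x. f x + g x) \<in> borel_measurable lebesgue" by measurable
  show "integrable lebesgue (\<lambda>x. (cmod (f x + g x))\<^sup>2)"
  proof (rule Bochner_Integration.integrable_bound)
    show "(\<lambda>x. (cmod (f x + g x))\<^sup>2) \<in> borel_measurable lebesgue" by measurable
    show "integrable lebesgue (\<lambda>x. 2 * (cmod (f x))\<^sup>2 + 2 * (cmod (g x))\<^sup>2)" using assms unfolding L2_def by auto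
    have "(cmod (f x + g x))\<^sup>2 \<le> 2 * (cmod (f x))\<^sup>2 + 2 * (cmod (g x))\<^sup>2" for x
    proof -
      have "(cmod (f x + g x))\<^sup>2 \<le> (cmod (f x) + cmod (g x))\<^sup>2" by (intro power_mono norm_triangle_ineq) auto
      then show ?thesis using sum_squares_bound[of "cmod (f x)" "cmod (g x)"] by (simp add: power2_sum)
    qed
    then show "AE x in lebesgue. norm ((cmod (f x + g x))\<^sup>2) \<le> norm (2 * (cmod (f x))\<^sup>2 + 2 * (cmod (g x))\<^sup>2)" by auto
  qed
qed

lemma L2_scale: "f \<in> L2 \<Longrightarrow> (\<lambda>x. c * f x) \<in> L2" and q2_scale: "q2 (\<lambda>x. c * f x) = (cmod c)\<^sup>2 * q2 f"
  unfolding L2_def q2_def by (auto simp: norm_mult power_mult_distrib)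

lemma L2_diff: "f \<in> L2 \<Longrightarrow> g \<in> L2 \<Longrightarrow> (\<lambda>x. f x - g x) \<in> L2"
  using L2_add[OF _ L2_scale[of g "-1"]] by simp

lemma L2_cong_AE:
  assumes "f \<in> L2" "g \<in> borel_measurable lebesgue" "AE x in lebesgue. f x = g x"
  shows "g \<in> L2" "q2 g = q2 f"
proof -
  have "N2 f = N2 g" unfolding N2_def by (rule nn_integral_cong_AE) (use assms(3) in auto)
  then show "g \<in> L2" using assms unfolding L2_iff by auto
  show "q2 g = q2 f" unfolding q2_def
  proof (rule integral_cong_AE)
    note [measurable] = L2_measurable[OF assms(1)] assms(2)
    show "(\<lambda>x. (cmod (g x))\<^sup>2) \<in> borel_measurable lebesgue" "(\<lambda>x. (cmod (f x))\<^sup>2) \<in> borel_measurable lebesgue" by measurable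
  qed (use assms(3) in auto)
qed

lemma L2_schwartz: assumes "schwartz f" shows "f \<in> L2"
  unfolding L2_def
proof safe
  show "f \<in> borel_measurable lebesgue" by (rule schwartz_measurable[OF assms])
  have "integrable lebesgue (\<lambda>x. cmod (f x * cnj (f x)))"
    using schwartz_integrable[OF schwartz_mult[OF assms schwartz_cnj[OF assms]]] by (rule integrable_norm)
  then show "integrable lebesgue (\<lambda>x. (cmod (f x))\<^sup>2)" by (simp add: norm_mult power2_eq_square)
qed

section \<open>The inner product and Cauchy-Schwarz\<close>

lemma ip_self: "ip f f = complex_of_real (q2 f)"
  unfolding ip_def q2_def by (simp add: complex_norm_square[symmetric] flip: of_real_power)

lemma ip_integrable: "f \<in> L2 \<Longrightarrow> g \<in> L2 \<Longrightarrow> integrable lebesgue (\<lambda>x. f x * cnj (g x))"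
  by (intro L2_mult_integrable L2_cnj)

lemma ip_cnj: "ip g f = cnj (ip f g)"
  unfolding ip_def Bochner_Integration.integral_cnj[symmetric] by (simp add: mult.commute)

lemma ip_add_left: "f \<in> L2 \<Longrightarrow> g \<in> L2 \<Longrightarrow> h \<in> L2 \<Longrightarrow> ip (\<lambda>x. f x + g x) h = ip f h + ip g h"
  unfolding ip_def by (simp add: distrib_right ip_integrable)

lemma ip_diff_left: "f \<in> L2 \<Longrightarrow> g \<in> L2 \<Longrightarrow> h \<in> L2 \<Longrightarrow> ip (\<lambda>x. f x - g x) h = ip f h - ip g h"
  unfolding ip_def by (simp add: left_diff_distrib ip_integrable)

lemma ip_scale_left: "ip (\<lambda>x. c * f x) h = c * ip f h"
  unfolding ip_def by (simp add: mult.assoc)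

lemma q2_add:
  assumes "f \<in> L2" "g \<in> L2"
  shows "q2 (\<lambda>x. f x + g x) = q2 f + q2 g + 2 * Re (ip f g)"
proof -
  define s where "s = (\<lambda>x. f x + g x)"
  have s: "s \<in> L2" unfolding s_def by (rule L2_add[OF assms])
  have right: "ip u s = ip u f + ip u g" if "u \<in> L2" for u
  proof -
    have "ip s u = ip f u + ip g u" unfolding s_def by (rule ip_add_left[OF assms that])
    then have "cnj (ip s u) = cnj (ip f u) + cnj (ip g u)" by simp
    then show ?thesis unfolding ip_cnj[of u s] ip_cnj[of u f] ip_cnj[of u g] .
  qed
  have "ip s s = ip f s + ip g s" using ip_add_left[OF assms s] unfolding s_def[symmetric] .
  also have "\<dots> = (ip f f + ip f g) + (cnj (ip f g) + ip g g)"
    unfolding right[OF assms(1)] right[OF assms(2)] using ip_cnj[of g f] by simp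
  finally have "Re (ip s s) = Re ((ip f f + ip f g) + (cnj (ip f g) + ip g g))" by (rule arg_cong)
  then have "q2 s = q2 f + q2 g + 2 * Re (ip f g)" unfolding ip_self by simp
  then show ?thesis unfolding s_def .
qed

lemma Cauchy_Schwarz_L2:
  assumes "f \<in> L2" "g \<in> L2" shows "(cmod (ip f g))\<^sup>2 \<le> q2 f * q2 g"
proof -
  let ?I = "\<integral>\<^sup>+x. ennreal (cmod (f x)) * ennreal (cmod (g x)) \<partial>lebesgue"
  have "ennreal (cmod (ip f g)) \<le> (\<integral>\<^sup>+x. ennreal (cmod (f x * cnj (g x))) \<partial>lebesgue)"
    unfolding ip_def by (rule integral_norm_bound_ennreal[OF ip_integrable[OF assms]])
  also have "\<dots> = ?I" by (simp add: norm_mult ennreal_mult)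
  finally have "(ennreal (cmod (ip f g)))\<^sup>2 \<le> ?I\<^sup>2" by (rule power_mono) simp
  also have "\<dots> \<le> (\<integral>\<^sup>+x. (ennreal (cmod (f x)))\<^sup>2 \<partial>lebesgue) * (\<integral>\<^sup>+x. (ennreal (cmod (g x)))\<^sup>2 \<partial>lebesgue)"
    by (rule Cauchy_Schwarz_nn_integral) (use assms[THEN L2_measurable] in auto)
  also have "\<dots> = ennreal (q2 f * q2 g)"
    using N2_eq[OF assms(1)] N2_eq[OF assms(2)] by (simp add: N2_def ennreal_power ennreal_mult q2_nonneg)
  finally show ?thesis by (simp add: ennreal_power q2_nonneg)
qed

text \<open>Completeness of L2 for sequences with a geometric rate, which is all that the minimising
  sequences below require. The rate leaves room for a factor \<open>2 ^ k\<close>, whose weighted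
  squares then have a finite sum almost everywhere and force pointwise convergence; Fatou carries
  the rate over to the limit.\<close>

lemma L2_geometric_limit:
  assumes f: "\<And>k. f k \<in> L2" and C: "C \<ge> 0"
    and cauchy: "\<And>j k. k \<le> j \<Longrightarrow> q2 (\<lambda>x. f k x - f j x) \<le> C * (1/4) ^ k"
  shows "\<exists>h\<in>L2. \<forall>k. q2 (\<lambda>x. f k x - h x) \<le> C * (1/4) ^ k"
proof -
  have [measurable]: "f k \<in> borel_measurable lebesgue" for k using f L2_measurable by blast
  define d where "d k x = cmod (f k x - f (Suc k) x)" for k x
  have dm[measurable]: "d k \<in> borel_measurable lebesgue" for k unfolding d_def by measurable
  have "(\<integral>\<^sup>+x. (\<Sum>k. ennreal (2 ^ k * (d k x)\<^sup>2)) \<partial>lebesgue) = (\<Sum>k. \<integral>\<^sup>+x. ennreal (2 ^ k * (d k x)\<^sup>2) \<partial>lebesgue)"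
    by (rule nn_integral_suminf) measurable
  also have "\<dots> = (\<Sum>k. ennreal (2 ^ k * q2 (\<lambda>x. f k x - f (Suc k) x)))"
  proof (intro suminf_cong)
    fix k
    have "(\<integral>\<^sup>+x. ennreal (2 ^ k * (d k x)\<^sup>2) \<partial>lebesgue) = ennreal (2 ^ k) * N2 (\<lambda>x. f k x - f (Suc k) x)"
      unfolding N2_def d_def[symmetric] by (simp add: ennreal_mult nn_integral_cmult)
    then show "(\<integral>\<^sup>+x. ennreal (2 ^ k * (d k x)\<^sup>2) \<partial>lebesgue) = ennreal (2 ^ k * q2 (\<lambda>x. f k x - f (Suc k) x))"
      using N2_eq[OF L2_diff[OF f[of k] f[of "Suc k"]]] by (simp add: ennreal_mult q2_nonneg)
  qed
  also have "\<dots> \<le> (\<Sum>k. ennreal (C * (1/2) ^ k))"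
  proof (intro suminf_le ennreal_leI)
    fix k
    have "2 ^ k * q2 (\<lambda>x. f k x - f (Suc k) x) \<le> 2 ^ k * (C * (1/4) ^ k)" by (intro mult_left_mono cauchy) auto
    also have "\<dots> = C * (2 * (1/4)) ^ k" by (simp only: power_mult_distrib) (simp only: ac_simps)
    finally show "2 ^ k * q2 (\<lambda>x. f k x - f (Suc k) x) \<le> C * (1/2) ^ k" by simp
  qed auto
  also have "\<dots> < \<infinity>"
  proof -
    have "summable (\<lambda>k. C * (1/2::real) ^ k)" by (intro summable_mult summable_geometric) simp
    then show ?thesis using C by (simp add: suminf_ennreal2)
  qed
  finally have "(\<integral>\<^sup>+x. (\<Sum>k. ennreal (2 ^ k * (d k x)\<^sup>2)) \<partial>lebesgue) \<noteq> \<infinity>" by simp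
  then have "AE x in lebesgue. (\<Sum>k. ennreal (2 ^ k * (d k x)\<^sup>2)) \<noteq> \<infinity>"
    by (rule nn_integral_PInf_AE[rotated]) measurable
  then have conv: "AE x in lebesgue. convergent (\<lambda>k. f k x)"
  proof eventually_elim
    fix x assume "(\<Sum>k. ennreal (2 ^ k * (d k x)\<^sup>2)) \<noteq> \<infinity>"
    then have s: "summable (\<lambda>k. 2 ^ k * (d k x)\<^sup>2)" by (intro summable_suminf_not_top) auto
    have S1: "summable (\<lambda>k. (1/2::real) ^ k + 2 ^ k * (d k x)\<^sup>2)" by (intro summable_add s summable_geometric) simp
    have S2: "norm (f (Suc k) x - f k x) \<le> (1/2) ^ k + 2 ^ k * (d k x)\<^sup>2" for k
    proof -
      \<comment> \<open>Arithmetic-geometric mean: the square is chosen so that its expansion bounds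
        \<open>d k x\<close> by a geometric term plus the summable weighted square.\<close>
      have "0 \<le> (1/2::real) ^ k * (2 ^ k * d k x - 1)\<^sup>2" by simp
      also have "\<dots> = ((1/2) * 2) ^ k * (2 ^ k * (d k x)\<^sup>2 - 2 * d k x) + (1/2) ^ k"
        unfolding power_mult_distrib by (simp add: power2_eq_square algebra_simps)
      finally have "2 * d k x \<le> (1/2) ^ k + 2 ^ k * (d k x)\<^sup>2" by simp
      moreover have "d k x \<ge> 0" by (simp add: d_def)
      ultimately have "d k x \<le> (1/2) ^ k + 2 ^ k * (d k x)\<^sup>2" by linarith
      then show ?thesis unfolding d_def by (simp add: norm_minus_commute)
    qed
    have "summable (\<lambda>k. f (Suc k) x - f k x)" by (rule summable_comparison_test'[OF S1, of 0]) (rule S2)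
    then have "convergent (\<lambda>n. \<Sum>k<n. f (Suc k) x - f k x)" by (simp add: summable_iff_convergent)
    then have "convergent (\<lambda>n. f n x - f 0 x)" unfolding sum_lessThan_telescope[of "\<lambda>k. f k x"] .
    from convergent_add[OF this convergent_const[of "f 0 x"]] show "convergent (\<lambda>k. f k x)" by simp
  qed
  \<comment> \<open>Where the sequence diverges, \<open>lim\<close> has an arbitrary value; this
    happens only on a null set.\<close>
  define h where "h x = lim (\<lambda>k. f k x)" for x
  have hm[measurable]: "h \<in> borel_measurable lebesgue" unfolding h_def by measurable
  have N: "N2 (\<lambda>x. f k x - h x) \<le> ennreal (C * (1/4) ^ k)" for k
  proof -
    have "N2 (\<lambda>x. f k x - h x) = (\<integral>\<^sup>+x. liminf (\<lambda>j. ennreal ((cmod (f k x - f j x))\<^sup>2)) \<partial>lebesgue)"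
      unfolding N2_def
    proof (intro nn_integral_cong_AE, use conv in eventually_elim)
      fix x assume "convergent (\<lambda>k. f k x)"
      then have "(\<lambda>j. f j x) \<longlonglongrightarrow> h x" unfolding h_def by (simp add: convergent_LIMSEQ_iff)
      then have "(\<lambda>j. ennreal ((cmod (f k x - f j x))\<^sup>2)) \<longlonglongrightarrow> ennreal ((cmod (f k x - h x))\<^sup>2)"
        by (intro tendsto_ennrealI tendsto_power tendsto_norm tendsto_diff tendsto_const)
      then show "ennreal ((cmod (f k x - h x))\<^sup>2) = liminf (\<lambda>j. ennreal ((cmod (f k x - f j x))\<^sup>2))"
        by (rule lim_imp_Liminf[OF trivial_limit_sequentially, symmetric])
    qed
    also have "\<dots> \<le> liminf (\<lambda>j. \<integral>\<^sup>+x. ennreal ((cmod (f k x - f j x))\<^sup>2) \<partial>lebesgue)"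
      by (rule nn_integral_liminf) measurable
    also have "\<dots> \<le> liminf (\<lambda>j. ennreal (C * (1/4) ^ k))"
    proof (rule Liminf_mono)
      show "\<forall>\<^sub>F j in sequentially. (\<integral>\<^sup>+x. ennreal ((cmod (f k x - f j x))\<^sup>2) \<partial>lebesgue) \<le> ennreal (C * (1/4) ^ k)"
        unfolding N2_def[symmetric] eventually_sequentially
        using N2_eq[OF L2_diff[OF f f]] cauchy by (intro exI[of _ k]) (auto intro!: ennreal_leI)
    qed
    also have "\<dots> = ennreal (C * (1/4) ^ k)" by (simp add: Liminf_const)
    finally show ?thesis .
  qed
  have d: "(\<lambda>x. f k x - h x) \<in> L2" for k
    unfolding L2_iff using N[of k] by (auto intro: le_less_trans)
  have "h \<in> L2" using L2_diff[OF f[of 0] d[of 0]] by simp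
  moreover have "q2 (\<lambda>x. f k x - h x) \<le> C * (1/4) ^ k" for k
    using N[of k] C unfolding N2_eq[OF d] by simp
  ultimately show ?thesis by blast
qed

text \<open>The subspace \<open>V\<close> is not assumed to be closed; the representing function is the limit in \<open>L2\<close> of a
  minimising sequence in \<open>V\<close> for the functional \<open>q2 v - 2 Re (L v)\<close>.\<close>

lemma riesz_L2:
  fixes V :: "((real^'n) \<Rightarrow> complex) set"
  assumes V: "V \<subseteq> L2" "V \<noteq> {}"
    and Va: "\<And>u v. u \<in> V \<Longrightarrow> v \<in> V \<Longrightarrow> (\<lambda>x. u x + v x) \<in> V"
    and Vs: "\<And>c v. v \<in> V \<Longrightarrow> (\<lambda>x. c * v x) \<in> V"
    and La: "\<And>u v. u \<in> V \<Longrightarrow> v \<in> V \<Longrightarrow> L (\<lambda>x. u x + v x) = L u + L v"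
    and Ls: "\<And>c v. v \<in> V \<Longrightarrow> L (\<lambda>x. c * v x) = c * L v"
    and C: "\<And>v. v \<in> V \<Longrightarrow> (cmod (L v))\<^sup>2 \<le> C * q2 v" "C \<ge> 0"
  obtains h vs where "h \<in> L2" "\<And>k. vs k \<in> V" "(\<lambda>k. q2 (\<lambda>x. vs k x - h x)) \<longlonglongrightarrow> 0"
    "\<And>v. v \<in> V \<Longrightarrow> L v = ip v h" "q2 h \<le> C"
proof -
  define Q where "Q v = q2 v - 2 * Re (L v)" for v
  have Vm: "(\<lambda>x. u x - v x) \<in> V" if "u \<in> V" "v \<in> V" for u v
    using Va[OF that(1) Vs[OF that(2), of "-1"]] by simp
  have VL: "v \<in> V \<Longrightarrow> v \<in> L2" for v using V by auto
  have Qb: "Q v \<ge> - C" if v: "v \<in> V" for v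
  proof -
    have "2 * cmod (L v) \<le> C + q2 v"
    proof (rule power2_le_imp_le)
      have "0 \<le> (C - q2 v)\<^sup>2" by simp
      then show "(2 * cmod (L v))\<^sup>2 \<le> (C + q2 v)\<^sup>2" using C(1)[OF v] by (simp add: power_mult_distrib power2_sum power2_diff)
    qed (use C q2_nonneg in \<open>auto intro: add_nonneg_nonneg\<close>)
    then show ?thesis using complex_Re_le_cmod[of "L v"] unfolding Q_def by linarith
  qed
  define m where "m = Inf (Q ` V)"
  have bdd: "bdd_below (Q ` V)" using Qb by (auto intro!: bdd_belowI)
  have m: "m \<le> Q v" if "v \<in> V" for v unfolding m_def using that bdd by (intro cInf_lower) auto
  have "\<exists>v\<in>V. Q v < m + (1/4) ^ k" for k
  proof -
    have "\<exists>y\<in>Q ` V. y < m + (1/4) ^ k" using V(2) bdd unfolding m_def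
      by (subst cInf_less_iff[symmetric]) auto
    then show ?thesis by auto
  qed
  then obtain vs where vs: "\<And>k. vs k \<in> V" "\<And>k. Q (vs k) < m + (1/4) ^ k" by metis
  \<comment> \<open>Parallelogram law: the midpoint of \<open>u\<close> and \<open>v\<close> lies in
    \<open>V\<close>, so \<open>Q\<close> is at least \<open>m\<close> there, and two almost minimal
    vectors must be close.\<close>
  have par: "q2 (\<lambda>x. u x - v x) \<le> 2 * (Q u - m) + 2 * (Q v - m)" if u: "u \<in> V" and v: "v \<in> V" for u v
  proof -
    let ?w = "\<lambda>x. (1/2) * (u x + v x)"
    have w: "?w \<in> V" by (intro Vs Va u v)
    have "q2 ?w = (cmod (1/2))\<^sup>2 * q2 (\<lambda>x. u x + v x)" by (rule q2_scale)
    then have "4 * q2 ?w = q2 u + q2 v + 2 * Re (ip u v)"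
      using q2_add[OF VL[OF u] VL[OF v]] by (simp add: power2_eq_square)
    moreover have "q2 (\<lambda>x. u x - v x) = q2 u + q2 v - 2 * Re (ip u v)"
      using q2_add[OF VL[OF u] L2_scale[OF VL[OF v], of "-1"]] q2_scale[of "-1" v]
        ip_cnj[of u "\<lambda>x. (-1) * v x"] ip_scale_left[of "-1" v u] ip_cnj[of u v] by simp
    moreover have "L ?w = (1/2) * (L u + L v)" using Ls[OF Va[OF u v], of "1/2"] La[OF u v] by simp
    then have "Re (L ?w) = Re ((1/2) * (L u + L v))" by (rule arg_cong)
    then have "Re (L ?w) = (1/2) * (Re (L u) + Re (L v))" by simp
    moreover have "m \<le> Q ?w" by (rule m[OF w])
    ultimately show ?thesis unfolding Q_def by (simp add: field_simps)
  qed
  have cau: "q2 (\<lambda>x. vs k x - vs j x) \<le> 4 * (1/4) ^ k" if "k \<le> j" for j k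
  proof -
    have "(1/4::real) ^ j \<le> (1/4) ^ k" using that by (intro power_decreasing) auto
    moreover have "y \<le> 2 * (a - m) + 2 * (b - m) \<Longrightarrow> a < m + p \<Longrightarrow> b < m + r \<Longrightarrow> r \<le> p \<Longrightarrow> y \<le> 4 * p" for y a b p r :: real
      unfolding right_diff_distrib by linarith
    ultimately show ?thesis using par[OF vs(1) vs(1), of k j] vs(2)[of k] vs(2)[of j] by blast
  qed
  obtain h where h: "h \<in> L2" "\<And>k. q2 (\<lambda>x. vs k x - h x) \<le> 4 * (1/4) ^ k"
    using L2_geometric_limit[of vs 4, OF VL[OF vs(1)] zero_le_numeral cau] by blast
  have geo: "(\<lambda>k. c * (1/4::real) ^ k) \<longlonglongrightarrow> 0" for c
    by (rule tendsto_mult_right_zero[OF LIMSEQ_power_zero]) simp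
  have lim: "(\<lambda>k. q2 (\<lambda>x. vs k x - h x)) \<longlonglongrightarrow> 0"
    by (rule tendsto_sandwich[OF _ _ tendsto_const geo[of 4]]) (auto intro!: always_eventually h(2) q2_nonneg)
  have iplim: "(\<lambda>k. ip (\<lambda>x. vs k x - h x) v) \<longlonglongrightarrow> 0" if v: "v \<in> L2" for v
  proof -
    have "(\<lambda>k. q2 (\<lambda>x. vs k x - h x) * q2 v) \<longlonglongrightarrow> 0" by (rule tendsto_mult_left_zero[OF lim])
    then have "(\<lambda>k. (cmod (ip (\<lambda>x. vs k x - h x) v))\<^sup>2) \<longlonglongrightarrow> 0"
      by (rule tendsto_sandwich[OF _ _ tendsto_const, rotated 2])
        (use Cauchy_Schwarz_L2[OF L2_diff[OF VL[OF vs(1)] h(1)] v] in auto)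
    then have "(\<lambda>k. sqrt ((cmod (ip (\<lambda>x. vs k x - h x) v))\<^sup>2)) \<longlonglongrightarrow> sqrt 0" by (intro tendsto_real_sqrt)
    then show ?thesis by (intro tendsto_norm_zero_cancel[where f = "\<lambda>k. ip (\<lambda>x. vs k x - h x) v"]) simp
  qed
  have rep: "L v = ip v h" if v: "v \<in> V" for v
  proof -
    define D where "D k = ip v (vs k) - L v" for k
    \<comment> \<open>Approximate first-order condition. Moving from \<open>vs k\<close> by a
      multiple of \<open>v\<close> cannot lower \<open>Q\<close> below \<open>m\<close>, and
      \<open>vs k\<close> is within \<open>(1/4) ^ k\<close> of it. The step size is close to the
      optimal one; the summand 1 in its denominator covers \<open>q2 v = 0\<close>.\<close>
    have "(cmod (D k))\<^sup>2 \<le> (q2 v + 1) * (1/4) ^ k" for k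
    proof -
      define s where "s = 1 / (q2 v + 1)"
      define t where "t = - complex_of_real s * cnj (D k)"
      have s: "s > 0" unfolding s_def using q2_nonneg[of v] by simp
      have tv: "(\<lambda>x. t * v x) \<in> V" by (rule Vs[OF v])
      have "m \<le> Q (\<lambda>x. vs k x + t * v x)" by (rule m[OF Va[OF vs(1) tv]])
      also have "\<dots> = Q (vs k) + (cmod t)\<^sup>2 * q2 v + 2 * Re (ip (vs k) (\<lambda>x. t * v x)) - 2 * Re (t * L v)"
        unfolding Q_def using q2_add[OF VL[OF vs(1)] VL[OF tv], of k] q2_scale[of t v] La[OF vs(1) tv, of k] Ls[OF v, of t] by simp
      also have "Re (ip (vs k) (\<lambda>x. t * v x)) = Re (t * ip v (vs k))"
        using ip_cnj[of "vs k" "\<lambda>x. t * v x"] ip_scale_left[of t v "vs k"] by simp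
      finally have "m \<le> Q (vs k) + (cmod t)\<^sup>2 * q2 v + 2 * Re (t * D k)"
        unfolding D_def by (simp only: right_diff_distrib minus_complex.simps)
      moreover have "t * D k = complex_of_real (- s * (cmod (D k))\<^sup>2)"
        unfolding t_def using complex_norm_square[of "D k"] by (simp add: ac_simps)
      then have "Re (t * D k) = - s * (cmod (D k))\<^sup>2" by (simp only: Re_complex_of_real)
      moreover have "(cmod t)\<^sup>2 * q2 v \<le> s * (cmod (D k))\<^sup>2"
      proof -
        have "cmod t = s * cmod (D k)" unfolding t_def using s by (simp add: norm_mult)
        then have "(cmod t)\<^sup>2 * q2 v = (s * q2 v) * (s * (cmod (D k))\<^sup>2)"
          by (simp add: power_mult_distrib power2_eq_square)
        also have "\<dots> \<le> 1 * (s * (cmod (D k))\<^sup>2)"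
          using q2_nonneg[of v] s by (intro mult_right_mono mult_nonneg_nonneg) (auto simp: s_def divide_simps)
        finally show ?thesis by simp
      qed
      ultimately have "s * (cmod (D k))\<^sup>2 \<le> (1/4) ^ k" using vs(2)[of k] by linarith
      then show ?thesis using q2_nonneg[of v] unfolding s_def by (simp add: field_simps)
    qed
    then have "(\<lambda>k. (cmod (D k))\<^sup>2) \<longlonglongrightarrow> 0"
      by (intro tendsto_sandwich[OF _ _ tendsto_const geo[of "q2 v + 1"]]) (auto intro!: always_eventually)
    then have "(\<lambda>k. sqrt ((cmod (D k))\<^sup>2)) \<longlonglongrightarrow> sqrt 0" by (intro tendsto_real_sqrt)
    then have "(\<lambda>k. ip v (vs k) - L v) \<longlonglongrightarrow> 0"
      unfolding D_def[symmetric] by (intro tendsto_norm_zero_cancel[of D]) simp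
    then have "(\<lambda>k. cnj (ip v (vs k) - L v)) \<longlonglongrightarrow> cnj 0" by (rule tendsto_cnj)
    moreover have "cnj (ip v (vs k) - L v) = ip (\<lambda>x. vs k x - h x) v + (ip h v - cnj (L v))" for k
      using ip_diff_left[OF VL[OF vs(1)] h(1) VL[OF v], of k] ip_cnj[of v "vs k"] by simp
    ultimately have A: "(\<lambda>k. ip (\<lambda>x. vs k x - h x) v + (ip h v - cnj (L v))) \<longlonglongrightarrow> 0" by (simp only: complex_cnj_zero)
    have "(\<lambda>k. ip (\<lambda>x. vs k x - h x) v + (ip h v - cnj (L v))) \<longlonglongrightarrow> 0 + (ip h v - cnj (L v))"
      by (intro tendsto_add tendsto_const iplim VL v)
    with A have "ip h v - cnj (L v) = 0" using LIMSEQ_unique by fastforce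
    then show "L v = ip v h" using ip_cnj[of v h] by simp
  qed
  \<comment> \<open>Although \<open>h\<close> need not lie in \<open>V\<close>, it is a limit of
    elements of \<open>V\<close>, so the bound on \<open>L\<close> passes to the limit with
    \<open>ip h h\<close> in place of \<open>L (vs k)\<close>.\<close>
  have "q2 h \<le> C"
  proof -
    have eq: "q2 (vs k) = q2 (\<lambda>x. vs k x - h x) + q2 h + 2 * Re (ip (\<lambda>x. vs k x - h x) h)" for k
      using q2_add[OF L2_diff[OF VL[OF vs(1)] h(1)] h(1), of k] by simp
    have "(\<lambda>k. q2 (\<lambda>x. vs k x - h x) + q2 h + 2 * Re (ip (\<lambda>x. vs k x - h x) h)) \<longlonglongrightarrow> 0 + q2 h + 2 * Re 0"
      by (intro tendsto_intros lim iplim h)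
    then have q: "(\<lambda>k. C * q2 (vs k)) \<longlonglongrightarrow> C * q2 h" unfolding eq[symmetric] by (intro tendsto_mult tendsto_const) simp
    have "(\<lambda>k. ip (\<lambda>x. vs k x - h x) h + ip h h) \<longlonglongrightarrow> 0 + ip h h" by (intro tendsto_intros iplim h)
    moreover have "ip (\<lambda>x. vs k x - h x) h + ip h h = L (vs k)" for k
      using ip_diff_left[OF VL[OF vs(1)] h(1) h(1), of k] rep[OF vs(1)] by simp
    ultimately have "(\<lambda>k. (cmod (L (vs k)))\<^sup>2) \<longlonglongrightarrow> (cmod (ip h h))\<^sup>2" by (intro tendsto_power tendsto_norm) simp
    then have "(cmod (ip h h))\<^sup>2 \<le> C * q2 h"
      using C(1)[OF vs(1)] by (intro LIMSEQ_le[OF _ q]) auto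
    then have "q2 h * q2 h \<le> C * q2 h" by (simp add: ip_self q2_nonneg power2_eq_square)
    then show ?thesis using q2_nonneg[of h] C(2) by (cases "q2 h = 0") (auto simp: mult_le_cancel_right)
  qed
  then show ?thesis using that[OF h(1) vs(1) lim rep] by blast
qed

section \<open>Testing against bump functions\<close>

text \<open>The common setting for L2 functions, continuous functions and densities of
  distributions. Boxes are used because the bump functions are supported in them and because they
  generate the Borel sets.\<close>

definition locint :: "((real^'n) \<Rightarrow> 'b::{banach, second_countable_topology}) \<Rightarrow> bool" where
  "locint g \<longleftrightarrow> (\<forall>a b. integrable lebesgue (\<lambda>x. indicator (box a b) x *\<^sub>R g x))"

lemma locint_measurable:
  fixes g :: "(real^'n) \<Rightarrow> 'b::{banach, second_countable_topology}"
  assumes "locint g" shows "g \<in> borel_measurable lebesgue"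
proof (rule borel_measurable_LIMSEQ_metric)
  let ?B = "\<lambda>k::nat. box (\<chi> i. - real k) (\<chi> i. real k) :: (real^'n) set"
  show "(\<lambda>x. indicator (?B k) x *\<^sub>R g x) \<in> borel_measurable lebesgue" for k
    by (rule borel_measurable_integrable[OF assms[unfolded locint_def, rule_format]])
  fix x :: "real^'n"
  obtain K :: nat where K: "norm x < real K" using reals_Archimedean2 by blast
  have "x \<in> ?B k" if "k \<ge> K" for k
  proof -
    have "\<bar>x $ i\<bar> < real k" for i using component_le_norm_cart[of x i] K that by linarith
    then show ?thesis by (auto simp: mem_box_cart abs_less_iff minus_less_iff)
  qed
  then have "\<forall>\<^sub>F k in sequentially. indicator (?B k) x *\<^sub>R g x = g x"
    unfolding eventually_sequentially by (intro exI[of _ K]) auto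
  then show "(\<lambda>k. indicator (?B k) x *\<^sub>R g x) \<longlonglongrightarrow> g x" by (rule tendsto_eventually)
qed

text \<open>The positive and negative parts are densities of two measures that agree, with finite
  values, on all boxes. Boxes form an intersection-stable generator, so the measures coincide, and
  densities are unique almost everywhere.\<close>

lemma AE_zero_of_box_integrals:
  fixes h :: "real^'n \<Rightarrow> real"
  assumes h: "locint h" and zero: "\<And>a b. (LINT x|lebesgue. indicator (box a b) x *\<^sub>R h x) = 0"
  shows "AE x in lebesgue. h x = 0"
proof -
  obtain h' where h'[measurable]: "h' \<in> borel_measurable lborel" and AE: "AE x in lborel. h x = h' x"
    using completion_ex_borel_measurable_real[OF locint_measurable[OF h]] by blast
  have AEl: "AE x in lebesgue. h x = h' x" using AE by (rule AE_completion)
  have int: "integrable lborel (\<lambda>x. indicator (box a b) x *\<^sub>R h' x)"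
    and int0: "(LINT x|lborel. indicator (box a b) x *\<^sub>R h' x) = 0" for a b
  proof -
    have hl: "h' \<in> borel_measurable lebesgue" using h' by (rule measurable_completion)
    have i: "integrable lebesgue (\<lambda>x. indicator (box a b) x *\<^sub>R h x)" using h unfolding locint_def by blast
    have "integrable lebesgue (\<lambda>x. indicator (box a b) x *\<^sub>R h' x)"
      by (rule integrable_cong_AE_imp[OF i borel_measurable_scaleR[OF box_indicator_measurable hl]]) (use AEl in auto)
    moreover have "(LINT x|lebesgue. indicator (box a b) x *\<^sub>R h' x) = (LINT x|lebesgue. indicator (box a b) x *\<^sub>R h x)"
      by (rule integral_cong_AE[OF borel_measurable_scaleR[OF box_indicator_measurable hl] borel_measurable_integrable[OF i]]) (use AEl in auto)
    ultimately show "integrable lborel (\<lambda>x. indicator (box a b) x *\<^sub>R h' x)"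
      "(LINT x|lborel. indicator (box a b) x *\<^sub>R h' x) = 0"
      using zero by (simp_all add: integrable_completion integral_completion)
  qed
  \<comment> \<open>Since \<open>ennreal\<close> sends negative reals to 0, these are the positive
    and the negative part.\<close>
  let ?p = "\<lambda>x. ennreal (h' x)" and ?n = "\<lambda>x. ennreal (- h' x)"
  have box: "emeasure (density lborel ?p) (box a b) = emeasure (density lborel ?n) (box a b)"
    "emeasure (density lborel ?p) (box a b) \<noteq> \<infinity>" for a b
  proof -
    let ?g = "\<lambda>x. indicator (box a b) x *\<^sub>R h' x"
    have P: "emeasure (density lborel ?p) (box a b) = (\<integral>\<^sup>+x. ennreal (?g x) \<partial>lborel)"
      and N: "emeasure (density lborel ?n) (box a b) = (\<integral>\<^sup>+x. ennreal (- ?g x) \<partial>lborel)"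
      by (subst emeasure_density, auto intro!: nn_integral_cong simp: indicator_def)+
    have fin: "(\<integral>\<^sup>+x. ennreal (?g x) \<partial>lborel) \<noteq> \<infinity>" "(\<integral>\<^sup>+x. ennreal (- ?g x) \<partial>lborel) \<noteq> \<infinity>"
      using int[of a b] unfolding real_integrable_def by auto
    have "enn2real (\<integral>\<^sup>+x. ennreal (?g x) \<partial>lborel) = enn2real (\<integral>\<^sup>+x. ennreal (- ?g x) \<partial>lborel)"
      using real_lebesgue_integral_def[OF int[of a b]] int0[of a b] by simp
    then have "ennreal (enn2real (\<integral>\<^sup>+x. ennreal (?g x) \<partial>lborel)) = ennreal (enn2real (\<integral>\<^sup>+x. ennreal (- ?g x) \<partial>lborel))"
      by (rule arg_cong)
    then show "emeasure (density lborel ?p) (box a b) = emeasure (density lborel ?n) (box a b)"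
      unfolding P N using fin by (simp only: ennreal_enn2real less_top infinity_ennreal_def)
    show "emeasure (density lborel ?p) (box a b) \<noteq> \<infinity>" unfolding P by (rule fin(1))
  qed
  have "density lborel ?p = density lborel ?n"
  proof (rule measure_eqI_generator_eq[where E = "range (\<lambda>(a, b). box a b)" and \<Omega> = UNIV
        and A = "\<lambda>n::nat. box (- (real n *\<^sub>R One)) (real n *\<^sub>R One)"])
    show "Int_stable (range (\<lambda>(a, b). box a b :: (real^'n) set))"
      by (auto simp: Int_stable_def box_Int_box)
    show "sets (density lborel ?p) = sigma_sets UNIV (range (\<lambda>(a, b). box a b))"
      "sets (density lborel ?n) = sigma_sets UNIV (range (\<lambda>(a, b). box a b))"
      by (simp_all add: borel_eq_box)
    show "(\<Union>n::nat. box (- (real n *\<^sub>R One)) (real n *\<^sub>R One) :: (real^'n) set) = UNIV"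
      using UN_box_eq_UNIV by blast
  qed (use box in auto)
  then have "AE x in lborel. ?p x = ?n x"
    by (subst (asm) sigma_finite_measure.density_unique_iff[OF sigma_finite_lborel]) auto
  then have "AE x in lborel. h' x = 0"
  proof eventually_elim
    fix x assume "?p x = ?n x"
    then show "h' x = 0" by (cases "h' x \<ge> 0") (auto simp: ennreal_neg)
  qed
  then have "AE x in lebesgue. h' x = 0" by (rule AE_completion)
  then show ?thesis using AEl by eventually_elim simp
qed

text \<open>As \<open>k\<close> grows, the bumps converge boundedly to the indicator of the box, so
  all box integrals vanish too; real and imaginary parts are then treated separately.\<close>

lemma AE_zero_of_bump_integrals:
  fixes g :: "real^'n \<Rightarrow> complex"
  assumes g: "locint g"
    and zero: "\<And>k a b. k > 0 \<Longrightarrow> (LINT x|lebesgue. g x * complex_of_real (bump k a b x)) = 0"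
  shows "AE x in lebesgue. g x = 0"
proof -
  note [measurable] = locint_measurable[OF g]
  have box0: "(LINT x|lebesgue. indicator (box a b) x *\<^sub>R g x) = 0" for a b
  proof -
    have "(\<lambda>k. LINT x|lebesgue. g x * complex_of_real (bump (real (Suc k)) a b x))
        \<longlonglongrightarrow> (LINT x|lebesgue. g x * complex_of_real (indicator (box a b) x))"
    proof (rule integral_dominated_convergence[where w = "\<lambda>x. cmod (indicator (box a b) x *\<^sub>R g x)"])
      show "integrable lebesgue (\<lambda>x. cmod (indicator (box a b) x *\<^sub>R g x))"
        using g unfolding locint_def by (intro integrable_norm) blast
      show "AE x in lebesgue. (\<lambda>k. g x * complex_of_real (bump (real (Suc k)) a b x)) \<longlonglongrightarrow> g x * complex_of_real (indicator (box a b) x)"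
        by (intro always_eventually allI tendsto_mult tendsto_const tendsto_of_real bump_tendsto)
      fix k
      have bm: "(\<lambda>x. complex_of_real (bump (real (Suc k)) a b x)) \<in> borel_measurable lebesgue"
        by (rule schwartz_measurable[OF schwartz_bump]) simp
      then show "(\<lambda>x. g x * complex_of_real (bump (real (Suc k)) a b x)) \<in> borel_measurable lebesgue"
        by (intro borel_measurable_times) auto
      have "cmod (g x * complex_of_real (bump (real (Suc k)) a b x)) \<le> cmod (indicator (box a b) x *\<^sub>R g x)" for x
      proof (cases "x \<in> box a b")
        case True
        then show ?thesis using bump_bounds[of "real (Suc k)" a b x]
          by (simp add: norm_mult abs_of_nonneg mult_left_le del: of_nat_Suc)
      next
        case False
        then have "bump (real (Suc k)) a b x = 0" by (intro bump_support) auto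
        then show ?thesis by simp
      qed
      then show "AE x in lebesgue. cmod (g x * complex_of_real (bump (real (Suc k)) a b x)) \<le> cmod (indicator (box a b) x *\<^sub>R g x)"
        by blast
    qed (intro borel_measurable_times locint_measurable[OF g] box_indicator_measurable_complex)
    moreover have "(LINT x|lebesgue. g x * complex_of_real (bump (real (Suc k)) a b x)) = 0" for k
      by (rule zero) simp
    ultimately have "(LINT x|lebesgue. g x * complex_of_real (indicator (box a b) x)) = 0"
      by (simp add: LIMSEQ_const_iff)
    then show ?thesis by (simp add: scaleR_conv_of_real mult.commute)
  qed
  have gi: "integrable lebesgue (\<lambda>x. indicator (box a b) x *\<^sub>R g x)" for a b using g unfolding locint_def by blast
  have "AE x in lebesgue. Re (g x) = 0"
  proof (rule AE_zero_of_box_integrals)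
    show "locint (\<lambda>x. Re (g x))" unfolding locint_def using integrable_Re[OF gi] by simp
    show "(LINT x|lebesgue. indicator (box a b) x *\<^sub>R Re (g x)) = 0" for a b
      using integral_Re[OF gi, of a b] box0[of a b] by simp
  qed
  moreover have "AE x in lebesgue. Im (g x) = 0"
  proof (rule AE_zero_of_box_integrals)
    show "locint (\<lambda>x. Im (g x))" unfolding locint_def using integrable_Im[OF gi] by simp
    show "(LINT x|lebesgue. indicator (box a b) x *\<^sub>R Im (g x)) = 0" for a b
      using integral_Im[OF gi, of a b] box0[of a b] by simp
  qed
  ultimately show ?thesis by eventually_elim (simp add: complex_eq_iff)
qed

lemma AE_eq_of_bump_integrals:
  fixes f g :: "real^'n \<Rightarrow> complex"
  assumes f: "locint f" and g: "locint g"
    and eq: "\<And>\<psi>. schwartz \<psi> \<Longrightarrow> (LINT x|lebesgue. f x * \<psi> x) = (LINT x|lebesgue. g x * \<psi> x)"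
  shows "AE x in lebesgue. f x = g x"
proof -
  have d: "locint (\<lambda>x. f x - g x)" using f g unfolding locint_def by (simp add: scaleR_diff_right)
  have "AE x in lebesgue. f x - g x = 0"
  proof (rule AE_zero_of_bump_integrals[OF d])
    fix k :: real and a b :: "real^'n" assume k: "k > 0"
    let ?\<psi> = "\<lambda>x. complex_of_real (bump k a b x)"
    have s: "schwartz ?\<psi>" by (rule schwartz_bump[OF k])
    have i: "integrable lebesgue (\<lambda>x. u x * ?\<psi> x)" if u: "locint u" for u :: "real^'n \<Rightarrow> complex"
    proof (rule Bochner_Integration.integrable_bound)
      show "integrable lebesgue (\<lambda>x. indicator (box a b) x *\<^sub>R u x)" using u unfolding locint_def by blast
      show "(\<lambda>x. u x * ?\<psi> x) \<in> borel_measurable lebesgue"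
        by (intro borel_measurable_times locint_measurable[OF u] schwartz_measurable(1)[OF s])
      have "cmod (u x * ?\<psi> x) \<le> cmod (indicator (box a b) x *\<^sub>R u x)" for x
        using bump_bounds[of k a b x] bump_support[OF k, of x a b]
        by (cases "x \<in> box a b") (auto simp: norm_mult abs_of_nonneg mult_left_le)
      then show "AE x in lebesgue. norm (u x * ?\<psi> x) \<le> norm (indicator (box a b) x *\<^sub>R u x)" by blast
    qed
    show "(LINT x|lebesgue. (f x - g x) * ?\<psi> x) = 0"
      using i[OF f] i[OF g] eq[OF s] by (simp add: left_diff_distrib)
  qed
  then show ?thesis by simp
qed

lemma locint_L2:
  assumes "g \<in> L2" shows "locint g"
  unfolding locint_def
proof (intro allI)
  fix a b :: "real^'a"
  have "(\<lambda>x. complex_of_real (indicator (box a b) x)) \<in> L2"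
  proof -
    have "(\<lambda>x. (cmod (complex_of_real (indicator (box a b) x)))\<^sup>2) = indicator (box a b)" by (auto simp: indicator_def)
    then show ?thesis unfolding L2_def using box_indicator_integrable[of a b] box_indicator_measurable_complex[of a b]
      by simp
  qed
  from L2_mult_integrable[OF this assms]
  show "integrable lebesgue (\<lambda>x. indicator (box a b) x *\<^sub>R g x)" by (simp add: scaleR_conv_of_real)
qed

lemma locint_continuous:
  fixes g :: "real^'n \<Rightarrow> complex"
  assumes g: "continuous_on UNIV g" shows "locint g"
  unfolding locint_def
proof (intro allI)
  fix a b :: "real^'n"
  have "bounded (g ` cbox a b)"
    by (intro compact_imp_bounded compact_continuous_image continuous_on_subset[OF g]) auto
  then obtain B where B: "\<And>x. x \<in> cbox a b \<Longrightarrow> cmod (g x) \<le> B" unfolding bounded_iff by auto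
  show "integrable lebesgue (\<lambda>x. indicator (box a b) x *\<^sub>R g x)"
  proof (rule Bochner_Integration.integrable_bound)
    show "integrable lebesgue (\<lambda>x. B * indicator (box a b) x :: real)" by (intro integrable_mult_right box_indicator_integrable)
    show "(\<lambda>x. indicator (box a b) x *\<^sub>R g x) \<in> borel_measurable lebesgue"
      by (intro borel_measurable_scaleR box_indicator_measurable continuous_imp_lebesgue_measurable g)
    show "AE x in lebesgue. norm (indicator (box a b) x *\<^sub>R g x) \<le> norm (B * indicator (box a b) x :: real)"
    proof (intro always_eventually allI)
      fix x show "norm (indicator (box a b) x *\<^sub>R g x) \<le> norm (B * indicator (box a b) x :: real)"
      proof (cases "x \<in> box a b")
        case True
        then have "cmod (g x) \<le> B" using B box_subset_cbox by blast
        then show ?thesis using True by simp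
      qed simp
    qed
  qed
qed

section \<open>The Fourier transform on square integrable functions\<close>

abbreviation cF :: "'n itself \<Rightarrow> real" where "cF _ \<equiv> (2 * pi) ^ CARD('n)"

text \<open>A duality characterisation of the Plancherel transform, which avoids the choice operator in the
  definitions of \<open>FT2\<close> and \<open>IFT2\<close>.\<close>

definition wFT :: "((real^'n) \<Rightarrow> complex) \<Rightarrow> ((real^'n) \<Rightarrow> complex) \<Rightarrow> bool" where
  "wFT f g \<longleftrightarrow> f \<in> L2 \<and> g \<in> L2 \<and>
     (\<forall>\<psi>. schwartz \<psi> \<longrightarrow> (LINT x|lebesgue. g x * \<psi> x) = (LINT x|lebesgue. f x * FT \<psi> x))"

lemma wFTD:
  assumes "wFT f g"
  shows "f \<in> L2" "g \<in> L2" "schwartz \<psi> \<Longrightarrow> (LINT x|lebesgue. g x * \<psi> x) = (LINT x|lebesgue. f x * FT \<psi> x)"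
  using assms unfolding wFT_def by auto

lemma q2_zero_AE: assumes "f \<in> L2" "q2 f = 0" shows "AE x in lebesgue. f x = 0"
proof -
  have "AE x in lebesgue. (cmod (f x))\<^sup>2 = 0"
    using assms integral_nonneg_eq_0_iff_AE[of lebesgue "\<lambda>x. (cmod (f x))\<^sup>2"] unfolding L2_def q2_def by auto
  then show ?thesis by eventually_elim simp
qed

text \<open>A squared form of the triangle inequality, sufficient for the uniqueness of L2
  limits.\<close>

lemma q2_diff_le:
  assumes "f \<in> L2" "g \<in> L2" "h \<in> L2"
  shows "q2 (\<lambda>x. f x - g x) \<le> 2 * q2 (\<lambda>x. h x - f x) + 2 * q2 (\<lambda>x. h x - g x)"
proof -
  have i: "integrable lebesgue (\<lambda>x. (cmod (u x - v x))\<^sup>2)" if "u \<in> L2" "v \<in> L2" for u v :: "(real^'a) \<Rightarrow> complex"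
    using L2_diff[OF that] unfolding L2_def by auto
  have "q2 (\<lambda>x. f x - g x) \<le> (LINT x|lebesgue. 2 * (cmod (h x - f x))\<^sup>2 + 2 * (cmod (h x - g x))\<^sup>2)"
    unfolding q2_def
  proof (rule integral_mono)
    fix x
    have "cmod (f x - g x) \<le> cmod (h x - f x) + cmod (h x - g x)"
      using norm_triangle_ineq4[of "h x - g x" "h x - f x"] by simp
    then have "(cmod (f x - g x))\<^sup>2 \<le> (cmod (h x - f x) + cmod (h x - g x))\<^sup>2" by (intro power_mono) auto
    then show "(cmod (f x - g x))\<^sup>2 \<le> 2 * (cmod (h x - f x))\<^sup>2 + 2 * (cmod (h x - g x))\<^sup>2"
      using sum_squares_bound[of "cmod (h x - f x)" "cmod (h x - g x)"] by (simp add: power2_sum)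
  qed (use i[OF assms(1,2)] i[OF assms(3,1)] i[OF assms(3,2)] in auto)
  also have "\<dots> = 2 * q2 (\<lambda>x. h x - f x) + 2 * q2 (\<lambda>x. h x - g x)"
    unfolding q2_def using i[OF assms(3,1)] i[OF assms(3,2)] by simp
  finally show ?thesis .
qed

lemma q2_FT_schwartz: "schwartz \<psi> \<Longrightarrow> q2 (FT \<psi>) = cF TYPE('n) * q2 \<psi>" for \<psi> :: "(real^'n) \<Rightarrow> complex"
proof -
  assume "schwartz \<psi>"
  from parseval_schwartz[OF this] have "ip (FT \<psi>) (FT \<psi>) = complex_of_real (cF TYPE('n)) * ip \<psi> \<psi>"
    unfolding ip_def .
  then have "complex_of_real (q2 (FT \<psi>)) = complex_of_real (cF TYPE('n) * q2 \<psi>)" unfolding ip_self by simp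
  then show ?thesis by (simp only: of_real_eq_iff)
qed

lemma wFT_unique:
  assumes "wFT f g" "wFT f g'" shows "AE x in lebesgue. g x = g' x"
  by (rule AE_eq_of_bump_integrals)
     (use assms in \<open>auto simp: wFT_def intro: locint_L2\<close>)

lemma wFT_inverse:
  assumes "wFT f g" "schwartz \<psi>"
  shows "(LINT x|lebesgue. f x * \<psi> x) = (LINT x|lebesgue. g x * IFT \<psi> x)"
  using wFTD(3)[OF assms(1) schwartz_IFT[OF assms(2)]] FT_IFT[OF assms(2)] by simp

lemma wFT_inj:
  assumes "wFT f g" "wFT f' g" shows "AE x in lebesgue. f x = f' x"
proof (rule AE_eq_of_bump_integrals)
  show "locint f" "locint f'" by (intro locint_L2 wFTD(1)[OF assms(1)] wFTD(1)[OF assms(2)])+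
  show "(LINT x|lebesgue. f x * \<psi> x) = (LINT x|lebesgue. f' x * \<psi> x)" if "schwartz \<psi>" for \<psi>
    unfolding wFT_inverse[OF assms(1) that] wFT_inverse[OF assms(2) that] ..
qed

lemma wFT_cong:
  assumes w: "wFT f g" and m: "f' \<in> borel_measurable lebesgue" "g' \<in> borel_measurable lebesgue"
    and ae: "AE x in lebesgue. f x = f' x" "AE x in lebesgue. g x = g' x"
  shows "wFT f' g'"
  unfolding wFT_def
proof (intro conjI allI impI)
  show f': "f' \<in> L2" by (rule L2_cong_AE[OF wFTD(1)[OF w] m(1) ae(1)])
  show g': "g' \<in> L2" by (rule L2_cong_AE[OF wFTD(2)[OF w] m(2) ae(2)])
  fix \<psi> :: "(real^'a) \<Rightarrow> complex" assume s: "schwartz \<psi>"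
  have "(LINT x|lebesgue. g x * \<psi> x) = (LINT x|lebesgue. g' x * \<psi> x)"
    by (rule integral_cong_AE)
       (use ae(2) in \<open>auto intro!: borel_measurable_times L2_measurable[OF wFTD(2)[OF w]] m schwartz_measurable(1)[OF s]\<close>)
  moreover have "(LINT x|lebesgue. f x * FT \<psi> x) = (LINT x|lebesgue. f' x * FT \<psi> x)"
    by (rule integral_cong_AE)
       (use ae(1) in \<open>auto intro!: borel_measurable_times L2_measurable[OF wFTD(1)[OF w]] m schwartz_measurable(1)[OF schwartz_FT[OF s]]\<close>)
  ultimately show "(LINT x|lebesgue. g' x * \<psi> x) = (LINT x|lebesgue. f' x * FT \<psi> x)"
    using wFTD(3)[OF w s] by simp
qed

text \<open>Plancherel for Schwartz functions makes
  \<open>\<psi> \<mapsto> \<integral> f FT \<psi>\<close> bounded in the L2 norm of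
  \<open>\<psi>\<close>, and Riesz supplies its representative. The conjugate appears because
  \<open>ip\<close> is conjugate linear in its second argument.\<close>

lemma wFT_exists:
  fixes f :: "(real^'n) \<Rightarrow> complex"
  assumes f: "f \<in> L2" shows "\<exists>g. wFT f g \<and> q2 g \<le> cF TYPE('n) * q2 f"
proof -
  let ?V = "{\<psi> :: (real^'n) \<Rightarrow> complex. schwartz \<psi>}"
  let ?L = "\<lambda>\<psi>. LINT x|lebesgue. f x * FT \<psi> x"
  have i: "integrable lebesgue (\<lambda>x. f x * FT \<psi> x)" if "schwartz \<psi>" for \<psi>
    by (rule L2_mult_integrable[OF f L2_schwartz[OF schwartz_FT[OF that]]])
  have "\<exists>h. h \<in> L2 \<and> (\<forall>\<psi>\<in>?V. ?L \<psi> = ip \<psi> h) \<and> q2 h \<le> cF TYPE('n) * q2 f"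
  proof (rule riesz_L2[of ?V ?L "cF TYPE('n) * q2 f"])
    show "?V \<subseteq> L2" using L2_schwartz by auto
    show "?V \<noteq> {}" using schwartz_gauss by blast
    fix u v :: "(real^'n) \<Rightarrow> complex" and c assume uv: "v \<in> ?V"
    then have v: "schwartz v" by simp
    show "(\<lambda>x. c * v x) \<in> ?V" using v by (simp add: schwartz_scale)
    have "f x * FT (\<lambda>x. c * v x) x = c * (f x * FT v x)" for x by (simp add: FT_scale)
    then show "?L (\<lambda>x. c * v x) = c * ?L v" by (simp only: integral_mult_right_zero)
    have "ip f (\<lambda>x. cnj (FT v x)) = ?L v" unfolding ip_def by simp
    then show "(cmod (?L v))\<^sup>2 \<le> cF TYPE('n) * q2 f * q2 v"
      using Cauchy_Schwarz_L2[OF f L2_cnj[OF L2_schwartz[OF schwartz_FT[OF v]]]] q2_FT_schwartz[OF v]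
      by (simp add: q2_cnj ac_simps)
    assume "u \<in> ?V"
    then have u: "schwartz u" by simp
    show "(\<lambda>x. u x + v x) \<in> ?V" using u v by (simp add: schwartz_add)
    have "f x * FT (\<lambda>x. u x + v x) x = f x * FT u x + f x * FT v x" for x
      using FT_add[OF schwartz_integrable[OF u] schwartz_integrable[OF v]] by (simp add: distrib_left)
    then show "?L (\<lambda>x. u x + v x) = ?L u + ?L v" using i[OF u] i[OF v] by simp
  next
    show "0 \<le> cF TYPE('n) * q2 f" using q2_nonneg[of f] by simp
  next
    fix h and vs :: "nat \<Rightarrow> (real^'n) \<Rightarrow> complex"
    assume "h \<in> L2" "\<And>v. v \<in> ?V \<Longrightarrow> ?L v = ip v h" "q2 h \<le> cF TYPE('n) * q2 f"
    then show "\<exists>h. h \<in> L2 \<and> (\<forall>\<psi>\<in>?V. ?L \<psi> = ip \<psi> h) \<and> q2 h \<le> cF TYPE('n) * q2 f" by (intro exI[of _ h]) auto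
  qed
  then obtain h where h: "h \<in> L2" "\<And>\<psi>. schwartz \<psi> \<Longrightarrow> ?L \<psi> = ip \<psi> h" "q2 h \<le> cF TYPE('n) * q2 f" by auto
  have "wFT f (\<lambda>x. cnj (h x))"
    unfolding wFT_def using f L2_cnj[OF h(1)] h(2) by (simp add: ip_def mult.commute)
  then show ?thesis using h(3) q2_cnj[of h] by auto
qed

lemma wFT_q2:
  fixes f :: "(real^'n) \<Rightarrow> complex"
  assumes "wFT f g" shows "q2 g \<le> cF TYPE('n) * q2 f"
proof -
  obtain g' where g': "wFT f g'" "q2 g' \<le> cF TYPE('n) * q2 f" using wFT_exists[OF wFTD(1)[OF assms]] by blast
  then have "q2 g = q2 g'"
    using L2_cong_AE(2)[OF wFTD(2)[OF g'(1)] L2_measurable[OF wFTD(2)[OF assms]] wFT_unique[OF g'(1) assms]] by simp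
  then show ?thesis using g'(2) by simp
qed

lemma wFT_diff:
  assumes "wFT f g" "wFT f' g'" shows "wFT (\<lambda>x. f x - f' x) (\<lambda>x. g x - g' x)"
  unfolding wFT_def
proof (intro conjI allI impI)
  note a = wFTD[OF assms(1)] and b = wFTD[OF assms(2)]
  show "(\<lambda>x. f x - f' x) \<in> L2" "(\<lambda>x. g x - g' x) \<in> L2" by (intro L2_diff a b)+
  fix \<psi> :: "(real^'a) \<Rightarrow> complex" assume s: "schwartz \<psi>"
  note s2 = L2_schwartz[OF s] and F2 = L2_schwartz[OF schwartz_FT[OF s]]
  show "(LINT x|lebesgue. (g x - g' x) * \<psi> x) = (LINT x|lebesgue. (f x - f' x) * FT \<psi> x)"
    unfolding left_diff_distrib
    using a(3)[OF s] b(3)[OF s] L2_mult_integrable[OF a(1) F2] L2_mult_integrable[OF b(1) F2]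
      L2_mult_integrable[OF a(2) s2] L2_mult_integrable[OF b(2) s2] by simp
qed

text \<open>By the multiplication formula the integral transform passes the same tests as the weak
  one, and both are locally integrable.\<close>

lemma wFT_FT:
  assumes f: "f \<in> L2" and i: "integrable lebesgue f" shows "wFT f (FT f)"
proof -
  obtain g where g: "wFT f g" using wFT_exists[OF f] by blast
  have "AE x in lebesgue. g x = FT f x"
  proof (rule AE_eq_of_bump_integrals)
    show "locint g" by (rule locint_L2[OF wFTD(2)[OF g]])
    show "locint (FT f)" by (rule locint_continuous[OF FT_continuous[OF i]])
    show "(LINT x|lebesgue. g x * \<psi> x) = (LINT x|lebesgue. FT f x * \<psi> x)" if "schwartz \<psi>" for \<psi>
      using wFTD(3)[OF g that] FT_multiplication[OF i schwartz_integrable[OF that]] by simp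
  qed
  then show ?thesis
    using wFT_cong[OF g L2_measurable[OF f] FT_measurable[OF i]] by auto
qed

lemma L2_reflect: assumes "f \<in> L2" shows "(\<lambda>x. f (- x)) \<in> L2"
  using borel_measurable_reflect_lebesgue[of f] integrable_reflect_lebesgue[of "\<lambda>x. (cmod (f x))\<^sup>2"] assms
  unfolding L2_def by auto

lemma q2_reflect: assumes "f \<in> L2" shows "q2 (\<lambda>x. f (- x)) = q2 f"
proof -
  have "(\<lambda>x. (cmod (f x))\<^sup>2) \<in> borel_measurable lebesgue" using L2_measurable[OF assms] by measurable
  from integral_reflect_lebesgue[OF this] show ?thesis unfolding q2_def by simp
qed

text \<open>The map \<open>J\<close> becomes plain conjugation on the Fourier side. This is why
  \<open>J T J\<close> has the conjugate symbol.\<close>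

lemma wFT_reflect_cnj:
  assumes w: "wFT f g" shows "wFT (\<lambda>x. cnj (f (- x))) (\<lambda>\<xi>. cnj (g \<xi>))"
  unfolding wFT_def
proof (intro conjI allI impI)
  show "(\<lambda>x. cnj (f (- x))) \<in> L2" "(\<lambda>\<xi>. cnj (g \<xi>)) \<in> L2" by (intro L2_cnj L2_reflect wFTD[OF w])+
  fix \<psi> :: "(real^'a) \<Rightarrow> complex" assume s: "schwartz \<psi>"
  have "(LINT x|lebesgue. cnj (g x) * \<psi> x) = (LINT x|lebesgue. cnj (g x * cnj (\<psi> x)))" by simp
  also have "\<dots> = cnj (LINT x|lebesgue. g x * cnj (\<psi> x))" by (rule Bochner_Integration.integral_cnj)
  also have "\<dots> = cnj (LINT x|lebesgue. f x * cnj (FT \<psi> (- x)))"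
    using wFTD(3)[OF w schwartz_cnj[OF s]] by (simp add: FT_cnj)
  also have "\<dots> = (LINT x|lebesgue. cnj (f x * cnj (FT \<psi> (- x))))" by (rule Bochner_Integration.integral_cnj[symmetric])
  also have "\<dots> = (LINT x|lebesgue. cnj (f x) * FT \<psi> (- x))" by simp
  also have "\<dots> = (LINT x|lebesgue. cnj (f (- x)) * FT \<psi> x)"
  proof -
    have "(\<lambda>x. cnj (f (- x)) * FT \<psi> x) \<in> borel_measurable lebesgue"
      by (intro borel_measurable_times borel_measurable_cnj L2_measurable[OF L2_reflect[OF wFTD(1)[OF w]]]
          schwartz_measurable(1)[OF schwartz_FT[OF s]])
    from integral_reflect_lebesgue[OF this] show ?thesis by simp
  qed
  finally show "(LINT x|lebesgue. cnj (g x) * \<psi> x) = (LINT x|lebesgue. cnj (f (- x)) * FT \<psi> x)" .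
qed

text \<open>The choice operator picks some limit; limits in L2 agree almost everywhere, so any limit
  that can be exhibited describes the chosen one.\<close>

lemma SOME_L2_limit:
  fixes F :: "nat \<Rightarrow> (real^'n) \<Rightarrow> complex"
  assumes F: "\<And>k. F k \<in> L2" and g: "g \<in> L2" and lim: "(\<lambda>k. q2 (\<lambda>x. F k x - g x)) \<longlonglongrightarrow> 0"
  defines "G \<equiv> SOME g. g \<in> L2 \<and> (\<lambda>k. \<integral>\<^sup>+\<xi>. ennreal ((cmod (F k \<xi> - g \<xi>))\<^sup>2) \<partial>lebesgue) \<longlonglongrightarrow> 0"
  shows "G \<in> L2" "AE x in lebesgue. g x = G x"
proof -
  have N: "(\<integral>\<^sup>+\<xi>. ennreal ((cmod (F k \<xi> - u \<xi>))\<^sup>2) \<partial>lebesgue) = ennreal (q2 (\<lambda>x. F k x - u x))" if "u \<in> L2" for u k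
    using N2_eq[OF L2_diff[OF F that]] unfolding N2_def .
  have "g \<in> L2 \<and> (\<lambda>k. \<integral>\<^sup>+\<xi>. ennreal ((cmod (F k \<xi> - g \<xi>))\<^sup>2) \<partial>lebesgue) \<longlonglongrightarrow> 0"
    unfolding N[OF g] using g tendsto_ennrealI[OF lim] by simp
  then have "G \<in> L2 \<and> (\<lambda>k. \<integral>\<^sup>+\<xi>. ennreal ((cmod (F k \<xi> - G \<xi>))\<^sup>2) \<partial>lebesgue) \<longlonglongrightarrow> 0"
    unfolding G_def by (rule someI[where P = "\<lambda>g. g \<in> L2 \<and> (\<lambda>k. \<integral>\<^sup>+\<xi>. ennreal ((cmod (F k \<xi> - g \<xi>))\<^sup>2) \<partial>lebesgue) \<longlonglongrightarrow> 0"])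
  then have G: "G \<in> L2" and lG: "(\<lambda>k. \<integral>\<^sup>+\<xi>. ennreal ((cmod (F k \<xi> - G \<xi>))\<^sup>2) \<partial>lebesgue) \<longlonglongrightarrow> 0" by blast+
  have "(\<lambda>k. ennreal (q2 (\<lambda>x. F k x - G x))) \<longlonglongrightarrow> ennreal 0" using lG unfolding N[OF G] by simp
  then have limG: "(\<lambda>k. q2 (\<lambda>x. F k x - G x)) \<longlonglongrightarrow> 0"
    by (subst (asm) tendsto_ennreal_iff) (auto intro!: always_eventually q2_nonneg)
  show "G \<in> L2" by (rule G)
  have "(\<lambda>k. 2 * q2 (\<lambda>x. F k x - g x) + 2 * q2 (\<lambda>x. F k x - G x)) \<longlonglongrightarrow> 2 * 0 + 2 * 0"
    by (intro tendsto_intros lim limG)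
  then have "q2 (\<lambda>x. g x - G x) \<le> 2 * 0 + 2 * 0"
    by (rule LIMSEQ_le_const) (use q2_diff_le[OF g G F] in blast)
  then have "q2 (\<lambda>x. g x - G x) = 0" using q2_nonneg[of "\<lambda>x. g x - G x"] by simp
  from q2_zero_AE[OF L2_diff[OF g G] this] show "AE x in lebesgue. g x = G x" by simp
qed

lemma L2_truncation:
  fixes u :: "(real^'n) \<Rightarrow> complex"
  assumes u: "u \<in> L2"
  defines "t \<equiv> \<lambda>k y. indicator (ball 0 (real k)) y * u y"
  shows "t k \<in> L2" "integrable lebesgue (t k)" "(\<lambda>k. q2 (\<lambda>x. t k x - u x)) \<longlonglongrightarrow> 0"
proof -
  have i2: "integrable lebesgue (\<lambda>x. (cmod (u x))\<^sup>2)" using u unfolding L2_def by simp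
  have ib: "integrable lebesgue (indicator (ball 0 (real k)) :: real^'n \<Rightarrow> real)" for k
    using lmeasurable_ball lmeasurable_iff_integrable by blast
  have ic: "(\<lambda>x. indicator (ball 0 (real k)) x :: complex) = (\<lambda>x::real^'n. complex_of_real (indicator (ball 0 (real k)) x))" for k
    by (auto simp: indicator_def)
  have im: "(\<lambda>x::real^'n. indicator (ball 0 (real k)) x :: complex) \<in> borel_measurable lebesgue" for k
    unfolding ic by (rule borel_measurable_continuous_on[OF continuous_on_of_real[OF continuous_on_id] borel_measurable_integrable[OF ib]])
  have i2i: "(\<lambda>x::real^'n. indicator (ball 0 (real k)) x :: complex) \<in> L2" for k
  proof -
    have "(\<lambda>x::real^'n. (cmod (indicator (ball 0 (real k)) x))\<^sup>2) = indicator (ball 0 (real k))" by (auto simp: indicator_def)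
    then show ?thesis unfolding L2_def using im[of k] ib[of k] by simp
  qed
  have tm: "t k \<in> borel_measurable lebesgue" for k unfolding t_def using im u L2_measurable by (intro borel_measurable_times) auto
  show t: "t k \<in> L2" for k
    unfolding L2_def
  proof safe
    show "integrable lebesgue (\<lambda>x. (cmod (t k x))\<^sup>2)"
    proof (rule Bochner_Integration.integrable_bound[OF i2])
      show "(\<lambda>x. (cmod (t k x))\<^sup>2) \<in> borel_measurable lebesgue" using tm[of k] by measurable
    qed (auto simp: t_def indicator_def)
  qed (rule tm)
  show "integrable lebesgue (t k)" unfolding t_def by (rule L2_mult_integrable[OF i2i u])
  have "(\<lambda>k. LINT x|lebesgue. (cmod (t k x - u x))\<^sup>2) \<longlonglongrightarrow> (LINT x|(lebesgue :: (real^'n) measure). 0)"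
  proof (rule integral_dominated_convergence[OF _ _ i2])
    show "(\<lambda>x. (cmod (t k x - u x))\<^sup>2) \<in> borel_measurable lebesgue" for k
    proof -
      note [measurable] = tm[of k] L2_measurable[OF u]
      show ?thesis by measurable
    qed
    show "AE x in lebesgue. (\<lambda>k. (cmod (t k x - u x))\<^sup>2) \<longlonglongrightarrow> 0"
    proof (intro always_eventually allI)
      fix x :: "real^'n"
      obtain K :: nat where "norm x < real K" using reals_Archimedean2 by blast
      then have "\<forall>k\<ge>K. (cmod (t k x - u x))\<^sup>2 = 0" by (auto simp: t_def indicator_def)
      then show "(\<lambda>k. (cmod (t k x - u x))\<^sup>2) \<longlonglongrightarrow> 0"
        by (intro tendsto_eventually) (auto simp: eventually_sequentially)
    qed
    show "AE x in lebesgue. norm ((cmod (t k x - u x))\<^sup>2) \<le> (cmod (u x))\<^sup>2" for k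
      by (auto simp: t_def indicator_def)
  qed simp
  then show "(\<lambda>k. q2 (\<lambda>x. t k x - u x)) \<longlonglongrightarrow> 0" unfolding q2_def by simp
qed

lemma q2_FT_truncation:
  fixes u :: "(real^'n) \<Rightarrow> complex"
  assumes u: "u \<in> L2" and g: "wFT u g"
  shows "(\<lambda>k. q2 (\<lambda>\<xi>. FT (\<lambda>y. indicator (ball 0 (real k)) y * u y) \<xi> - g \<xi>)) \<longlonglongrightarrow> 0"
proof (rule tendsto_sandwich[OF _ _ tendsto_const])
  let ?t = "\<lambda>k y. indicator (ball 0 (real k)) y * u y"
  show "(\<lambda>k. cF TYPE('n) * q2 (\<lambda>x. ?t k x - u x)) \<longlonglongrightarrow> 0"
    by (rule tendsto_mult_right_zero[OF L2_truncation(3)[OF u]])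
  have "wFT (\<lambda>x. ?t k x - u x) (\<lambda>\<xi>. FT (?t k) \<xi> - g \<xi>)" for k
    by (rule wFT_diff[OF wFT_FT[OF L2_truncation(1,2)[OF u]] g])
  from wFT_q2[OF this]
  show "\<forall>\<^sub>F k in sequentially. q2 (\<lambda>\<xi>. FT (?t k) \<xi> - g \<xi>) \<le> cF TYPE('n) * q2 (\<lambda>x. ?t k x - u x)"
    by (intro always_eventually allI)
qed (auto intro!: always_eventually q2_nonneg)

lemma FT2_wFT:
  assumes u: "u \<in> L2" shows "wFT u (FT2 u)"
proof -
  obtain g where g: "wFT u g" using wFT_exists[OF u] by blast
  note L = SOME_L2_limit[OF wFTD(2)[OF wFT_FT[OF L2_truncation(1,2)[OF u]]] wFTD(2)[OF g] q2_FT_truncation[OF u g], folded FT2_def]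
  show ?thesis by (rule wFT_cong[OF g L2_measurable[OF u] L2_measurable[OF L(1)] _ L(2)]) simp
qed

text \<open>Up to a constant, the inverse transform is the reflected forward transform. Stating that
  \<open>v\<close> is the weak transform of \<open>IFT2 v\<close> makes \<open>wFT\<close> the only
  relation needed for both directions.\<close>

lemma IFT2_wFT:
  fixes v :: "(real^'n) \<Rightarrow> complex"
  assumes v: "v \<in> L2" shows "wFT (IFT2 v) v"
proof -
  obtain g where g: "wFT v g" using wFT_exists[OF v] by blast
  let ?c = "complex_of_real (1 / (2 * pi) ^ CARD('n))"
  let ?t = "\<lambda>k y. indicator (ball 0 (real k)) y * v y"
  define w where "w x = ?c * g (- x)" for x
  have w2: "w \<in> L2" unfolding w_def by (intro L2_scale L2_reflect wFTD[OF g])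
  have F2: "FT (?t k) \<in> L2" for k by (rule wFTD(2)[OF wFT_FT[OF L2_truncation(1,2)[OF v]]])
  have W: "wFT w v"
    unfolding wFT_def
  proof (intro conjI allI impI w2 v)
    fix \<psi> :: "(real^'n) \<Rightarrow> complex" assume s: "schwartz \<psi>"
    have m: "(\<lambda>x. w x * FT \<psi> x) \<in> borel_measurable lebesgue"
      by (intro borel_measurable_times L2_measurable[OF w2] schwartz_measurable(1)[OF schwartz_FT[OF s]])
    have "(LINT x|lebesgue. w x * FT \<psi> x) = (LINT x|lebesgue. w (- x) * FT \<psi> (- x))"
      by (rule integral_reflect_lebesgue[OF m])
    also have "\<dots> = (LINT x|lebesgue. g x * IFT \<psi> x)" unfolding w_def IFT_eq_FT by (simp add: ac_simps)
    also have "\<dots> = (LINT x|lebesgue. v x * \<psi> x)" by (rule wFT_inverse[OF g s, symmetric])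
    finally show "(LINT x|lebesgue. v x * \<psi> x) = (LINT x|lebesgue. w x * FT \<psi> x)" by simp
  qed
  have I2: "IFT (?t k) \<in> L2" for k unfolding IFT_eq_FT[abs_def] by (intro L2_scale L2_reflect F2)
  have "q2 (\<lambda>x. IFT (?t k) x - w x) = (cmod ?c)\<^sup>2 * q2 (\<lambda>\<xi>. FT (?t k) \<xi> - g \<xi>)" for k
  proof -
    have "(\<lambda>x. IFT (?t k) x - w x) = (\<lambda>x. ?c * (FT (?t k) (- x) - g (- x)))"
      unfolding w_def IFT_eq_FT by (simp add: right_diff_distrib)
    then show ?thesis using q2_scale[of ?c "\<lambda>x. FT (?t k) (- x) - g (- x)"] q2_reflect[OF L2_diff[OF F2[of k] wFTD(2)[OF g]]] by simp
  qed
  then have "(\<lambda>k. q2 (\<lambda>x. IFT (?t k) x - w x)) \<longlonglongrightarrow> 0"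
    using tendsto_mult_right_zero[OF q2_FT_truncation[OF v g], of "(cmod ?c)\<^sup>2"] by simp
  note L = SOME_L2_limit[OF I2 w2 this, folded IFT2_def]
  show ?thesis by (rule wFT_cong[OF W L2_measurable[OF L(1)] L2_measurable[OF v] L(2)]) simp
qed

lemma integrable_bump: "k > 0 \<Longrightarrow> integrable lebesgue (bump k a d)"
  using integrable_Re[OF schwartz_integrable[OF schwartz_bump]] by simp

text \<open>A vanishing integral would make a nonempty open box negligible.\<close>

lemma integral_bump_pos:
  assumes k: "k > 0" and ne: "box a d \<noteq> {}" shows "(LINT x|lebesgue. bump k a d x) > 0"
proof (rule ccontr)
  assume "\<not> (LINT x|lebesgue. bump k a d x) > 0"
  moreover have "(LINT x|lebesgue. bump k a d x) \<ge> 0" by (rule integral_nonneg_AE[OF AE_I2[OF bump_bounds(1)]])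
  ultimately have "(LINT x|lebesgue. bump k a d x) = 0" by simp
  then have "AE x in lebesgue. bump k a d x = 0"
    using integral_nonneg_eq_0_iff_AE[OF integrable_bump[OF k, of a d] AE_I2[OF bump_bounds(1)]] by simp
  then have "AE x in lebesgue. x \<notin> box a d"
    by eventually_elim (use bump_pos[OF k, of _ a d] in force)
  then have "box a d \<in> null_sets lebesgue"
    by (subst AE_iff_null_sets) (auto intro: lmeasurable_box[THEN fmeasurableD])
  then have "negligible (box a d)" by (simp add: negligible_iff_null_sets)
  then show False using open_not_negligible[OF open_box ne] by blast
qed

section \<open>Banach function norms\<close>

context
  fixes \<rho> :: "((real^'n) \<Rightarrow> ennreal) \<Rightarrow> ennreal"
  assumes bfn: "banach_function_norm \<rho>"
begin

lemma bfn_zero_iff: "f \<in> borel_measurable lebesgue \<Longrightarrow> \<rho> f = 0 \<longleftrightarrow> (AE x in lebesgue. f x = 0)"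
  using bfn unfolding banach_function_norm_def by blast

lemma bfn_scale: "f \<in> borel_measurable lebesgue \<Longrightarrow> 0 \<le> a \<Longrightarrow> \<rho> (\<lambda>x. ennreal a * f x) = ennreal a * \<rho> f"
  using bfn unfolding banach_function_norm_def by blast

lemma bfn_add:
  "f \<in> borel_measurable lebesgue \<Longrightarrow> g \<in> borel_measurable lebesgue \<Longrightarrow> \<rho> (\<lambda>x. f x + g x) \<le> \<rho> f + \<rho> g"
  using bfn unfolding banach_function_norm_def by blast

lemma bfn_mono:
  "f \<in> borel_measurable lebesgue \<Longrightarrow> g \<in> borel_measurable lebesgue \<Longrightarrow> (AE x in lebesgue. g x \<le> f x) \<Longrightarrow> \<rho> g \<le> \<rho> f"
  using bfn unfolding banach_function_norm_def by blast

lemma bfn_Fatou: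
  assumes "\<And>j. fs j \<in> borel_measurable lebesgue" "f \<in> borel_measurable lebesgue"
    "AE x in lebesgue. incseq (\<lambda>j. fs j x) \<and> (\<lambda>j. fs j x) \<longlonglongrightarrow> f x"
  shows "(\<lambda>j. \<rho> (fs j)) \<longlonglongrightarrow> \<rho> f"
  using bfn assms unfolding banach_function_norm_def by blast

lemma bfn_finite: "E \<in> sets lebesgue \<Longrightarrow> emeasure lebesgue E < \<infinity> \<Longrightarrow> \<rho> (indicator E) < \<infinity>"
  using bfn unfolding banach_function_norm_def by blast

lemma bfn_local:
  "E \<in> sets lebesgue \<Longrightarrow> emeasure lebesgue E < \<infinity> \<Longrightarrow>
    \<exists>C. 0 < C \<and> (\<forall>f\<in>borel_measurable lebesgue. (\<integral>\<^sup>+x\<in>E. f x \<partial>lebesgue) \<le> ennreal C * \<rho> f)"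
  using bfn unfolding banach_function_norm_def by blast

lemma Xset_measurable: "f \<in> Xset \<rho> \<Longrightarrow> f \<in> borel_measurable lebesgue"
  and Xset_finite: "f \<in> Xset \<rho> \<Longrightarrow> Xn \<rho> f < \<infinity>"
  by (simp_all add: Xset_def)

lemma cmod_measurable: "f \<in> borel_measurable M \<Longrightarrow> (\<lambda>x. ennreal (cmod (f x))) \<in> borel_measurable M"
  by measurable

lemma Xn_zero_iff: "f \<in> borel_measurable lebesgue \<Longrightarrow> Xn \<rho> f = 0 \<longleftrightarrow> (AE x in lebesgue. f x = 0)"
  unfolding Xn_def by (subst bfn_zero_iff) (auto intro: cmod_measurable)

lemma Xn_mono:
  assumes "f \<in> borel_measurable lebesgue" "g \<in> borel_measurable lebesgue" "AE x in lebesgue. cmod (g x) \<le> cmod (f x)"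
  shows "Xn \<rho> g \<le> Xn \<rho> f"
  unfolding Xn_def by (rule bfn_mono) (use assms in \<open>auto intro: cmod_measurable\<close>)

lemma Xn_cong_AE:
  assumes "f \<in> borel_measurable lebesgue" "g \<in> borel_measurable lebesgue" "AE x in lebesgue. f x = g x"
  shows "Xn \<rho> f = Xn \<rho> g"
  by (rule antisym; rule Xn_mono) (use assms in auto)

text \<open>The modulus is at most the indicator of a box of finite measure, so (A2) and (A4)
  apply.\<close>

lemma modulated_bump_Xset:
  assumes k: "k > 0" shows "(\<lambda>x. cis (x \<bullet> \<eta>) * complex_of_real (bump k a d x)) \<in> Xset \<rho>"
proof -
  let ?u = "\<lambda>x. cis (x \<bullet> \<eta>) * complex_of_real (bump k a d x)"
  have m: "?u \<in> borel_measurable lebesgue" by (rule schwartz_measurable(1)[OF schwartz_modulate[OF schwartz_bump[OF k]]])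
  have b: "box a d \<in> sets lebesgue" "emeasure lebesgue (box a d) < \<infinity>"
    using lmeasurable_box[of a d] by (auto simp: fmeasurable_def)
  have "Xn \<rho> ?u \<le> \<rho> (indicator (box a d))"
    unfolding Xn_def
  proof (rule bfn_mono)
    show "AE x in lebesgue. ennreal (cmod (?u x)) \<le> indicator (box a d) x"
      using bump_bounds[of k a d] bump_support[OF k, of _ a d] by (auto simp: norm_mult indicator_def abs_of_nonneg)
  qed (intro borel_measurable_indicator b cmod_measurable m)+
  then show ?thesis unfolding Xset_def using m bfn_finite[OF b] by (auto intro: le_less_trans)
qed

lemma Xset_reflect_cnj:
  assumes r: "reflection_invariant \<rho>" and f: "f \<in> Xset \<rho>"
  shows "(\<lambda>x. cnj (f (- x))) \<in> Xset \<rho>" "Xn \<rho> (\<lambda>x. cnj (f (- x))) = Xn \<rho> f"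
proof -
  have "Xn \<rho> (\<lambda>x. cnj (f (- x))) = Xn \<rho> (\<lambda>x. f (- x))" unfolding Xn_def by simp
  also have "\<dots> = Xn \<rho> f" using r f unfolding reflection_invariant_def by metis
  finally show "Xn \<rho> (\<lambda>x. cnj (f (- x))) = Xn \<rho> f" .
  then show "(\<lambda>x. cnj (f (- x))) \<in> Xset \<rho>"
    using f borel_measurable_reflect_lebesgue[OF Xset_measurable[OF f]] unfolding Xset_def by (auto intro: borel_measurable_cnj)
qed

text \<open>The operator \<open>J T J T\<close> is iterated on an invariant set \<open>C\<close> of functions, so that the same argument
  applies to all of \<open>L2 \<inter> Xset \<rho>\<close> and to the Schwartz functions in \<open>Xset \<rho>\<close>.\<close>

lemma multiplier_bound:
  fixes b :: "(real^'n) \<Rightarrow> complex" and C :: "((real^'n) \<Rightarrow> complex) set"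
  assumes r: "reflection_invariant \<rho>"
    and b: "b \<in> borel_measurable lebesgue" and M: "M \<ge> 0"
    and C: "C \<subseteq> L2 \<inter> Xset \<rho>"
    and Cbump: "\<And>k a d \<eta>. k > 0 \<Longrightarrow> (\<lambda>x. cis (x \<bullet> \<eta>) * complex_of_real (bump k a d x)) \<in> C"
    and J: "\<And>f. f \<in> C \<Longrightarrow> (\<lambda>x. cnj (f (- x))) \<in> C"
    and T: "\<And>f. f \<in> C \<Longrightarrow> T f \<in> C" "\<And>f. f \<in> C \<Longrightarrow> Xn \<rho> (T f) \<le> ennreal M * Xn \<rho> f"
    and TF: "\<And>f g. f \<in> C \<Longrightarrow> wFT f g \<Longrightarrow> wFT (T f) (\<lambda>\<xi>. b \<xi> * g \<xi>)"
  shows "AE \<xi> in lebesgue. cmod (b \<xi>) \<le> M"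
proof -
  \<comment> \<open>The estimate for a single test function, valid only where its transform is
    nonzero; the end of the proof varies the modulation.\<close>
  have one: "AE \<xi> in lebesgue. FT (\<lambda>x. cis (x \<bullet> \<eta>) * complex_of_real (bump k a d x)) \<xi> = 0 \<or> cmod (b \<xi>) \<le> M"
    if k: "k > 0" for k a d \<eta>
  proof -
    define u where "u = (\<lambda>x. cis (x \<bullet> \<eta>) * complex_of_real (bump k a d x))"
    have us: "schwartz u" unfolding u_def by (rule schwartz_modulate[OF schwartz_bump[OF k]])
    have uC: "u \<in> C" unfolding u_def by (rule Cbump[OF k])
    define J' where "J' f = (\<lambda>x. cnj (f (- x)))" for f :: "(real^'n) \<Rightarrow> complex"
    define v where "v m = ((\<lambda>f. J' (T (J' (T f)))) ^^ m) u" for m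
    have v0: "v 0 = u" and vS: "v (Suc m) = J' (T (J' (T (v m))))" for m unfolding v_def by simp_all
    have vC: "v m \<in> C" for m by (induction m) (auto simp: v0 vS uC J'_def intro: J T)
    have JX: "Xn \<rho> (J' f) = Xn \<rho> f" if "f \<in> C" for f
      unfolding J'_def using Xset_reflect_cnj[OF r, of f] that C by auto
    have vX: "Xn \<rho> (v m) \<le> ennreal (M ^ (2 * m)) * Xn \<rho> u" for m
    proof (induction m)
      case (Suc m)
      have c: "T (v m) \<in> C" "J' (T (v m)) \<in> C" "T (J' (T (v m))) \<in> C" using vC[of m] J T(1) unfolding J'_def by auto
      have "Xn \<rho> (v (Suc m)) \<le> ennreal M * Xn \<rho> (T (v m))"
        unfolding vS using JX[OF c(3)] T(2)[OF c(2)] JX[OF c(1)] by simp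
      also have "\<dots> \<le> ennreal M * (ennreal M * (ennreal (M ^ (2 * m)) * Xn \<rho> u))"
        by (intro mult_left_mono order_trans[OF T(2)[OF vC]] Suc) auto
      finally show ?case using M by (simp add: ennreal_mult mult.assoc)
    qed (simp add: v0)
    have vF: "wFT (v m) (\<lambda>\<xi>. complex_of_real (cmod (b \<xi>) ^ (2 * m)) * FT u \<xi>)" for m
    proof (induction m)
      case 0 show ?case unfolding v0 using wFT_FT[OF L2_schwartz[OF us] schwartz_integrable[OF us]] by simp
    next
      case (Suc m)
      have c: "T (v m) \<in> C" "J' (T (v m)) \<in> C" "T (J' (T (v m))) \<in> C" using vC[of m] J T(1) unfolding J'_def by auto
      let ?g = "\<lambda>\<xi>. complex_of_real (cmod (b \<xi>) ^ (2 * m)) * FT u \<xi>"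
      have "wFT (v (Suc m)) (\<lambda>\<xi>. cnj (b \<xi> * cnj (b \<xi> * ?g \<xi>)))"
        unfolding vS J'_def by (rule wFT_reflect_cnj[OF TF[OF c(2)[unfolded J'_def] wFT_reflect_cnj[OF TF[OF vC Suc]]]])
      moreover have "cnj (b \<xi> * cnj (b \<xi> * ?g \<xi>)) = complex_of_real (cmod (b \<xi>) ^ (2 * Suc m)) * FT u \<xi>" for \<xi>
        using complex_norm_square[of "b \<xi>"] by (simp add: power2_eq_square ac_simps)
      ultimately show ?case by (simp only:)
    qed
    let ?c = "1 / (2 * pi) ^ CARD('n)"
    have c0: "?c > 0" by simp
    define I where "I m = (LINT \<xi>|lebesgue. cmod (b \<xi>) ^ (2 * m) * (cmod (FT u \<xi>))\<^sup>2)" for m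
    have Iint: "integrable lebesgue (\<lambda>\<xi>. cmod (b \<xi>) ^ (2 * m) * (cmod (FT u \<xi>))\<^sup>2)" for m
    proof -
      have "integrable lebesgue (\<lambda>\<xi>. cmod ((complex_of_real (cmod (b \<xi>) ^ (2 * m)) * FT u \<xi>) * FT u \<xi>))"
        by (intro integrable_norm L2_mult_integrable wFTD(2)[OF vF] L2_schwartz schwartz_FT us)
      then show ?thesis by (simp add: norm_mult norm_power power2_eq_square mult.assoc)
    qed
    have b': "box a d \<in> sets lebesgue" "emeasure lebesgue (box a d) < \<infinity>"
      using lmeasurable_box[of a d] by (auto simp: fmeasurable_def)
    obtain CE where CE: "0 < CE" "\<And>f. f \<in> borel_measurable lebesgue \<Longrightarrow> (\<integral>\<^sup>+x\<in>box a d. f x \<partial>lebesgue) \<le> ennreal CE * \<rho> f"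
      using bfn_local[OF b'] by blast
    \<comment> \<open>The essential point is that \<open>K\<close> depends on \<open>u\<close>, its
      box and the dimension, but not on \<open>m\<close>.\<close>
    define K where "K = CE * enn2real (Xn \<rho> u) / ?c"
    have Xu: "Xn \<rho> u = ennreal (enn2real (Xn \<rho> u))" using uC C Xset_finite by (auto simp: less_top)
    \<comment> \<open>Parseval expresses \<open>I m\<close> through the pairing of
      \<open>v m\<close> with \<open>u\<close>. Since \<open>u\<close> is bounded by 1 and supported
      in the box, the pairing is at most the integral of the modulus of \<open>v m\<close> over the
      box, which (A5) controls by the norm of \<open>v m\<close>.\<close>
    have IK: "I m \<le> K * M ^ (2 * m)" for m
    proof -
      have "complex_of_real (?c * I m) = (LINT \<xi>|lebesgue. (complex_of_real (cmod (b \<xi>) ^ (2 * m)) * FT u \<xi>) * IFT (\<lambda>x. cnj (u x)) \<xi>)"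
      proof -
        have "(complex_of_real (cmod (b \<xi>) ^ (2 * m)) * FT u \<xi>) * IFT (\<lambda>x. cnj (u x)) \<xi>
            = complex_of_real ?c * complex_of_real (cmod (b \<xi>) ^ (2 * m) * (cmod (FT u \<xi>))\<^sup>2)" for \<xi>
          unfolding IFT_eq_FT FT_cnj of_real_mult[of "_ ^ (2 * m)"] complex_norm_square by (simp add: ac_simps)
        then show ?thesis unfolding I_def
          by (simp only: integral_mult_right_zero integral_complex_of_real of_real_mult[of ?c])
      qed
      also have "\<dots> = (LINT x|lebesgue. v m x * cnj (u x))"
        using wFT_inverse[OF vF schwartz_cnj[OF us]] by simp
      finally have "cmod (complex_of_real (?c * I m)) = cmod (LINT x|lebesgue. v m x * cnj (u x))" by (rule arg_cong)
      moreover have "I m \<ge> 0" unfolding I_def by simp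
      ultimately have eq: "?c * I m = cmod (LINT x|lebesgue. v m x * cnj (u x))"
        using c0 by (simp only: norm_of_real abs_of_nonneg mult_nonneg_nonneg less_imp_le)
      have vm: "v m \<in> borel_measurable lebesgue" using vC[of m] C Xset_measurable by blast
      have "ennreal (?c * I m) \<le> (\<integral>\<^sup>+x. ennreal (cmod (v m x * cnj (u x))) \<partial>lebesgue)"
        unfolding eq using vC[of m] uC C by (intro integral_norm_bound_ennreal ip_integrable) auto
      also have "\<dots> \<le> (\<integral>\<^sup>+x\<in>box a d. ennreal (cmod (v m x)) \<partial>lebesgue)"
        using bump_bounds[of k a d] bump_support[OF k, of _ a d]
        by (intro nn_integral_mono) (auto simp: u_def norm_mult indicator_def abs_of_nonneg intro!: ennreal_leI mult_left_le)
      also have "\<dots> \<le> ennreal CE * Xn \<rho> (v m)" unfolding Xn_def by (intro CE cmod_measurable vm)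
      also have "\<dots> \<le> ennreal CE * (ennreal (M ^ (2 * m)) * ennreal (enn2real (Xn \<rho> u)))"
        using vX[of m] unfolding Xu[symmetric] by (intro mult_left_mono) auto
      also have "\<dots> = ennreal (CE * (M ^ (2 * m) * enn2real (Xn \<rho> u)))"
        using CE M by (simp add: ennreal_mult)
      finally have "?c * I m \<le> CE * (M ^ (2 * m) * enn2real (Xn \<rho> u))"
        by (subst (asm) ennreal_le_iff) (use CE M in auto)
      then show ?thesis using c0 unfolding K_def by (simp add: field_simps)
    qed
    \<comment> \<open>Where the modulus of \<open>b\<close> is at least \<open>q > M\<close>, the
      integrand of \<open>I m\<close> is at least the \<open>2 * m\<close>-th power of
      \<open>q\<close> times the squared modulus of \<open>FT u\<close>. Comparison with
      \<open>IK\<close> leaves a ratio below 1 to the power \<open>m\<close>, so that part has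
      integral zero. Thresholds \<open>M + 1 / Suc j\<close> keep the exceptional sets countable in
      number.\<close>
    have "AE \<xi> in lebesgue. FT u \<xi> = 0 \<or> cmod (b \<xi>) < M + 1 / real (Suc j)" for j
    proof -
      define q where "q = M + 1 / real (Suc j)"
      have q: "q > M" "q > 0" unfolding q_def using M by (auto simp: add_nonneg_pos)
      define g where "g \<xi> = (if cmod (b \<xi>) < q then 0 else (cmod (FT u \<xi>))\<^sup>2)" for \<xi>
      have Fi: "integrable lebesgue (\<lambda>\<xi>. (cmod (FT u \<xi>))\<^sup>2)" using Iint[of 0] by simp
      have gi: "integrable lebesgue g"
      proof (rule Bochner_Integration.integrable_bound[OF Fi])
        note [measurable] = b schwartz_measurable(1)[OF schwartz_FT[OF us]]
        show "g \<in> borel_measurable lebesgue" unfolding g_def by measurable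
      qed (auto simp: g_def)
      have "(LINT \<xi>|lebesgue. g \<xi>) \<le> K * (M\<^sup>2 / q\<^sup>2) ^ m" for m
      proof -
        have "q ^ (2 * m) * (LINT \<xi>|lebesgue. g \<xi>) = (LINT \<xi>|lebesgue. q ^ (2 * m) * g \<xi>)" by simp
        also have "\<dots> \<le> I m"
          unfolding I_def
        proof (rule integral_mono[OF _ Iint])
          show "integrable lebesgue (\<lambda>\<xi>. q ^ (2 * m) * g \<xi>)" using gi by simp
          show "q ^ (2 * m) * g \<xi> \<le> cmod (b \<xi>) ^ (2 * m) * (cmod (FT u \<xi>))\<^sup>2" for \<xi>
            unfolding g_def using q by (auto intro!: mult_right_mono power_mono)
        qed
        also have "\<dots> \<le> K * M ^ (2 * m)" by (rule IK)
        finally have "(q\<^sup>2) ^ m * (LINT \<xi>|lebesgue. g \<xi>) \<le> K * (M\<^sup>2) ^ m" by (simp only: power_mult)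
        moreover have "(q\<^sup>2) ^ m > 0" using q by simp
        ultimately show ?thesis unfolding power_divide by (simp add: pos_le_divide_eq mult.commute)
      qed
      moreover have "(\<lambda>m. K * (M\<^sup>2 / q\<^sup>2) ^ m) \<longlonglongrightarrow> 0"
        by (rule tendsto_mult_right_zero[OF LIMSEQ_power_zero])
           (use q M in \<open>auto simp: power_strict_mono\<close>)
      ultimately have "(LINT \<xi>|lebesgue. g \<xi>) \<le> 0" by (intro LIMSEQ_le_const) auto
      moreover have g0: "g \<xi> \<ge> 0" for \<xi> by (simp add: g_def)
      then have "(LINT \<xi>|lebesgue. g \<xi>) \<ge> 0" by simp
      ultimately have "(LINT \<xi>|lebesgue. g \<xi>) = 0" by simp
      then have "AE \<xi> in lebesgue. g \<xi> = 0"
        using integral_nonneg_eq_0_iff_AE[OF gi] g0 by simp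
      then show ?thesis unfolding q_def[symmetric] by eventually_elim (auto simp: g_def split: if_splits)
    qed
    then have "AE \<xi> in lebesgue. \<forall>j. FT u \<xi> = 0 \<or> cmod (b \<xi>) < M + 1 / real (Suc j)" unfolding AE_all_countable by blast
    then have "AE \<xi> in lebesgue. FT u \<xi> = 0 \<or> cmod (b \<xi>) \<le> M"
    proof eventually_elim
      fix \<xi> assume h: "\<forall>j. FT u \<xi> = 0 \<or> cmod (b \<xi>) < M + 1 / real (Suc j)"
      have "cmod (b \<xi>) \<le> M" if "FT u \<xi> \<noteq> 0"
      proof (rule field_le_epsilon)
        fix e :: real assume "e > 0"
        then obtain j where "1 / real (Suc j) < e" using nat_approx_posE by blast
        then show "cmod (b \<xi>) \<le> M + e" using h that by (auto dest!: spec[of _ j])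
      qed
      then show "FT u \<xi> = 0 \<or> cmod (b \<xi>) \<le> M" by blast
    qed
    then show ?thesis unfolding u_def .
  qed
  define a0 d0 :: "real^'n" where "a0 = (\<chi> i. - 1)" and "d0 = (\<chi> i. 1)"
  let ?\<phi> = "\<lambda>x. complex_of_real (bump 1 a0 d0 x)"
  have \<phi>s: "schwartz ?\<phi>" by (rule schwartz_bump) simp
  have F0: "FT ?\<phi> 0 \<noteq> 0"
  proof -
    have "0 \<in> box a0 d0" unfolding a0_def d0_def by (simp add: mem_box_cart)
    then have "(LINT x|lebesgue. bump 1 a0 d0 x) > 0" by (intro integral_bump_pos) auto
    then show ?thesis unfolding FT_def by simp
  qed
  have ct: "continuous (at 0) (FT ?\<phi>)"
    using FT_continuous[OF schwartz_integrable[OF \<phi>s]] continuous_on_eq_continuous_at by blast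
  have "\<exists>e>0. \<forall>y. dist 0 y < e \<longrightarrow> FT ?\<phi> y \<noteq> 0"
    by (rule continuous_at_avoid[where f = "FT ?\<phi>" and a = 0, OF ct F0])
  then obtain e where e: "e > 0" "\<And>y. norm y < e \<Longrightarrow> FT ?\<phi> y \<noteq> 0" by auto
  \<comment> \<open>Only countably many null sets may be united. A dense set of frequencies suffices
    because the transform of the fixed bump is nonzero on a whole ball around the origin.\<close>
  obtain D :: "(real^'n) set" where D: "countable D" "\<And>X. open X \<Longrightarrow> X \<noteq> {} \<Longrightarrow> \<exists>d\<in>D. d \<in> X"
    using countable_dense_setE by blast
  have "AE \<xi> in lebesgue. \<forall>\<eta>\<in>D. FT ?\<phi> (\<xi> - \<eta>) = 0 \<or> cmod (b \<xi>) \<le> M"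
    unfolding AE_ball_countable[OF D(1)]
  proof
    fix \<eta> show "AE \<xi> in lebesgue. FT ?\<phi> (\<xi> - \<eta>) = 0 \<or> cmod (b \<xi>) \<le> M"
      using one[of 1 \<eta> a0 d0] unfolding FT_modulate by simp
  qed
  then show ?thesis
  proof eventually_elim
    fix \<xi> assume h: "\<forall>\<eta>\<in>D. FT ?\<phi> (\<xi> - \<eta>) = 0 \<or> cmod (b \<xi>) \<le> M"
    obtain \<eta> where "\<eta> \<in> D" "\<eta> \<in> ball \<xi> e" using D(2)[of "ball \<xi> e"] e(1) by auto
    then show "cmod (b \<xi>) \<le> M" using h e(2)[of "\<xi> - \<eta>"] by (auto simp: dist_norm)
  qed
qed

lemma Xset_L2_J: "reflection_invariant \<rho> \<Longrightarrow> f \<in> L2 \<inter> Xset \<rho> \<Longrightarrow> (\<lambda>x. cnj (f (- x))) \<in> L2 \<inter> Xset \<rho>"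
  using Xset_reflect_cnj(1) L2_cnj[OF L2_reflect] by auto

end

section \<open>Bounded symbols and the first inequality\<close>

lemma ennreal_le_of_divide_le:
  fixes x y m :: ennreal
  assumes "y \<noteq> 0" "y \<noteq> top" "x / y \<le> m" shows "x \<le> m * y"
proof -
  have "x = x / y * y" using assms by (simp add: ennreal_divide_times ennreal_divide_self less_top)
  also have "\<dots> \<le> m * y" by (intro mult_right_mono assms) simp
  finally show ?thesis .
qed

lemma Linf_normD:
  assumes "a \<in> Linf" obtains B where "B \<ge> 0" "AE x in lebesgue. cmod (a x) \<le> B"
proof -
  have "Inf {C. AE x in lebesgue. ennreal (cmod (a x)) \<le> C} < \<infinity>" using assms unfolding Linf_def Linf_norm_def by blast
  then obtain C where C: "AE x in lebesgue. ennreal (cmod (a x)) \<le> C" "C < \<infinity>" unfolding Inf_less_iff by blast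
  have "AE x in lebesgue. cmod (a x) \<le> enn2real C"
    using C(1)
  proof eventually_elim
    fix x assume "ennreal (cmod (a x)) \<le> C"
    also have "C = ennreal (enn2real C)" using C(2) by simp
    finally show "cmod (a x) \<le> enn2real C" by simp
  qed
  then show ?thesis by (intro that[of "enn2real C"]) auto
qed

lemma Linf_norm_le: "(AE x in lebesgue. cmod (a x) \<le> M) \<Longrightarrow> Linf_norm a \<le> ennreal M"
  unfolding Linf_norm_def by (intro Inf_lower CollectI) (auto elim!: eventually_mono intro: ennreal_leI)

lemma Linf_norm_one: "Linf_norm (\<lambda>x::real^'n. 1) = 1"
proof (rule antisym)
  show "Linf_norm (\<lambda>x::real^'n. 1) \<le> 1" using Linf_norm_le[of "\<lambda>x::real^'n. 1" 1] by simp
  show "1 \<le> Linf_norm (\<lambda>x::real^'n. 1)"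
    unfolding Linf_norm_def
  proof (rule Inf_greatest)
    fix C :: ennreal assume "C \<in> {C. AE x::real^'n in lebesgue. ennreal (cmod 1) \<le> C}"
    then have *: "AE x::real^'n in lebesgue. 1 \<le> C" by simp
    have "emeasure lebesgue (UNIV :: (real^'n) set) \<noteq> 0" by simp
    then have "ae_filter (lebesgue :: (real^'n) measure) \<noteq> bot" by (simp add: ae_filter_eq_bot_iff)
    then show "1 \<le> C" using * by (simp add: eventually_const)
  qed
qed

lemma L2_mult_Linf:
  assumes a: "a \<in> Linf" and g: "g \<in> L2" shows "(\<lambda>x. a x * g x) \<in> L2"
proof -
  obtain B where B: "B \<ge> 0" "AE x in lebesgue. cmod (a x) \<le> B" by (rule Linf_normD[OF a])
  note [measurable] = L2_measurable[OF g]
  have [measurable]: "a \<in> borel_measurable lebesgue" using a unfolding Linf_def by simp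
  show ?thesis unfolding L2_def
  proof safe
    show "(\<lambda>x. a x * g x) \<in> borel_measurable lebesgue" by measurable
    show "integrable lebesgue (\<lambda>x. (cmod (a x * g x))\<^sup>2)"
    proof (rule Bochner_Integration.integrable_bound)
      show "integrable lebesgue (\<lambda>x. B\<^sup>2 * (cmod (g x))\<^sup>2)" using g unfolding L2_def by simp
      show "AE x in lebesgue. norm ((cmod (a x * g x))\<^sup>2) \<le> norm (B\<^sup>2 * (cmod (g x))\<^sup>2)"
        using B(2)
      proof eventually_elim
        fix x assume "cmod (a x) \<le> B"
        then have "(cmod (a x))\<^sup>2 \<le> B\<^sup>2" by (intro power_mono) auto
        then show "norm ((cmod (a x * g x))\<^sup>2) \<le> norm (B\<^sup>2 * (cmod (g x))\<^sup>2)"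
          by (simp add: norm_mult power_mult_distrib mult_right_mono)
      qed
    qed measurable
  qed
qed

text \<open>Here the operator already acts on all of L2, so \<open>multiplier_bound\<close> applies
  with the largest invariant set, L2 intersected with \<open>Xset \<rho>\<close>.\<close>

lemma M0_lower_bound:
  fixes \<rho> :: "((real^'n) \<Rightarrow> ennreal) \<Rightarrow> ennreal"
  assumes bfn: "banach_function_norm \<rho>" and r: "reflection_invariant \<rho>" and a: "a \<in> M0_set \<rho>"
  shows "Linf_norm a \<le> M0_norm \<rho> a"
proof -
  have aL: "a \<in> Linf" and fin: "M0_norm \<rho> a < \<infinity>" using a unfolding M0_set_def by auto
  then have am: "a \<in> borel_measurable lebesgue" unfolding Linf_def by simp
  define T where "T u = IFT2 (\<lambda>\<xi>. a \<xi> * FT2 u \<xi>)" for u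
  have M: "M0_norm \<rho> a = ennreal (enn2real (M0_norm \<rho> a))" using fin by simp
  have TF: "wFT (T u) (\<lambda>\<xi>. a \<xi> * FT2 u \<xi>)" if "u \<in> L2" for u
    unfolding T_def by (rule IFT2_wFT[OF L2_mult_Linf[OF aL wFTD(2)[OF FT2_wFT[OF that]]]])
  have TX: "Xn \<rho> (T u) \<le> M0_norm \<rho> a * Xn \<rho> u" if u: "u \<in> L2" "u \<in> Xset \<rho>" for u
  proof (cases "AE x in lebesgue. u x = 0")
    \<comment> \<open>The supremum excludes such \<open>u\<close>. The bound still holds because
      \<open>T u\<close> vanishes almost everywhere, by uniqueness and injectivity of the weak
      transform.\<close>
    case True
    have z: "(\<lambda>x. 0) \<in> L2" unfolding L2_def by simp
    have w0: "wFT (\<lambda>x. 0) (\<lambda>x. 0)" unfolding wFT_def using z by simp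
    have "wFT (\<lambda>x. 0) (FT2 u)"
      by (rule wFT_cong[OF FT2_wFT[OF u(1)]]) (use True L2_measurable[OF wFTD(2)[OF FT2_wFT[OF u(1)]]] in auto)
    then have "AE x in lebesgue. FT2 u x = 0" using wFT_unique[OF _ w0] by blast
    then have "wFT (T u) (\<lambda>x. 0)"
      by (intro wFT_cong[OF TF[OF u(1)] L2_measurable[OF wFTD(1)[OF TF[OF u(1)]]]]) auto
    then have "AE x in lebesgue. T u x = 0" using wFT_inj[OF _ w0] by blast
    then have "Xn \<rho> (T u) = 0" using Xn_zero_iff[OF bfn L2_measurable[OF wFTD(1)[OF TF[OF u(1)]]]] by simp
    then show ?thesis by simp
  next
    case False
    have "Xn \<rho> (T u) / Xn \<rho> u \<le> M0_norm \<rho> a"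
      unfolding M0_norm_def T_def by (rule SUP_upper) (use u False in simp)
    then show ?thesis
      using False Xn_zero_iff[OF bfn Xset_measurable[OF bfn u(2)]] Xset_finite[OF bfn u(2)]
      by (intro ennreal_le_of_divide_le) auto
  qed
  have "AE \<xi> in lebesgue. cmod (a \<xi>) \<le> enn2real (M0_norm \<rho> a)"
  proof (rule multiplier_bound[OF bfn r am, where C = "L2 \<inter> Xset \<rho>" and T = T])
    show "(\<lambda>x. cis (x \<bullet> \<eta>) * complex_of_real (bump k c d x)) \<in> L2 \<inter> Xset \<rho>" if "k > 0" for k c d \<eta>
      using modulated_bump_Xset[OF bfn that] L2_schwartz[OF schwartz_modulate[OF schwartz_bump[OF that]]] by blast
    show "(\<lambda>x. cnj (f (- x))) \<in> L2 \<inter> Xset \<rho>" if "f \<in> L2 \<inter> Xset \<rho>" for f by (rule Xset_L2_J[OF bfn r that])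
    fix f assume f: "f \<in> L2 \<inter> Xset \<rho>"
    show X: "Xn \<rho> (T f) \<le> ennreal (enn2real (M0_norm \<rho> a)) * Xn \<rho> f" using TX[of f] f M by simp
    also have "\<dots> < \<infinity>" using Xset_finite[OF bfn, of f] f by (simp add: ennreal_mult_less_top)
    finally show "T f \<in> L2 \<inter> Xset \<rho>"
      using wFTD(1)[OF TF] f L2_measurable unfolding Xset_def by blast
    fix g assume g: "wFT f g"
    have "f \<in> L2" using f by simp
    show "wFT (T f) (\<lambda>\<xi>. a \<xi> * g \<xi>)"
      by (rule wFT_cong[OF TF[OF \<open>f \<in> L2\<close>] L2_measurable[OF wFTD(1)[OF TF[OF \<open>f \<in> L2\<close>]]]])
         (use wFT_unique[OF FT2_wFT[OF \<open>f \<in> L2\<close>] g] am L2_measurable[OF wFTD(2)[OF g]] in auto)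
  qed auto
  then show ?thesis using Linf_norm_le M by metis
qed

text \<open>For sharpness: injectivity of the weak transform shows that symbol 1 acts as the
  identity almost everywhere.\<close>

lemma M0_norm_one:
  fixes \<rho> :: "((real^'n) \<Rightarrow> ennreal) \<Rightarrow> ennreal"
  assumes bfn: "banach_function_norm \<rho>"
  shows "M0_norm \<rho> (\<lambda>\<xi>. 1) \<le> 1" "(\<lambda>\<xi>. 1) \<in> M0_set \<rho>"
proof -
  show *: "M0_norm \<rho> (\<lambda>\<xi>. 1) \<le> 1"
    unfolding M0_norm_def
  proof (rule SUP_least)
    fix u assume "u \<in> {u. u \<in> L2 \<and> u \<in> Xset \<rho> \<and> \<not> (AE x in lebesgue. u x = 0)}"
    then have u: "u \<in> L2" "u \<in> Xset \<rho>" "\<not> (AE x in lebesgue. u x = 0)" by auto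
    have w: "wFT (IFT2 (FT2 u)) (FT2 u)" by (rule IFT2_wFT[OF wFTD(2)[OF FT2_wFT[OF u(1)]]])
    have "Xn \<rho> (IFT2 (FT2 u)) = Xn \<rho> u"
      by (rule Xn_cong_AE[OF bfn L2_measurable[OF wFTD(1)[OF w]] L2_measurable[OF u(1)] wFT_inj[OF w FT2_wFT[OF u(1)]]])
    moreover have "Xn \<rho> u \<noteq> 0" using u Xn_zero_iff[OF bfn L2_measurable[OF u(1)]] by simp
    moreover have "Xn \<rho> u \<noteq> top" using Xset_finite[OF bfn u(2)] by auto
    ultimately show "Xn \<rho> (IFT2 (\<lambda>\<xi>. 1 * FT2 u \<xi>)) / Xn \<rho> u \<le> 1"
      by (simp add: ennreal_divide_self less_top)
  qed
  have "(\<lambda>\<xi>::real^'n. 1) \<in> Linf" unfolding Linf_def by (simp add: Linf_norm_one)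
  then show "(\<lambda>\<xi>. 1) \<in> M0_set \<rho>" unfolding M0_set_def using * by (auto intro: le_less_trans)
qed

section \<open>Continuous families of Schwartz functions\<close>

lemma pderiv_dir_add: "schwartz f \<Longrightarrow> schwartz g \<Longrightarrow> pderiv_dir i (\<lambda>x. f x + g x) = (\<lambda>x. pderiv_dir i f x + pderiv_dir i g x)"
  by (rule has_pd_imp(1)[OF has_pd_add[OF schwartzD(3) schwartzD(3)]])

lemma pderiv_dir_scale: "schwartz f \<Longrightarrow> pderiv_dir i (\<lambda>x. c * f x) = (\<lambda>x. c * pderiv_dir i f x)"
  by (rule has_pd_imp(1)[OF has_pd_scale[OF schwartzD(3)]])

lemma schwartz_Dl: "schwartz f \<Longrightarrow> schwartz (Dl is f)"
  by (induction "is") (auto intro: schwartzD(4))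

lemma Dl_add: "schwartz f \<Longrightarrow> schwartz g \<Longrightarrow> Dl is (\<lambda>x. f x + g x) = (\<lambda>x. Dl is f x + Dl is g x)"
  by (induction "is") (simp_all add: pderiv_dir_add schwartz_Dl)

lemma Dl_scale: "schwartz f \<Longrightarrow> Dl is (\<lambda>x. c * f x) = (\<lambda>x. c * Dl is f x)"
  by (induction "is") (simp_all add: pderiv_dir_scale schwartz_Dl)

lemma schwartz_diff: "schwartz f \<Longrightarrow> schwartz g \<Longrightarrow> schwartz (\<lambda>x. f x - g x)"
  using schwartz_add[OF _ schwartz_scale[of g "-1"]] by simp

lemma Dl_diff: "schwartz f \<Longrightarrow> schwartz g \<Longrightarrow> Dl is (\<lambda>x. f x - g x) = (\<lambda>x. Dl is f x - Dl is g x)"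
  using Dl_add[OF _ schwartz_scale[of g "-1"], of f "is"] Dl_scale[of g "is" "-1"] by simp

text \<open>The supremum in \<open>schwartz_seminorm\<close> is taken in the reals, so it bounds its
  terms only because the range is bounded for a Schwartz function.\<close>

lemma seminorm_upper:
  assumes "schwartz f" shows "(1 + norm x) ^ k * cmod (Dl is f x) \<le> schwartz_seminorm k is f"
  unfolding schwartz_seminorm_def
proof (rule cSUP_upper)
  show "bdd_above (range (\<lambda>x. (1 + norm x) ^ k * cmod (Dl is f x)))"
    using assms unfolding schwartz_def by (intro bounded_imp_bdd_above) blast
qed simp

lemma seminorm_least:
  assumes "\<And>x. (1 + norm x) ^ k * cmod (Dl is f x) \<le> B" shows "schwartz_seminorm k is f \<le> B"
  unfolding schwartz_seminorm_def by (rule cSUP_least) (use assms in auto)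

lemma seminorm_nonneg: "schwartz f \<Longrightarrow> 0 \<le> schwartz_seminorm k is f"
  using seminorm_upper[of f 0 k "is"] by (rule order_trans[rotated]) simp_all

definition pN :: "nat \<Rightarrow> ((real^'n) \<Rightarrow> complex) \<Rightarrow> real" where
  "pN N f = (\<Sum>k\<le>N. \<Sum>is \<in> {is. length is \<le> N}. schwartz_seminorm k is f)"

lemma finite_multi_indices: "finite {is :: 'n::finite list. length is \<le> N}"
  using finite_lists_length_le[of "UNIV :: 'n set" N] by simp

lemma pN_nonneg: "schwartz f \<Longrightarrow> 0 \<le> pN N f"
  unfolding pN_def by (intro sum_nonneg seminorm_nonneg)

lemma temperedD:
  assumes "tempered T"
  shows "schwartz f \<Longrightarrow> schwartz g \<Longrightarrow> T (\<lambda>x. f x + g x) = T f + T g"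
    "schwartz f \<Longrightarrow> T (\<lambda>x. c * f x) = c * T f"
    "\<exists>N C. C \<ge> 0 \<and> (\<forall>f. schwartz f \<longrightarrow> cmod (T f) \<le> C * pN N f)"
proof -
  show "schwartz f \<Longrightarrow> schwartz g \<Longrightarrow> T (\<lambda>x. f x + g x) = T f + T g" "schwartz f \<Longrightarrow> T (\<lambda>x. c * f x) = c * T f"
    using assms unfolding tempered_def by blast+
  obtain N C where *: "\<And>f. schwartz f \<Longrightarrow> cmod (T f) \<le> C * pN N f"
    using assms unfolding tempered_def pN_def by blast
  have "cmod (T f) \<le> \<bar>C\<bar> * pN N f" if "schwartz f" for f
    using *[OF that] mult_right_mono[OF abs_ge_self[of C] pN_nonneg[OF that, of N]] by linarith
  then show "\<exists>N C. C \<ge> 0 \<and> (\<forall>f. schwartz f \<longrightarrow> cmod (T f) \<le> C * pN N f)"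
    by (intro exI[of _ N] exI[of _ "\<bar>C\<bar>"]) auto
qed

lemma tempered_diff:
  assumes "tempered T" "schwartz f" "schwartz g" shows "T (\<lambda>x. f x - g x) = T f - T g"
  using temperedD(1)[OF assms(1,2) schwartz_scale[OF assms(3), of "-1"]] temperedD(2)[OF assms(1,3), of "-1"] by simp

lemma tempered_zero: assumes "tempered T" shows "T (\<lambda>x. 0) = 0"
  using temperedD(2)[OF assms schwartz_gauss, of 0] by simp

lemma schwartz_zero: "schwartz (\<lambda>x. 0)"
  using schwartz_scale[OF schwartz_gauss, of 0] by simp

text \<open>Membership, the value of \<open>T\<close> and the derivatives are proved together: these
  are the three facts about the finite sums that arise from sampling a parameter integral.\<close>

lemma tempered_sum:
  assumes T: "tempered T" and "finite I" "\<And>i. i \<in> I \<Longrightarrow> schwartz (f i)"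
  shows "schwartz (\<lambda>x. \<Sum>i\<in>I. c i * f i x) \<and> T (\<lambda>x. \<Sum>i\<in>I. c i * f i x) = (\<Sum>i\<in>I. c i * T (f i))
    \<and> Dl is (\<lambda>x. \<Sum>i\<in>I. c i * f i x) = (\<lambda>x. \<Sum>i\<in>I. c i * Dl is (f i) x)"
  using assms(2,3)
proof (induction I)
  case empty
  have "Dl is (\<lambda>x. 0 * gauss x) = (\<lambda>x. 0 * Dl is gauss x)" by (rule Dl_scale[OF schwartz_gauss])
  then show ?case using tempered_zero[OF T] schwartz_zero by simp
next
  case (insert i I)
  have s: "schwartz (\<lambda>x. c i * f i x)" and r: "schwartz (\<lambda>x. \<Sum>i\<in>I. c i * f i x)"
    using insert by (auto intro: schwartz_scale)
  have fi: "schwartz (f i)" using insert by simp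
  show ?case
    using insert schwartz_add[OF s r] temperedD(1)[OF T s r] temperedD(2)[OF T fi, of "c i"]
      Dl_add[OF s r, of "is"] Dl_scale[OF fi, of "is" "c i"] by simp
qed

lemma tempered_tendsto:
  assumes T: "tempered T" and f: "schwartz f" and fj: "\<And>j. schwartz (fs j)"
    and lim: "\<And>k is. ((\<lambda>j. schwartz_seminorm k is (\<lambda>x. fs j x - f x)) \<longlongrightarrow> 0) F"
  shows "((\<lambda>j. T (fs j)) \<longlongrightarrow> T f) F"
proof -
  obtain N C where C: "\<And>f. schwartz f \<Longrightarrow> cmod (T f) \<le> C * pN N f" using temperedD(3)[OF T] by blast
  have "((\<lambda>j. pN N (\<lambda>x. fs j x - f x)) \<longlongrightarrow> (\<Sum>k\<le>N. \<Sum>is\<in>{is::'a list. length is \<le> N}. 0)) F"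
    unfolding pN_def by (intro tendsto_sum lim)
  then have lim0: "((\<lambda>j. C * pN N (\<lambda>x. fs j x - f x)) \<longlongrightarrow> 0) F" by (intro tendsto_mult_right_zero) simp
  have "\<forall>\<^sub>F j in F. norm (T (fs j) - T f) \<le> C * pN N (\<lambda>x. fs j x - f x)"
    using C[OF schwartz_diff[OF fj f]] tempered_diff[OF T fj f] by (intro always_eventually) simp
  from Lim_null_comparison[OF this lim0] show ?thesis by (rule LIM_zero_cancel)
qed

definition nice0 :: "((real^'n) \<Rightarrow> (real^'n) \<Rightarrow> complex) \<Rightarrow> bool" where
  "nice0 \<Theta> \<longleftrightarrow> (\<forall>k. \<exists>C m. \<forall>x \<xi>. (1 + norm \<xi>) ^ k * cmod (\<Theta> x \<xi>) \<le> C * (1 + norm x) ^ m) \<and>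
     (\<forall>k x e. e > 0 \<longrightarrow> (\<forall>\<^sub>F y in nhds x. \<forall>\<xi>. (1 + norm \<xi>) ^ k * cmod (\<Theta> y \<xi> - \<Theta> x \<xi>) \<le> e))"

text \<open>Continuous and polynomially bounded families in the Schwartz space: exactly what is needed to move a
  tempered distribution under an integral against a Schwartz weight.\<close>

definition nice_fam :: "((real^'n) \<Rightarrow> (real^'n) \<Rightarrow> complex) \<Rightarrow> bool" where
  "nice_fam \<Theta> \<longleftrightarrow> (\<forall>x. schwartz (\<Theta> x)) \<and> (\<forall>is. nice0 (\<lambda>x. Dl is (\<Theta> x)))"

lemma nice0_bound:
  assumes "nice0 \<Theta>"
  shows "\<exists>C m. C \<ge> 0 \<and> (\<forall>x \<xi>. (1 + norm \<xi>) ^ k * cmod (\<Theta> x \<xi>) \<le> C * (1 + norm x) ^ m)"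
proof -
  obtain C m where C: "\<And>x \<xi>. (1 + norm \<xi>) ^ k * cmod (\<Theta> x \<xi>) \<le> C * (1 + norm x) ^ m"
    using assms unfolding nice0_def by metis
  have "C \<ge> 0" using order_trans[OF _ C[of 0 0]] by simp
  then show ?thesis using C by blast
qed

lemma nice0_cont:
  assumes "nice0 \<Theta>" "e > 0" shows "\<forall>\<^sub>F y in nhds x. \<forall>\<xi>. (1 + norm \<xi>) ^ k * cmod (\<Theta> y \<xi> - \<Theta> x \<xi>) \<le> e"
  using assms unfolding nice0_def by blast

lemma nice_famD:
  assumes "nice_fam \<Theta>"
  shows "schwartz (\<Theta> x)" "nice0 (\<lambda>x. Dl is (\<Theta> x))" "nice0 \<Theta>"
proof -
  show "schwartz (\<Theta> x)" "nice0 (\<lambda>x. Dl is (\<Theta> x))" using assms unfolding nice_fam_def by auto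
  have "nice0 (\<lambda>x. Dl [] (\<Theta> x))" using assms unfolding nice_fam_def by blast
  then show "nice0 \<Theta>" by simp
qed

lemma nice_fam_Dl: assumes "nice_fam \<Theta>" shows "nice_fam (\<lambda>x. Dl is (\<Theta> x))"
  unfolding nice_fam_def Dl_append[symmetric] using nice_famD[OF assms] schwartz_Dl by auto

section \<open>Stability of the family conditions\<close>

lemma nice0_add:
  fixes A B :: "(real^'n) \<Rightarrow> (real^'n) \<Rightarrow> complex"
  assumes A: "nice0 A" and B: "nice0 B" shows "nice0 (\<lambda>x \<xi>. A x \<xi> + B x \<xi>)"
  unfolding nice0_def
proof safe
  fix k
  obtain C m where C: "C \<ge> 0" "\<And>x \<xi>. (1 + norm \<xi>) ^ k * cmod (A x \<xi>) \<le> C * (1 + norm x) ^ m" using nice0_bound[OF A] by blast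
  obtain D n where D: "D \<ge> 0" "\<And>x \<xi>. (1 + norm \<xi>) ^ k * cmod (B x \<xi>) \<le> D * (1 + norm x) ^ n" using nice0_bound[OF B] by blast
  have "(1 + norm \<xi>) ^ k * cmod (A x \<xi> + B x \<xi>) \<le> (C + D) * (1 + norm x) ^ (m + n)" for x \<xi>
  proof -
    have "(1 + norm \<xi>) ^ k * cmod (A x \<xi> + B x \<xi>) \<le> (1 + norm \<xi>) ^ k * (cmod (A x \<xi>) + cmod (B x \<xi>))"
      by (intro mult_left_mono norm_triangle_ineq) auto
    also have "\<dots> \<le> C * (1 + norm x) ^ m + D * (1 + norm x) ^ n" unfolding distrib_left by (intro add_mono C D)
    also have "\<dots> \<le> C * (1 + norm x) ^ (m + n) + D * (1 + norm x) ^ (m + n)"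
      by (intro add_mono mult_left_mono power_increasing C D) auto
    finally show ?thesis by (simp add: distrib_right)
  qed
  then show "\<exists>C m. \<forall>x \<xi>. (1 + norm \<xi>) ^ k * cmod (A x \<xi> + B x \<xi>) \<le> C * (1 + norm x) ^ m" by blast
next
  fix k and x :: "real^'n" and e :: real assume "e > 0"
  then have "e / 2 > 0" by simp
  from nice0_cont[OF A this, of k x] nice0_cont[OF B this, of k x]
  show "\<forall>\<^sub>F y in nhds x. \<forall>\<xi>. (1 + norm \<xi>) ^ k * cmod (A y \<xi> + B y \<xi> - (A x \<xi> + B x \<xi>)) \<le> e"
  proof eventually_elim
    case (elim y)
    show ?case
    proof
      fix \<xi>
      have "A y \<xi> + B y \<xi> - (A x \<xi> + B x \<xi>) = (A y \<xi> - A x \<xi>) + (B y \<xi> - B x \<xi>)" by simp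
      then have "(1 + norm \<xi>) ^ k * cmod (A y \<xi> + B y \<xi> - (A x \<xi> + B x \<xi>)) \<le> (1 + norm \<xi>) ^ k * (cmod (A y \<xi> - A x \<xi>)
          + cmod (B y \<xi> - B x \<xi>))"
        by (simp only:) (intro mult_left_mono norm_triangle_ineq, simp)
      also have "\<dots> \<le> e / 2 + e / 2" unfolding distrib_left using elim by (intro add_mono) auto
      finally show "(1 + norm \<xi>) ^ k * cmod (A y \<xi> + B y \<xi> - (A x \<xi> + B x \<xi>)) \<le> e" by simp
    qed
  qed
qed

lemma nice0_mult:
  fixes A :: "(real^'n) \<Rightarrow> (real^'n) \<Rightarrow> complex"
  assumes A: "nice0 A" and g: "continuous_on UNIV g" "polyb g" shows "nice0 (\<lambda>x \<xi>. g x * A x \<xi>)"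
  unfolding nice0_def
proof safe
  fix k
  obtain C m where C: "C \<ge> 0" "\<And>x \<xi>. (1 + norm \<xi>) ^ k * cmod (A x \<xi>) \<le> C * (1 + norm x) ^ m" using nice0_bound[OF A] by blast
  obtain l D where D: "\<And>x. cmod (g x) \<le> D * (1 + norm x) ^ l" using g(2) unfolding polyb_def by blast
  have "(1 + norm \<xi>) ^ k * cmod (g x * A x \<xi>) \<le> (D * C) * (1 + norm x) ^ (l + m)" for x \<xi>
  proof -
    have "(1 + norm \<xi>) ^ k * cmod (g x * A x \<xi>) = cmod (g x) * ((1 + norm \<xi>) ^ k * cmod (A x \<xi>))" by (simp add: norm_mult)
    also have "\<dots> \<le> (D * (1 + norm x) ^ l) * (C * (1 + norm x) ^ m)"
      by (intro mult_mono D C order_trans[OF norm_ge_zero D]) auto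
    finally show ?thesis by (simp add: power_add mult_ac)
  qed
  then show "\<exists>C m. \<forall>x \<xi>. (1 + norm \<xi>) ^ k * cmod (g x * A x \<xi>) \<le> C * (1 + norm x) ^ m" by blast
next
  fix k and x :: "real^'n" and e :: real assume e: "e > 0"
  obtain C m where C: "C \<ge> 0" "\<And>x \<xi>. (1 + norm \<xi>) ^ k * cmod (A x \<xi>) \<le> C * (1 + norm x) ^ m" using nice0_bound[OF A] by blast
  define B where "B = C * (1 + norm x) ^ m"
  have B: "B \<ge> 0" "\<And>\<xi>. (1 + norm \<xi>) ^ k * cmod (A x \<xi>) \<le> B" unfolding B_def using C by auto
  \<comment> \<open>The difference of the products splits into two terms, each kept below
    \<open>e / 2\<close>. \<open>G\<close> bounds \<open>g\<close> near \<open>x\<close>, where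
    \<open>g\<close> changes by less than 1, and \<open>B + 1\<close> replaces \<open>B\<close> to
    avoid a zero denominator.\<close>
  define G where "G = cmod (g x) + 1"
  have G: "G > 0" unfolding G_def by (simp add: add_nonneg_pos)
  have gt: "(g \<longlongrightarrow> g x) (nhds x)" using g(1) by (simp add: continuous_on_eq_continuous_at isCont_def tendsto_at_iff_tendsto_nhds)
  have e2: "e / (2 * G) > 0" "e / (2 * (B + 1)) > 0" using e G B by auto
  have "\<forall>\<^sub>F y in nhds x. dist (g y) (g x) < min 1 (e / (2 * (B + 1)))"
    using e2 by (intro tendstoD[OF gt]) simp
  with nice0_cont[OF A e2(1), of k x]
  show "\<forall>\<^sub>F y in nhds x. \<forall>\<xi>. (1 + norm \<xi>) ^ k * cmod (g y * A y \<xi> - g x * A x \<xi>) \<le> e"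
  proof eventually_elim
    case (elim y)
    have d: "cmod (g y - g x) < 1" "cmod (g y - g x) \<le> e / (2 * (B + 1))" using elim(2) by (auto simp: dist_norm)
    have gy: "cmod (g y) \<le> G" unfolding G_def using d(1) norm_triangle_ineq2[of "g y" "g x"] by linarith
    show ?case
    proof
      fix \<xi> :: "real^'n"
      let ?w = "(1 + norm \<xi>) ^ k"
      have "g y * A y \<xi> - g x * A x \<xi> = g y * (A y \<xi> - A x \<xi>) + (g y - g x) * A x \<xi>" by (simp add: algebra_simps)
      then have "cmod (g y * A y \<xi> - g x * A x \<xi>) \<le> cmod (g y) * cmod (A y \<xi> - A x \<xi>) + cmod (g y - g x) * cmod (A x \<xi>)"
        by (simp only: norm_mult[symmetric] norm_triangle_ineq)
      then have "?w * cmod (g y * A y \<xi> - g x * A x \<xi>) \<le> ?w * (cmod (g y) * cmod (A y \<xi> - A x \<xi>) + cmod (g y - g x) * cmod (A x \<xi>))"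
        by (intro mult_left_mono) auto
      also have "\<dots> = cmod (g y) * (?w * cmod (A y \<xi> - A x \<xi>)) + cmod (g y - g x) * (?w * cmod (A x \<xi>))"
        by (simp only: distrib_left mult_ac)
      also have "\<dots> \<le> G * (e / (2 * G)) + e / (2 * (B + 1)) * (B + 1)"
      proof (intro add_mono mult_mono)
        show "?w * cmod (A x \<xi>) \<le> B + 1" using B(2)[of \<xi>] by linarith
      qed (use elim(1) gy d e2 G B in auto)
      also have "\<dots> = e"
      proof -
        have half: "e / (2 * D) * D = e / 2" if "D > 0" for D :: real using that by simp
        have "G * (e / (2 * G)) = e / 2" using half[OF G] by (simp only: mult.commute)
        moreover have "e / (2 * (B + 1)) * (B + 1) = e / 2" by (rule half) (use B in linarith)
        ultimately show ?thesis by linarith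
      qed
      finally show "?w * cmod (g y * A y \<xi> - g x * A x \<xi>) \<le> e" .
    qed
  qed
qed

text \<open>For large arguments one extra power of decay makes both translates small; on the
  remaining ball uniform continuity of \<open>f\<close> compares them.\<close>

lemma rapid_translation_nice0:
  fixes f :: "(real^'a) \<Rightarrow> complex"
  assumes f: "continuous_on UNIV f" "rapid f" shows "nice0 (\<lambda>\<eta> \<zeta>. f (\<zeta> - \<eta>))"
proof -
  have w: "1 + norm \<zeta> \<le> (1 + norm \<eta>) * (1 + norm (\<zeta> - \<eta>))" for \<zeta> \<eta> :: "real^'a"
  proof -
    have "norm \<zeta> \<le> norm \<eta> + norm (\<zeta> - \<eta>)" using norm_triangle_ineq[of \<eta> "\<zeta> - \<eta>"] by simp
    moreover have "0 \<le> norm \<eta> * norm (\<zeta> - \<eta>)" by simp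
    ultimately show ?thesis unfolding distrib_left distrib_right mult_1_left mult_1_right by linarith
  qed
  have bd: "(1 + norm \<zeta>) ^ k * cmod (f (\<zeta> - \<eta>)) \<le> C * (1 + norm \<eta>) ^ k"
    if C: "\<And>x. (1 + norm x) ^ k * cmod (f x) \<le> C" for k C \<zeta> \<eta>
  proof -
    have "(1 + norm \<zeta>) ^ k * cmod (f (\<zeta> - \<eta>)) \<le> ((1 + norm \<eta>) * (1 + norm (\<zeta> - \<eta>))) ^ k * cmod (f (\<zeta> - \<eta>))"
      by (intro mult_right_mono power_mono w) auto
    also have "\<dots> = (1 + norm \<eta>) ^ k * ((1 + norm (\<zeta> - \<eta>)) ^ k * cmod (f (\<zeta> - \<eta>)))" by (simp only: power_mult_distrib mult.assoc)
    also have "\<dots> \<le> (1 + norm \<eta>) ^ k * C" by (intro mult_left_mono C) auto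
    finally show ?thesis by (simp add: mult.commute)
  qed
  show ?thesis unfolding nice0_def
  proof safe
    fix k
    obtain C where "\<And>x. (1 + norm x) ^ k * cmod (f x) \<le> C" using f(2) unfolding rapid_def by metis
    from bd[OF this] show "\<exists>C m. \<forall>\<eta> \<zeta>. (1 + norm \<zeta>) ^ k * cmod (f (\<zeta> - \<eta>)) \<le> C * (1 + norm \<eta>) ^ m" by blast
  next
    fix k and \<eta> :: "real^'a" and e :: real assume e: "e > 0"
    obtain C where C: "\<And>x. (1 + norm x) ^ Suc k * cmod (f x) \<le> C" using f(2) unfolding rapid_def by metis
    have C0: "C \<ge> 0" using order_trans[OF _ C[of 0]] by simp
    define B where "B = C * (2 + norm \<eta>) ^ Suc k"
    have B0: "B \<ge> 0" unfolding B_def using C0 by simp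
    \<comment> \<open>Beyond radius \<open>R\<close> the spare factor
      \<open>1 + norm \<zeta>\<close> is at least \<open>2 * B / e\<close>, which reduces the bound
      \<open>B\<close> to \<open>e / 2\<close>.\<close>
    define R where "R = 2 * B / e"
    have R0: "R \<ge> 0" unfolding R_def using B0 e by simp
    have far: "(1 + norm \<zeta>) ^ k * cmod (f (\<zeta> - \<eta>')) \<le> e / 2" if \<zeta>: "norm \<zeta> \<ge> R" and \<eta>': "norm \<eta>' \<le> 1 + norm \<eta>" for \<zeta> \<eta>'
    proof -
      have "(1 + norm \<zeta>) * ((1 + norm \<zeta>) ^ k * cmod (f (\<zeta> - \<eta>'))) \<le> C * (1 + norm \<eta>') ^ Suc k"
        using bd[OF C, of \<zeta> \<eta>'] by (simp add: mult.assoc)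
      also have "\<dots> \<le> B" unfolding B_def using \<eta>' C0 by (intro mult_left_mono power_mono) auto
      also have "B = R * (e / 2)" unfolding R_def using e by simp
      also have "\<dots> \<le> (1 + norm \<zeta>) * (e / 2)" using \<zeta> e by (intro mult_right_mono) auto
      finally have "(1 + norm \<zeta>) * ((1 + norm \<zeta>) ^ k * cmod (f (\<zeta> - \<eta>'))) \<le> (1 + norm \<zeta>) * (e / 2)" .
      then show ?thesis by (rule mult_left_le_imp_le) (simp add: add_pos_nonneg)
    qed
    have "uniformly_continuous_on (cball 0 (R + norm \<eta> + 1)) f"
      by (intro compact_uniformly_continuous continuous_on_subset[OF f(1)]) auto
    moreover have "e / (1 + R) ^ k > 0" using e R0 by simp
    ultimately obtain d where d: "d > 0" "\<And>x y. x \<in> cball 0 (R + norm \<eta> + 1) \<Longrightarrow> y \<in> cball 0 (R + norm \<eta> + 1) \<Longrightarrow>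
        dist y x < d \<Longrightarrow> dist (f y) (f x) < e / (1 + R) ^ k"
      unfolding uniformly_continuous_on_def by metis
    have "\<forall>\<^sub>F \<eta>' in nhds \<eta>. dist \<eta>' \<eta> < min 1 d" unfolding eventually_nhds_metric using d(1) by (intro exI[of _ "min 1 d"]) auto
    then show "\<forall>\<^sub>F \<eta>' in nhds \<eta>. \<forall>\<zeta>. (1 + norm \<zeta>) ^ k * cmod (f (\<zeta> - \<eta>') - f (\<zeta> - \<eta>)) \<le> e"
    proof eventually_elim
      case (elim \<eta>')
      then have n: "norm (\<eta>' - \<eta>) < 1" "norm (\<eta>' - \<eta>) < d" by (auto simp: dist_norm)
      have \<eta>': "norm \<eta>' \<le> 1 + norm \<eta>" using n(1) norm_triangle_ineq2[of \<eta>' \<eta>] by linarith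
      show ?case
      proof
        fix \<zeta>
        show "(1 + norm \<zeta>) ^ k * cmod (f (\<zeta> - \<eta>') - f (\<zeta> - \<eta>)) \<le> e"
        proof (cases "norm \<zeta> \<ge> R")
          case True
          have "(1 + norm \<zeta>) ^ k * cmod (f (\<zeta> - \<eta>') - f (\<zeta> - \<eta>)) \<le> (1 + norm \<zeta>) ^ k * (cmod (f (\<zeta> - \<eta>')) + cmod (f (\<zeta> - \<eta>)))"
            by (intro mult_left_mono norm_triangle_ineq4) auto
          also have "\<dots> \<le> e / 2 + e / 2" unfolding distrib_left by (intro add_mono far True \<eta>') simp
          finally show ?thesis by simp
        next
          case False
          have "dist (f (\<zeta> - \<eta>')) (f (\<zeta> - \<eta>)) < e / (1 + R) ^ k"
          proof (rule d(2))
            show "\<zeta> - \<eta> \<in> cball 0 (R + norm \<eta> + 1)" using False norm_triangle_ineq4[of \<zeta> \<eta>] by simp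
            show "\<zeta> - \<eta>' \<in> cball 0 (R + norm \<eta> + 1)" using False \<eta>' norm_triangle_ineq4[of \<zeta> \<eta>'] by simp
            show "dist (\<zeta> - \<eta>') (\<zeta> - \<eta>) < d" using n(2) by (simp add: dist_norm norm_minus_commute)
          qed
          moreover have "(1 + norm \<zeta>) ^ k \<le> (1 + R) ^ k" using False by (intro power_mono) auto
          ultimately have "(1 + norm \<zeta>) ^ k * cmod (f (\<zeta> - \<eta>') - f (\<zeta> - \<eta>)) \<le> (1 + R) ^ k * (e / (1 + R) ^ k)"
            using R0 by (intro mult_mono) (auto simp: dist_norm)
          then show ?thesis using R0 by simp
        qed
      qed
    qed
  qed
qed

lemma Dl_translate: "schwartz f \<Longrightarrow> Dl is (\<lambda>\<zeta>. f (\<zeta> - \<eta>)) = (\<lambda>\<zeta>. Dl is f (\<zeta> - \<eta>))"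
proof (induction "is")
  case (Cons i js)
  have "has_pd i (\<lambda>\<zeta>. Dl js f (1 *\<^sub>R \<zeta> + - \<eta>)) (\<lambda>\<zeta>. complex_of_real 1 * pderiv_dir i (Dl js f) (1 *\<^sub>R \<zeta> + - \<eta>))"
    by (rule has_pd_affine[OF schwartzD(3)[OF schwartz_Dl[OF Cons.prems]]])
  from has_pd_imp(1)[OF this] Cons show ?case by simp
qed simp

lemma nice_fam_translation:
  assumes "schwartz f" shows "nice_fam (\<lambda>\<eta> \<zeta>. f (\<zeta> - \<eta>))"
  unfolding nice_fam_def Dl_translate[OF assms]
  using schwartz_translate[OF assms] rapid_translation_nice0 schwartzD(1,2)[OF schwartz_Dl[OF assms]] by blast

text \<open>Differentiating a modulated function in the inner variable produces a factor linear in
  the parameter. Closure under sums and such coordinate factors makes the class stable under all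
  derivatives.\<close>

inductive mod_fam :: "((real^'n::finite) \<Rightarrow> (real^'n) \<Rightarrow> complex) \<Rightarrow> bool" where
  base: "schwartz v \<Longrightarrow> mod_fam (\<lambda>x \<xi>. cis (\<xi> \<bullet> x) * v \<xi>)"
| add: "mod_fam A \<Longrightarrow> mod_fam B \<Longrightarrow> mod_fam (\<lambda>x \<xi>. A x \<xi> + B x \<xi>)"
| coord: "mod_fam A \<Longrightarrow> mod_fam (\<lambda>x \<xi>. (\<i> * complex_of_real (x $ i)) * A x \<xi>)"

lemma cmod_cis_diff_le: "cmod (cis a - cis b) \<le> \<bar>a - b\<bar>"
proof -
  have "norm (cis a - cis b) \<le> 1 * norm (a - b)"
  proof (rule differentiable_bound[of UNIV cis "\<lambda>t h. h *\<^sub>R (\<i> * cis t)"])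
    show "(cis has_derivative (\<lambda>h. h *\<^sub>R (\<i> * cis t))) (at t within UNIV)" for t
      using has_vector_derivative_cis unfolding has_vector_derivative_def .
    show "onorm (\<lambda>h. h *\<^sub>R (\<i> * cis t)) \<le> 1" for t by (rule onorm_bound) (auto simp: norm_mult)
  qed auto
  then show ?thesis by simp
qed

text \<open>\<open>cis\<close> is Lipschitz, so a change of the parameter costs one power of
  \<open>1 + norm \<xi>\<close>, which the decay of \<open>v\<close> pays for.\<close>

lemma mod_fam_base_nice0:
  fixes v :: "(real^'n) \<Rightarrow> complex"
  assumes v: "schwartz v" shows "nice0 (\<lambda>x \<xi>. cis (\<xi> \<bullet> x) * v \<xi>)"
  unfolding nice0_def
proof safe
  fix k
  obtain C where C: "\<And>\<xi>. (1 + norm \<xi>) ^ k * cmod (v \<xi>) \<le> C" using schwartzD(2)[OF v] unfolding rapid_def by metis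
  then show "\<exists>C m. \<forall>x \<xi>. (1 + norm \<xi>) ^ k * cmod (cis (\<xi> \<bullet> x) * v \<xi>) \<le> C * (1 + norm x) ^ m"
    by (intro exI[of _ C] exI[of _ 0]) (simp add: norm_mult)
next
  fix k and x :: "real^'n" and e :: real assume e: "e > 0"
  obtain C where C: "\<And>\<xi>. (1 + norm \<xi>) ^ Suc k * cmod (v \<xi>) \<le> C" using schwartzD(2)[OF v] unfolding rapid_def by metis
  have C0: "C \<ge> 0" using order_trans[OF _ C[of 0]] by simp
  have "\<forall>\<^sub>F y in nhds x. dist y x < e / (C + 1)"
    unfolding eventually_nhds_metric using e C0 by (intro exI[of _ "e / (C + 1)"]) auto
  then show "\<forall>\<^sub>F y in nhds x. \<forall>\<xi>. (1 + norm \<xi>) ^ k * cmod (cis (\<xi> \<bullet> y) * v \<xi> - cis (\<xi> \<bullet> x) * v \<xi>) \<le> e"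
  proof eventually_elim
    case (elim y)
    show ?case
    proof
      fix \<xi>
      have "cmod (cis (\<xi> \<bullet> y) - cis (\<xi> \<bullet> x)) \<le> \<bar>\<xi> \<bullet> (y - x)\<bar>" using cmod_cis_diff_le by (simp add: inner_diff_right)
      also have "\<dots> \<le> norm \<xi> * norm (y - x)" by (rule Cauchy_Schwarz_ineq2)
      also have "\<dots> \<le> (1 + norm \<xi>) * norm (y - x)" by (intro mult_right_mono) auto
      finally have c: "cmod (cis (\<xi> \<bullet> y) - cis (\<xi> \<bullet> x)) \<le> (1 + norm \<xi>) * norm (y - x)" .
      have "(1 + norm \<xi>) ^ k * cmod (cis (\<xi> \<bullet> y) * v \<xi> - cis (\<xi> \<bullet> x) * v \<xi>) = (1 + norm \<xi>) ^ k * (cmod (cis (\<xi> \<bullet> y)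
          - cis (\<xi> \<bullet> x)) * cmod (v \<xi>))"
        by (simp add: norm_mult left_diff_distrib[symmetric])
      also have "\<dots> \<le> (1 + norm \<xi>) ^ k * (((1 + norm \<xi>) * norm (y - x)) * cmod (v \<xi>))"
        by (intro mult_left_mono mult_right_mono c) auto
      also have "\<dots> = norm (y - x) * ((1 + norm \<xi>) ^ Suc k * cmod (v \<xi>))" by (simp only: power_Suc mult_ac)
      also have "\<dots> \<le> e / (C + 1) * (C + 1)"
        using elim C[of \<xi>] C0 e by (intro mult_mono) (auto simp: dist_norm)
      also have "\<dots> = e" using C0 by simp
      finally show "(1 + norm \<xi>) ^ k * cmod (cis (\<xi> \<bullet> y) * v \<xi> - cis (\<xi> \<bullet> x) * v \<xi>) \<le> e" .
    qed
  qed
qed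

lemma mod_fam_props:
  fixes A :: "(real^'n) \<Rightarrow> (real^'n) \<Rightarrow> complex"
  assumes "mod_fam A"
  shows "(\<forall>x. schwartz (A x)) \<and> nice0 A \<and> (\<forall>i. \<exists>A'. mod_fam A' \<and> (\<forall>x. pderiv_dir i (A x) = A' x))"
  using assms
proof induction
  case (base v)
  have s: "schwartz (\<lambda>\<xi>. cis (\<xi> \<bullet> x) * v \<xi>)" for x by (rule schwartz_modulate[OF base])
  have "\<exists>A'. mod_fam A' \<and> (\<forall>x. pderiv_dir i (\<lambda>\<xi>. cis (\<xi> \<bullet> x) * v \<xi>) = A' x)" for i
  proof (intro exI conjI allI)
    show "mod_fam (\<lambda>x \<xi>. cis (\<xi> \<bullet> x) * pderiv_dir i v \<xi> + (\<i> * complex_of_real (x $ i)) * (cis (\<xi> \<bullet> x) * v \<xi>))"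
      by (intro mod_fam.intros base schwartzD(4))
    have "has_pd i (\<lambda>\<xi>. cis (\<xi> \<bullet> x) * v \<xi>) (\<lambda>\<xi>. cis (\<xi> \<bullet> x) * pderiv_dir i v \<xi> + \<i> * complex_of_real (x $ i) * cis (\<xi> \<bullet> x) * v \<xi>)" for x
      by (rule has_pd_mult[OF has_pd_cis schwartzD(3)[OF base]])
    from has_pd_imp(1)[OF this]
    show "pderiv_dir i (\<lambda>\<xi>. cis (\<xi> \<bullet> x) * v \<xi>) = (\<lambda>\<xi>. cis (\<xi> \<bullet> x) * pderiv_dir i v \<xi>
        + (\<i> * complex_of_real (x $ i)) * (cis (\<xi> \<bullet> x) * v \<xi>))" for x
      by (simp only: mult.assoc)
  qed
  then show ?case using s mod_fam_base_nice0[OF base] by blast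
next
  case (add A B)
  have "\<exists>A'. mod_fam A' \<and> (\<forall>x. pderiv_dir i (\<lambda>\<xi>. A x \<xi> + B x \<xi>) = A' x)" for i
  proof -
    obtain A' B' where "mod_fam A'" "\<And>x. pderiv_dir i (A x) = A' x" "mod_fam B'" "\<And>x. pderiv_dir i (B x) = B' x"
      using add.IH by metis
    then show ?thesis
      using add.IH by (intro exI[of _ "\<lambda>x \<xi>. A' x \<xi> + B' x \<xi>"] conjI mod_fam.add allI) (simp_all add: pderiv_dir_add)
  qed
  moreover have "nice0 (\<lambda>x \<xi>. A x \<xi> + B x \<xi>)" using add.IH by (intro nice0_add) auto
  moreover have "schwartz (\<lambda>\<xi>. A x \<xi> + B x \<xi>)" for x using add.IH by (intro schwartz_add) auto
  ultimately show ?case by blast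
next
  case (coord A j)
  have "\<exists>A'. mod_fam A' \<and> (\<forall>x. pderiv_dir i (\<lambda>\<xi>. (\<i> * complex_of_real (x $ j)) * A x \<xi>) = A' x)" for i
  proof -
    obtain A' where "mod_fam A'" "\<And>x. pderiv_dir i (A x) = A' x" using coord.IH by metis
    then show ?thesis
      using coord.IH by (intro exI[of _ "\<lambda>x \<xi>. (\<i> * complex_of_real (x $ j)) * A' x \<xi>"] conjI mod_fam.coord allI)
        (simp_all only: pderiv_dir_scale)
  qed
  moreover have "slow (\<lambda>x::real^'n. \<i> * complex_of_real (x $ j))" by (rule slow_scale[OF slow_coord])
  then have "nice0 (\<lambda>x \<xi>. (\<i> * complex_of_real (x $ j)) * A x \<xi>)"
    using coord.IH smooth_inD(1,2) by (intro nice0_mult) blast+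
  moreover have "schwartz (\<lambda>\<xi>. (\<i> * complex_of_real (x $ j)) * A x \<xi>)" for x using coord.IH by (intro schwartz_scale) auto
  ultimately show ?case by blast
qed

lemma mod_fam_Dl: assumes "mod_fam A" shows "\<exists>A'. mod_fam A' \<and> (\<forall>x. Dl is (A x) = A' x)"
proof (induction "is")
  case Nil then show ?case using assms by auto
next
  case (Cons i js)
  then obtain A' where A': "mod_fam A'" "\<And>x. Dl js (A x) = A' x" by blast
  then show ?case using mod_fam_props[OF A'(1)] by simp
qed

lemma nice_fam_modulation:
  assumes "schwartz v" shows "nice_fam (\<lambda>x \<xi>. cis (\<xi> \<bullet> x) * v \<xi>)"
  unfolding nice_fam_def
proof (intro conjI allI)
  have m: "mod_fam (\<lambda>x \<xi>. cis (\<xi> \<bullet> x) * v \<xi>)" by (rule mod_fam.base[OF assms])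
  show "schwartz (\<lambda>\<xi>. cis (\<xi> \<bullet> x) * v \<xi>)" for x by (rule schwartz_modulate[OF assms])
  fix "is"
  obtain A' where "mod_fam A'" "\<And>x. Dl is (\<lambda>\<xi>. cis (\<xi> \<bullet> x) * v \<xi>) = A' x" using mod_fam_Dl[OF m] by blast
  then show "nice0 (\<lambda>x. Dl is (\<lambda>\<xi>. cis (\<xi> \<bullet> x) * v \<xi>))" using mod_fam_props[of A'] by simp
qed

section \<open>Exchanging a tempered distribution with an integral\<close>

lemma nice0_seminorm_tendsto:
  assumes \<Theta>: "nice_fam \<Theta>" and lim: "filterlim y (nhds x) F"
  shows "((\<lambda>j. schwartz_seminorm k is (\<lambda>\<xi>. \<Theta> (y j) \<xi> - \<Theta> x \<xi>)) \<longlongrightarrow> 0) F"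
proof (rule tendstoI)
  fix e :: real assume e: "e > 0"
  note s = nice_famD(1)[OF \<Theta>]
  have "\<forall>\<^sub>F j in F. \<forall>\<xi>. (1 + norm \<xi>) ^ k * cmod (Dl is (\<Theta> (y j)) \<xi> - Dl is (\<Theta> x) \<xi>) \<le> e / 2"
    by (rule eventually_compose_filterlim[OF nice0_cont[OF nice_famD(2)[OF \<Theta>, of "is"]] lim]) (use e in simp)
  then show "\<forall>\<^sub>F j in F. dist (schwartz_seminorm k is (\<lambda>\<xi>. \<Theta> (y j) \<xi> - \<Theta> x \<xi>)) 0 < e"
  proof eventually_elim
    case (elim j)
    have "schwartz_seminorm k is (\<lambda>\<xi>. \<Theta> (y j) \<xi> - \<Theta> x \<xi>) \<le> e / 2"
      by (rule seminorm_least) (use elim in \<open>simp add: Dl_diff s\<close>)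
    then show ?case using e seminorm_nonneg[OF schwartz_diff[OF s[of "y j"] s[of x]], of k "is"] by simp
  qed
qed

lemma tempered_nice_continuous:
  assumes T: "tempered T" and \<Theta>: "nice_fam \<Theta>" shows "continuous_on UNIV (\<lambda>x. T (\<Theta> x))"
  unfolding continuous_on_def
proof
  fix x
  show "((\<lambda>x. T (\<Theta> x)) \<longlongrightarrow> T (\<Theta> x)) (at x)"
    by (rule tempered_tendsto[OF T nice_famD(1)[OF \<Theta>] nice_famD(1)[OF \<Theta>]])
       (rule nice0_seminorm_tendsto[OF \<Theta> tendsto_ident_at])
qed

lemma polyb_sum: "finite I \<Longrightarrow> (\<And>i. i \<in> I \<Longrightarrow> polyb (f i)) \<Longrightarrow> polyb (\<lambda>x. \<Sum>i\<in>I. f i x)"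
proof (induction I rule: finite_induct)
  case empty show ?case using smooth_inD(2)[OF slow_const[of 0]] by simp
next
  case (insert i I)
  then show ?case
    using lin_closed_polyb[unfolded lin_closed_def, THEN conjunct1, rule_format, of "f i" "\<lambda>x. \<Sum>i\<in>I. f i x"] by simp
qed

lemma polyb_mono: "polyb g \<Longrightarrow> (\<And>x. cmod (f x) \<le> cmod (g x)) \<Longrightarrow> polyb f"
  unfolding polyb_def by (meson order_trans)

lemma polyb_seminorm:
  assumes \<Theta>: "nice_fam \<Theta>" shows "polyb (\<lambda>x. complex_of_real (schwartz_seminorm k is (\<Theta> x)))"
proof -
  obtain C m where C: "\<And>x \<xi>. (1 + norm \<xi>) ^ k * cmod (Dl is (\<Theta> x) \<xi>) \<le> C * (1 + norm x) ^ m"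
    using nice0_bound[OF nice_famD(2)[OF \<Theta>]] by blast
  have "schwartz_seminorm k is (\<Theta> x) \<le> C * (1 + norm x) ^ m" for x by (rule seminorm_least[OF C])
  then show ?thesis unfolding polyb_def norm_of_real
    using seminorm_nonneg[OF nice_famD(1)[OF \<Theta>]] by (intro exI[of _ m] exI[of _ C]) (simp add: abs_of_nonneg)
qed

lemma tempered_nice_polyb:
  assumes T: "tempered T" and \<Theta>: "nice_fam \<Theta>" shows "polyb (\<lambda>x. T (\<Theta> x))"
proof -
  obtain N C where C: "C \<ge> 0" "\<And>f. schwartz f \<Longrightarrow> cmod (T f) \<le> C * pN N f" using temperedD(3)[OF T] by blast
  have "polyb (\<lambda>x. complex_of_real C * (\<Sum>k\<le>N. \<Sum>is\<in>{is. length is \<le> N}. complex_of_real (schwartz_seminorm k is (\<Theta> x))))"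
    by (intro polyb_mult polyb_sum polyb_seminorm \<Theta> finite_multi_indices smooth_inD(2)[OF slow_const]) auto
  then have "polyb (\<lambda>x. complex_of_real (C * pN N (\<Theta> x)))" unfolding pN_def by simp
  then show ?thesis
  proof (rule polyb_mono)
    fix x show "cmod (T (\<Theta> x)) \<le> cmod (complex_of_real (C * pN N (\<Theta> x)))"
      unfolding norm_of_real by (rule order_trans[OF C(2)[OF nice_famD(1)[OF \<Theta>]] abs_ge_self])
  qed
qed

section \<open>Integrals against Schwartz weights\<close>

lemma rapid_mult_integrable:
  assumes "schwartz \<psi>" "g \<in> borel_measurable lebesgue" "polyb g" shows "integrable lebesgue (\<lambda>x. \<psi> x * g x)"
proof -
  have r: "rapid (\<lambda>x. g x * \<psi> x)" by (rule polyb_rapid_mult[OF assms(3) schwartzD(2)[OF assms(1)]])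
  obtain C where "\<And>x. (1 + norm x) ^ 0 * cmod (g x * \<psi> x) \<le> C * wt x" using rapid_wt_bound[OF r, of 0] by blast
  then have "integrable lebesgue (\<lambda>x. g x * \<psi> x)"
    by (intro integrable_wt_bound[of _ C] borel_measurable_times assms schwartz_measurable) simp_all
  then show ?thesis by (simp add: mult.commute)
qed

text \<open>The integral of a family with values in the Schwartz space, taken pointwise in the inner
  variable.\<close>

definition Ifam :: "((real^'n) \<Rightarrow> complex) \<Rightarrow> ((real^'n) \<Rightarrow> (real^'n) \<Rightarrow> complex) \<Rightarrow> (real^'n) \<Rightarrow> complex" where
  "Ifam \<psi> \<Theta> \<xi> = (LINT x|lebesgue. \<psi> x * \<Theta> x \<xi>)"

lemma nice0_continuous: assumes \<Theta>: "nice0 \<Theta>" shows "continuous_on UNIV (\<lambda>x. \<Theta> x \<xi>)"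
  unfolding continuous_on_def
proof
  fix x
  have "(\<lambda>y. \<Theta> y \<xi>) \<midarrow>x\<rightarrow> \<Theta> x \<xi>"
  proof (rule tendstoI)
    fix e :: real assume e: "e > 0"
    then have "\<forall>\<^sub>F y in nhds x. \<forall>\<xi>. (1 + norm \<xi>) ^ 0 * cmod (\<Theta> y \<xi> - \<Theta> x \<xi>) \<le> e / 2" by (intro nice0_cont[OF \<Theta>]) simp
    then have "\<forall>\<^sub>F y in nhds x. dist (\<Theta> y \<xi>) (\<Theta> x \<xi>) < e"
    proof eventually_elim
      case (elim y)
      then have "cmod (\<Theta> y \<xi> - \<Theta> x \<xi>) \<le> e / 2" by simp
      then show ?case using e by (simp add: dist_norm)
    qed
    then show "\<forall>\<^sub>F y in at x. dist (\<Theta> y \<xi>) (\<Theta> x \<xi>) < e" by (simp add: eventually_at_filter eventually_mono)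
  qed
  then show "((\<lambda>x. \<Theta> x \<xi>) \<longlongrightarrow> \<Theta> x \<xi>) (at x)" .
qed

lemma polyb_of_bound: "(\<And>x. cmod (f x) \<le> C * (1 + norm x) ^ m) \<Longrightarrow> polyb f"
  unfolding polyb_def by blast

lemma nice0_polyb: assumes \<Theta>: "nice0 \<Theta>" shows "polyb (\<lambda>x. \<Theta> x \<xi>)"
proof -
  obtain C m where "\<And>x \<xi>. (1 + norm \<xi>) ^ 0 * cmod (\<Theta> x \<xi>) \<le> C * (1 + norm x) ^ m" using nice0_bound[OF \<Theta>] by blast
  then show ?thesis by (intro polyb_of_bound[of _ C m]) simp
qed

lemma integrable_schwartz_nice:
  assumes "schwartz \<psi>" "nice0 \<Theta>" shows "integrable lebesgue (\<lambda>x. \<psi> x * \<Theta> x \<xi>)"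
  by (rule rapid_mult_integrable[OF assms(1) continuous_imp_lebesgue_measurable[OF nice0_continuous[OF assms(2)]] nice0_polyb[OF assms(2)]])

lemma integrable_schwartz_weight:
  assumes "schwartz \<psi>" shows "integrable lebesgue (\<lambda>x. cmod (\<psi> x) * (C * (1 + norm x) ^ m))"
proof -
  have c: "continuous_on UNIV (\<lambda>x::real^'a. complex_of_real (C * (1 + norm x) ^ m))" by (intro continuous_intros)
  have "cmod (complex_of_real (C * (1 + norm x) ^ m)) \<le> \<bar>C\<bar> * (1 + norm x) ^ m" for x :: "real^'a"
    unfolding norm_of_real by (simp add: abs_mult)
  then have p: "polyb (\<lambda>x::real^'a. complex_of_real (C * (1 + norm x) ^ m))" by (rule polyb_of_bound)
  from integrable_norm[OF rapid_mult_integrable[OF assms continuous_imp_lebesgue_measurable[OF c] p]]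
  have i: "integrable lebesgue (\<lambda>x. cmod (\<psi> x * complex_of_real (C * (1 + norm x) ^ m)))" .
  have "(if C < 0 then - 1 else 1) * cmod (\<psi> x * complex_of_real (C * (1 + norm x) ^ m)) = cmod (\<psi> x) * (C * (1 + norm x) ^ m)" for x
    unfolding norm_mult norm_of_real abs_mult by simp
  then show ?thesis using integrable_mult_right[OF i, of "if C < 0 then - 1 else 1"] by (simp only:)
qed

lemma has_pd_Ifam:
  assumes \<psi>: "schwartz \<psi>" and \<Theta>: "nice_fam \<Theta>"
  shows "has_pd i (Ifam \<psi> \<Theta>) (Ifam \<psi> (\<lambda>x. pderiv_dir i (\<Theta> x)))"
  unfolding has_pd_def Ifam_def
proof
  fix \<xi> :: "real^'a"
  have \<Theta>': "nice0 (\<lambda>x. pderiv_dir i (\<Theta> x))" using nice_famD(2)[OF \<Theta>, of "[i]"] by simp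
  obtain C m where C: "C \<ge> 0" "\<And>x \<xi>. (1 + norm \<xi>) ^ 0 * cmod (pderiv_dir i (\<Theta> x) \<xi>) \<le> C * (1 + norm x) ^ m"
    using nice0_bound[OF \<Theta>'] by blast
  have "((\<lambda>t. LINT x|lebesgue. \<psi> x * \<Theta> x (\<xi> + t *\<^sub>R axis i 1)) has_vector_derivative
     (LINT x|lebesgue. \<psi> x * pderiv_dir i (\<Theta> x) (\<xi> + 0 *\<^sub>R axis i 1))) (at 0)"
  proof (rule has_vector_derivative_integral[where w = "\<lambda>x. cmod (\<psi> x) * (C * (1 + norm x) ^ m)"])
    show "integrable lebesgue (\<lambda>x. \<psi> x * \<Theta> x (\<xi> + t *\<^sub>R axis i 1))" for t
      by (rule integrable_schwartz_nice[OF \<psi> nice_famD(3)[OF \<Theta>]])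
    show "((\<lambda>t. \<psi> x * \<Theta> x (\<xi> + t *\<^sub>R axis i 1)) has_vector_derivative \<psi> x * pderiv_dir i (\<Theta> x) (\<xi> + t *\<^sub>R axis i 1)) (at t)" for x t
      by (intro has_vector_derivative_mult_right has_pd_line schwartzD(3) nice_famD(1)[OF \<Theta>])
    show "cmod (\<psi> x * pderiv_dir i (\<Theta> x) (\<xi> + t *\<^sub>R axis i 1)) \<le> cmod (\<psi> x) * (C * (1 + norm x) ^ m)" for x t
      unfolding norm_mult using C(2)[of "\<xi> + t *\<^sub>R axis i 1" x] by (intro mult_left_mono) auto
    show "integrable lebesgue (\<lambda>x. cmod (\<psi> x) * (C * (1 + norm x) ^ m))" by (rule integrable_schwartz_weight[OF \<psi>])
    show "(\<lambda>x. \<psi> x * pderiv_dir i (\<Theta> x) (\<xi> + 0 *\<^sub>R axis i 1)) \<in> borel_measurable lebesgue"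
      by (rule borel_measurable_integrable[OF integrable_schwartz_nice[OF \<psi> \<Theta>']])
  qed
  then show "((\<lambda>t. LINT x|lebesgue. \<psi> x * \<Theta> x (\<xi> + t *\<^sub>R axis i 1)) has_vector_derivative
     (LINT x|lebesgue. \<psi> x * pderiv_dir i (\<Theta> x) \<xi>)) (at 0)" by simp
qed

text \<open>A derivative of the integral is the integral of the differentiated family, which is
  again a family of the same kind, so coinduction runs over the family with \<open>\<psi>\<close>
  fixed.\<close>

lemma schwartz_Ifam:
  assumes \<psi>: "schwartz \<psi>" and \<Theta>: "nice_fam \<Theta>" shows "schwartz (Ifam \<psi> \<Theta>)"
  using \<Theta> unfolding schwartz_eq[THEN fun_cong, of "Ifam \<psi> \<Theta>"]
proof (coinduction arbitrary: \<Theta> rule: smooth_in.coinduct)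
  case smooth_in
  note \<Theta> = smooth_in and s = nice_famD(1)[OF smooth_in] and n = nice_famD(3)[OF smooth_in]
  have "continuous_on UNIV (Ifam \<psi> \<Theta>)"
    unfolding continuous_on_sequentially comp_def
  proof safe
    fix X :: "nat \<Rightarrow> real^'a" and \<xi> assume X: "X \<longlonglongrightarrow> \<xi>"
    obtain C m where C: "C \<ge> 0" "\<And>x \<xi>. (1 + norm \<xi>) ^ 0 * cmod (\<Theta> x \<xi>) \<le> C * (1 + norm x) ^ m"
      using nice0_bound[OF n] by blast
    show "(\<lambda>j. Ifam \<psi> \<Theta> (X j)) \<longlonglongrightarrow> Ifam \<psi> \<Theta> \<xi>"
      unfolding Ifam_def
    proof (rule integral_dominated_convergence[OF _ _ integrable_schwartz_weight[OF \<psi>, of C m]])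
      show "AE x in lebesgue. (\<lambda>j. \<psi> x * \<Theta> x (X j)) \<longlonglongrightarrow> \<psi> x * \<Theta> x \<xi>"
      proof (intro always_eventually allI tendsto_mult tendsto_const)
        fix x show "(\<lambda>j. \<Theta> x (X j)) \<longlonglongrightarrow> \<Theta> x \<xi>"
          using schwartzD(1)[OF s] X unfolding continuous_on_sequentially comp_def by blast
      qed
      show "AE x in lebesgue. cmod (\<psi> x * \<Theta> x (X j)) \<le> cmod (\<psi> x) * (C * (1 + norm x) ^ m)" for j
        unfolding norm_mult using C(2)[of "X j"] by (intro always_eventually allI mult_left_mono) auto
    qed (intro borel_measurable_integrable integrable_schwartz_nice \<psi> n)+
  qed
  moreover have "rapid (Ifam \<psi> \<Theta>)"
    unfolding rapid_def
  proof
    fix k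
    obtain C m where C: "C \<ge> 0" "\<And>x \<xi>. (1 + norm \<xi>) ^ k * cmod (\<Theta> x \<xi>) \<le> C * (1 + norm x) ^ m"
      using nice0_bound[OF n] by blast
    have "(1 + norm \<xi>) ^ k * cmod (Ifam \<psi> \<Theta> \<xi>) \<le> (LINT x|lebesgue. cmod (\<psi> x) * (C * (1 + norm x) ^ m))" for \<xi>
    proof -
      have i: "integrable lebesgue (\<lambda>x. cmod (\<psi> x * \<Theta> x \<xi>))" by (intro integrable_norm integrable_schwartz_nice \<psi> n)
      have "(1 + norm \<xi>) ^ k * cmod (Ifam \<psi> \<Theta> \<xi>) \<le> (1 + norm \<xi>) ^ k * (LINT x|lebesgue. cmod (\<psi> x * \<Theta> x \<xi>))"
        unfolding Ifam_def by (intro mult_left_mono integral_norm_bound) auto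
      also have "\<dots> = (LINT x|lebesgue. (1 + norm \<xi>) ^ k * cmod (\<psi> x * \<Theta> x \<xi>))" by (rule integral_mult_right_zero[symmetric])
      also have "\<dots> \<le> (LINT x|lebesgue. cmod (\<psi> x) * (C * (1 + norm x) ^ m))"
      proof (rule integral_mono[OF integrable_mult_right[OF i] integrable_schwartz_weight[OF \<psi>]])
        fix x
        have "(1 + norm \<xi>) ^ k * cmod (\<psi> x * \<Theta> x \<xi>) = cmod (\<psi> x) * ((1 + norm \<xi>) ^ k * cmod (\<Theta> x \<xi>))" by (simp add: norm_mult)
        also have "\<dots> \<le> cmod (\<psi> x) * (C * (1 + norm x) ^ m)" by (intro mult_left_mono C) auto
        finally show "(1 + norm \<xi>) ^ k * cmod (\<psi> x * \<Theta> x \<xi>) \<le> cmod (\<psi> x) * (C * (1 + norm x) ^ m)" .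
      qed
      finally show ?thesis .
    qed
    then show "\<exists>C. \<forall>\<xi>. (1 + norm \<xi>) ^ k * cmod (Ifam \<psi> \<Theta> \<xi>) \<le> C" by blast
  qed
  moreover have "\<exists>f'. has_pd i (Ifam \<psi> \<Theta>) f' \<and> ((\<exists>\<Theta>. f' = Ifam \<psi> \<Theta> \<and> nice_fam \<Theta>) \<or> smooth_in rapid f')" for i
    using has_pd_Ifam[OF \<psi> \<Theta>, of i] nice_fam_Dl[OF \<Theta>, of "[i]"] by auto
  ultimately show ?case by blast
qed

lemma Dl_Ifam:
  assumes \<psi>: "schwartz \<psi>" and \<Theta>: "nice_fam \<Theta>" shows "Dl is (Ifam \<psi> \<Theta>) = Ifam \<psi> (\<lambda>x. Dl is (\<Theta> x))"
proof (induction "is")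
  case (Cons i js)
  then show ?case using has_pd_imp(1)[OF has_pd_Ifam[OF \<psi> nice_fam_Dl[OF \<Theta>, of js]]] by simp
qed simp

text \<open>Simple functions converging to the identity serve as sample points of a Riemann-type
  sum; the norm bound keeps polynomially bounded integrands dominated.\<close>

lemma simple_sampling:
  "\<exists>s :: nat \<Rightarrow> (real^'n) \<Rightarrow> real^'n. (\<forall>j. simple_function lebesgue (s j)) \<and> (\<forall>x. (\<lambda>j. s j x) \<longlonglongrightarrow> x) \<and> (\<forall>j x. norm (s j x) \<le> 2 * norm x)"
proof -
  have "(\<lambda>x::real^'n. x) \<in> borel_measurable lebesgue" by (rule measurable_completion) simp
  from borel_measurable_implies_sequence_metric[OF this, of 0] show ?thesis by auto
qed

text \<open>After sampling, only finitely many values of \<open>h\<close> occur, so the integral is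
  a finite sum for an arbitrary \<open>h\<close>. This allows \<open>h\<close> to be a tempered
  distribution evaluated on a family.\<close>

lemma sampled_integral:
  fixes s :: "(real^'n) \<Rightarrow> real^'n" and \<psi> h :: "(real^'n) \<Rightarrow> complex"
  assumes s: "simple_function lebesgue s" and \<psi>: "integrable lebesgue \<psi>"
  shows "(LINT x|lebesgue. \<psi> x * h (s x)) = (\<Sum>y\<in>range s. (LINT x|lebesgue. \<psi> x * indicator (s -` {y}) x) * h y)"
    and "integrable lebesgue (\<lambda>x. \<psi> x * h (s x))"
proof -
  have fin: "finite (range s)" using simple_functionD(1)[OF s] by simp
  have m: "s -` {y} \<in> sets lebesgue" for y using simple_functionD(2)[OF s, of "{y}"] by simp
  have i: "integrable lebesgue (\<lambda>x. \<psi> x * indicator (s -` {y}) x)" for y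
  proof -
    have "indicator (s -` {y}) x *\<^sub>R \<psi> x = \<psi> x * indicator (s -` {y}) x" for x by (simp add: indicator_def)
    then show ?thesis using integrable_mult_indicator[OF m \<psi>, of y] by (simp only:)
  qed
  have eq: "\<psi> x * h (s x) = (\<Sum>y\<in>range s. (\<psi> x * indicator (s -` {y}) x) * h y)" for x
  proof -
    have "(\<Sum>y\<in>range s. (\<psi> x * indicator (s -` {y}) x) * h y) = (\<Sum>y\<in>range s. if y = s x then \<psi> x * h y else 0)"
      by (intro sum.cong refl) (auto simp: indicator_def)
    then show ?thesis using fin by (simp add: sum.delta')
  qed
  show "integrable lebesgue (\<lambda>x. \<psi> x * h (s x))" unfolding eq
    by (intro Bochner_Integration.integrable_sum integrable_mult_left i)
  show "(LINT x|lebesgue. \<psi> x * h (s x)) = (\<Sum>y\<in>range s. (LINT x|lebesgue. \<psi> x * indicator (s -` {y}) x) * h y)"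
    unfolding eq by (subst Bochner_Integration.integral_sum) (auto intro: integrable_mult_left i)
qed

text \<open>For quantities depending on both the sample point and the point itself: the finitely
  many level sets of \<open>s\<close> reduce measurability to each fixed sample.\<close>

lemma simple_function_compose_measurable:
  fixes H :: "(real^'n) \<Rightarrow> (real^'n) \<Rightarrow> 'b::real_normed_vector"
  assumes s: "simple_function lebesgue s" and H: "\<And>y. H y \<in> borel_measurable lebesgue"
  shows "(\<lambda>x. H (s x) x) \<in> borel_measurable lebesgue"
proof (rule measurable_compose_countable'[where I = "range s" and f = H and g = s])
  show "s \<in> lebesgue \<rightarrow>\<^sub>M count_space (range s)"
    using measurable_simple_function[OF s] simple_functionD[OF s] by (simp add: measurable_count_space_eq2 measurable_sets)
  show "countable (range s)" using simple_functionD(1)[OF s] by (simp add: countable_finite)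
qed (rule H)

lemma sampled_dominated:
  fixes s :: "nat \<Rightarrow> (real^'n) \<Rightarrow> real^'n" and g \<psi> :: "(real^'n) \<Rightarrow> complex"
  assumes s: "\<And>j. simple_function lebesgue (s j)" "\<And>x. (\<lambda>j. s j x) \<longlonglongrightarrow> x" "\<And>j x. norm (s j x) \<le> 2 * norm x"
    and \<psi>: "schwartz \<psi>" and g: "continuous_on UNIV g" "polyb g"
  shows "(\<lambda>j. LINT x|lebesgue. \<psi> x * g (s j x)) \<longlonglongrightarrow> (LINT x|lebesgue. \<psi> x * g x)"
proof -
  obtain k C where C: "\<And>x. cmod (g x) \<le> C * (1 + norm x) ^ k" using g(2) unfolding polyb_def by blast
  have C0: "C \<ge> 0" using C[of 0] by (simp add: order_trans[OF norm_ge_zero])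
  show ?thesis
  proof (rule integral_dominated_convergence[OF _ _ integrable_schwartz_weight[OF \<psi>, of "C * 2 ^ k" k]])
    show "(\<lambda>x. \<psi> x * g x) \<in> borel_measurable lebesgue"
      by (intro borel_measurable_times schwartz_measurable(1)[OF \<psi>] continuous_imp_lebesgue_measurable g)
    show "(\<lambda>x. \<psi> x * g (s j x)) \<in> borel_measurable lebesgue" for j
      by (rule borel_measurable_integrable[OF sampled_integral(2)[OF s(1) schwartz_integrable[OF \<psi>]]])
    show "AE x in lebesgue. (\<lambda>j. \<psi> x * g (s j x)) \<longlonglongrightarrow> \<psi> x * g x"
    proof (intro always_eventually allI tendsto_mult tendsto_const)
      fix x show "(\<lambda>j. g (s j x)) \<longlonglongrightarrow> g x"
        using g(1) s(2)[of x] unfolding continuous_on_sequentially comp_def by blast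
    qed
    show "AE x in lebesgue. cmod (\<psi> x * g (s j x)) \<le> cmod (\<psi> x) * (C * 2 ^ k * (1 + norm x) ^ k)" for j
      unfolding norm_mult
    proof (intro always_eventually allI mult_left_mono)
      fix x
      have "1 + norm (s j x) \<le> 2 * (1 + norm x)" using s(3)[of j x] by simp
      then have "(1 + norm (s j x)) ^ k \<le> (2 * (1 + norm x)) ^ k" by (intro power_mono) auto
      then have "C * (1 + norm (s j x)) ^ k \<le> C * (2 ^ k * (1 + norm x) ^ k)"
        unfolding power_mult_distrib using C0 by (rule mult_left_mono)
      then show "cmod (g (s j x)) \<le> C * 2 ^ k * (1 + norm x) ^ k" using C[of "s j x"] by (simp add: mult.assoc)
    qed simp
  qed
qed

lemma seminorm_triangle:
  assumes "schwartz f" "schwartz g" "schwartz h"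
  shows "schwartz_seminorm k is (\<lambda>\<xi>. f \<xi> - h \<xi>) \<le> schwartz_seminorm k is (\<lambda>\<xi>. f \<xi> - g \<xi>) + schwartz_seminorm k is (\<lambda>\<xi>. g \<xi> - h \<xi>)"
proof (rule seminorm_least)
  fix x
  have "Dl is (\<lambda>\<xi>. f \<xi> - h \<xi>) x = Dl is (\<lambda>\<xi>. f \<xi> - g \<xi>) x + Dl is (\<lambda>\<xi>. g \<xi> - h \<xi>) x"
    using assms by (simp add: Dl_diff)
  then have "(1 + norm x) ^ k * cmod (Dl is (\<lambda>\<xi>. f \<xi> - h \<xi>) x)
      \<le> (1 + norm x) ^ k * (cmod (Dl is (\<lambda>\<xi>. f \<xi> - g \<xi>) x) + cmod (Dl is (\<lambda>\<xi>. g \<xi> - h \<xi>) x))"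
    by (simp only:) (intro mult_left_mono norm_triangle_ineq, simp)
  also have "\<dots> \<le> schwartz_seminorm k is (\<lambda>\<xi>. f \<xi> - g \<xi>) + schwartz_seminorm k is (\<lambda>\<xi>. g \<xi> - h \<xi>)"
    unfolding distrib_left by (intro add_mono seminorm_upper schwartz_diff assms)
  finally show "(1 + norm x) ^ k * cmod (Dl is (\<lambda>\<xi>. f \<xi> - h \<xi>) x)
      \<le> schwartz_seminorm k is (\<lambda>\<xi>. f \<xi> - g \<xi>) + schwartz_seminorm k is (\<lambda>\<xi>. g \<xi> - h \<xi>)" .
qed

text \<open>A seminorm is a supremum over uncountably many points; its measurability in the
  parameter comes from continuity, which the triangle inequality reduces to continuity of the
  family.\<close>

lemma seminorm_continuous:
  assumes \<Theta>: "nice_fam \<Theta>" and f: "schwartz f"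
  shows "continuous_on UNIV (\<lambda>x. schwartz_seminorm k is (\<lambda>\<xi>. f \<xi> - \<Theta> x \<xi>))"
  unfolding continuous_on_def
proof
  fix x
  note s = nice_famD(1)[OF \<Theta>]
  let ?S = "\<lambda>f g. schwartz_seminorm k is (\<lambda>\<xi>. f \<xi> - g \<xi>)"
  have sym: "?S u v = ?S v u" if "schwartz u" "schwartz v" for u v
    unfolding schwartz_seminorm_def by (simp add: Dl_diff that norm_minus_commute)
  have L: "((\<lambda>y. ?S (\<Theta> y) (\<Theta> x)) \<longlongrightarrow> 0) (at x)" by (rule nice0_seminorm_tendsto[OF \<Theta> tendsto_ident_at])
  have N: "norm (?S f (\<Theta> y) - ?S f (\<Theta> x)) \<le> ?S (\<Theta> y) (\<Theta> x)" for y
    using seminorm_triangle[OF f s[of x] s[of y], of k "is"] seminorm_triangle[OF f s[of y] s[of x], of k "is"] sym[OF s[of x] s[of y]]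
    by simp
  have "((\<lambda>y. ?S f (\<Theta> y) - ?S f (\<Theta> x)) \<longlongrightarrow> 0) (at x)"
    by (rule Lim_null_comparison[OF always_eventually[OF allI[OF N]] L])
  then show "((\<lambda>y. ?S f (\<Theta> y)) \<longlongrightarrow> ?S f (\<Theta> x)) (at x)" by (rule LIM_zero_cancel)
qed

text \<open>Sampling the parameter by simple functions turns the integral into finite sums, which converge in
  every Schwartz seminorm.\<close>

lemma tempered_Ifam:
  fixes T :: "((real^'n) \<Rightarrow> complex) \<Rightarrow> complex"
  assumes T: "tempered T" and \<psi>: "schwartz \<psi>" and \<Theta>: "nice_fam \<Theta>"
  shows "T (Ifam \<psi> \<Theta>) = (LINT x|lebesgue. \<psi> x * T (\<Theta> x))"
proof -
  note sch = nice_famD(1)[OF \<Theta>]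
  obtain s :: "nat \<Rightarrow> (real^'n) \<Rightarrow> real^'n" where s: "\<And>j. simple_function lebesgue (s j)" "\<And>x. (\<lambda>j. s j x) \<longlonglongrightarrow> x"
      "\<And>j x. norm (s j x) \<le> 2 * norm x"
    using simple_sampling by blast
  define f where "f j \<xi> = (LINT x|lebesgue. \<psi> x * \<Theta> (s j x) \<xi>)" for j \<xi>
  let ?c = "\<lambda>j y. LINT x|lebesgue. \<psi> x * indicator (s j -` {y}) x"
  have fin: "finite (range (s j))" for j using simple_functionD(1)[OF s(1)] by simp
  have f_eq: "f j = (\<lambda>\<xi>. \<Sum>y\<in>range (s j). ?c j y * \<Theta> y \<xi>)" for j
    unfolding f_def by (intro ext sampled_integral(1)[OF s(1) schwartz_integrable[OF \<psi>]])
  have f: "schwartz (f j)" "T (f j) = (\<Sum>y\<in>range (s j). ?c j y * T (\<Theta> y))"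
    "Dl is (f j) = (\<lambda>\<xi>. \<Sum>y\<in>range (s j). ?c j y * Dl is (\<Theta> y) \<xi>)" for j "is"
    unfolding f_eq using tempered_sum[OF T fin, of j \<Theta> "?c j" "is"] sch by blast+
  have Tf: "T (f j) = (LINT x|lebesgue. \<psi> x * T (\<Theta> (s j x)))" for j
    unfolding f(2) by (rule sampled_integral(1)[OF s(1) schwartz_integrable[OF \<psi>], symmetric])
  have Df: "Dl is (f j) \<xi> = (LINT x|lebesgue. \<psi> x * Dl is (\<Theta> (s j x)) \<xi>)" for j "is" \<xi>
    unfolding f(3) by (rule sampled_integral(1)[OF s(1) schwartz_integrable[OF \<psi>], symmetric])
  have "(\<lambda>j. T (f j)) \<longlonglongrightarrow> (LINT x|lebesgue. \<psi> x * T (\<Theta> x))"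
    unfolding Tf by (rule sampled_dominated[OF s \<psi> tempered_nice_continuous[OF T \<Theta>] tempered_nice_polyb[OF T \<Theta>]])
  moreover have "(\<lambda>j. T (f j)) \<longlonglongrightarrow> T (Ifam \<psi> \<Theta>)"
  proof (rule tempered_tendsto[OF T schwartz_Ifam[OF \<psi> \<Theta>] f(1)])
    fix k "is"
    \<comment> \<open>The sampling error at \<open>x\<close> in one fixed seminorm. Dominated
      convergence sends its weighted integral to 0, and the estimate \<open>le\<close> below shows
      that this integral bounds the seminorm of the difference.\<close>
    define S where "S j x = schwartz_seminorm k is (\<lambda>\<xi>. \<Theta> (s j x) \<xi> - \<Theta> x \<xi>)" for j x
    obtain C m where C: "C \<ge> 0" "\<And>x \<xi>. (1 + norm \<xi>) ^ k * cmod (Dl is (\<Theta> x) \<xi>) \<le> C * (1 + norm x) ^ m"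
      using nice0_bound[OF nice_famD(2)[OF \<Theta>]] by blast
    have S0: "0 \<le> S j x" for j x unfolding S_def by (rule seminorm_nonneg[OF schwartz_diff[OF sch sch]])
    have Sb: "S j x \<le> (C * 2 ^ m + C) * (1 + norm x) ^ m" for j x
      unfolding S_def
    proof (rule seminorm_least)
      fix \<xi>
      have "1 + norm (s j x) \<le> 2 * (1 + norm x)" using s(3)[of j x] by simp
      then have "(1 + norm (s j x)) ^ m \<le> (2 * (1 + norm x)) ^ m" by (intro power_mono) auto
      then have p: "C * (1 + norm (s j x)) ^ m \<le> C * (2 ^ m * (1 + norm x) ^ m)"
        unfolding power_mult_distrib using C(1) by (rule mult_left_mono)
      have "(1 + norm \<xi>) ^ k * cmod (Dl is (\<Theta> (s j x)) \<xi> - Dl is (\<Theta> x) \<xi>) \<le> (1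
          + norm \<xi>) ^ k * (cmod (Dl is (\<Theta> (s j x)) \<xi>) + cmod (Dl is (\<Theta> x) \<xi>))"
        by (intro mult_left_mono norm_triangle_ineq4) auto
      also have "\<dots> \<le> C * (2 ^ m * (1 + norm x) ^ m) + C * (1 + norm x) ^ m"
        unfolding distrib_left by (intro add_mono C(2) order_trans[OF C(2) p])
      finally show "(1 + norm \<xi>) ^ k * cmod (Dl is (\<lambda>\<xi>. \<Theta> (s j x) \<xi> - \<Theta> x \<xi>) \<xi>) \<le> (C * 2 ^ m + C) * (1 + norm x) ^ m"
        by (simp add: Dl_diff sch distrib_right mult.assoc)
    qed
    have Sm: "S j \<in> borel_measurable lebesgue" for j
      unfolding S_def
      by (rule simple_function_compose_measurable[OF s(1)])
         (intro continuous_imp_lebesgue_measurable seminorm_continuous \<Theta> sch)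
    have "(\<lambda>j. LINT x|lebesgue. cmod (\<psi> x) * S j x) \<longlonglongrightarrow> (LINT x|(lebesgue :: (real^'n) measure). 0)"
    proof (rule integral_dominated_convergence[OF _ _ integrable_schwartz_weight[OF \<psi>, of "C * 2 ^ m + C" m]])
      note [measurable] = Sm schwartz_measurable(1)[OF \<psi>]
      show "(\<lambda>x. cmod (\<psi> x) * S j x) \<in> borel_measurable lebesgue" for j by measurable
      show "AE x in lebesgue. (\<lambda>j. cmod (\<psi> x) * S j x) \<longlonglongrightarrow> 0"
        unfolding S_def by (intro always_eventually allI tendsto_mult_right_zero nice0_seminorm_tendsto[OF \<Theta>] s(2))
      show "AE x in lebesgue. norm (cmod (\<psi> x) * S j x) \<le> cmod (\<psi> x) * ((C * 2 ^ m + C) * (1 + norm x) ^ m)" for j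
        using Sb[of j] S0[of j] by (intro always_eventually allI) (simp add: abs_mult mult_left_mono)
    qed simp
    then have lim: "(\<lambda>j. LINT x|lebesgue. cmod (\<psi> x) * S j x) \<longlonglongrightarrow> 0" by simp
    have Si: "integrable lebesgue (\<lambda>x. cmod (\<psi> x) * S j x)" for j
    proof (rule Bochner_Integration.integrable_bound[OF integrable_schwartz_weight[OF \<psi>, of "C * 2 ^ m + C" m]])
      note [measurable] = Sm[of j] schwartz_measurable(1)[OF \<psi>]
      show "(\<lambda>x. cmod (\<psi> x) * S j x) \<in> borel_measurable lebesgue" by measurable
      show "AE x in lebesgue. norm (cmod (\<psi> x) * S j x) \<le> norm (cmod (\<psi> x) * ((C * 2 ^ m + C) * (1 + norm x) ^ m))"
        using Sb[of j] S0[of j] C(1) by (intro always_eventually allI) (simp add: abs_mult mult_left_mono)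
    qed
    have le: "schwartz_seminorm k is (\<lambda>\<xi>. f j \<xi> - Ifam \<psi> \<Theta> \<xi>) \<le> (LINT x|lebesgue. cmod (\<psi> x) * S j x)" for j
    proof (rule seminorm_least)
      fix \<xi>
      have i1: "integrable lebesgue (\<lambda>x. \<psi> x * Dl is (\<Theta> (s j x)) \<xi>)" by (rule sampled_integral(2)[OF s(1) schwartz_integrable[OF \<psi>]])
      have i2: "integrable lebesgue (\<lambda>x. \<psi> x * Dl is (\<Theta> x) \<xi>)" by (rule integrable_schwartz_nice[OF \<psi> nice_famD(2)[OF \<Theta>]])
      have "Dl is (\<lambda>\<xi>. f j \<xi> - Ifam \<psi> \<Theta> \<xi>) \<xi> = (LINT x|lebesgue. \<psi> x * Dl is (\<Theta> (s j x)) \<xi> - \<psi> x * Dl is (\<Theta> x) \<xi>)"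
        unfolding Dl_diff[OF f(1) schwartz_Ifam[OF \<psi> \<Theta>]] Df Dl_Ifam[OF \<psi> \<Theta>] unfolding Ifam_def using i1 i2 by simp
      then have "(1 + norm \<xi>) ^ k * cmod (Dl is (\<lambda>\<xi>. f j \<xi> - Ifam \<psi> \<Theta> \<xi>) \<xi>)
          \<le> (1 + norm \<xi>) ^ k * (LINT x|lebesgue. cmod (\<psi> x * Dl is (\<Theta> (s j x)) \<xi> - \<psi> x * Dl is (\<Theta> x) \<xi>))"
        by (simp only:) (intro mult_left_mono integral_norm_bound, simp)
      also have "\<dots> = (LINT x|lebesgue. (1 + norm \<xi>) ^ k * cmod (\<psi> x * Dl is (\<Theta> (s j x)) \<xi> - \<psi> x * Dl is (\<Theta> x) \<xi>))"
        by (rule integral_mult_right_zero[symmetric])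
      also have "\<dots> \<le> (LINT x|lebesgue. cmod (\<psi> x) * S j x)"
      proof (rule integral_mono[OF integrable_mult_right Si])
        show "integrable lebesgue (\<lambda>x. cmod (\<psi> x * Dl is (\<Theta> (s j x)) \<xi> - \<psi> x * Dl is (\<Theta> x) \<xi>))"
          by (intro integrable_norm Bochner_Integration.integrable_diff i1 i2)
        fix x
        have "(1 + norm \<xi>) ^ k * cmod (\<psi> x * Dl is (\<Theta> (s j x)) \<xi> - \<psi> x * Dl is (\<Theta> x) \<xi>)
          = cmod (\<psi> x) * ((1 + norm \<xi>) ^ k * cmod (Dl is (\<lambda>\<xi>. \<Theta> (s j x) \<xi> - \<Theta> x \<xi>) \<xi>))"
          by (simp add: Dl_diff sch right_diff_distrib[symmetric] norm_mult)
        also have "\<dots> \<le> cmod (\<psi> x) * S j x" unfolding S_def by (intro mult_left_mono seminorm_upper schwartz_diff sch) simp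
        finally show "(1 + norm \<xi>) ^ k * cmod (\<psi> x * Dl is (\<Theta> (s j x)) \<xi> - \<psi> x * Dl is (\<Theta> x) \<xi>) \<le> cmod (\<psi> x) * S j x" .
      qed
      finally show "(1 + norm \<xi>) ^ k * cmod (Dl is (\<lambda>\<xi>. f j \<xi> - Ifam \<psi> \<Theta> \<xi>) \<xi>) \<le> (LINT x|lebesgue. cmod (\<psi> x) * S j x)" .
    qed
    show "(\<lambda>j. schwartz_seminorm k is (\<lambda>x. f j x - Ifam \<psi> \<Theta> x)) \<longlonglongrightarrow> 0"
      by (rule tendsto_sandwich[OF _ _ tendsto_const lim])
         (auto intro!: always_eventually le seminorm_nonneg schwartz_diff f(1) schwartz_Ifam[OF \<psi> \<Theta>])
  qed
  ultimately show ?thesis using LIMSEQ_unique by blast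
qed

section \<open>Fourier multipliers with distributional symbols\<close>

text \<open>On the Fourier side both derivatives are multiplications, which commute; inversion
  brings the identity back.\<close>

lemma pderiv_dir_commute:
  assumes f: "schwartz f" shows "pderiv_dir i (pderiv_dir j f) = pderiv_dir j (pderiv_dir i f)"
proof -
  have s: "schwartz (pderiv_dir i (pderiv_dir j f))" "schwartz (pderiv_dir j (pderiv_dir i f))"
    by (intro schwartzD(4) f)+
  have "FT (pderiv_dir i (pderiv_dir j f)) = FT (pderiv_dir j (pderiv_dir i f))"
    by (simp add: fun_eq_iff FT_pderiv schwartzD(4) f)
  then have "IFT (FT (pderiv_dir i (pderiv_dir j f))) = IFT (FT (pderiv_dir j (pderiv_dir i f)))" by (rule arg_cong)
  then show ?thesis unfolding IFT_FT[OF s(1)] IFT_FT[OF s(2)] .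
qed

lemma Dl_pderiv: "schwartz f \<Longrightarrow> Dl is (pderiv_dir i f) = pderiv_dir i (Dl is f)"
  by (induction "is") (simp_all add: pderiv_dir_commute schwartz_Dl)

text \<open>The difference quotients of the translates converge in every Schwartz seminorm: their
  linearisation error is controlled by how much the derivative varies along a short segment,
  uniformly in the weighted norm because translations form a nice family. Continuity of
  \<open>T\<close> does the rest; the sign comes from the subtraction of
  \<open>\<xi>\<close>.\<close>

lemma has_pd_symbol:
  fixes T :: "((real^'n) \<Rightarrow> complex) \<Rightarrow> complex"
  assumes T: "tempered T" and \<omega>: "schwartz \<omega>"
  shows "has_pd i (\<lambda>\<xi>. T (\<lambda>\<zeta>. \<omega> (\<zeta> - \<xi>))) (\<lambda>\<xi>. T (\<lambda>\<zeta>. - 1 * pderiv_dir i \<omega> (\<zeta> - \<xi>)))"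
  unfolding has_pd_def has_vector_derivative_at_0
proof
  fix \<xi> :: "real^'n"
  let ?e = "axis i 1 :: real^'n"
  define q where "q t \<zeta> = complex_of_real (1 / t) * (\<omega> (\<zeta> - (\<xi> + t *\<^sub>R ?e)) - \<omega> (\<zeta> - \<xi>))" for t \<zeta>
  define \<omega>' where "\<omega>' \<zeta> = - 1 * pderiv_dir i \<omega> (\<zeta> - \<xi>)" for \<zeta>
  have tr: "schwartz (\<lambda>\<zeta>. \<omega> (\<zeta> - \<eta>))" for \<eta> by (rule schwartz_translate[OF \<omega>])
  have d: "schwartz (\<lambda>\<zeta>. \<omega> (\<zeta> - (\<xi> + t *\<^sub>R ?e)) - \<omega> (\<zeta> - \<xi>))" for t by (rule schwartz_diff[OF tr tr])
  have q: "schwartz (q t)" for t unfolding q_def by (rule schwartz_scale[OF d])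
  have dtr: "schwartz (\<lambda>\<zeta>. pderiv_dir i \<omega> (\<zeta> - \<xi>))" by (rule schwartz_translate[OF schwartzD(4)[OF \<omega>]])
  have \<omega>': "schwartz \<omega>'" unfolding \<omega>'_def by (rule schwartz_scale[OF dtr])
  have "((\<lambda>t. T (q t)) \<longlongrightarrow> T \<omega>') (at 0)"
  proof (rule tempered_tendsto[OF T \<omega>' q], rule tendstoI)
    fix k "is" and e :: real assume e: "e > 0"
    let ?h = "Dl is \<omega>" and ?hi = "Dl is (pderiv_dir i \<omega>)"
    have hi: "?hi = pderiv_dir i ?h" by (rule Dl_pderiv[OF \<omega>])
    have e2: "e / 2 > 0" using e by simp
    have nc: "nice0 (\<lambda>\<eta> \<zeta>. ?hi (\<zeta> - \<eta>))"
      using nice_famD(2)[OF nice_fam_translation[OF schwartzD(4)[OF \<omega>, of i]], of "is"] unfolding Dl_translate[OF schwartzD(4)[OF \<omega>]] .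
    obtain r where r: "r > 0" "\<And>y \<zeta>. dist y \<xi> < r \<Longrightarrow> (1 + norm \<zeta>) ^ k * cmod (?hi (\<zeta> - y) - ?hi (\<zeta> - \<xi>)) \<le> e / 2"
      using nice0_cont[OF nc e2, of k \<xi>] unfolding eventually_nhds_metric by blast
    have main: "schwartz_seminorm k is (\<lambda>\<zeta>. q t \<zeta> - \<omega>' \<zeta>) \<le> e / 2" if t: "t \<noteq> 0" "\<bar>t\<bar> < r" for t
    proof (rule seminorm_least)
      fix \<zeta>
      let ?x = "\<zeta> - \<xi>" and ?w = "(1 + norm \<zeta>) ^ k"
      have w: "?w > 0" by (simp add: add_pos_nonneg)
      \<comment> \<open>The tolerance is divided by the weight at \<open>\<zeta>\<close>, so that
        multiplying back gives one bound for all \<open>\<zeta>\<close>.\<close>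
      have "norm (?h (?x + (- t) *\<^sub>R ?e) - ?h (?x + 0 *\<^sub>R ?e) - (- t - 0) *\<^sub>R ?hi (?x + 0 *\<^sub>R ?e)) \<le> norm (- t - 0) * (e / 2 / ?w)"
      proof (rule vector_differentiable_bound_linearization[where S = "closed_segment 0 (- t)" and f = "\<lambda>s. ?h (?x
          + s *\<^sub>R ?e)" and f' = "\<lambda>s. ?hi (?x + s *\<^sub>R ?e)" and a = 0 and b = "- t" and ?x0.0 = 0 and B = "e / 2 / ?w"])
        show "closed_segment 0 (- t) \<subseteq> closed_segment 0 (- t)" "0 \<in> closed_segment 0 (- t)" by auto
        fix s assume s: "s \<in> closed_segment 0 (- t)"
        show "((\<lambda>s. ?h (?x + s *\<^sub>R ?e)) has_vector_derivative ?hi (?x + s *\<^sub>R ?e)) (at s within closed_segment 0 (- t))"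
          unfolding hi by (rule has_vector_derivative_at_within[OF has_pd_line[OF schwartzD(3)[OF schwartz_Dl[OF \<omega>]]]])
        have "\<bar>s\<bar> \<le> \<bar>t\<bar>" using s by (auto simp: closed_segment_eq_real_ivl split: if_splits)
        then have "dist (\<xi> - s *\<^sub>R ?e) \<xi> < r" using t by (simp add: dist_norm)
        from r(2)[OF this, of \<zeta>] have "?w * cmod (?hi (?x + s *\<^sub>R ?e) - ?hi ?x) \<le> e / 2" by (simp add: algebra_simps)
        then show "norm (?hi (?x + s *\<^sub>R ?e) - ?hi (?x + 0 *\<^sub>R ?e)) \<le> e / 2 / ?w"
          using w by (simp add: pos_le_divide_eq mult.commute)
      qed
      then have lin: "cmod (?h (?x - t *\<^sub>R ?e) - ?h ?x + complex_of_real t * ?hi ?x) \<le> \<bar>t\<bar> * (e / 2 / ?w)"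
        by (simp add: scaleR_conv_of_real)
      have "Dl is (\<lambda>\<zeta>. q t \<zeta> - \<omega>' \<zeta>) \<zeta> = complex_of_real (1 / t) * (?h (\<zeta> - (\<xi> + t *\<^sub>R ?e)) - ?h ?x) - (- 1 * ?hi ?x)"
        unfolding Dl_diff[OF q \<omega>'] unfolding q_def[abs_def] \<omega>'_def[abs_def] Dl_scale[OF d] Dl_scale[OF dtr] Dl_diff[OF tr tr]
          Dl_translate[OF \<omega>] Dl_translate[OF schwartzD(4)[OF \<omega>]] ..
      also have "\<dots> = complex_of_real (1 / t) * (?h (?x - t *\<^sub>R ?e) - ?h ?x + complex_of_real t * ?hi ?x)"
        using t(1) by (simp add: distrib_left diff_diff_eq)
      finally have "cmod (Dl is (\<lambda>\<zeta>. q t \<zeta> - \<omega>' \<zeta>) \<zeta>) = (1 / \<bar>t\<bar>) * cmod (?h (?x - t *\<^sub>R ?e) - ?h ?x + complex_of_real t * ?hi ?x)"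
        by (simp only: norm_mult norm_of_real) simp
      also have "\<dots> \<le> (1 / \<bar>t\<bar>) * (\<bar>t\<bar> * (e / 2 / ?w))" by (intro mult_left_mono lin) simp
      also have "\<dots> = e / 2 / ?w" using t(1) by simp
      finally have "?w * cmod (Dl is (\<lambda>\<zeta>. q t \<zeta> - \<omega>' \<zeta>) \<zeta>) \<le> ?w * (e / 2 / ?w)" using w by (intro mult_left_mono) auto
      show "?w * cmod (Dl is (\<lambda>\<zeta>. q t \<zeta> - \<omega>' \<zeta>) \<zeta>) \<le> e / 2"
      proof -
        have "y * (z / y) = z" if "y > 0" for y z :: real using that by simp
        from this[OF w] show ?thesis using \<open>?w * cmod (Dl is (\<lambda>\<zeta>. q t \<zeta> - \<omega>' \<zeta>) \<zeta>) \<le> ?w * (e / 2 / ?w)\<close> by (simp only:)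
      qed
    qed
    have "\<forall>\<^sub>F t in at 0. t \<noteq> 0 \<and> \<bar>t\<bar> < r" unfolding eventually_at using r(1) by (intro exI[of _ r]) (auto simp: dist_real_def)
    then show "\<forall>\<^sub>F t in at 0. dist (schwartz_seminorm k is (\<lambda>\<zeta>. q t \<zeta> - \<omega>' \<zeta>)) 0 < e"
    proof eventually_elim
      case (elim t)
      then show ?case using main[of t] seminorm_nonneg[OF schwartz_diff[OF q[of t] \<omega>'], of k "is"] e by simp
    qed
  qed
  moreover have "T (q t) = (T (\<lambda>\<zeta>. \<omega> (\<zeta> - (\<xi> + t *\<^sub>R ?e))) - T (\<lambda>\<zeta>. \<omega> (\<zeta> - (\<xi> + 0 *\<^sub>R ?e)))) /\<^sub>R t" for t
  proof -
    have "T (q t) = complex_of_real (1 / t) * (T (\<lambda>\<zeta>. \<omega> (\<zeta> - (\<xi> + t *\<^sub>R ?e))) - T (\<lambda>\<zeta>. \<omega> (\<zeta> - \<xi>)))"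
      unfolding q_def[abs_def] temperedD(2)[OF T d] tempered_diff[OF T tr tr] ..
    then show ?thesis by (simp add: scaleR_conv_of_real divide_inverse)
  qed
  ultimately show "((\<lambda>t. (T (\<lambda>\<zeta>. \<omega> (\<zeta> - (\<xi> + t *\<^sub>R ?e))) - T (\<lambda>\<zeta>. \<omega> (\<zeta> - (\<xi> + 0 *\<^sub>R ?e)))) /\<^sub>R t) \<longlongrightarrow> T (\<lambda>\<zeta>.
      - 1 * pderiv_dir i \<omega> (\<zeta> - \<xi>))) (at 0)"
    unfolding \<omega>'_def by simp
qed

text \<open>A derivative of the mollified symbol is the mollified symbol of another Schwartz
  function, so coinduction runs over \<open>\<omega>\<close>.\<close>

lemma slow_symbol:
  assumes T: "tempered T" and \<omega>: "schwartz \<omega>" shows "slow (\<lambda>\<xi>. T (\<lambda>\<zeta>. \<omega> (\<zeta> - \<xi>)))"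
  using \<omega>
proof (coinduction arbitrary: \<omega> rule: smooth_in.coinduct)
  case smooth_in
  note n = nice_fam_translation[OF smooth_in]
  have s: "schwartz (\<lambda>x. - 1 * pderiv_dir i \<omega> x)" for i by (intro schwartz_scale schwartzD(4) smooth_in)
  have "\<exists>f'. has_pd i (\<lambda>\<xi>. T (\<lambda>\<zeta>. \<omega> (\<zeta> - \<xi>))) f' \<and>
      ((\<exists>\<omega>. f' = (\<lambda>\<xi>. T (\<lambda>\<zeta>. \<omega> (\<zeta> - \<xi>))) \<and> schwartz \<omega>) \<or> smooth_in polyb f')" for i
    by (rule exI[of _ "\<lambda>\<xi>. T (\<lambda>\<zeta>. - 1 * pderiv_dir i \<omega> (\<zeta> - \<xi>))"], rule conjI, rule has_pd_symbol[OF T smooth_in],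
        rule disjI1, rule exI[of _ "\<lambda>x. - 1 * pderiv_dir i \<omega> x"], rule conjI, rule refl, rule s)
  then show ?case
    using tempered_nice_continuous[OF T n] tempered_nice_polyb[OF T n] by blast
qed

lemma integral_reflect_translate:
  fixes f :: "(real^'n) \<Rightarrow> complex"
  assumes "f \<in> borel_measurable lebesgue" shows "(LINT x|lebesgue. f x) = (LINT x|lebesgue. f (t - x))"
  using integral_affine_lebesgue[of "-1" f t] assms by simp

text \<open>Both sides are \<open>T\<close> applied to the convolution of \<open>\<phi>\<close> and
  \<open>v\<close>, written with the roles of the two functions exchanged.\<close>

lemma tempered_convolution:
  assumes T: "tempered T" and \<phi>: "schwartz \<phi>" and v: "schwartz v"
  shows "(LINT \<eta>|lebesgue. \<phi> \<eta> * T (\<lambda>\<zeta>. v (\<zeta> - \<eta>))) = (LINT \<xi>|lebesgue. v \<xi> * T (\<lambda>\<zeta>. \<phi> (\<zeta> - \<xi>)))"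
proof -
  note n\<phi> = nice_fam_translation[OF \<phi>] and nv = nice_fam_translation[OF v]
  have "Ifam \<phi> (\<lambda>\<eta> \<zeta>. v (\<zeta> - \<eta>)) \<zeta> = Ifam v (\<lambda>\<xi> \<zeta>. \<phi> (\<zeta> - \<xi>)) \<zeta>" for \<zeta>
  proof -
    have m: "(\<lambda>\<eta>. \<phi> \<eta> * v (\<zeta> - \<eta>)) \<in> borel_measurable lebesgue"
      by (rule borel_measurable_integrable[OF integrable_schwartz_nice[OF \<phi> nice_famD(3)[OF nv]]])
    show ?thesis unfolding Ifam_def using integral_reflect_translate[OF m, of \<zeta>] by (simp add: mult.commute)
  qed
  then have "T (Ifam \<phi> (\<lambda>\<eta> \<zeta>. v (\<zeta> - \<eta>))) = T (Ifam v (\<lambda>\<xi> \<zeta>. \<phi> (\<zeta> - \<xi>)))" by presburger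
  then show ?thesis unfolding tempered_Ifam[OF T \<phi> nv] tempered_Ifam[OF T v n\<phi>] .
qed

text \<open>The regular distribution \<open>mult_op a u\<close> is given by this continuous function.\<close>

definition Rop :: "(((real^'n) \<Rightarrow> complex) \<Rightarrow> complex) \<Rightarrow> ((real^'n) \<Rightarrow> complex) \<Rightarrow> (real^'n) \<Rightarrow> complex" where
  "Rop a u x = complex_of_real (1 / (2 * pi) ^ CARD('n)) * a (\<lambda>\<xi>. cis (\<xi> \<bullet> x) * FT u \<xi>)"

lemma Rop_continuous:
  assumes "tempered a" "schwartz u" shows "continuous_on UNIV (Rop a u)"
  unfolding Rop_def[abs_def]
  by (intro continuous_on_mult continuous_on_const tempered_nice_continuous[OF assms(1)] nice_fam_modulation schwartz_FT assms(2))

text \<open>The product of \<open>FT u\<close> with the inverse transform of a test function is a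
  parameter integral of modulated copies of \<open>FT u\<close>, and \<open>a\<close> may be moved
  inside that integral.\<close>

lemma represents_Rop:
  fixes u :: "(real^'n) \<Rightarrow> complex"
  assumes a: "tempered a" and u: "schwartz u" shows "represents (mult_op a u) (Rop a u)"
  unfolding represents_def
proof (intro conjI allI impI)
  let ?c = "complex_of_real (1 / (2 * pi) ^ CARD('n))"
  let ?\<Theta> = "\<lambda>x \<xi>. cis (\<xi> \<bullet> x) * FT u \<xi>"
  have n: "nice_fam ?\<Theta>" by (rule nice_fam_modulation[OF schwartz_FT[OF u]])
  show "Rop a u \<in> borel_measurable lebesgue" by (rule continuous_imp_lebesgue_measurable[OF Rop_continuous[OF a u]])
  fix \<phi> :: "(real^'n) \<Rightarrow> complex" assume \<phi>: "schwartz \<phi>"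
  have s: "schwartz (\<lambda>x. ?c * \<phi> x)" by (rule schwartz_scale[OF \<phi>])
  have eq: "(?c * \<phi> x) * a (?\<Theta> x) = Rop a u x * \<phi> x" for x unfolding Rop_def by (simp only: mult_ac)
  have "integrable lebesgue (\<lambda>x. (?c * \<phi> x) * a (?\<Theta> x))"
    by (rule rapid_mult_integrable[OF s continuous_imp_lebesgue_measurable[OF tempered_nice_continuous[OF a n]] tempered_nice_polyb[OF a n]])
  then show "integrable lebesgue (\<lambda>x. Rop a u x * \<phi> x)" unfolding eq .
  have "FT u \<xi> * IFT \<phi> \<xi> = Ifam (\<lambda>x. ?c * \<phi> x) ?\<Theta> \<xi>" for \<xi>
  proof -
    have "(?c * \<phi> x) * (cis (\<xi> \<bullet> x) * FT u \<xi>) = (FT u \<xi> * ?c) * (\<phi> x * cis (\<xi> \<bullet> x))" for x by (simp only: mult_ac)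
    then show ?thesis unfolding Ifam_def IFT_def by (simp only: integral_mult_right_zero mult.assoc)
  qed
  then have "mult_op a u \<phi> = a (Ifam (\<lambda>x. ?c * \<phi> x) ?\<Theta>)" unfolding mult_op_def by presburger
  also have "\<dots> = (LINT x|lebesgue. Rop a u x * \<phi> x)" unfolding tempered_Ifam[OF a s n] eq ..
  finally show "mult_op a u \<phi> = (LINT x|lebesgue. Rop a u x * \<phi> x)" .
qed

text \<open>The Gaussian is an admissible test function and is bounded below on every box.\<close>

lemma represents_locint:
  fixes g :: "(real^'n) \<Rightarrow> complex"
  assumes "represents T g" shows "locint g"
  unfolding locint_def
proof (intro allI)
  fix a b :: "real^'n"
  have gm: "g \<in> borel_measurable lebesgue" and gi: "integrable lebesgue (\<lambda>x. g x * gauss x)"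
    using assms schwartz_gauss unfolding represents_def by blast+
  obtain R where R: "\<And>x. x \<in> box a b \<Longrightarrow> norm x \<le> R" using bounded_box[of a b] unfolding bounded_iff by blast
  show "integrable lebesgue (\<lambda>x. indicator (box a b) x *\<^sub>R g x)"
  proof (rule Bochner_Integration.integrable_bound)
    show "integrable lebesgue (\<lambda>x. complex_of_real (exp (R\<^sup>2 / 2)) * (g x * gauss x))" by (rule integrable_mult_right[OF gi])
    show "(\<lambda>x. indicator (box a b) x *\<^sub>R g x) \<in> borel_measurable lebesgue"
      by (intro borel_measurable_scaleR box_indicator_measurable gm)
    have "cmod (indicator (box a b) x *\<^sub>R g x) \<le> cmod (complex_of_real (exp (R\<^sup>2 / 2)) * (g x * gauss x))" for x
    proof (cases "x \<in> box a b")
      case True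
      have "(norm x)\<^sup>2 \<le> R\<^sup>2" using R[OF True] by (intro power_mono) auto
      then have "1 \<le> exp (R\<^sup>2 / 2) * exp (- (norm x)\<^sup>2 / 2)" by (simp add: exp_add[symmetric])
      then have "cmod (g x) * 1 \<le> cmod (g x) * (exp (R\<^sup>2 / 2) * exp (- (norm x)\<^sup>2 / 2))" by (intro mult_left_mono) auto
      then show ?thesis using True by (simp add: norm_mult gauss_def mult_ac)
    qed simp
    then show "AE x in lebesgue. norm (indicator (box a b) x *\<^sub>R g x) \<le> norm (complex_of_real (exp (R\<^sup>2 / 2)) * (g x * gauss x))" by blast
  qed
qed

lemma represents_unique:
  assumes "represents T g" "represents T g'" shows "AE x in lebesgue. g x = g' x"
proof (rule AE_eq_of_bump_integrals[OF represents_locint[OF assms(1)] represents_locint[OF assms(2)]])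
  show "(LINT x|lebesgue. g x * \<psi> x) = (LINT x|lebesgue. g' x * \<psi> x)" if "schwartz \<psi>" for \<psi>
    using assms that unfolding represents_def by metis
qed

lemma approximate_unit:
  assumes r: "r > 0"
  shows "\<exists>p :: real^'n \<Rightarrow> real. schwartz (\<lambda>x. complex_of_real (p x)) \<and> (\<forall>x. p x \<ge> 0) \<and> (LINT x|lebesgue. p x) = 1
      \<and> (\<forall>x. p x \<noteq> 0 \<longrightarrow> norm x < r)"
proof -
  \<comment> \<open>The norm is at most the sum of the coordinates, so a cube with this half-width
    stays within radius \<open>r / 2\<close>.\<close>
  define \<delta> where "\<delta> = r / (2 * real CARD('n))"
  have \<delta>: "\<delta> > 0" unfolding \<delta>_def using r by simp
  define a d :: "real^'n" where "a = (\<chi> i. - \<delta>)" and "d = (\<chi> i. \<delta>)"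
  define I where "I = (LINT x|lebesgue. bump 1 a d x)"
  have "0 \<in> box a d" unfolding a_def d_def using \<delta> by (simp add: mem_box_cart)
  then have I: "I > 0" unfolding I_def by (intro integral_bump_pos) auto
  have "norm x < r" if "bump 1 a d x \<noteq> 0" for x
  proof -
    have x: "x \<in> box a d" using that bump_support[of 1 x a d] by auto
    have "norm x \<le> (\<Sum>i\<in>UNIV. \<bar>x $ i\<bar>)" by (rule norm_le_l1_cart)
    also have "\<dots> \<le> (\<Sum>i\<in>(UNIV :: 'n set). \<delta>)"
      using x unfolding a_def d_def by (intro sum_mono) (auto simp: mem_box_cart abs_le_iff intro: less_imp_le dest!: spec)
    also have "\<dots> = r / 2" unfolding \<delta>_def by simp
    finally show ?thesis using r by simp
  qed
  moreover have "schwartz (\<lambda>x. complex_of_real (1 / I) * complex_of_real (bump 1 a d x))"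
    by (intro schwartz_scale schwartz_bump) simp
  moreover have "(LINT x|lebesgue. (1 / I) * bump 1 a d x) = 1"
    unfolding integral_mult_right_zero I_def[symmetric] using I by simp
  ultimately show ?thesis
    using I bump_bounds(1)[of 1 a d] by (intro exI[of _ "\<lambda>x. (1 / I) * bump 1 a d x"]) auto
qed

section \<open>Norm estimates for distributional symbols\<close>

context
  fixes \<rho> :: "((real^'n) \<Rightarrow> ennreal) \<Rightarrow> ennreal"
  assumes bfn: "banach_function_norm \<rho>"
begin

text \<open>Representing functions agree almost everywhere, so the infimum is over a single
  value.\<close>

lemma dist_Xn_eq:
  assumes "represents T g" shows "dist_Xn \<rho> T = Xn \<rho> g"
proof -
  have "Xn \<rho> g' = Xn \<rho> g" if "represents T g'" for g'
    by (rule Xn_cong_AE[OF bfn _ _ represents_unique[OF that assms]])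
       (use that assms in \<open>auto simp: represents_def\<close>)
  then have "(INF g\<in>{g. represents T g}. Xn \<rho> g) = (INF g'\<in>{g. represents T g}. Xn \<rho> g)" by (intro INF_cong) auto
  also have "\<dots> = Xn \<rho> g" using assms by (intro cINF_const) auto
  finally show ?thesis unfolding dist_Xn_def .
qed

lemma Xn_Rop_le:
  assumes a: "tempered a" and u: "schwartz u" "u \<in> Xset \<rho>"
  shows "Xn \<rho> (Rop a u) \<le> M_norm \<rho> a * Xn \<rho> u"
proof (cases "AE x in lebesgue. u x = 0")
  case True
  have "FT u = FT (\<lambda>x. 0)" by (rule FT_cong_AE[OF schwartz_measurable(1)[OF u(1)] _ True]) simp
  then have "FT u \<xi> = 0" for \<xi> by (simp add: FT_def)
  then have "Rop a u = (\<lambda>x. 0)" by (simp add: fun_eq_iff Rop_def tempered_zero[OF a])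
  then show ?thesis using Xn_zero_iff[OF bfn, of "\<lambda>x. 0"] by simp
next
  case False
  have "dist_Xn \<rho> (mult_op a u) / Xn \<rho> u \<le> M_norm \<rho> a"
    unfolding M_norm_def by (rule SUP_upper) (use u False in simp)
  then show ?thesis
    unfolding dist_Xn_eq[OF represents_Rop[OF a u(1)]]
    using False Xn_zero_iff[OF bfn Xset_measurable[OF bfn u(2)]] Xset_finite[OF bfn u(2)]
    by (intro ennreal_le_of_divide_le) auto
qed

text \<open>Fatou's lemma for the norm of X: (A3) is applied to the increasing infima over tails,
  whose limit is the modulus of \<open>g\<close>.\<close>

lemma Xn_limit_le:
  fixes f :: "nat \<Rightarrow> (real^'n) \<Rightarrow> complex"
  assumes f: "\<And>j. f j \<in> borel_measurable lebesgue" and lim: "\<And>x. (\<lambda>j. f j x) \<longlonglongrightarrow> g x"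
    and K: "\<And>j. Xn \<rho> (f j) \<le> K"
  shows "Xn \<rho> g \<le> K"
proof -
  define h where "h j x = (INF i\<in>{j..}. ennreal (cmod (f i x)))" for j x
  have hm: "h j \<in> borel_measurable lebesgue" for j
    unfolding h_def using cmod_measurable[OF bfn f] by (intro borel_measurable_INF) auto
  have gm: "g \<in> borel_measurable lebesgue" by (rule borel_measurable_LIMSEQ_metric[OF f lim])
  have "(\<lambda>j. \<rho> (h j)) \<longlonglongrightarrow> \<rho> (\<lambda>x. ennreal (cmod (g x)))"
  proof (rule bfn_Fatou[OF bfn hm cmod_measurable[OF bfn gm]], intro always_eventually allI conjI)
    fix x
    show inc: "incseq (\<lambda>j. h j x)" unfolding h_def incseq_def by (intro allI impI INF_superset_mono) auto
    have "(\<lambda>j. ennreal (cmod (f j x))) \<longlonglongrightarrow> ennreal (cmod (g x))"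
      by (intro tendsto_ennrealI tendsto_norm lim)
    then have "liminf (\<lambda>j. ennreal (cmod (f j x))) = ennreal (cmod (g x))"
      by (rule lim_imp_Liminf[OF trivial_limit_sequentially])
    then have "(SUP j. h j x) = ennreal (cmod (g x))" unfolding liminf_SUP_INF h_def .
    then show "(\<lambda>j. h j x) \<longlonglongrightarrow> ennreal (cmod (g x))" using LIMSEQ_SUP[OF inc] by simp
  qed
  moreover have "\<rho> (h j) \<le> K" for j
  proof -
    have "\<rho> (h j) \<le> Xn \<rho> (f j)" unfolding Xn_def
      by (rule bfn_mono[OF bfn cmod_measurable[OF bfn f] hm]) (auto simp: h_def intro!: always_eventually INF_lower)
    then show ?thesis using K by (rule order_trans)
  qed
  ultimately show ?thesis unfolding Xn_def by (intro LIMSEQ_le_const2) auto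
qed

text \<open>Together with \<open>Xn_limit_le\<close> this takes the place of Minkowski's integral
  inequality: averages are handled as limits of finite convex combinations.\<close>

lemma Xn_convex_combination:
  assumes "finite I" "\<And>i. i \<in> I \<Longrightarrow> c i \<ge> 0" "\<And>i. i \<in> I \<Longrightarrow> f i \<in> borel_measurable lebesgue" "\<And>i. i \<in> I \<Longrightarrow> Xn \<rho> (f i) \<le> K"
  shows "Xn \<rho> (\<lambda>x. \<Sum>i\<in>I. complex_of_real (c i) * f i x) \<le> ennreal (\<Sum>i\<in>I. c i) * K
      \<and> (\<lambda>x. \<Sum>i\<in>I. complex_of_real (c i) * f i x) \<in> borel_measurable lebesgue"
  using assms
proof (induction I rule: finite_induct)
  case empty
  then show ?case using Xn_zero_iff[OF bfn, of "\<lambda>x. 0"] by simp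
next
  case (insert i I)
  let ?g = "\<lambda>x. \<Sum>i\<in>I. complex_of_real (c i) * f i x" and ?h = "\<lambda>x. complex_of_real (c i) * f i x"
  have IH: "Xn \<rho> ?g \<le> ennreal (\<Sum>i\<in>I. c i) * K" "?g \<in> borel_measurable lebesgue" using insert by auto
  have fm: "f i \<in> borel_measurable lebesgue" using insert by auto
  then have hm: "?h \<in> borel_measurable lebesgue" by (intro borel_measurable_times) auto
  have c: "c i \<ge> 0" using insert by auto
  have "Xn \<rho> ?h = \<rho> (\<lambda>x. ennreal (c i) * ennreal (cmod (f i x)))"
    unfolding Xn_def using c by (simp add: norm_mult ennreal_mult)
  also have "\<dots> = ennreal (c i) * Xn \<rho> (f i)" unfolding Xn_def by (rule bfn_scale[OF bfn cmod_measurable[OF bfn fm] c])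
  also have "\<dots> \<le> ennreal (c i) * K" using insert by (intro mult_left_mono) auto
  finally have h: "Xn \<rho> ?h \<le> ennreal (c i) * K" .
  have "Xn \<rho> (\<lambda>x. ?h x + ?g x) \<le> \<rho> (\<lambda>x. ennreal (cmod (?h x)) + ennreal (cmod (?g x)))"
    unfolding Xn_def
  proof (rule bfn_mono[OF bfn])
    show "AE x in lebesgue. ennreal (cmod (?h x + ?g x)) \<le> ennreal (cmod (?h x)) + ennreal (cmod (?g x))"
      by (intro always_eventually allI) (simp only: ennreal_plus[symmetric] norm_ge_zero ennreal_leI norm_triangle_ineq)
  qed (intro borel_measurable_add cmod_measurable[OF bfn] hm IH borel_measurable_add[of ?h])+
  also have "\<dots> \<le> Xn \<rho> ?h + Xn \<rho> ?g" unfolding Xn_def by (intro bfn_add[OF bfn] cmod_measurable[OF bfn] hm IH)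
  also have "\<dots> \<le> ennreal (c i) * K + ennreal (\<Sum>i\<in>I. c i) * K" by (intro add_mono h IH)
  also have "\<dots> = ennreal (\<Sum>i\<in>insert i I. c i) * K"
    using insert c by (simp add: distrib_right ennreal_plus sum_nonneg)
  finally have "Xn \<rho> (\<lambda>x. ?h x + ?g x) \<le> ennreal (\<Sum>i\<in>insert i I. c i) * K" .
  moreover have "(\<lambda>x. ?h x + ?g x) \<in> borel_measurable lebesgue" by (intro borel_measurable_add hm IH)
  ultimately show ?case using insert(1,2) by simp
qed

text \<open>The multiplier with symbol \<open>b\<close> is the average, with weight \<open>p\<close>, of the conjugates of the multiplier
  with symbol \<open>a\<close> by modulations, which are isometries.\<close>

lemma mollified_symbol_bound:
  assumes r: "reflection_invariant \<rho>" and a: "a \<in> M_set \<rho>"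
    and p: "schwartz (\<lambda>x. complex_of_real (p x))" "\<And>x. p x \<ge> 0" "(LINT x|lebesgue. p x) = 1"
  defines "b \<equiv> \<lambda>\<xi>. a (\<lambda>\<zeta>. complex_of_real (p (\<zeta> - \<xi>)))"
  shows "AE \<xi> in lebesgue. cmod (b \<xi>) \<le> enn2real (M_norm \<rho> a)"
proof -
  have t: "tempered a" and fin: "M_norm \<rho> a < \<infinity>" using a unfolding M_set_def by auto
  let ?M = "enn2real (M_norm \<rho> a)"
  have M: "ennreal ?M = M_norm \<rho> a" using fin by simp
  let ?\<phi> = "\<lambda>x. complex_of_real (p x)" and ?c = "complex_of_real (1 / (2 * pi) ^ CARD('n))"
  have b: "slow b" unfolding b_def by (rule slow_symbol[OF t p(1)])
  define T where "T u = IFT (\<lambda>\<xi>. b \<xi> * FT u \<xi>)" for u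
  have bF: "schwartz (\<lambda>\<xi>. b \<xi> * FT u \<xi>)" if "schwartz u" for u by (rule slow_schwartz_mult[OF b schwartz_FT[OF that]])
  have Ts: "schwartz (T u)" if "schwartz u" for u unfolding T_def by (rule schwartz_IFT[OF bF[OF that]])
  have TX: "Xn \<rho> (T u) \<le> ennreal ?M * Xn \<rho> u" if u: "schwartz u" "u \<in> Xset \<rho>" for u
  proof -
    define v where "v x = (\<lambda>\<zeta>. cis (\<zeta> \<bullet> x) * FT u \<zeta>)" for x
    have v: "schwartz (v x)" for x unfolding v_def by (rule schwartz_modulate[OF schwartz_FT[OF u(1)]])
    \<comment> \<open>\<open>G \<eta>\<close> is the multiplier of \<open>a\<close>, conjugated by
      modulation with frequency \<open>\<eta>\<close> and applied to \<open>u\<close>;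
      \<open>G_eq\<close> makes this explicit, so its norm obeys the bound for
      \<open>Rop\<close>.\<close>
    define G where "G \<eta> x = ?c * a (\<lambda>\<zeta>. v x (\<zeta> - \<eta>))" for \<eta> x
    define e where "e \<eta> = (\<lambda>y. cis (y \<bullet> \<eta>) * u y)" for \<eta>
    have es: "schwartz (e \<eta>)" for \<eta> unfolding e_def by (rule schwartz_modulate[OF u(1)])
    have eX: "Xn \<rho> (e \<eta>) = Xn \<rho> u" for \<eta> unfolding e_def Xn_def by (simp add: norm_mult)
    have eXs: "e \<eta> \<in> Xset \<rho>" for \<eta>
      using eX[of \<eta>] u(2) schwartz_measurable(1)[OF es] unfolding Xset_def by simp
    have G_eq: "G \<eta> x = cis (- (\<eta> \<bullet> x)) * Rop a (e \<eta>) x" for \<eta> x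
    proof -
      have "v x (\<zeta> - \<eta>) = cis (- (\<eta> \<bullet> x)) * (cis (\<zeta> \<bullet> x) * FT (e \<eta>) \<zeta>)" for \<zeta>
        unfolding v_def e_def FT_modulate mult.assoc[symmetric] cis_mult by (simp add: inner_diff_left)
      then have "a (\<lambda>\<zeta>. v x (\<zeta> - \<eta>)) = cis (- (\<eta> \<bullet> x)) * a (\<lambda>\<zeta>. cis (\<zeta> \<bullet> x) * FT (e \<eta>) \<zeta>)"
        using temperedD(2)[OF t schwartz_modulate[OF schwartz_FT[OF es]]] by simp
      then show ?thesis unfolding G_def Rop_def by (simp only: mult_ac)
    qed
    have Gm: "G \<eta> \<in> borel_measurable lebesgue" for \<eta>
      unfolding G_eq[abs_def]
      by (intro continuous_imp_lebesgue_measurable continuous_on_mult Rop_continuous t es continuous_intros)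
    have GX: "Xn \<rho> (G \<eta>) \<le> ennreal ?M * Xn \<rho> u" for \<eta>
    proof -
      have "Xn \<rho> (G \<eta>) = Xn \<rho> (Rop a (e \<eta>))" unfolding Xn_def G_eq by (simp add: norm_mult)
      then show ?thesis using Xn_Rop_le[OF t es eXs] unfolding M eX by simp
    qed
    \<comment> \<open>The convolution identity moves the mollification from the symbol to the
      integration over frequencies.\<close>
    have T_eq: "T u x = (LINT \<eta>|lebesgue. ?\<phi> \<eta> * G \<eta> x)" for x
    proof -
      have "T u x = ?c * (LINT \<xi>|lebesgue. v x \<xi> * b \<xi>)"
        unfolding T_def IFT_def v_def by (simp only: inner_commute[of x] mult_ac)
      also have "\<dots> = ?c * (LINT \<eta>|lebesgue. ?\<phi> \<eta> * a (\<lambda>\<zeta>. v x (\<zeta> - \<eta>)))"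
        unfolding b_def using tempered_convolution[OF t p(1) v] by simp
      also have "\<dots> = (LINT \<eta>|lebesgue. ?c * (?\<phi> \<eta> * a (\<lambda>\<zeta>. v x (\<zeta> - \<eta>))))" by (rule integral_mult_right_zero[symmetric])
      also have "\<dots> = (LINT \<eta>|lebesgue. ?\<phi> \<eta> * G \<eta> x)" unfolding G_def by (simp only: mult_ac)
      finally show ?thesis .
    qed
    obtain s :: "nat \<Rightarrow> (real^'n) \<Rightarrow> real^'n" where s: "\<And>j. simple_function lebesgue (s j)" "\<And>x. (\<lambda>j. s j x) \<longlonglongrightarrow> x"
        "\<And>j x. norm (s j x) \<le> 2 * norm x"
      using simple_sampling by blast
    define f where "f j x = (LINT \<eta>|lebesgue. ?\<phi> \<eta> * G (s j \<eta>) x)" for j x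
    define c where "c j y = (LINT x|lebesgue. p x * indicator (s j -` {y}) x)" for j y
    have fin: "finite (range (s j))" for j using simple_functionD(1)[OF s(1)] by simp
    have cc: "(LINT x|lebesgue. ?\<phi> x * indicator (s j -` {y}) x) = complex_of_real (c j y)" for j y
    proof -
      have "?\<phi> x * indicator (s j -` {y}) x = complex_of_real (p x * indicator (s j -` {y}) x)" for x by (simp add: indicator_def)
      then show ?thesis unfolding c_def by (simp only: integral_complex_of_real)
    qed
    have c0: "c j y \<ge> 0" for j y unfolding c_def by (rule integral_nonneg_AE) (simp add: p(2))
    \<comment> \<open>Because \<open>p\<close> has integral 1, every sampled average is a convex
      combination of the functions \<open>G y\<close>.\<close>
    have c1: "(\<Sum>y\<in>range (s j). c j y) = 1" for j
    proof -
      have "(LINT x|lebesgue. ?\<phi> x * 1) = (\<Sum>y\<in>range (s j). complex_of_real (c j y) * 1)"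
        using sampled_integral(1)[OF s(1) schwartz_integrable[OF p(1)], where h = "\<lambda>_. 1"] unfolding cc .
      then have "complex_of_real (\<Sum>y\<in>range (s j). c j y) = complex_of_real 1" using p(3) by simp
      then show ?thesis by (simp only: of_real_eq_iff)
    qed
    have f_eq: "f j = (\<lambda>x. \<Sum>y\<in>range (s j). complex_of_real (c j y) * G y x)" for j
    proof
      fix x show "f j x = (\<Sum>y\<in>range (s j). complex_of_real (c j y) * G y x)"
        unfolding f_def using sampled_integral(1)[OF s(1) schwartz_integrable[OF p(1)], where h = "\<lambda>\<eta>. G \<eta> x"] unfolding cc .
    qed
    have fX: "Xn \<rho> (f j) \<le> ennreal ?M * Xn \<rho> u" "f j \<in> borel_measurable lebesgue" for j
      unfolding f_eq using Xn_convex_combination[where I = "range (s j)" and c = "c j" and f = G and K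
          = "ennreal ?M * Xn \<rho> u", OF fin c0 Gm GX] c1[of j] by simp_all
    have lim: "(\<lambda>j. f j x) \<longlonglongrightarrow> T u x" for x
    proof -
      have nv: "nice_fam (\<lambda>\<eta> \<zeta>. v x (\<zeta> - \<eta>))" by (rule nice_fam_translation[OF v])
      have "continuous_on UNIV (\<lambda>\<eta>. G \<eta> x)" unfolding G_def
        by (intro continuous_on_mult continuous_on_const tempered_nice_continuous[OF t nv])
      moreover have "polyb (\<lambda>\<eta>. G \<eta> x)" unfolding G_def
        by (rule polyb_mult[OF smooth_inD(2)[OF slow_const] tempered_nice_polyb[OF t nv]])
      ultimately show ?thesis unfolding f_def T_eq by (rule sampled_dominated[OF s p(1)])
    qed
    show ?thesis by (rule Xn_limit_le[OF fX(2) lim fX(1)])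
  qed
  show ?thesis
  proof (rule multiplier_bound[OF bfn r slow_measurable[OF b], where C = "{u. schwartz u} \<inter> Xset \<rho>" and T = T])
    show "{u. schwartz u} \<inter> Xset \<rho> \<subseteq> L2 \<inter> Xset \<rho>" using L2_schwartz by blast
    show "(\<lambda>x. cis (x \<bullet> \<eta>) * complex_of_real (bump k c d x)) \<in> {u. schwartz u} \<inter> Xset \<rho>" if "k > 0" for k c d \<eta>
      using modulated_bump_Xset[OF bfn that] schwartz_modulate[OF schwartz_bump[OF that]] by blast
    show "(\<lambda>x. cnj (f (- x))) \<in> {u. schwartz u} \<inter> Xset \<rho>" if "f \<in> {u. schwartz u} \<inter> Xset \<rho>" for f
      using that Xset_reflect_cnj(1)[OF bfn r] schwartz_cnj[OF schwartz_reflect] by auto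
    fix f assume f: "f \<in> {u. schwartz u} \<inter> Xset \<rho>"
    then have fs: "schwartz f" by simp
    show X: "Xn \<rho> (T f) \<le> ennreal ?M * Xn \<rho> f" using TX f by simp
    also have "\<dots> < \<infinity>" using Xset_finite[OF bfn, of f] f by (simp add: ennreal_mult_less_top)
    finally show "T f \<in> {u. schwartz u} \<inter> Xset \<rho>"
      using Ts[OF fs] schwartz_measurable(1)[OF Ts[OF fs]] unfolding Xset_def by simp
    fix g assume g: "wFT f g"
    have F: "wFT f (FT f)" by (rule wFT_FT[OF L2_schwartz[OF fs] schwartz_integrable[OF fs]])
    have "FT (T f) = (\<lambda>\<xi>. b \<xi> * FT f \<xi>)" unfolding T_def by (rule FT_IFT[OF bF[OF fs]])
    then have "wFT (T f) (\<lambda>\<xi>. b \<xi> * FT f \<xi>)"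
      using wFT_FT[OF L2_schwartz[OF Ts[OF fs]] schwartz_integrable[OF Ts[OF fs]]] by simp
    then show "wFT (T f) (\<lambda>\<xi>. b \<xi> * g \<xi>)"
      by (rule wFT_cong[OF _ schwartz_measurable(1)[OF Ts[OF fs]]])
         (use wFT_unique[OF F g] slow_measurable[OF b] L2_measurable[OF wFTD(2)[OF g]] in auto)
  qed simp
qed

text \<open>With \<open>v\<close> fixed, the unit mass \<open>p\<close> is concentrated where
  \<open>a\<close> of the translates of \<open>v\<close> differs from \<open>a v\<close> by less
  than \<open>e\<close>. The average over these translates equals the integral of \<open>v\<close>
  against the mollified symbol, whose bound is uniform in \<open>p\<close>.\<close>

lemma tempered_L1_bound:
  assumes r: "reflection_invariant \<rho>" and a: "a \<in> M_set \<rho>" and v: "schwartz v"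
  shows "cmod (a v) \<le> enn2real (M_norm \<rho> a) * (LINT x|lebesgue. cmod (v x))"
proof (rule field_le_epsilon)
  fix e :: real assume e: "e > 0"
  have t: "tempered a" using a unfolding M_set_def by auto
  let ?M = "enn2real (M_norm \<rho> a)"
  note nv = nice_fam_translation[OF v]
  have ct: "continuous_on UNIV (\<lambda>\<eta>. a (\<lambda>\<zeta>. v (\<zeta> - \<eta>)))" by (rule tempered_nice_continuous[OF t nv])
  then obtain d where d: "d > 0" "\<And>\<eta>. dist \<eta> 0 < d \<Longrightarrow> dist (a (\<lambda>\<zeta>. v (\<zeta> - \<eta>))) (a (\<lambda>\<zeta>. v (\<zeta> - 0))) < e"
    using e unfolding continuous_on_iff by (metis UNIV_I)
  obtain p :: "real^'n \<Rightarrow> real" where p: "schwartz (\<lambda>x. complex_of_real (p x))" "\<And>x. p x \<ge> 0" "(LINT x|lebesgue. p x)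
      = 1" "\<And>x. p x \<noteq> 0 \<Longrightarrow> norm x < d"
    using approximate_unit[OF d(1)] by blast
  let ?\<phi> = "\<lambda>x. complex_of_real (p x)"
  let ?g = "\<lambda>\<eta>. a (\<lambda>\<zeta>. v (\<zeta> - \<eta>))"
  have pi: "integrable lebesgue p" using integrable_Re[OF schwartz_integrable[OF p(1)]] by simp
  have gi: "integrable lebesgue (\<lambda>\<eta>. ?\<phi> \<eta> * ?g \<eta>)"
    by (rule rapid_mult_integrable[OF p(1) continuous_imp_lebesgue_measurable[OF ct] tempered_nice_polyb[OF t nv]])
  have ai: "integrable lebesgue (\<lambda>\<eta>. ?\<phi> \<eta> * a v)" using schwartz_integrable[OF p(1)] by simp
  have av: "(LINT \<eta>|lebesgue. ?\<phi> \<eta> * a v) = a v" using p(3) by simp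
  have "cmod (a v - (LINT \<eta>|lebesgue. ?\<phi> \<eta> * ?g \<eta>)) = cmod (LINT \<eta>|lebesgue. ?\<phi> \<eta> * a v - ?\<phi> \<eta> * ?g \<eta>)"
    unfolding Bochner_Integration.integral_diff[OF ai gi] av ..
  also have "\<dots> \<le> (LINT \<eta>|lebesgue. cmod (?\<phi> \<eta> * a v - ?\<phi> \<eta> * ?g \<eta>))" by (rule integral_norm_bound)
  also have "\<dots> \<le> (LINT \<eta>|lebesgue. p \<eta> * e)"
  proof (rule integral_mono)
    show "integrable lebesgue (\<lambda>\<eta>. cmod (?\<phi> \<eta> * a v - ?\<phi> \<eta> * ?g \<eta>))" using gi ai by simp
    show "integrable lebesgue (\<lambda>\<eta>. p \<eta> * e)" using pi by simp
    fix \<eta>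
    show "cmod (?\<phi> \<eta> * a v - ?\<phi> \<eta> * ?g \<eta>) \<le> p \<eta> * e"
    proof (cases "p \<eta> = 0")
      case False
      then have "dist (?g \<eta>) (a (\<lambda>\<zeta>. v (\<zeta> - 0))) < e" using p(4) d(2)[of \<eta>] by simp
      then have "cmod (a v - ?g \<eta>) \<le> e" by (simp add: dist_norm norm_minus_commute)
      then have "p \<eta> * cmod (a v - ?g \<eta>) \<le> p \<eta> * e" by (rule mult_left_mono[OF _ p(2)])
      then show ?thesis using p(2)[of \<eta>] by (simp add: right_diff_distrib[symmetric] norm_mult)
    qed simp
  qed
  also have "\<dots> = e" using p(3) by simp
  finally have 1: "cmod (a v - (LINT \<eta>|lebesgue. ?\<phi> \<eta> * ?g \<eta>)) \<le> e" .
  let ?b = "\<lambda>\<xi>. a (\<lambda>\<zeta>. complex_of_real (p (\<zeta> - \<xi>)))"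
  note np = nice_fam_translation[OF p(1)]
  have vb: "integrable lebesgue (\<lambda>\<xi>. v \<xi> * ?b \<xi>)"
    by (rule rapid_mult_integrable[OF v continuous_imp_lebesgue_measurable[OF tempered_nice_continuous[OF t np]] tempered_nice_polyb[OF t np]])
  have "cmod (LINT \<eta>|lebesgue. ?\<phi> \<eta> * ?g \<eta>) = cmod (LINT \<xi>|lebesgue. v \<xi> * ?b \<xi>)"
    unfolding tempered_convolution[OF t p(1) v] ..
  also have "\<dots> \<le> (LINT \<xi>|lebesgue. cmod (v \<xi> * ?b \<xi>))" by (rule integral_norm_bound)
  also have "\<dots> \<le> (LINT \<xi>|lebesgue. ?M * cmod (v \<xi>))"
  proof (rule integral_mono_AE)
    show "AE \<xi> in lebesgue. cmod (v \<xi> * ?b \<xi>) \<le> ?M * cmod (v \<xi>)"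
      using mollified_symbol_bound[OF r a p(1-3)]
      by eventually_elim (simp add: norm_mult mult.commute[of "cmod (v _)"] mult_right_mono)
  qed (use vb schwartz_integrable[OF v] in auto)
  also have "\<dots> = ?M * (LINT x|lebesgue. cmod (v x))" by simp
  finally have 2: "cmod (LINT \<eta>|lebesgue. ?\<phi> \<eta> * ?g \<eta>) \<le> ?M * (LINT x|lebesgue. cmod (v x))" .
  show "cmod (a v) \<le> ?M * (LINT x|lebesgue. cmod (v x)) + e"
    using norm_triangle_sub[of "a v" "LINT \<eta>|lebesgue. ?\<phi> \<eta> * ?g \<eta>"] 1 2 by linarith
qed

end

section \<open>Distributions bounded by the integral norm\<close>

lemma slow_inverse_wt: "slow (\<lambda>x::real^'n. complex_of_real (1 / wt x))"
proof -
  have "slow (\<lambda>x::real^'n. \<Prod>i\<in>UNIV. 1 + complex_of_real (x $ i) * complex_of_real (x $ i))"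
    by (intro slow_prod slow_add slow_const slow_mult slow_coord) simp
  moreover have "complex_of_real (1 / wt x) = (\<Prod>i\<in>UNIV. 1 + complex_of_real (x $ i) * complex_of_real (x $ i))" for x :: "real^'n"
    unfolding wt_def by (simp add: prod_dividef power2_eq_square)
  ultimately show ?thesis by simp
qed

lemma wt_L2: "(\<lambda>x. complex_of_real (wt x)) \<in> L2"
  unfolding L2_def
proof safe
  show m: "(\<lambda>x::real^'a. complex_of_real (wt x)) \<in> borel_measurable lebesgue"
    by (rule measurable_completion) simp
  have "integrable lebesgue (\<lambda>x::real^'a. (wt x)\<^sup>2)"
  proof (rule Bochner_Integration.integrable_bound[OF integrable_wt])
    show "(\<lambda>x::real^'a. (wt x)\<^sup>2) \<in> borel_measurable lebesgue" by (rule measurable_completion) simp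
    show "AE x in lebesgue. norm ((wt x)\<^sup>2) \<le> norm (wt (x::real^'a))"
    proof (intro always_eventually allI)
      fix x :: "real^'a"
      have "wt x * wt x \<le> wt x * 1" using wt_pos[of x] by (intro mult_left_mono wt_le_1) simp
      then show "norm ((wt x)\<^sup>2) \<le> norm (wt x)" by (simp add: power2_eq_square)
    qed
  qed
  then show "integrable lebesgue (\<lambda>x::real^'a. (cmod (complex_of_real (wt x)))\<^sup>2)" by simp
qed

lemma L2_cmod: "f \<in> L2 \<Longrightarrow> (\<lambda>x. complex_of_real (cmod (f x))) \<in> L2"
proof -
  assume f: "f \<in> L2"
  note [measurable] = L2_measurable[OF f]
  have "(\<lambda>x. complex_of_real (cmod (f x))) \<in> borel_measurable lebesgue" by measurable
  then show ?thesis using f unfolding L2_def by simp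
qed

text \<open>Cauchy-Schwarz with \<open>wt\<close> in L2; this turns weighted L1 bounds into the L2
  bounds that Riesz requires.\<close>

lemma wt_integral_bound:
  fixes f :: "(real^'n) \<Rightarrow> complex"
  assumes f: "f \<in> L2"
  shows "integrable lebesgue (\<lambda>x. wt x * cmod (f x))"
    "(LINT x|lebesgue. wt x * cmod (f x)) \<le> sqrt (q2 (\<lambda>x::real^'n. complex_of_real (wt x))) * sqrt (q2 f)"
proof -
  have eq: "complex_of_real (wt x) * cnj (complex_of_real (cmod (f x))) = complex_of_real (wt x * cmod (f x))" for x by simp
  show i: "integrable lebesgue (\<lambda>x. wt x * cmod (f x))"
    using integrable_Re[OF ip_integrable[OF wt_L2 L2_cmod[OF f]]] by simp
  have q: "q2 (\<lambda>x. complex_of_real (cmod (f x))) = q2 f" unfolding q2_def by simp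
  have "ip (\<lambda>x. complex_of_real (wt x)) (\<lambda>x. complex_of_real (cmod (f x))) = complex_of_real (LINT x|lebesgue. wt x * cmod (f x))"
    unfolding ip_def eq by (rule integral_complex_of_real)
  then have "(LINT x|lebesgue. wt x * cmod (f x))\<^sup>2 \<le> q2 (\<lambda>x::real^'n. complex_of_real (wt x)) * q2 f"
    using Cauchy_Schwarz_L2[OF wt_L2 L2_cmod[OF f]] unfolding q by simp
  then have "\<bar>LINT x|lebesgue. wt x * cmod (f x)\<bar> \<le> sqrt (q2 (\<lambda>x::real^'n. complex_of_real (wt x)) * q2 f)"
    by (metis real_sqrt_abs real_sqrt_le_mono)
  then show "(LINT x|lebesgue. wt x * cmod (f x)) \<le> sqrt (q2 (\<lambda>x::real^'n. complex_of_real (wt x))) * sqrt (q2 f)"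
    unfolding real_sqrt_mult by linarith
qed

lemma ip_le: "f \<in> L2 \<Longrightarrow> g \<in> L2 \<Longrightarrow> cmod (ip f g) \<le> sqrt (q2 f) * sqrt (q2 g)"
  using real_sqrt_le_mono[OF Cauchy_Schwarz_L2, of f g] by (simp add: real_sqrt_mult)

lemma locint_continuous_mult:
  fixes c g :: "(real^'n) \<Rightarrow> complex"
  assumes c: "continuous_on UNIV c" and g: "locint g" shows "locint (\<lambda>x. c x * g x)"
  unfolding locint_def
proof (intro allI)
  fix a b :: "real^'n"
  have "bounded (c ` cbox a b)"
    by (intro compact_imp_bounded compact_continuous_image continuous_on_subset[OF c]) auto
  then obtain B where B: "\<And>x. x \<in> cbox a b \<Longrightarrow> cmod (c x) \<le> B" unfolding bounded_iff by auto
  show "integrable lebesgue (\<lambda>x. indicator (box a b) x *\<^sub>R (c x * g x))"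
  proof (rule Bochner_Integration.integrable_bound)
    show "integrable lebesgue (\<lambda>x. complex_of_real B * (indicator (box a b) x *\<^sub>R g x))"
      using g unfolding locint_def by (intro integrable_mult_right) blast
    show "(\<lambda>x. indicator (box a b) x *\<^sub>R (c x * g x)) \<in> borel_measurable lebesgue"
      by (intro borel_measurable_scaleR borel_measurable_times box_indicator_measurable continuous_imp_lebesgue_measurable c locint_measurable[OF g])
    show "AE x in lebesgue. norm (indicator (box a b) x *\<^sub>R (c x * g x)) \<le> norm (complex_of_real B * (indicator (box a b) x *\<^sub>R g x))"
    proof (intro always_eventually allI)
      fix x show "norm (indicator (box a b) x *\<^sub>R (c x * g x)) \<le> norm (complex_of_real B * (indicator (box a b) x *\<^sub>R g x))"
      proof (cases "x \<in> box a b")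
        case True
        then have "cmod (c x) \<le> \<bar>B\<bar>" using B[of x] box_subset_cbox by fastforce
        then show ?thesis using True by (simp add: norm_mult mult_right_mono)
      qed simp
    qed
  qed
qed

text \<open>The functional is transported to \<open>L f = a (wt f)\<close> on \<open>V\<close>, the
  Schwartz functions divided by \<open>wt\<close>; there it is bounded in L2, and Riesz gives
  \<open>h\<close> with density \<open>cnj h / wt\<close>. The sharp bound on the density is a
  second step, through duality with the original estimate.\<close>

lemma represents_of_L1_bound:
  fixes a :: "((real^'n) \<Rightarrow> complex) \<Rightarrow> complex"
  assumes t: "tempered a" and M: "M \<ge> 0"
    and bd: "\<And>v. schwartz v \<Longrightarrow> cmod (a v) \<le> M * (LINT x|lebesgue. cmod (v x))"
  shows "\<exists>g. represents a g \<and> (AE x in lebesgue. cmod (g x) \<le> M)"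
proof -
  let ?p = "\<lambda>x::real^'n. complex_of_real (1 / wt x)"
  have w0: "wt x \<noteq> 0" for x :: "real^'n" using wt_pos[of x] by simp
  define V where "V = {f. \<exists>\<phi>. schwartz \<phi> \<and> f = (\<lambda>x. ?p x * \<phi> x)}"
  define L where "L f = a (\<lambda>x. complex_of_real (wt x) * f x)" for f
  have cancel: "complex_of_real (wt x) * (?p x * \<phi>) = \<phi>" for x and \<phi> :: complex using w0[of x] by simp
  have Lp: "L (\<lambda>x. ?p x * \<phi> x) = a \<phi>" for \<phi> unfolding L_def cancel ..
  have Vs: "schwartz f" if "f \<in> V" for f using that slow_schwartz_mult[OF slow_inverse_wt] unfolding V_def by blast
  have V2: "V \<subseteq> L2" using Vs L2_schwartz by blast
  have Vne: "V \<noteq> {}" using schwartz_gauss unfolding V_def by blast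
  have Vadd: "(\<lambda>x. u x + v x) \<in> V" and Ladd: "L (\<lambda>x. u x + v x) = L u + L v" if uv: "u \<in> V" "v \<in> V" for u v
  proof -
    obtain \<phi> \<psi> where 1: "schwartz \<phi>" "u = (\<lambda>x. ?p x * \<phi> x)" "schwartz \<psi>" "v = (\<lambda>x. ?p x * \<psi> x)" using uv unfolding V_def by blast
    have eq: "(\<lambda>x. u x + v x) = (\<lambda>x. ?p x * (\<phi> x + \<psi> x))" unfolding 1 by (simp add: distrib_left)
    show "(\<lambda>x. u x + v x) \<in> V" unfolding V_def eq using schwartz_add[OF 1(1,3)] by blast
    show "L (\<lambda>x. u x + v x) = L u + L v" unfolding eq Lp unfolding 1(2,4) Lp by (rule temperedD(1)[OF t 1(1,3)])
  qed
  have Vsc: "(\<lambda>x. c * v x) \<in> V" and Lsc: "L (\<lambda>x. c * v x) = c * L v" if v: "v \<in> V" for c v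
  proof -
    obtain \<psi> where 1: "schwartz \<psi>" "v = (\<lambda>x. ?p x * \<psi> x)" using v unfolding V_def by blast
    have eq: "(\<lambda>x. c * v x) = (\<lambda>x. ?p x * (c * \<psi> x))" unfolding 1 by (simp add: mult.left_commute)
    show "(\<lambda>x. c * v x) \<in> V" unfolding V_def eq using schwartz_scale[OF 1(1)] by blast
    show "L (\<lambda>x. c * v x) = c * L v" unfolding eq Lp unfolding 1(2) Lp by (rule temperedD(2)[OF t 1(1)])
  qed
  define W where "W = sqrt (q2 (\<lambda>x::real^'n. complex_of_real (wt x)))"
  have W0: "W \<ge> 0" unfolding W_def by (simp add: q2_nonneg)
  have Lb: "cmod (L v) \<le> M * (LINT x|lebesgue. wt x * cmod (v x))" if v: "v \<in> V" for v
  proof -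
    obtain \<psi> where 1: "schwartz \<psi>" "v = (\<lambda>x. ?p x * \<psi> x)" using v unfolding V_def by blast
    have "wt x * cmod (v x) = cmod (\<psi> x)" for x
    proof -
      have "cmod (complex_of_real (wt x) * (?p x * \<psi> x)) = cmod (\<psi> x)" unfolding cancel ..
      then show ?thesis unfolding 1 norm_mult[of "complex_of_real (wt x)"] using wt_pos[of x] by simp
    qed
    then show ?thesis using bd[OF 1(1)] unfolding 1(2) Lp by simp
  qed
  have LC: "(cmod (L v))\<^sup>2 \<le> (M * W)\<^sup>2 * q2 v" if v: "v \<in> V" for v
  proof -
    have "v \<in> L2" using V2 v by blast
    then have "M * (LINT x|lebesgue. wt x * cmod (v x)) \<le> M * (W * sqrt (q2 v))"
      unfolding W_def by (intro mult_left_mono wt_integral_bound(2) M)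
    then have "cmod (L v) \<le> M * W * sqrt (q2 v)" using Lb[OF v] by (simp add: mult.assoc)
    then have "(cmod (L v))\<^sup>2 \<le> (M * W * sqrt (q2 v))\<^sup>2" by (intro power_mono) auto
    then show ?thesis by (simp add: power_mult_distrib q2_nonneg)
  qed
  have "\<exists>h. h \<in> L2 \<and> (\<forall>v\<in>V. L v = ip v h)"
  proof (rule riesz_L2[of V L "(M * W)\<^sup>2"])
    fix h and vs :: "nat \<Rightarrow> (real^'n) \<Rightarrow> complex"
    assume "h \<in> L2" "\<And>v. v \<in> V \<Longrightarrow> L v = ip v h"
    then show "\<exists>h. h \<in> L2 \<and> (\<forall>v\<in>V. L v = ip v h)" by blast
  qed (use V2 Vne Vadd Ladd Vsc Lsc LC in auto)
  then obtain h where h: "h \<in> L2" "\<And>v. v \<in> V \<Longrightarrow> L v = ip v h" by blast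
  define g where "g x = ?p x * cnj (h x)" for x
  have pV: "(\<lambda>x. ?p x * \<phi> x) \<in> V" if "schwartz \<phi>" for \<phi> unfolding V_def using that by blast
  have "represents a g"
    unfolding represents_def
  proof (intro conjI allI impI)
    show "g \<in> borel_measurable lebesgue" unfolding g_def
      by (intro borel_measurable_times slow_measurable[OF slow_inverse_wt] L2_measurable[OF L2_cnj[OF h(1)]])
    fix \<phi> :: "(real^'n) \<Rightarrow> complex" assume \<phi>: "schwartz \<phi>"
    have eq: "g x * \<phi> x = (?p x * \<phi> x) * cnj (h x)" for x unfolding g_def by (simp only: mult_ac)
    show "integrable lebesgue (\<lambda>x. g x * \<phi> x)" unfolding eq using pV[OF \<phi>] V2 h(1) by (intro ip_integrable) auto
    show "a \<phi> = (LINT x|lebesgue. g x * \<phi> x)" unfolding eq using h(2)[OF pV[OF \<phi>]] unfolding Lp ip_def .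
  qed
  \<comment> \<open>The weighted L1 estimate holds on \<open>V\<close> and is extended to all of L2
    by density. Density is also obtained from Riesz: for given \<open>f\<close>, the representative
    \<open>k\<close> of \<open>v \<mapsto> ip v f\<close> is a limit of elements of
    \<open>V\<close>, and \<open>f - k\<close> is orthogonal to \<open>V\<close>, hence zero almost
    everywhere.\<close>
  moreover have dual: "cmod (ip f h) \<le> M * (LINT x|lebesgue. wt x * cmod (f x))" if f: "f \<in> L2" for f
  proof -
    have "\<exists>k vs. k \<in> L2 \<and> (\<forall>j. vs j \<in> V) \<and> (\<lambda>j. q2 (\<lambda>x. vs j x - k x)) \<longlonglongrightarrow> 0 \<and> (\<forall>v\<in>V. ip v f = ip v k)"
    proof (rule riesz_L2[of V "\<lambda>v. ip v f" "q2 f"])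
      fix k and vs :: "nat \<Rightarrow> (real^'n) \<Rightarrow> complex"
      assume "k \<in> L2" "\<And>j. vs j \<in> V" "(\<lambda>j. q2 (\<lambda>x. vs j x - k x)) \<longlonglongrightarrow> 0" "\<And>v. v \<in> V \<Longrightarrow> ip v f = ip v k"
      then show "\<exists>k vs. k \<in> L2 \<and> (\<forall>j. vs j \<in> V) \<and> (\<lambda>j. q2 (\<lambda>x. vs j x - k x)) \<longlonglongrightarrow> 0 \<and> (\<forall>v\<in>V. ip v f = ip v k)" by blast
    next
      fix v assume "v \<in> V"
      then have "v \<in> L2" using V2 by blast
      from Cauchy_Schwarz_L2[OF this f] show "(cmod (ip v f))\<^sup>2 \<le> q2 f * q2 v" by (simp add: mult.commute)
    next
      fix u v assume "u \<in> V" "v \<in> V"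
      then show "ip (\<lambda>x. u x + v x) f = ip u f + ip v f" using V2 f by (intro ip_add_left) auto
    qed (use V2 Vne Vadd Vsc q2_nonneg[of f] in \<open>auto simp: ip_scale_left\<close>)
    then obtain k vs where k: "k \<in> L2" and vs: "\<And>j. vs j \<in> V" "(\<lambda>j. q2 (\<lambda>x. vs j x - k x)) \<longlonglongrightarrow> 0" and ipk: "\<And>v. v \<in> V \<Longrightarrow> ip v f = ip v k"
      by blast
    have vs2: "vs j \<in> L2" for j using vs(1) V2 by blast
    define d where "d x = f x - k x" for x
    have d: "d \<in> L2" unfolding d_def by (rule L2_diff[OF f k])
    have "AE x in lebesgue. ?p x * cnj (d x) = 0"
    proof (rule AE_zero_of_bump_integrals)
      show "locint (\<lambda>x. ?p x * cnj (d x))"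
        by (intro locint_continuous_mult smooth_inD(1)[OF slow_inverse_wt] locint_L2 L2_cnj d)
      fix r :: real and c e :: "real^'n" assume r: "r > 0"
      let ?\<phi> = "\<lambda>x. complex_of_real (bump r c e x)"
      have v: "(\<lambda>x. ?p x * ?\<phi> x) \<in> V" by (rule pV[OF schwartz_bump[OF r]])
      have v2: "(\<lambda>x. ?p x * ?\<phi> x) \<in> L2" using v V2 by blast
      have "ip (\<lambda>x. ?p x * ?\<phi> x) f = ip (\<lambda>x. ?p x * ?\<phi> x) k" by (rule ipk[OF v])
      then have "ip f (\<lambda>x. ?p x * ?\<phi> x) = ip k (\<lambda>x. ?p x * ?\<phi> x)"
        unfolding ip_cnj[of f] ip_cnj[of k] by simp
      then have "ip d (\<lambda>x. ?p x * ?\<phi> x) = 0" unfolding d_def using ip_diff_left[OF f k v2] by simp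
      then have "ip (\<lambda>x. ?p x * ?\<phi> x) d = 0" unfolding ip_cnj[of _ d] by simp
      moreover have "?p x * cnj (d x) * ?\<phi> x = (?p x * ?\<phi> x) * cnj (d x)" for x by (simp only: mult_ac)
      ultimately show "(LINT x|lebesgue. ?p x * cnj (d x) * ?\<phi> x) = 0" unfolding ip_def by (simp only:)
    qed
    then have fk: "AE x in lebesgue. k x = f x" by eventually_elim (use w0 in \<open>simp add: d_def\<close>)
    have q: "q2 (\<lambda>x. vs j x - f x) = q2 (\<lambda>x. vs j x - k x)" for j
      by (rule L2_cong_AE(2)[OF L2_diff[OF vs2 k] L2_measurable[OF L2_diff[OF vs2 f]]]) (use fk in eventually_elim, simp)
    define \<delta> where "\<delta> j = sqrt (q2 (\<lambda>x. vs j x - f x))" for j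
    have \<delta>0: "\<delta> \<longlonglongrightarrow> 0" unfolding \<delta>_def q using tendsto_real_sqrt[OF vs(2)] by simp
    have step: "cmod (ip f h) \<le> M * (LINT x|lebesgue. wt x * cmod (f x)) + (M * W + sqrt (q2 h)) * \<delta> j" for j
    proof -
      have df: "(\<lambda>x. vs j x - f x) \<in> L2" by (rule L2_diff[OF vs2 f])
      have "ip f h = ip (vs j) h - ip (\<lambda>x. vs j x - f x) h" using ip_diff_left[OF vs2 f h(1)] by simp
      then have "cmod (ip f h) \<le> cmod (ip (vs j) h) + cmod (ip (\<lambda>x. vs j x - f x) h)" by (simp only: norm_triangle_ineq4)
      moreover have "cmod (ip (\<lambda>x. vs j x - f x) h) \<le> \<delta> j * sqrt (q2 h)" unfolding \<delta>_def by (rule ip_le[OF df h(1)])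
      moreover have "cmod (ip (vs j) h) \<le> M * (LINT x|lebesgue. wt x * cmod (vs j x))" using Lb[OF vs(1)] h(2)[OF vs(1)] by simp
      moreover have "(LINT x|lebesgue. wt x * cmod (vs j x)) \<le> (LINT x|lebesgue. wt x * cmod (f x)) + W * \<delta> j"
      proof -
        have "(LINT x|lebesgue. wt x * cmod (vs j x)) \<le> (LINT x|lebesgue. wt x * cmod (f x) + wt x * cmod (vs j x - f x))"
        proof (rule integral_mono)
          fix x
          have "cmod (vs j x) \<le> cmod (f x) + cmod (vs j x - f x)" by (rule norm_triangle_sub)
          then have "wt x * cmod (vs j x) \<le> wt x * (cmod (f x) + cmod (vs j x - f x))"
            using wt_pos[of x] by (intro mult_left_mono) auto
          then show "wt x * cmod (vs j x) \<le> wt x * cmod (f x) + wt x * cmod (vs j x - f x)" by (simp only: distrib_left)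
        qed (intro Bochner_Integration.integrable_add wt_integral_bound(1) vs2 f df)+
        also have "\<dots> = (LINT x|lebesgue. wt x * cmod (f x)) + (LINT x|lebesgue. wt x * cmod (vs j x - f x))"
          by (rule Bochner_Integration.integral_add[OF wt_integral_bound(1)[OF f] wt_integral_bound(1)[OF df]])
        also have "\<dots> \<le> (LINT x|lebesgue. wt x * cmod (f x)) + W * \<delta> j"
          unfolding W_def \<delta>_def by (intro add_left_mono wt_integral_bound(2) df)
        finally show ?thesis .
      qed
      then have "M * (LINT x|lebesgue. wt x * cmod (vs j x)) \<le> M * ((LINT x|lebesgue. wt x * cmod (f x)) + W * \<delta> j)"
        by (rule mult_left_mono[OF _ M])
      ultimately show ?thesis unfolding distrib_left distrib_right mult.assoc mult.commute[of "\<delta> j"] by linarith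
    qed
    have "(\<lambda>j. M * (LINT x|lebesgue. wt x * cmod (f x)) + (M * W + sqrt (q2 h)) * \<delta> j)
        \<longlonglongrightarrow> M * (LINT x|lebesgue. wt x * cmod (f x)) + (M * W + sqrt (q2 h)) * 0"
      by (intro tendsto_intros \<delta>0)
    then have "cmod (ip f h) \<le> M * (LINT x|lebesgue. wt x * cmod (f x)) + (M * W + sqrt (q2 h)) * 0"
      by (rule LIMSEQ_le_const) (use step in blast)
    then show ?thesis by simp
  qed
  moreover have "AE x in lebesgue. cmod (g x) \<le> M"
  proof -
    note [measurable] = L2_measurable[OF h(1)]
    have [measurable]: "(wt :: real^'n \<Rightarrow> real) \<in> borel_measurable lebesgue" using integrable_wt by blast
    \<comment> \<open>The test function has the phase of \<open>h\<close> and modulus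
      \<open>wt\<close> exactly where the desired bound fails. The factor \<open>wt\<close> keeps it
      in L2 even if that set has infinite measure.\<close>
    define s where "s x = (if M * wt x < cmod (h x) then wt x else 0)" for x
    have sm[measurable]: "s \<in> borel_measurable lebesgue" unfolding s_def by measurable
    define f where "f x = complex_of_real (s x / cmod (h x)) * h x" for x
    have fm: "f \<in> borel_measurable lebesgue" unfolding f_def by measurable
    have fs: "cmod (f x) = s x" for x
    proof (cases "h x = 0")
      case True
      then have "\<not> M * wt x < cmod (h x)" using M wt_pos[of x] by (simp add: not_less)
      then show ?thesis unfolding f_def s_def using True by simp
    qed (use wt_pos[of x] in \<open>auto simp: f_def s_def norm_mult norm_divide\<close>)
    have "f \<in> L2"
    proof -
      have wi: "integrable lebesgue (\<lambda>x::real^'n. (cmod (complex_of_real (wt x)))\<^sup>2)" using wt_L2 unfolding L2_def by blast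
      have "integrable lebesgue (\<lambda>x. (cmod (f x))\<^sup>2)"
      proof (rule Bochner_Integration.integrable_bound[OF wi])
        show "(\<lambda>x. (cmod (f x))\<^sup>2) \<in> borel_measurable lebesgue" using fm by measurable
        show "AE x in lebesgue. norm ((cmod (f x))\<^sup>2) \<le> norm ((cmod (complex_of_real (wt x)))\<^sup>2)"
          unfolding fs s_def by auto
      qed
      then show ?thesis unfolding L2_def using fm by simp
    qed
    note f = this
    have sh: "f x * cnj (h x) = complex_of_real (s x * cmod (h x))" for x
    proof (cases "h x = 0")
      case False
      have "f x * cnj (h x) = complex_of_real (s x / cmod (h x)) * complex_of_real ((cmod (h x))\<^sup>2)"
        unfolding f_def complex_norm_square by (simp only: mult.assoc)
      also have "\<dots> = complex_of_real (s x / cmod (h x) * (cmod (h x))\<^sup>2)" by (rule of_real_mult[symmetric])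
      also have "s x / cmod (h x) * (cmod (h x))\<^sup>2 = s x * cmod (h x)" using False by (simp add: power2_eq_square)
      finally show ?thesis .
    qed (simp add: f_def)
    have i1: "integrable lebesgue (\<lambda>x. s x * cmod (h x))"
      using integrable_Re[OF ip_integrable[OF f h(1)]] unfolding sh by simp
    have i2: "integrable lebesgue (\<lambda>x. wt x * s x)" using wt_integral_bound(1)[OF f] unfolding fs .
    have s0: "s x \<ge> 0" for x unfolding s_def using wt_pos[of x] by simp
    have "ip f h = complex_of_real (LINT x|lebesgue. s x * cmod (h x))" unfolding ip_def sh by (rule integral_complex_of_real)
    then have "(LINT x|lebesgue. s x * cmod (h x)) \<le> M * (LINT x|lebesgue. wt x * s x)"
      using dual[OF f] unfolding fs by simp
    then have le: "(LINT x|lebesgue. s x * cmod (h x) - M * (wt x * s x)) \<le> 0" using i1 i2 by simp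
    have nn: "s x * cmod (h x) - M * (wt x * s x) \<ge> 0" for x
    proof -
      have "s x * (cmod (h x) - M * wt x) \<ge> 0" unfolding s_def using wt_pos[of x] by simp
      then show ?thesis by (simp add: right_diff_distrib mult_ac)
    qed
    have i: "integrable lebesgue (\<lambda>x. s x * cmod (h x) - M * (wt x * s x))" using i1 i2 by simp
    have "(LINT x|lebesgue. s x * cmod (h x) - M * (wt x * s x)) \<ge> 0" by (rule integral_nonneg_AE) (use nn in simp)
    then have "AE x in lebesgue. s x * cmod (h x) - M * (wt x * s x) = 0"
      using le integral_nonneg_eq_0_iff_AE[OF i AE_I2[OF nn]] by simp
    then show ?thesis
    proof eventually_elim
      fix x assume "s x * cmod (h x) - M * (wt x * s x) = 0"
      then have "s x * (cmod (h x) - M * wt x) = 0" by (simp add: right_diff_distrib mult_ac)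
      then have "cmod (h x) \<le> M * wt x" unfolding s_def using wt_pos[of x] by (auto split: if_splits)
      then show "cmod (g x) \<le> M" unfolding g_def using wt_pos[of x] by (simp add: norm_mult norm_divide pos_divide_le_eq)
    qed
  qed
  ultimately show ?thesis by blast
qed

text \<open>The weight of exponent \<open>2 * CARD('n)\<close> turns a single Schwartz seminorm
  without derivatives into an integrable bound.\<close>

lemma tempered_integral: "tempered (\<lambda>\<psi>::(real^'n) \<Rightarrow> complex. LINT x|lebesgue. \<psi> x)"
  unfolding tempered_def
proof (intro conjI allI impI)
  fix \<phi> \<psi> :: "(real^'n) \<Rightarrow> complex" assume "schwartz \<phi>" "schwartz \<psi>"
  then show "(LINT x|lebesgue. \<phi> x + \<psi> x) = (LINT x|lebesgue. \<phi> x) + (LINT x|lebesgue. \<psi> x)"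
    by (intro Bochner_Integration.integral_add schwartz_integrable)
next
  fix \<phi> :: "(real^'n) \<Rightarrow> complex" and c assume "schwartz \<phi>"
  show "(LINT x|lebesgue. c * \<phi> x) = c * (LINT x|lebesgue. \<phi> x)" by (rule integral_mult_right_zero)
next
  let ?N = "2 * CARD('n)" and ?W = "LINT x|lebesgue. wt (x::real^'n)"
  have "cmod (LINT x|lebesgue. \<phi> x) \<le> ?W * pN ?N \<phi>" if \<phi>: "schwartz \<phi>" for \<phi> :: "(real^'n) \<Rightarrow> complex"
  proof -
    have "schwartz_seminorm ?N [] \<phi> \<le> (\<Sum>is\<in>{is::'n list. length is \<le> ?N}. schwartz_seminorm ?N is \<phi>)"
      by (rule member_le_sum[of "[]" _ "\<lambda>is. schwartz_seminorm ?N is \<phi>"]) (auto intro: seminorm_nonneg[OF \<phi>] finite_multi_indices)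
    also have "\<dots> \<le> pN ?N \<phi>" unfolding pN_def
      by (rule member_le_sum[of ?N _ "\<lambda>k. \<Sum>is\<in>{is. length is
          \<le> ?N}. schwartz_seminorm k is \<phi>"]) (auto intro: sum_nonneg seminorm_nonneg[OF \<phi>])
    finally have S: "schwartz_seminorm ?N [] \<phi> \<le> pN ?N \<phi>" .
    have pt: "cmod (\<phi> x) \<le> wt x * pN ?N \<phi>" for x
    proof -
      have "cmod (\<phi> x) * 1 \<le> cmod (\<phi> x) * (wt x * (1 + norm x) ^ ?N)" by (intro mult_left_mono wt_ge) simp
      also have "\<dots> = wt x * ((1 + norm x) ^ ?N * cmod (Dl [] \<phi> x))" by (simp only: Dl.simps mult_ac)
      also have "\<dots> \<le> wt x * pN ?N \<phi>"
        using wt_pos[of x] by (intro mult_left_mono order_trans[OF seminorm_upper[OF \<phi>] S]) auto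
      finally show ?thesis by simp
    qed
    have "cmod (LINT x|lebesgue. \<phi> x) \<le> (LINT x|lebesgue. cmod (\<phi> x))" by (rule integral_norm_bound)
    also have "\<dots> \<le> (LINT x|lebesgue. wt (x::real^'n) * pN ?N \<phi>)"
      by (intro integral_mono integrable_norm[OF schwartz_integrable[OF \<phi>]] integrable_mult_left integrable_wt pt)
    also have "\<dots> = ?W * pN ?N \<phi>" by (rule integral_mult_left_zero)
    finally show ?thesis .
  qed
  then show "\<exists>N C. \<forall>\<phi>::(real^'n) \<Rightarrow> complex. schwartz \<phi> \<longrightarrow>
      cmod (LINT x|lebesgue. \<phi> x) \<le> C * (\<Sum>k\<le>N. \<Sum>is\<in>{is. length is \<le> N}. schwartz_seminorm k is \<phi>)"
    unfolding pN_def by blast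
qed

text \<open>Integration is the distribution with density 1; the multiplication formula shows that
  its multiplier reproduces \<open>u\<close>, so it witnesses sharpness.\<close>

lemma M_norm_one:
  fixes \<rho> :: "((real^'n) \<Rightarrow> ennreal) \<Rightarrow> ennreal"
  assumes bfn: "banach_function_norm \<rho>"
  defines "a \<equiv> \<lambda>\<psi>::(real^'n) \<Rightarrow> complex. LINT x|lebesgue. \<psi> x"
  shows "M_norm \<rho> a \<le> 1" "a \<in> M_set \<rho>" "represents a (\<lambda>x. 1)"
proof -
  show *: "M_norm \<rho> a \<le> 1"
    unfolding M_norm_def
  proof (rule SUP_least)
    fix u assume "u \<in> {u. schwartz u \<and> u \<in> Xset \<rho> \<and> \<not> (AE x in lebesgue. u x = 0)}"
    then have u: "schwartz u" "u \<in> Xset \<rho>" "\<not> (AE x in lebesgue. u x = 0)" by auto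
    have "represents (mult_op a u) u"
      unfolding represents_def
    proof (intro conjI allI impI)
      show "u \<in> borel_measurable lebesgue" by (rule schwartz_measurable(1)[OF u(1)])
      fix \<phi> :: "(real^'n) \<Rightarrow> complex" assume \<phi>: "schwartz \<phi>"
      show "integrable lebesgue (\<lambda>x. u x * \<phi> x)" by (rule schwartz_integrable[OF schwartz_mult[OF u(1) \<phi>]])
      show "mult_op a u \<phi> = (LINT x|lebesgue. u x * \<phi> x)"
        unfolding mult_op_def a_def
        using FT_multiplication[OF schwartz_integrable[OF u(1)] schwartz_integrable[OF schwartz_IFT[OF \<phi>]]] FT_IFT[OF \<phi>] by simp
    qed
    then have "dist_Xn \<rho> (mult_op a u) = Xn \<rho> u" by (rule dist_Xn_eq[OF bfn])
    moreover have "Xn \<rho> u \<noteq> 0" using u Xn_zero_iff[OF bfn schwartz_measurable(1)[OF u(1)]] by simp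
    moreover have "Xn \<rho> u \<noteq> top" using Xset_finite[OF bfn u(2)] by auto
    ultimately show "dist_Xn \<rho> (mult_op a u) / Xn \<rho> u \<le> 1" by (simp add: ennreal_divide_self less_top)
  qed
  then show "a \<in> M_set \<rho>" unfolding M_set_def a_def using tempered_integral by (auto intro: le_less_trans)
  show "represents a (\<lambda>x. 1)" unfolding represents_def a_def using schwartz_integrable by auto
qed

lemma one_not_le_contraction:
  assumes "C < 1" "y \<le> 1" shows "\<not> 1 \<le> ennreal C * y"
proof
  assume "1 \<le> ennreal C * y"
  also have "\<dots> \<le> ennreal C * 1" by (intro mult_left_mono assms(2)) simp
  \<comment> \<open>Negative \<open>C\<close> is included: \<open>ennreal C\<close> is then
    0.\<close>
  also have "\<dots> < 1" using assms(1) by (cases "C \<ge> 0") (auto simp: ennreal_less_one_iff ennreal_neg)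
  finally show False by simp
qed

theorem theorem7p11:
  fixes \<rho> :: "((real^'n) \<Rightarrow> ennreal) \<Rightarrow> ennreal"
  assumes "banach_function_norm \<rho>"
    and "reflection_invariant \<rho>"
  shows "(\<forall>a \<in> M0_set \<rho>. Linf_norm a \<le> M0_norm \<rho> a)
       \<and> (\<forall>C::real. C < 1 \<longrightarrow> \<not> (\<forall>a \<in> M0_set \<rho>. Linf_norm a \<le> ennreal C * M0_norm \<rho> a))
       \<and> (reflexive_X \<rho> \<longrightarrow>
            (\<forall>a \<in> M_set \<rho>. \<exists>g. represents a g \<and> g \<in> Linf \<and> Linf_norm g \<le> M_norm \<rho> a)
          \<and> (\<forall>C::real. C < 1 \<longrightarrow>
               \<not> (\<forall>a \<in> M_set \<rho>. \<forall>g. represents a g \<longrightarrow> Linf_norm g \<le> ennreal C * M_norm \<rho> a)))"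
proof (intro conjI impI ballI allI)
  show "Linf_norm a \<le> M0_norm \<rho> a" if "a \<in> M0_set \<rho>" for a
    by (rule M0_lower_bound[OF assms that])
  show "\<not> (\<forall>a \<in> M0_set \<rho>. Linf_norm a \<le> ennreal C * M0_norm \<rho> a)" if "C < 1" for C
    using one_not_le_contraction[OF that M0_norm_one(1)[OF assms(1)]] M0_norm_one(2)[OF assms(1)] Linf_norm_one by metis
  show "\<not> (\<forall>a \<in> M_set \<rho>. \<forall>g. represents a g \<longrightarrow> Linf_norm g \<le> ennreal C * M_norm \<rho> a)" if "C < 1" for C
    using one_not_le_contraction[OF that M_norm_one(1)[OF assms(1)]] M_norm_one(2,3)[OF assms(1)] Linf_norm_one by metis
  show "\<exists>g. represents a g \<and> g \<in> Linf \<and> Linf_norm g \<le> M_norm \<rho> a" if a: "a \<in> M_set \<rho>" for a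
  proof -
    have t: "tempered a" and M: "M_norm \<rho> a = ennreal (enn2real (M_norm \<rho> a))" using a unfolding M_set_def by auto
    obtain g where g: "represents a g" "AE x in lebesgue. cmod (g x) \<le> enn2real (M_norm \<rho> a)"
      using represents_of_L1_bound[OF t enn2real_nonneg tempered_L1_bound[OF assms a]] by blast
    have le: "Linf_norm g \<le> M_norm \<rho> a" using Linf_norm_le[OF g(2)] M by simp
    moreover have "M_norm \<rho> a < \<infinity>" using a unfolding M_set_def by simp
    ultimately have "g \<in> Linf" using g(1) unfolding Linf_def represents_def by (auto intro: le_less_trans)
    then show ?thesis using g(1) le by blast
  qed
qed

end
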